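(* Let $G$ be a group that is virtually in $\Xi$ or virtually in $\Omega$, via a fixed virtual HHG structure $(H,\mathfrak S)$, and suppose that the expanded core graph of $(H,\mathfrak S)$ has finite chromatic number, $\chi(\widehat{\mathcal G}^{\mathfrak S})<\infty$. Then, for every positive integer $M$, there exists a finite graph $\Lambda_M$ of girth at least $M$ such that $\mathbb A(\Lambda_M)$ does not embed into $G$.
   Context: Graphs are simplicial; $\chi$ is the chromatic number. RAAG: for a finite graph $\Lambda$, $\mathbb A(\Lambda)=\langle V(\Lambda)\mid [v,w]=1 \text{ for } \{v,w\}\in E(\Lambda)\rangle$. HHS: a hierarchically hyperbolic space (Behrstock–Hagen–Sisto) $(\mathcal X,\mathfrak S)$ consists of a quasi-geodesic metric space $\mathcal X$, a set $\mathfrak S$ of domains and a constant $E\ge1$ with the following data and axioms (maps are coarse: points go to nonempty sets of diameter $\le E$; $d_V$ is distance in $\mathcal CV$). (1) Each $U\in\mathfrak S$ has an $E$-hyperbolic space $\mathcal CU$ and an $(E,E)$-coarsely Lipschitz, $E$-coarsely surjective projection $\pi_U:\mathcal X\to\mathcal CU$. (2) Nesting: a partial order $\sqsubseteq$ on $\mathfrak S$ with a unique maximal element, chains having at most $E$ elements. (3) Orthogonality: a symmetric anti-reflexive relation $\bot$; orthogonal domains are not $\sqsubseteq$-comparable; $V\sqsubseteq U$ and $U\bot W$ imply $V\bot W$; if $U\sqsubsetneq T$ and some $V\sqsubsetneq T$ satisfies $V\bot U$, there is $W\sqsubsetneq T$ (a container) into which every $V\sqsubsetneq T$ with $V\bot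 U$ is nested. (4) $U\pitchfork V$ (transverse) means distinct, not comparable and not orthogonal. If $U\pitchfork V$ or $U\sqsubsetneq V$ there is a set $\rho^U_V\subseteq\mathcal CV$ of diameter $\le E$; if $U\sqsubsetneq V$ there is also a coarse map $\rho^V_U:\mathcal CV\to\mathcal CU$. (5) Consistency: for $x\in\mathcal X$, if $U\pitchfork V$ then $\min\{d_U(\pi_U(x),\rho^V_U),d_V(\pi_V(x),\rho^U_V)\}\le E$; if $U\sqsubsetneq V$ then $\min\{d_V(\pi_V(x),\rho^U_V),\operatorname{diam}(\pi_U(x)\cup\rho^V_U(\pi_V(x)))\}\le E$; if $U\sqsubsetneq V$ then $d_W(\rho^U_W,\rho^V_W)\le E$ whenever $V\sqsubsetneq W$, or $V\pitchfork W$ and $W\not\bot U$. (6) Large links: for $W\in\mathfrak S$, $x,x'\in\mathcal X$ and $N=E\,d_W(\pi_W(x),\pi_W(x'))+E$ there are $T_1,\dots,T_{\lfloor N\rfloor}\sqsubsetneq W$ with $d_W(\pi_W(x),\rho^{T_i}_W)\le N$ such that each $T\sqsubsetneq W$ is nested in some $T_i$ or has $d_T(\pi_T(x),\pi_T(x'))<E$. (7) Bounded geodesic image: if $V\sqsubsetneq W$ and $\gamma$ is a geodesic in $\mathcal CW$, then $\operatorname{diam}\rho^W_V(\gamma)\le E$ or $\gamma$ meets the $E$-neighbourhood of $\rho^V_W$. (8) Partial realization: for pairwise orthogonal $V_j$ and $p_j\in\pi_{V_j}(\mathcal X)$ there is $x\in\mathcal X$ with $d_{V_j}(\pi_{V_j}(x),p_j)\le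 E$ and $d_V(\pi_V(x),\rho^{V_j}_V)\le E$ whenever $V_j\sqsubsetneq V$ or $V\pitchfork V_j$. (9) Uniqueness: for each $\kappa$ there is $\theta$ such that $d(x,y)\ge\theta$ implies $d_V(\pi_V(x),\pi_V(y))\ge\kappa$ for some $V$. HHG: an automorphism of $(\mathcal X,\mathfrak S)$ is a quasi-isometry of $\mathcal X$ with a relation-preserving bijection of $\mathfrak S$ and isometries $\mathcal CU\to\mathcal C(gU)$ uniformly coarsely commuting with all $\pi$ and $\rho$; automorphisms inducing the same bijection and isometries are identified, giving a group $\operatorname{Aut}(\mathfrak S)$. An HHG structure on a finitely generated group $H$ is an HHS with a homomorphism $H\to\operatorname{Aut}(\mathfrak S)$ whose quasi-action on $\mathcal X$ is proper and cobounded and whose action on $\mathfrak S$ has finitely many orbits. One takes $\mathcal X=H$ with left multiplication and assumes $g\pi_U(x)=\pi_{gU}(gx)$, $g\rho^U_V=\rho^{gU}_{gV}$. A group $G$ is virtually in a class of HHG structures, via the virtual HHG structure $(H,\mathfrak S)$, if $H\le G$ has finite index and $(H,\mathfrak S)$ is an HHG structure on $H$ in that class. A domain is unbounded if $\operatorname{diam}\mathcal CU=\infty$; a quasi-line is a space quasi-isometric to $\mathbb R$. $\operatorname{Big}(g)=\{U:\operatorname{diam}\pi_U(\langle g\rangle x)=\infty\}$; $g$ is axial if $n\mapsto g^nx$ is a quasi-isometric embedding. Factors and $H_U$: fix a sufficiently large $\kappa$. A $\kappa$-consistent tuple on a set of domains is a collection of nonempty sets $b_V\subseteq\mathcal CV$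 of uniformly bounded diameter satisfying the first two inequalities of (5) with $b_V$ for $\pi_V(x)$ and $\kappa$ for $E$. For $U\in\mathfrak S$, $\mathbf F_U$ is the set of $\kappa$-consistent tuples on $\mathfrak S_U=\{V:V\sqsubseteq U\}$ and $\mathbf E_U$ the set of $\kappa$-consistent tuples on $\{V:V\bot U\}$ (a point if there is no such $V$). The coarsely defined map $\phi_U:\mathbf F_U\times\mathbf E_U\to\mathcal X$ sends $(a,b)$ to a point with coordinates coarsely $a_V$ ($V\sqsubseteq U$), $b_V$ ($V\bot U$), $\rho^U_V$ (otherwise). Metrized as $\phi_U(\mathbf F_U\times\{e\})$ (well defined up to uniform quasi-isometry), $\mathbf F_U$ is an HHS with index set $\mathfrak S_U$ and inherited data. $\operatorname{Stab}_H(U)$ acts on $\mathbf E_U$ by $(g\mathbf b)_{gV}=g\,b_V$, and similarly on $\mathbf F_U$. Let $H_U\le\operatorname{Stab}_H(U)$ be the subgroup of elements acting as the identity on $\mathbf E_U$. Class $\Xi$: an axial $g$ is strongly fully supported on an unbounded domain $U$ if $g\in H_U$ and $U\in\operatorname{Big}(g)$. $(H,\mathfrak S)\in\Xi$ if: for every $U\in\mathfrak S$ the action of $H_U$ on $(\mathbf F_U,\mathfrak S_U)$ is an HHG structure on $H_U$; for every infinite-order $g$ with $\operatorname{Big}(g)=\{U_1,\dots,U_k\}$ there are $n>0$ and axial $h_1,\dots,h_k$ with $g^n=h_1\cdots h_k$ and $h_i$ strongly fully supported on $U_i$; and any two axial elements strongly fully supported on orthogonal unbounded domains commute. Class $\Omega$: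 an axial $g$ is fully supported on an unbounded $U$ if $\operatorname{Big}(g)=\{U\}$ and, for every unbounded $V\bot U$, $g$ fixes $V$ and $\langle g\rangle$ acts on $\mathcal CV$ with uniformly bounded orbits. A finite collection of axial elements is geometrically irredundant if for any two distinct members $g,h$ either $\operatorname{Big}(g)\ne\operatorname{Big}(h)$ or some $U\in\operatorname{Big}(g)\cap\operatorname{Big}(h)$ is such that the limit sets of $g,h$ in $\partial\mathcal CU$ are disjoint. $(H,\mathfrak S)\in\Omega$ if (1) for every unbounded $U$ there is an axial element fully supported on $U$, and if $\mathcal CU$ is not a quasi-line there is an infinite collection of axial elements fully supported on $U$ every finite subcollection of which is geometrically irredundant; (2) for every infinite-order $g$, with $\operatorname{Big}(g)=\{U_1,\dots,U_k\}$, there are $n>0$ and pairwise commuting axial $h_1,\dots,h_k$ with $g^n=h_1\cdots h_k$ and $h_i$ fully supported on $U_i$; (3) for axial $f_1,f_2$ fully supported on unbounded $U_1,U_2$: (a) if $U_1=U_2$, then $f_1,f_2$ have nonzero powers in common or $\{f_1,f_2\}$ is geometrically irredundant; (b) if $U_1\bot U_2$, then $[f_1^N,f_2^N]=1$ for some $N>0$; (c) if $[f_1,f_2]=1$, then $f_1,f_2$ have nonzero powers in common or $U_1\bot U_2$. Expanded core graph $\widehat{\mathcal G}^{\mathfrak S}$: let $\mathfrak G$ be the set of $\sqsubseteq$-minimal elements of the set of unbounded domains. For $U\in\mathfrak G$ let $V_U$ be a singleton if $\mathcal CU$ is a quasi-line and a countably infinite set otherwise. Vertex set $\bigsqcup_{U\in\mathfrak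 G}V_U$; $v\in V_U$, $w\in V_{U'}$ are adjacent iff $U\bot U'$. *)

theory Defs
  imports "HOL-Analysis.Analysis" "HOL-Algebra.Coset" "HOL-Algebra.Generated_Groups"
    "HOL-Library.Extended_Nat"
begin

section \<open>Graphs\<close>

text \<open>A graph is a pair of a vertex set and a set of unordered edges.\<close>

type_synonym 'a sgraph = "'a set \<times> 'a set set"

abbreviation verts :: "'a sgraph \<Rightarrow> 'a set" where "verts \<equiv> fst"
abbreviation edges :: "'a sgraph \<Rightarrow> 'a set set" where "edges \<equiv> snd"

definition simplicial_graph :: "'a sgraph \<Rightarrow> bool" where
  "simplicial_graph \<Gamma> \<longleftrightarrow> (\<forall>e\<in>edges \<Gamma>. e \<subseteq> verts \<Gamma> \<and> card e = 2)"

definition proper_colouring :: "'a sgraph \<Rightarrow> nat \<Rightarrow> ('a \<Rightarrow> nat) \<Rightarrow> bool" where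
  "proper_colouring \<Gamma> k c \<longleftrightarrow>
     c ` verts \<Gamma> \<subseteq> {..<k} \<and> (\<forall>v w. {v, w} \<in> edges \<Gamma> \<longrightarrow> c v \<noteq> c w)"

definition chromatic_number :: "'a sgraph \<Rightarrow> enat" where
  "chromatic_number \<Gamma> = Inf {enat k | k. \<exists>c. proper_colouring \<Gamma> k c}"

definition is_cycle :: "'a sgraph \<Rightarrow> 'a list \<Rightarrow> bool" where
  "is_cycle \<Gamma> p \<longleftrightarrow> length p \<ge> 3 \<and> distinct p \<and> set p \<subseteq> verts \<Gamma> \<and>
     (\<forall>i<length p. {p ! i, p ! (Suc i mod length p)} \<in> edges \<Gamma>)"

text \<open>The girth of a forest is \<^term>\<open>\<infinity>\<close>.\<close>

definition girth :: "'a sgraph \<Rightarrow> enat" where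
  "girth \<Gamma> = Inf {enat (length p) | p. is_cycle \<Gamma> p}"

section \<open>Group presentations and right-angled Artin groups\<close>

text \<open>A letter \<open>(v, True)\<close> stands for the generator \<open>v\<close> and \<open>(v, False)\<close> for its inverse.\<close>

type_synonym 'a word = "('a \<times> bool) list"

inductive pres_eq :: "'a set \<Rightarrow> 'a word set \<Rightarrow> 'a word \<Rightarrow> 'a word \<Rightarrow> bool"
  for X :: "'a set" and R :: "'a word set" where
  refl: "fst ` set u \<subseteq> X \<Longrightarrow> pres_eq X R u u"
| sym: "pres_eq X R u v \<Longrightarrow> pres_eq X R v u"
| trans: "pres_eq X R u v \<Longrightarrow> pres_eq X R v w \<Longrightarrow> pres_eq X R u w"
| cancel: "fst ` set (u @ w) \<subseteq> X \<Longrightarrow> x \<in> X \<Longrightarrow>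
    pres_eq X R (u @ [(x, b), (x, \<not> b)] @ w) (u @ w)"
| relator: "fst ` set (u @ r @ w) \<subseteq> X \<Longrightarrow> r \<in> R \<Longrightarrow> pres_eq X R (u @ r @ w) (u @ w)"

definition pres_rel :: "'a set \<Rightarrow> 'a word set \<Rightarrow> ('a word \<times> 'a word) set" where
  "pres_rel X R = {(u, v). pres_eq X R u v}"

definition presented_group :: "'a set \<Rightarrow> 'a word set \<Rightarrow> 'a word set monoid" where
  "presented_group X R =
     \<lparr> carrier = {u. fst ` set u \<subseteq> X} // pres_rel X R,
       mult = (\<lambda>A B. \<Union>u\<in>A. \<Union>v\<in>B. pres_rel X R `` {u @ v}),
       one = pres_rel X R `` {[]} \<rparr>"

definition commutator_word :: "'a \<Rightarrow> 'a \<Rightarrow> 'a word" where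
  "commutator_word v w = [(v, True), (w, True), (v, False), (w, False)]"

definition raag :: "'a sgraph \<Rightarrow> 'a word set monoid" where
  "raag \<Lambda> = presented_group (verts \<Lambda>) {commutator_word v w | v w. {v, w} \<in> edges \<Lambda>}"

definition embeds_into :: "('a, 'm) monoid_scheme \<Rightarrow> ('b, 'n) monoid_scheme \<Rightarrow> bool" where
  "embeds_into A B \<longleftrightarrow> (\<exists>f \<in> hom A B. inj_on f (carrier A))"

section \<open>Coarse geometry\<close>

text \<open>The distance between two sets is the infimum of the distances between their points.\<close>

definition set_dist :: "'a metric \<Rightarrow> 'a set \<Rightarrow> 'a set \<Rightarrow> real" where
  "set_dist m A B = (INF (x, y)\<in>A \<times> B. mdist m x y)"

definition diam :: "'a metric \<Rightarrow> 'a set \<Rightarrow> ereal" where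
  "diam m A = (SUP (x, y)\<in>A \<times> A. ereal (mdist m x y))"

definition qi_embedding :: "real \<Rightarrow> 'a metric \<Rightarrow> 'b metric \<Rightarrow> ('a \<Rightarrow> 'b) \<Rightarrow> bool" where
  "qi_embedding K m m' f \<longleftrightarrow> K \<ge> 1 \<and> f ` mspace m \<subseteq> mspace m' \<and>
     (\<forall>x\<in>mspace m. \<forall>y\<in>mspace m.
        mdist m x y / K - K \<le> mdist m' (f x) (f y) \<and> mdist m' (f x) (f y) \<le> K * mdist m x y + K)"

definition quasi_isometry :: "real \<Rightarrow> 'a metric \<Rightarrow> 'b metric \<Rightarrow> ('a \<Rightarrow> 'b) \<Rightarrow> bool" where
  "quasi_isometry K m m' f \<longleftrightarrow> qi_embedding K m m' f \<and>
     (\<forall>y\<in>mspace m'. \<exists>x\<in>mspace m. mdist m' (f x) y \<le> K)"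

definition isometry_onto :: "'a metric \<Rightarrow> 'b metric \<Rightarrow> ('a \<Rightarrow> 'b) \<Rightarrow> bool" where
  "isometry_onto m m' f \<longleftrightarrow> bij_betw f (mspace m) (mspace m') \<and>
     (\<forall>x\<in>mspace m. \<forall>y\<in>mspace m. mdist m' (f x) (f y) = mdist m x y)"

definition quasi_geodesic_space :: "'a metric \<Rightarrow> bool" where
  "quasi_geodesic_space m \<longleftrightarrow> (\<exists>K. \<forall>x\<in>mspace m. \<forall>y\<in>mspace m. \<exists>L\<ge>0. \<exists>c.
     qi_embedding K (submetric euclidean_metric {0..L::real}) m c \<and> c 0 = x \<and> c L = y)"

definition int_metric :: "int metric" where
  "int_metric = metric (UNIV, \<lambda>m n. \<bar>real_of_int m - real_of_int n\<bar>)"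

definition quasi_line :: "'a metric \<Rightarrow> bool" where
  "quasi_line m \<longleftrightarrow> (\<exists>K f. quasi_isometry K m (euclidean_metric :: real metric) f)"

definition geodesic :: "'a metric \<Rightarrow> real \<Rightarrow> (real \<Rightarrow> 'a) \<Rightarrow> bool" where
  "geodesic m L c \<longleftrightarrow> L \<ge> 0 \<and> c ` {0..L} \<subseteq> mspace m \<and>
     (\<forall>s\<in>{0..L}. \<forall>t\<in>{0..L}. mdist m (c s) (c t) = \<bar>s - t\<bar>)"

definition geodesic_between :: "'a metric \<Rightarrow> 'a \<Rightarrow> 'a \<Rightarrow> 'a set \<Rightarrow> bool" where
  "geodesic_between m x y \<gamma> \<longleftrightarrow>
     (\<exists>L c. geodesic m L c \<and> c 0 = x \<and> c L = y \<and> \<gamma> = c ` {0..L})"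

text \<open>Hyperbolic spaces are geodesic spaces whose geodesic triangles are \<open>\<delta>\<close>-slim.\<close>

definition hyperbolic_space :: "real \<Rightarrow> 'a metric \<Rightarrow> bool" where
  "hyperbolic_space \<delta> m \<longleftrightarrow>
     (\<forall>x\<in>mspace m. \<forall>y\<in>mspace m. \<exists>\<gamma>. geodesic_between m x y \<gamma>) \<and>
     (\<forall>x y z \<alpha> \<beta> \<gamma>. geodesic_between m x y \<alpha> \<and> geodesic_between m y z \<beta> \<and>
        geodesic_between m x z \<gamma> \<longrightarrow> (\<forall>p\<in>\<alpha>. \<exists>q\<in>\<beta> \<union> \<gamma>. mdist m p q \<le> \<delta>))"

subsection \<open>The Gromov boundary\<close>

definition gromov_product :: "'a metric \<Rightarrow> 'a \<Rightarrow> 'a \<Rightarrow> 'a \<Rightarrow> real" where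
  "gromov_product m p x y = (mdist m x p + mdist m y p - mdist m x y) / 2"

definition converges_to_infinity :: "'a metric \<Rightarrow> (nat \<Rightarrow> 'a) \<Rightarrow> bool" where
  "converges_to_infinity m \<sigma> \<longleftrightarrow> range \<sigma> \<subseteq> mspace m \<and>
     (\<forall>p\<in>mspace m. filterlim (\<lambda>(i, j). gromov_product m p (\<sigma> i) (\<sigma> j)) at_top
        (sequentially \<times>\<^sub>F sequentially))"

definition boundary_rel :: "'a metric \<Rightarrow> ((nat \<Rightarrow> 'a) \<times> (nat \<Rightarrow> 'a)) set" where
  "boundary_rel m = {(\<sigma>, \<tau>). converges_to_infinity m \<sigma> \<and> converges_to_infinity m \<tau> \<and>
     (\<forall>p\<in>mspace m. filterlim (\<lambda>n. gromov_product m p (\<sigma> n) (\<tau> n)) at_top sequentially)}"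

definition gromov_boundary :: "'a metric \<Rightarrow> (nat \<Rightarrow> 'a) set set" where
  "gromov_boundary m = {\<sigma>. converges_to_infinity m \<sigma>} // boundary_rel m"

definition limit_set :: "'a metric \<Rightarrow> 'a set \<Rightarrow> (nat \<Rightarrow> 'a) set set" where
  "limit_set m A = {\<xi> \<in> gromov_boundary m. \<exists>\<sigma>\<in>\<xi>. range \<sigma> \<subseteq> A}"

section \<open>Hierarchically hyperbolic spaces\<close>

text \<open>
  \<open>rho s U V\<close> is the set \<open>\<rho>\<close> with superscript \<open>U\<close> and subscript \<open>V\<close>, a subset of the space of \<open>V\<close>
  (meaningful if \<open>U\<close> and \<open>V\<close> are transverse or \<open>U\<close> is properly nested in \<open>V\<close>);
  \<open>rho_map s V U\<close> is the coarse map \<open>\<rho>\<close> with superscript \<open>V\<close> and subscript \<open>U\<close> from the space of \<open>V\<close>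
  to the space of \<open>U\<close> (meaningful if \<open>U\<close> is properly nested in \<open>V\<close>).
  The spaces \<open>cspace s U\<close> are independent metric spaces that only share a type of points.
\<close>

record ('x, 'd, 'c) hhs_data =
  total :: "'x metric"
  domains :: "'d set"
  cspace :: "'d \<Rightarrow> 'c metric"
  proj :: "'d \<Rightarrow> 'x \<Rightarrow> 'c set"
  nest :: "'d \<Rightarrow> 'd \<Rightarrow> bool"
  orth :: "'d \<Rightarrow> 'd \<Rightarrow> bool"
  rho :: "'d \<Rightarrow> 'd \<Rightarrow> 'c set"
  rho_map :: "'d \<Rightarrow> 'd \<Rightarrow> 'c \<Rightarrow> 'c set"

definition pnest :: "('x, 'd, 'c) hhs_data \<Rightarrow> 'd \<Rightarrow> 'd \<Rightarrow> bool" where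
  "pnest s U V \<longleftrightarrow> nest s U V \<and> U \<noteq> V"

definition transverse :: "('x, 'd, 'c) hhs_data \<Rightarrow> 'd \<Rightarrow> 'd \<Rightarrow> bool" where
  "transverse s U V \<longleftrightarrow> U \<noteq> V \<and> \<not> nest s U V \<and> \<not> nest s V U \<and> \<not> orth s U V"

abbreviation dist_in :: "('x, 'd, 'c) hhs_data \<Rightarrow> 'd \<Rightarrow> 'c set \<Rightarrow> 'c set \<Rightarrow> real" where
  "dist_in s V \<equiv> set_dist (cspace s V)"

abbreviation diam_in :: "('x, 'd, 'c) hhs_data \<Rightarrow> 'd \<Rightarrow> 'c set \<Rightarrow> ereal" where
  "diam_in s V \<equiv> diam (cspace s V)"

definition coarse_point :: "real \<Rightarrow> 'c metric \<Rightarrow> 'c set \<Rightarrow> bool" where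
  "coarse_point E m A \<longleftrightarrow> A \<noteq> {} \<and> A \<subseteq> mspace m \<and> diam m A \<le> ereal E"

definition hhs_projections :: "real \<Rightarrow> ('x, 'd, 'c) hhs_data \<Rightarrow> bool" where
  "hhs_projections E s \<longleftrightarrow> (\<forall>U\<in>domains s.
     hyperbolic_space E (cspace s U) \<and>
     (\<forall>x\<in>mspace (total s). coarse_point E (cspace s U) (proj s U x)) \<and>
     (\<forall>x\<in>mspace (total s). \<forall>y\<in>mspace (total s).
        dist_in s U (proj s U x) (proj s U y) \<le> E * mdist (total s) x y + E) \<and>
     (\<forall>p\<in>mspace (cspace s U). \<exists>x\<in>mspace (total s). dist_in s U (proj s U x) {p} \<le> E))"

definition hhs_nesting :: "real \<Rightarrow> ('x, 'd, 'c) hhs_data \<Rightarrow> bool" where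
  "hhs_nesting E s \<longleftrightarrow>
     partial_order_on (domains s) {(U, V). U \<in> domains s \<and> V \<in> domains s \<and> nest s U V} \<and>
     (\<exists>!T. T \<in> domains s \<and> (\<forall>U\<in>domains s. \<not> pnest s T U)) \<and>
     (\<forall>\<C>\<subseteq>domains s. (\<forall>U\<in>\<C>. \<forall>V\<in>\<C>. nest s U V \<or> nest s V U) \<longrightarrow>
        finite \<C> \<and> real (card \<C>) \<le> E)"

definition hhs_orthogonality :: "('x, 'd, 'c) hhs_data \<Rightarrow> bool" where
  "hhs_orthogonality s \<longleftrightarrow>
     (\<forall>U\<in>domains s. \<not> orth s U U) \<and>
     (\<forall>U\<in>domains s. \<forall>V\<in>domains s. orth s U V \<longrightarrow>
        orth s V U \<and> \<not> nest s U V \<and> \<not> nest s V U) \<and>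
     (\<forall>U\<in>domains s. \<forall>V\<in>domains s. \<forall>W\<in>domains s. nest s V U \<and> orth s U W \<longrightarrow> orth s V W) \<and>
     (\<forall>T\<in>domains s. \<forall>U\<in>domains s.
        pnest s U T \<and> (\<exists>V\<in>domains s. pnest s V T \<and> orth s V U) \<longrightarrow>
        (\<exists>W\<in>domains s. pnest s W T \<and>
           (\<forall>V\<in>domains s. pnest s V T \<and> orth s V U \<longrightarrow> nest s V W)))"

definition hhs_rho :: "real \<Rightarrow> ('x, 'd, 'c) hhs_data \<Rightarrow> bool" where
  "hhs_rho E s \<longleftrightarrow> (\<forall>U\<in>domains s. \<forall>V\<in>domains s.
     (transverse s U V \<or> pnest s U V \<longrightarrow> coarse_point E (cspace s V) (rho s U V)) \<and>
     (pnest s U V \<longrightarrow>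
        (\<forall>p\<in>mspace (cspace s V). coarse_point E (cspace s U) (rho_map s V U p))))"

text \<open>The two consistency inequalities for a family \<open>b\<close> of sets indexed by the domains in \<open>D\<close>.\<close>

definition consistent_on ::
  "real \<Rightarrow> ('x, 'd, 'c) hhs_data \<Rightarrow> 'd set \<Rightarrow> ('d \<Rightarrow> 'c set) \<Rightarrow> bool" where
  "consistent_on K s D b \<longleftrightarrow> (\<forall>U\<in>D. \<forall>V\<in>D.
     (transverse s U V \<longrightarrow>
        min (dist_in s U (b U) (rho s V U)) (dist_in s V (b V) (rho s U V)) \<le> K) \<and>
     (pnest s U V \<longrightarrow>
        min (ereal (dist_in s V (b V) (rho s U V)))
            (diam_in s U (b U \<union> (\<Union>p\<in>b V. rho_map s V U p))) \<le> ereal K))"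

definition hhs_consistency :: "real \<Rightarrow> ('x, 'd, 'c) hhs_data \<Rightarrow> bool" where
  "hhs_consistency E s \<longleftrightarrow>
     (\<forall>x\<in>mspace (total s). consistent_on E s (domains s) (\<lambda>V. proj s V x)) \<and>
     (\<forall>U\<in>domains s. \<forall>V\<in>domains s. \<forall>W\<in>domains s.
        pnest s U V \<and> (pnest s V W \<or> transverse s V W \<and> \<not> orth s W U) \<longrightarrow>
        dist_in s W (rho s U W) (rho s V W) \<le> E)"

text \<open>
  The list of domains in the large links axiom is a list of at most \<open>\<lfloor>N\<rfloor>\<close> entries; in particular it is
  empty when nothing is properly nested in \<open>W\<close>.
\<close>

definition hhs_large_links :: "real \<Rightarrow> ('x, 'd, 'c) hhs_data \<Rightarrow> bool" where
  "hhs_large_links E s \<longleftrightarrow>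
     (\<forall>W\<in>domains s. \<forall>x\<in>mspace (total s). \<forall>y\<in>mspace (total s).
        let N = E * dist_in s W (proj s W x) (proj s W y) + E in
        \<exists>\<T>. finite \<T> \<and> int (card \<T>) \<le> \<lfloor>N\<rfloor> \<and>
          (\<forall>T\<in>\<T>. T \<in> domains s \<and> pnest s T W \<and> dist_in s W (proj s W x) (rho s T W) \<le> N) \<and>
          (\<forall>T\<in>domains s. pnest s T W \<longrightarrow>
             (\<exists>T'\<in>\<T>. nest s T T') \<or> dist_in s T (proj s T x) (proj s T y) < E))"

definition hhs_bounded_geodesic_image :: "real \<Rightarrow> ('x, 'd, 'c) hhs_data \<Rightarrow> bool" where
  "hhs_bounded_geodesic_image E s \<longleftrightarrow>
     (\<forall>V\<in>domains s. \<forall>W\<in>domains s. \<forall>x y \<gamma>. pnest s V W \<and> geodesic_between (cspace s W) x y \<gamma> \<longrightarrow>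
        diam_in s V (\<Union>p\<in>\<gamma>. rho_map s W V p) \<le> ereal E \<or>
        (\<exists>p\<in>\<gamma>. \<exists>q\<in>rho s V W. mdist (cspace s W) p q \<le> E))"

definition hhs_partial_realization :: "real \<Rightarrow> ('x, 'd, 'c) hhs_data \<Rightarrow> bool" where
  "hhs_partial_realization E s \<longleftrightarrow>
     (\<forall>\<V>\<subseteq>domains s. \<forall>p. (\<forall>U\<in>\<V>. \<forall>V\<in>\<V>. U \<noteq> V \<longrightarrow> orth s U V) \<and>
        (\<forall>V\<in>\<V>. p V \<in> (\<Union>x\<in>mspace (total s). proj s V x)) \<longrightarrow>
        (\<exists>x\<in>mspace (total s). \<forall>V\<in>\<V>.
           dist_in s V (proj s V x) {p V} \<le> E \<and>
           (\<forall>W\<in>domains s. pnest s V W \<or> transverse s W V \<longrightarrow>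
              dist_in s W (proj s W x) (rho s V W) \<le> E)))"

definition hhs_uniqueness :: "('x, 'd, 'c) hhs_data \<Rightarrow> bool" where
  "hhs_uniqueness s \<longleftrightarrow>
     (\<forall>\<kappa>::real. \<exists>\<theta>::real. \<forall>x\<in>mspace (total s). \<forall>y\<in>mspace (total s).
        mdist (total s) x y \<ge> \<theta> \<longrightarrow>
        (\<exists>V\<in>domains s. dist_in s V (proj s V x) (proj s V y) \<ge> \<kappa>))"

definition hhs_with_constant :: "real \<Rightarrow> ('x, 'd, 'c) hhs_data \<Rightarrow> bool" where
  "hhs_with_constant E s \<longleftrightarrow> E \<ge> 1 \<and> quasi_geodesic_space (total s) \<and>
     hhs_projections E s \<and> hhs_nesting E s \<and> hhs_orthogonality s \<and> hhs_rho E s \<and>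
     hhs_consistency E s \<and> hhs_large_links E s \<and> hhs_bounded_geodesic_image E s \<and>
     hhs_partial_realization E s \<and> hhs_uniqueness s"

definition hhs :: "('x, 'd, 'c) hhs_data \<Rightarrow> bool" where
  "hhs s \<longleftrightarrow> (\<exists>E. hhs_with_constant E s)"

definition unbounded_domains :: "('x, 'd, 'c) hhs_data \<Rightarrow> 'd set" where
  "unbounded_domains s = {U \<in> domains s. diam_in s U (mspace (cspace s U)) = \<infinity>}"

section \<open>Hierarchically hyperbolic groups\<close>

definition hhs_automorphism ::
  "real \<Rightarrow> ('x, 'd, 'c) hhs_data \<Rightarrow> ('x \<Rightarrow> 'x) \<Rightarrow> ('d \<Rightarrow> 'd) \<Rightarrow> ('d \<Rightarrow> 'c \<Rightarrow> 'c) \<Rightarrow> bool" where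
  "hhs_automorphism K s f fD fC \<longleftrightarrow>
     quasi_isometry K (total s) (total s) f \<and>
     bij_betw fD (domains s) (domains s) \<and>
     (\<forall>U\<in>domains s. isometry_onto (cspace s U) (cspace s (fD U)) (fC U)) \<and>
     (\<forall>U\<in>domains s. \<forall>V\<in>domains s.
        (nest s (fD U) (fD V) \<longleftrightarrow> nest s U V) \<and> (orth s (fD U) (fD V) \<longleftrightarrow> orth s U V)) \<and>
     (\<forall>U\<in>domains s. \<forall>x\<in>mspace (total s).
        dist_in s (fD U) (fC U ` proj s U x) (proj s (fD U) (f x)) \<le> K) \<and>
     (\<forall>U\<in>domains s. \<forall>V\<in>domains s. transverse s U V \<or> pnest s U V \<longrightarrow>
        dist_in s (fD V) (fC V ` rho s U V) (rho s (fD U) (fD V)) \<le> K) \<and>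
     (\<forall>U\<in>domains s. \<forall>V\<in>domains s. pnest s U V \<longrightarrow> (\<forall>p\<in>mspace (cspace s V).
        dist_in s (fD U) (fC U ` rho_map s V U p) (rho_map s (fD V) (fD U) (fC V p)) \<le> K))"

text \<open>
  The bijections \<open>act_dom a g\<close> of the index set and the isometries \<open>act_pt a g U\<close> from the space of
  \<open>U\<close> to that of \<open>act_dom a g U\<close>, by which an element \<open>g\<close> of a group acts.
\<close>

record ('g, 'd, 'c) hhs_action =
  act_dom :: "'g \<Rightarrow> 'd \<Rightarrow> 'd"
  act_pt :: "'g \<Rightarrow> 'd \<Rightarrow> 'c \<Rightarrow> 'c"

definition finitely_generated :: "('g, 'm) monoid_scheme \<Rightarrow> bool" where
  "finitely_generated G \<longleftrightarrow> (\<exists>A. finite A \<and> A \<subseteq> carrier G \<and> generate G A = carrier G)"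

text \<open>
  \<open>\<phi> g\<close> represents the quasi-isometry by which \<open>g\<close> acts.  As automorphisms inducing the same bijection
  and isometries are identified, being a homomorphism to the automorphism group is a condition on
  \<open>act_dom\<close> and \<open>act_pt\<close> only; on the total space one gets a quasi-action.
\<close>

definition hhg_structure ::
  "('g, 'm) monoid_scheme \<Rightarrow> ('x, 'd, 'c) hhs_data \<Rightarrow> ('g, 'd, 'c) hhs_action \<Rightarrow>
   ('g \<Rightarrow> 'x \<Rightarrow> 'x) \<Rightarrow> bool" where
  "hhg_structure G s a \<phi> \<longleftrightarrow>
     group G \<and> finitely_generated G \<and> hhs s \<and>
     (\<forall>g\<in>carrier G. \<forall>h\<in>carrier G. \<forall>U\<in>domains s.
        act_dom a (g \<otimes>\<^bsub>G\<^esub> h) U = act_dom a g (act_dom a h U) \<and>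
        (\<forall>p\<in>mspace (cspace s U).
           act_pt a (g \<otimes>\<^bsub>G\<^esub> h) U p = act_pt a g (act_dom a h U) (act_pt a h U p))) \<and>
     (\<exists>K. (\<forall>g\<in>carrier G. hhs_automorphism K s (\<phi> g) (act_dom a g) (act_pt a g)) \<and>
        (\<forall>g\<in>carrier G. \<forall>h\<in>carrier G. \<forall>x\<in>mspace (total s).
           mdist (total s) (\<phi> (g \<otimes>\<^bsub>G\<^esub> h) x) (\<phi> g (\<phi> h x)) \<le> K)) \<and>
     (\<forall>x\<in>mspace (total s). \<forall>r. finite {g \<in> carrier G. mdist (total s) x (\<phi> g x) \<le> r}) \<and>
     (\<exists>x\<in>mspace (total s). \<exists>r. \<forall>y\<in>mspace (total s). \<exists>g\<in>carrier G. mdist (total s) (\<phi> g x) y \<le> r) \<and>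
     (\<exists>F. finite F \<and> F \<subseteq> domains s \<and> domains s = (\<Union>g\<in>carrier G. act_dom a g ` F))"

definition group_prod :: "('g, 'm) monoid_scheme \<Rightarrow> 'g list \<Rightarrow> 'g" where
  "group_prod G hs = foldr (mult G) hs \<one>\<^bsub>G\<^esub>"

definition word_length :: "('g, 'm) monoid_scheme \<Rightarrow> 'g set \<Rightarrow> 'g \<Rightarrow> nat" where
  "word_length G A g = (LEAST n. \<exists>ws. length ws = n \<and>
     set ws \<subseteq> A \<union> (\<lambda>x. inv\<^bsub>G\<^esub> x) ` A \<and> group_prod G ws = g)"

definition is_word_metric :: "('g, 'm) monoid_scheme \<Rightarrow> 'g metric \<Rightarrow> bool" where
  "is_word_metric G m \<longleftrightarrow> mspace m = carrier G \<and>
     (\<exists>A. finite A \<and> A \<subseteq> carrier G \<and> generate G A = carrier G \<and>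
        (\<forall>x\<in>carrier G. \<forall>y\<in>carrier G.
           mdist m x y = real (word_length G A (inv\<^bsub>G\<^esub> x \<otimes>\<^bsub>G\<^esub> y))))"

text \<open>
  The normalised form of an HHG structure: the total space is the group with a word metric, on which
  it acts by left multiplication, and all projections and relative projections are equivariant.
\<close>

definition hhg ::
  "('g, 'm) monoid_scheme \<Rightarrow> ('g, 'd, 'c) hhs_data \<Rightarrow> ('g, 'd, 'c) hhs_action \<Rightarrow> bool" where
  "hhg G s a \<longleftrightarrow> hhg_structure G s a (mult G) \<and> is_word_metric G (total s) \<and>
     (\<forall>g\<in>carrier G.
        (\<forall>U\<in>domains s. \<forall>x\<in>carrier G.
           act_pt a g U ` proj s U x = proj s (act_dom a g U) (g \<otimes>\<^bsub>G\<^esub> x)) \<and>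
        (\<forall>U\<in>domains s. \<forall>V\<in>domains s. transverse s U V \<or> pnest s U V \<longrightarrow>
           act_pt a g V ` rho s U V = rho s (act_dom a g U) (act_dom a g V)) \<and>
        (\<forall>U\<in>domains s. \<forall>V\<in>domains s. pnest s U V \<longrightarrow> (\<forall>p\<in>mspace (cspace s V).
           act_pt a g U ` rho_map s V U p =
             rho_map s (act_dom a g V) (act_dom a g U) (act_pt a g V p))))"

definition infinite_order :: "('g, 'm) monoid_scheme \<Rightarrow> 'g \<Rightarrow> bool" where
  "infinite_order G g \<longleftrightarrow> g \<in> carrier G \<and> (\<forall>n::nat. n > 0 \<longrightarrow> g [^]\<^bsub>G\<^esub> n \<noteq> \<one>\<^bsub>G\<^esub>)"

definition commute :: "('g, 'm) monoid_scheme \<Rightarrow> 'g \<Rightarrow> 'g \<Rightarrow> bool" where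
  "commute G g h \<longleftrightarrow> g \<otimes>\<^bsub>G\<^esub> h = h \<otimes>\<^bsub>G\<^esub> g"

definition common_power :: "('g, 'm) monoid_scheme \<Rightarrow> 'g \<Rightarrow> 'g \<Rightarrow> bool" where
  "common_power G g h \<longleftrightarrow> (\<exists>(m::int) (n::int). m \<noteq> 0 \<and> n \<noteq> 0 \<and> g [^]\<^bsub>G\<^esub> m = h [^]\<^bsub>G\<^esub> n)"

definition orbit_proj ::
  "('g, 'm) monoid_scheme \<Rightarrow> ('g, 'd, 'c) hhs_data \<Rightarrow> 'g \<Rightarrow> 'g \<Rightarrow> 'd \<Rightarrow> 'c set" where
  "orbit_proj G s g x U = (\<Union>n::int. proj s U (g [^]\<^bsub>G\<^esub> n \<otimes>\<^bsub>G\<^esub> x))"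

text \<open>The definitions of \<open>Big\<close>, of axial elements and of limit sets do not depend on the point \<open>x\<close>.\<close>

definition Big :: "('g, 'm) monoid_scheme \<Rightarrow> ('g, 'd, 'c) hhs_data \<Rightarrow> 'g \<Rightarrow> 'd set" where
  "Big G s g = {U \<in> domains s. \<exists>x\<in>carrier G. diam_in s U (orbit_proj G s g x U) = \<infinity>}"

definition axial :: "('g, 'm) monoid_scheme \<Rightarrow> ('g, 'd, 'c) hhs_data \<Rightarrow> 'g \<Rightarrow> bool" where
  "axial G s g \<longleftrightarrow> g \<in> carrier G \<and> (\<exists>x\<in>carrier G. \<exists>K.
     qi_embedding K int_metric (total s) (\<lambda>n. g [^]\<^bsub>G\<^esub> n \<otimes>\<^bsub>G\<^esub> x))"

section \<open>Factors\<close>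

text \<open>Tuples on a set \<open>D\<close> of domains are functions that are \<^const>\<open>undefined\<close> outside \<open>D\<close>.\<close>

definition consistent_tuples ::
  "real \<Rightarrow> ('x, 'd, 'c) hhs_data \<Rightarrow> 'd set \<Rightarrow> ('d \<Rightarrow> 'c set) set" where
  "consistent_tuples \<kappa> s D = {b \<in> extensional D.
     (\<forall>V\<in>D. coarse_point \<kappa> (cspace s V) (b V)) \<and> consistent_on \<kappa> s D b}"

definition below :: "('x, 'd, 'c) hhs_data \<Rightarrow> 'd \<Rightarrow> 'd set" where
  "below s U = {V \<in> domains s. nest s V U}"

definition orth_to :: "('x, 'd, 'c) hhs_data \<Rightarrow> 'd \<Rightarrow> 'd set" where
  "orth_to s U = {V \<in> domains s. orth s V U}"

definition F_tuples :: "real \<Rightarrow> ('x, 'd, 'c) hhs_data \<Rightarrow> 'd \<Rightarrow> ('d \<Rightarrow> 'c set) set" where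
  "F_tuples \<kappa> s U = consistent_tuples \<kappa> s (below s U)"

definition E_tuples :: "real \<Rightarrow> ('x, 'd, 'c) hhs_data \<Rightarrow> 'd \<Rightarrow> ('d \<Rightarrow> 'c set) set" where
  "E_tuples \<kappa> s U = consistent_tuples \<kappa> s (orth_to s U)"

text \<open>\<open>\<phi>\<close> is a version, with error \<open>\<theta>\<close>, of the coarsely defined map from the product of the factors.\<close>

definition is_product_map ::
  "real \<Rightarrow> real \<Rightarrow> ('x, 'd, 'c) hhs_data \<Rightarrow> 'd \<Rightarrow> (('d \<Rightarrow> 'c set) \<times> ('d \<Rightarrow> 'c set) \<Rightarrow> 'x) \<Rightarrow> bool" where
  "is_product_map \<theta> \<kappa> s U \<phi> \<longleftrightarrow> (\<forall>b\<in>F_tuples \<kappa> s U. \<forall>e\<in>E_tuples \<kappa> s U.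
     \<phi> (b, e) \<in> mspace (total s) \<and>
     (\<forall>V\<in>domains s. dist_in s V (proj s V (\<phi> (b, e)))
        (if nest s V U then b V else if orth s V U then e V else rho s U V) \<le> \<theta>))"

text \<open>
  The set of tuples carries the metric of its image under \<open>\<phi>\<close> in the total space only up to
  quasi-isometry (\<open>\<phi>\<close> need not be injective): a metric on it is admissible if \<open>\<phi> (-, e)\<close> is a
  quasi-isometric embedding.
\<close>

definition is_factor_metric ::
  "real \<Rightarrow> ('x, 'd, 'c) hhs_data \<Rightarrow> 'd \<Rightarrow> ('d \<Rightarrow> 'c set) metric \<Rightarrow> bool" where
  "is_factor_metric \<kappa> s U m \<longleftrightarrow> mspace m = F_tuples \<kappa> s U \<and>
     (\<exists>\<theta> \<phi> K. is_product_map \<theta> \<kappa> s U \<phi> \<and>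
        (\<exists>e\<in>E_tuples \<kappa> s U. qi_embedding K m (total s) (\<lambda>b. \<phi> (b, e))))"

definition factor_hhs ::
  "('x, 'd, 'c) hhs_data \<Rightarrow> 'd \<Rightarrow> ('d \<Rightarrow> 'c set) metric \<Rightarrow> ('d \<Rightarrow> 'c set, 'd, 'c) hhs_data" where
  "factor_hhs s U m =
     \<lparr> total = m, domains = below s U, cspace = cspace s, proj = (\<lambda>V b. b V),
       nest = nest s, orth = orth s, rho = rho s, rho_map = rho_map s \<rparr>"

text \<open>The action \<open>(g b)\<^sub>g\<^sub>V = g b\<^sub>V\<close> on tuples on a set \<open>D\<close> of domains that is invariant under \<open>g\<close>.\<close>

definition tuple_act ::
  "('g, 'm) monoid_scheme \<Rightarrow> ('g, 'd, 'c) hhs_action \<Rightarrow> 'd set \<Rightarrow> 'g \<Rightarrow> ('d \<Rightarrow> 'c set) \<Rightarrow>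
   ('d \<Rightarrow> 'c set)" where
  "tuple_act G a D g b =
     (\<lambda>W\<in>D. let V = act_dom a (inv\<^bsub>G\<^esub> g) W in act_pt a g V ` b V)"

definition dom_stabilizer ::
  "('g, 'm) monoid_scheme \<Rightarrow> ('g, 'd, 'c) hhs_action \<Rightarrow> 'd \<Rightarrow> 'g set" where
  "dom_stabilizer G a U = {g \<in> carrier G. act_dom a g U = U}"

definition factor_group ::
  "real \<Rightarrow> ('g, 'm) monoid_scheme \<Rightarrow> ('g, 'd, 'c) hhs_data \<Rightarrow> ('g, 'd, 'c) hhs_action \<Rightarrow> 'd \<Rightarrow>
   'g set" where
  "factor_group \<kappa> G s a U = {g \<in> dom_stabilizer G a U.
     \<forall>e\<in>E_tuples \<kappa> s U. tuple_act G a (orth_to s U) g e = e}"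

section \<open>The class \<open>\<Xi>\<close>\<close>

definition strongly_fully_supported ::
  "real \<Rightarrow> ('g, 'm) monoid_scheme \<Rightarrow> ('g, 'd, 'c) hhs_data \<Rightarrow> ('g, 'd, 'c) hhs_action \<Rightarrow> 'g \<Rightarrow> 'd \<Rightarrow>
   bool" where
  "strongly_fully_supported \<kappa> G s a g U \<longleftrightarrow>
     axial G s g \<and> U \<in> unbounded_domains s \<and> g \<in> factor_group \<kappa> G s a U \<and> U \<in> Big G s g"

definition Xi_conditions ::
  "real \<Rightarrow> ('g, 'm) monoid_scheme \<Rightarrow> ('g, 'd, 'c) hhs_data \<Rightarrow> ('g, 'd, 'c) hhs_action \<Rightarrow> bool" where
  "Xi_conditions \<kappa> G s a \<longleftrightarrow>
     (\<forall>U\<in>domains s. \<exists>m. is_factor_metric \<kappa> s U m \<and>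
        hhg_structure (G\<lparr>carrier := factor_group \<kappa> G s a U\<rparr>) (factor_hhs s U m) a
          (tuple_act G a (below s U))) \<and>
     (\<forall>g. infinite_order G g \<longrightarrow>
        (\<exists>n::nat. n > 0 \<and> (\<exists>Us hs. distinct Us \<and> set Us = Big G s g \<and> length hs = length Us \<and>
           g [^]\<^bsub>G\<^esub> n = group_prod G hs \<and>
           (\<forall>i<length Us. strongly_fully_supported \<kappa> G s a (hs ! i) (Us ! i))))) \<and>
     (\<forall>g h U V. strongly_fully_supported \<kappa> G s a g U \<and> strongly_fully_supported \<kappa> G s a h V \<and>
        orth s U V \<longrightarrow> commute G g h)"

text \<open>
  The constant \<open>\<kappa>\<close> is fixed and sufficiently large.  A statement \<open>P \<kappa> \<Longrightarrow> Q\<close> about all sufficiently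
  large \<open>\<kappa>\<close>, where \<open>Q\<close> does not mention \<open>\<kappa>\<close>, has the hypothesis \<open>\<exists>\<^sub>F \<kappa> in at_top. P \<kappa>\<close>.
\<close>

definition class_Xi ::
  "('g, 'm) monoid_scheme \<Rightarrow> ('g, 'd, 'c) hhs_data \<Rightarrow> ('g, 'd, 'c) hhs_action \<Rightarrow> bool" where
  "class_Xi G s a \<longleftrightarrow> hhg G s a \<and> (\<exists>\<^sub>F \<kappa> in at_top. Xi_conditions \<kappa> G s a)"

section \<open>The class \<open>\<Omega>\<close>\<close>

definition fully_supported ::
  "('g, 'm) monoid_scheme \<Rightarrow> ('g, 'd, 'c) hhs_data \<Rightarrow> ('g, 'd, 'c) hhs_action \<Rightarrow> 'g \<Rightarrow> 'd \<Rightarrow> bool" where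
  "fully_supported G s a g U \<longleftrightarrow>
     axial G s g \<and> U \<in> unbounded_domains s \<and> Big G s g = {U} \<and>
     (\<forall>V\<in>unbounded_domains s. orth s V U \<longrightarrow> act_dom a g V = V \<and>
        (\<exists>B::real. \<forall>p\<in>mspace (cspace s V).
           diam_in s V {act_pt a (g [^]\<^bsub>G\<^esub> n) V p | n::int. True} \<le> ereal B))"

text \<open>
  The limit set of \<open>g\<close> in the boundary of the space of \<open>U\<close> is the limit set of the projected orbit of
  \<open>g\<close>, which makes sense also if only a power of \<open>g\<close> fixes \<open>U\<close>.
\<close>

definition elt_limit_set ::
  "('g, 'm) monoid_scheme \<Rightarrow> ('g, 'd, 'c) hhs_data \<Rightarrow> 'g \<Rightarrow> 'd \<Rightarrow> (nat \<Rightarrow> 'c) set set" where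
  "elt_limit_set G s g U = (\<Union>x\<in>carrier G. limit_set (cspace s U) (orbit_proj G s g x U))"

definition geometrically_irredundant ::
  "('g, 'm) monoid_scheme \<Rightarrow> ('g, 'd, 'c) hhs_data \<Rightarrow> 'g set \<Rightarrow> bool" where
  "geometrically_irredundant G s A \<longleftrightarrow> finite A \<and> (\<forall>g\<in>A. axial G s g) \<and>
     (\<forall>g\<in>A. \<forall>h\<in>A. g \<noteq> h \<longrightarrow> Big G s g \<noteq> Big G s h \<or>
        (\<exists>U\<in>Big G s g \<inter> Big G s h. elt_limit_set G s g U \<inter> elt_limit_set G s h U = {}))"

definition class_Omega ::
  "('g, 'm) monoid_scheme \<Rightarrow> ('g, 'd, 'c) hhs_data \<Rightarrow> ('g, 'd, 'c) hhs_action \<Rightarrow> bool" where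
  "class_Omega G s a \<longleftrightarrow> hhg G s a \<and>
     (\<forall>U\<in>unbounded_domains s.
        (\<exists>g. fully_supported G s a g U) \<and>
        (\<not> quasi_line (cspace s U) \<longrightarrow>
           (\<exists>A. infinite A \<and> (\<forall>g\<in>A. fully_supported G s a g U) \<and>
              (\<forall>B\<subseteq>A. finite B \<longrightarrow> geometrically_irredundant G s B)))) \<and>
     (\<forall>g. infinite_order G g \<longrightarrow>
        (\<exists>n::nat. n > 0 \<and> (\<exists>Us hs. distinct Us \<and> set Us = Big G s g \<and> length hs = length Us \<and>
           g [^]\<^bsub>G\<^esub> n = group_prod G hs \<and>
           (\<forall>i<length hs. \<forall>j<length hs. commute G (hs ! i) (hs ! j)) \<and>
           (\<forall>i<length Us. fully_supported G s a (hs ! i) (Us ! i))))) \<and>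
     (\<forall>f1 f2 U1 U2. fully_supported G s a f1 U1 \<and> fully_supported G s a f2 U2 \<longrightarrow>
        (U1 = U2 \<longrightarrow> common_power G f1 f2 \<or> geometrically_irredundant G s {f1, f2}) \<and>
        (orth s U1 U2 \<longrightarrow> (\<exists>N::nat. N > 0 \<and> commute G (f1 [^]\<^bsub>G\<^esub> N) (f2 [^]\<^bsub>G\<^esub> N))) \<and>
        (commute G f1 f2 \<longrightarrow> common_power G f1 f2 \<or> orth s U1 U2))"

section \<open>Virtual structures and the expanded core graph\<close>

definition virtually_Xi ::
  "('g, 'm) monoid_scheme \<Rightarrow> 'g set \<Rightarrow> ('g, 'd, 'c) hhs_data \<Rightarrow> ('g, 'd, 'c) hhs_action \<Rightarrow> bool" where
  "virtually_Xi G H s a \<longleftrightarrow>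
     subgroup H G \<and> finite (rcosets\<^bsub>G\<^esub> H) \<and> class_Xi (G\<lparr>carrier := H\<rparr>) s a"

definition virtually_Omega ::
  "('g, 'm) monoid_scheme \<Rightarrow> 'g set \<Rightarrow> ('g, 'd, 'c) hhs_data \<Rightarrow> ('g, 'd, 'c) hhs_action \<Rightarrow> bool" where
  "virtually_Omega G H s a \<longleftrightarrow>
     subgroup H G \<and> finite (rcosets\<^bsub>G\<^esub> H) \<and> class_Omega (G\<lparr>carrier := H\<rparr>) s a"

definition core_domains :: "('x, 'd, 'c) hhs_data \<Rightarrow> 'd set" where
  "core_domains s = {U \<in> unbounded_domains s. \<forall>V\<in>unbounded_domains s. \<not> pnest s V U}"

definition expanded_core_graph :: "('x, 'd, 'c) hhs_data \<Rightarrow> ('d \<times> nat) sgraph" where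
  "expanded_core_graph s =
     (let vs = (SIGMA U : core_domains s. if quasi_line (cspace s U) then {0} else UNIV)
      in (vs, {{v, w} | v w. v \<in> vs \<and> w \<in> vs \<and> orth s (fst v) (fst w)}))"

end

theory Submission
  imports Defs
begin

text \<open>
  An embedding of the group of \<open>\<Lambda>\<close> sends the vertices to elements with powers \<open>g\<^sub>v\<close> in \<open>H\<close> such that
  \<open>g\<^sub>v\<close> and \<open>g\<^sub>w\<close> virtually commute only if \<open>v\<close> and \<open>w\<close> are equal or adjacent. For adjacent \<open>v\<close> and \<open>w\<close>
  any domain of \<open>Big(g\<^sub>v)\<close> is equal or orthogonal to any domain of \<open>Big(g\<^sub>w)\<close>. A colouring of the core
  graph with \<open>k\<close> colours induces one of the unbounded domains, by the colour of a core domain nested in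
  them, and \<open>v\<close> is coloured by the set of colours of \<open>Big(g\<^sub>v)\<close>. Adjacent vertices of the same colour
  then have the same \<open>Big\<close>, and everything that virtually commutes with one of the two elements does so
  with the other. If \<open>\<Lambda>\<close> has no triangles, such edges are therefore isolated, and \<open>\<Lambda>\<close> is coloured with
  \<open>2 \<cdot> 2\<^sup>k\<close> colours. Graphs of large girth and large chromatic number contradict this.

  The statement on virtual commutation reduces to components \<open>h\<close>, \<open>e\<close> supported on a common domain \<open>U\<close>,
  which must have a common power if they virtually commute. For the second class this follows because
  their limit sets in the boundary of the space of \<open>U\<close> meet. For the first class \<open>h\<close> and \<open>e\<close> are
  loxodromic on \<open>U\<close>, since an element that moves all points of an orbit little would have a power fixing
  a smaller domain or have infinitely many powers moving a point of the product region of \<open>U\<close> little.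
  Hence some combinations \<open>h\<^sup>i e\<^sup>j\<close> move three aligned points little, and by the same dichotomy only
  finitely many of them can be distinct.
\<close>

section \<open>Graphs of large girth and chromatic number\<close>

text \<open>The delicate point is uniformity. In the non-loxodromic case the three points depend on
  how many powers of \<open>h\<close> are to move them little. The number of exceptions therefore
  has to be bounded before the points are chosen, by a number that does not depend on them; this is
  why the counting lemmas quantify over all points after the bound. Which case applies is decided by
  a single inequality: at some point the displacement gains more than \<open>8 * E\<close> from
  \<open>h [^] j\<close> to \<open>h [^] (2 * j)\<close>. Exact commutation does not survive the
  steps of the argument (entering \<open>H\<close>, fixing domains, splitting into components), as
  each of them costs a power; hence virtual commutation throughout. The graphs come from the
  probabilistic method in counting form: each of \<open>n\<close> vertices chooses \<open>d\<close>
  neighbours, the \<open>i\<close>-th choice of \<open>x\<close> being \<open>F (i, x)\<close>, and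
  a vertex that chooses itself contributes no edge.\<close>

definition map_graph :: "nat \<Rightarrow> nat \<Rightarrow> (nat \<times> nat \<Rightarrow> nat) \<Rightarrow> nat sgraph" where
  "map_graph d n F = ({..<n}, {{x, F (i, x)} | i x. i < d \<and> x < n \<and> F (i, x) < n \<and> F (i, x) \<noteq> x})"

definition short_cycles :: "'a sgraph \<Rightarrow> nat \<Rightarrow> 'a list set" where
  "short_cycles \<Gamma> M = {p. is_cycle \<Gamma> p \<and> length p < M}"

text \<open>Multiplied out over the naturals, this says that \<open>l\<close> prescriptions at
  distinct arguments hold with probability at most \<open>1 / card T ^ l\<close>. It is only a bound
  because the entries of \<open>ys\<close> may lie outside \<open>T\<close>, and then nothing is
  counted.\<close>

lemma card_prescribed_values:
  fixes S :: "'a set" and T :: "'b set"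
  assumes "finite S" "finite T" "distinct xs" "set xs \<subseteq> S" "length ys = length xs"
  shows "card {F \<in> S \<rightarrow>\<^sub>E T. \<forall>j<length xs. F (xs ! j) = ys ! j} * card T ^ length xs \<le> card T ^ card S"
proof -
  let ?v = "\<lambda>a. ys ! (SOME j. j < length xs \<and> xs ! j = a)"
  have v: "?v (xs ! j) = ys ! j" if "j < length xs" for j
  proof -
    have "(SOME k. k < length xs \<and> xs ! k = xs ! j) = j"
      by (rule some_equality) (use that assms(3) nth_eq_iff_index_eq in auto)
    then show ?thesis by simp
  qed
  let ?B = "\<lambda>a. if a \<in> set xs then {?v a} else T"
  have "{F \<in> S \<rightarrow>\<^sub>E T. \<forall>j<length xs. F (xs ! j) = ys ! j} \<subseteq> PiE S ?B"
  proof
    fix F assume F: "F \<in> {F \<in> S \<rightarrow>\<^sub>E T. \<forall>j<length xs. F (xs ! j) = ys ! j}"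
    show "F \<in> PiE S ?B"
    proof (rule PiE_I)
      fix a assume a: "a \<in> S"
      show "F a \<in> ?B a"
      proof (cases "a \<in> set xs")
        case True
        then obtain j where j: "j < length xs" "a = xs ! j" by (metis in_set_conv_nth)
        then show ?thesis using F v[OF j(1)] by auto
      qed (use F a in auto)
    qed (use F in \<open>auto simp: PiE_def extensional_def\<close>)
  qed
  then have "card {F \<in> S \<rightarrow>\<^sub>E T. \<forall>j<length xs. F (xs ! j) = ys ! j} \<le> card (PiE S ?B)"
    by (intro card_mono finite_PiE) (use assms in auto)
  also have "\<dots> = (\<Prod>a\<in>S. card (?B a))" using assms(1) by (rule card_PiE)
  also have "\<dots> = (\<Prod>a\<in>S - set xs. card (?B a)) * (\<Prod>a\<in>set xs. card (?B a))"
    using assms(1,4) by (rule prod.subset_diff[OF _ _, rotated])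
  also have "\<dots> = card T ^ card (S - set xs)"
    by (simp add: Diff_eq[symmetric])
  also have "card (S - set xs) = card S - length xs"
    using assms by (simp add: card_Diff_subset distinct_card)
  finally have *: "card {F \<in> S \<rightarrow>\<^sub>E T. \<forall>j<length xs. F (xs ! j) = ys ! j} \<le> card T ^ (card S - length xs)" .
  have "length xs \<le> card S"
    using assms by (metis card_mono distinct_card)
  then have "card T ^ (card S - length xs) * card T ^ length xs = card T ^ card S"
    by (simp add: power_add[symmetric])
  then show ?thesis using mult_le_mono1[OF *, of "card T ^ length xs"] by (simp only:)
qed

text \<open>Length at least 3 matters: a closed walk of length 2 uses its only edge twice. Distinct
  edges make the choices behind the edges of a cycle independent.\<close>

lemma cycle_edges_distinct:
  assumes "distinct p" "length p \<ge> 3" "j < length p" "k < length p"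
    "{p ! j, p ! (Suc j mod length p)} = {p ! k, p ! (Suc k mod length p)}"
  shows "j = k"
proof (rule ccontr)
  assume ne: "j \<noteq> k"
  let ?l = "length p"
  have l: "Suc j mod ?l < ?l" "Suc k mod ?l < ?l" using assms(2) by (auto intro: mod_less_divisor)
  note eq = nth_eq_iff_index_eq[OF assms(1)]
  have "p ! j \<noteq> p ! k" using ne assms(3,4) eq by simp
  then have "p ! j = p ! (Suc k mod ?l)" "p ! k = p ! (Suc j mod ?l)"
    using assms(5) by (auto simp: doubleton_eq_iff)
  then have "j = Suc k mod ?l" "k = Suc j mod ?l"
    using assms(3,4) l eq by simp_all
  then show False using assms(2,3,4)
    by (simp add: mod_Suc mod_less[OF assms(3)] mod_less[OF assms(4)] split: if_splits)
qed

text \<open>Each of the \<open>l\<close> edges of a cycle arises from a choice made by one of its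
  two ends with one of \<open>d\<close> indices, so one of \<open>(2 * d) ^ l\<close> patterns
  holds. A fixed pattern prescribes \<open>l\<close> values of \<open>F\<close>.\<close>

lemma card_graphs_with_cycle:
  fixes d n :: nat
  assumes p: "distinct p" "length p \<ge> 3" "set p \<subseteq> {..<n}"
  defines "\<Omega> \<equiv> ({..<d} \<times> {..<n}) \<rightarrow>\<^sub>E {..<n}"
  shows "card {F \<in> \<Omega>. is_cycle (map_graph d n F) p} * n ^ length p \<le> (2 * d) ^ length p * n ^ (d * n)"
proof -
  let ?l = "length p"
  let ?L = "{ls :: (nat \<times> bool) list. set ls \<subseteq> {..<d} \<times> UNIV \<and> length ls = ?l}"
  \<comment> \<open>For the \<open>j\<close>-th edge of the cycle, \<open>ls ! j\<close> holds the
    index of the choice and, as a truth value, whether the earlier end makes it.\<close>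
  define arg where "arg = (\<lambda>(ls::(nat\<times>bool) list) j. (fst (ls ! j), if snd (ls ! j) then p ! j else p ! (Suc j mod ?l)))"
  define val where "val = (\<lambda>(ls::(nat\<times>bool) list) j. if snd (ls ! j) then p ! (Suc j mod ?l) else p ! j)"
  define Q where "Q = (\<lambda>ls. {F \<in> \<Omega>. \<forall>j<?l. F (arg ls j) = val ls j})"
  have fin\<Omega>: "finite \<Omega>" unfolding \<Omega>_def by (intro finite_PiE) auto
  have finL: "finite ?L" by (rule finite_lists_length_eq) auto
  have cardL: "card ?L = (2 * d) ^ ?l"
    by (subst card_lists_length_eq) (auto simp: card_cartesian_product mult.commute)
  have sub: "{F \<in> \<Omega>. is_cycle (map_graph d n F) p} \<subseteq> (\<Union>ls\<in>?L. Q ls)"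
  proof
    fix F assume F: "F \<in> {F \<in> \<Omega>. is_cycle (map_graph d n F) p}"
    have "\<exists>ib. fst ib < d \<and> F (fst ib, if snd ib then p ! j else p ! (Suc j mod ?l)) =
        (if snd ib then p ! (Suc j mod ?l) else p ! j)" if "j < ?l" for j
    proof -
      have "{p ! j, p ! (Suc j mod ?l)} \<in> edges (map_graph d n F)"
        using F that by (auto simp: is_cycle_def)
      then obtain i x where ix: "i < d" "{p ! j, p ! (Suc j mod ?l)} = {x, F (i, x)}"
        by (auto simp: map_graph_def)
      then consider "x = p ! j" "F (i, x) = p ! (Suc j mod ?l)" | "x = p ! (Suc j mod ?l)" "F (i, x) = p ! j"
        by (auto simp: doubleton_eq_iff)
      then show ?thesis
      proof cases
        case 1 then show ?thesis using ix by (intro exI[of _ "(i, True)"]) auto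
      next
        case 2 then show ?thesis using ix by (intro exI[of _ "(i, False)"]) auto
      qed
    qed
    then obtain ib where ib: "\<And>j. j < ?l \<Longrightarrow> fst (ib j) < d \<and> F (fst (ib j), if snd (ib j) then p ! j else p ! (Suc j mod ?l)) =
        (if snd (ib j) then p ! (Suc j mod ?l) else p ! j)" by metis
    let ?ls = "map ib [0..<?l]"
    have ib': "ib j \<in> {..<d} \<times> UNIV" if "j < ?l" for j using ib[OF that] by (cases "ib j") simp
    have "set ?ls \<subseteq> {..<d} \<times> UNIV"
      unfolding set_map set_upt by (rule image_subsetI) (use ib' in simp)
    then have "?ls \<in> ?L" by simp
    moreover have "F \<in> Q ?ls" using F ib by (auto simp: Q_def arg_def val_def)
    ultimately show "F \<in> (\<Union>ls\<in>?L. Q ls)" by blast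
  qed
  have Qle: "card (Q ls) * n ^ ?l \<le> n ^ (d * n)" if ls: "ls \<in> ?L" for ls
  proof (cases "Q ls = {}")
    case False
    then obtain F where F: "F \<in> Q ls" by blast
    let ?xs = "map (arg ls) [0..<?l]" and ?ys = "map (val ls) [0..<?l]"
    \<comment> \<open>Argument and value together determine the unordered edge. The value depends on
      the argument through \<open>F\<close> only, so a member of \<open>Q ls\<close> has to be at
      hand; an empty \<open>Q ls\<close> is trivial to count.\<close>
    have "inj_on (arg ls) {..<?l}"
    proof (rule inj_onI)
      fix j k assume jk: "j \<in> {..<?l}" "k \<in> {..<?l}" "arg ls j = arg ls k"
      have val: "val ls j = val ls k" using F jk by (auto simp: Q_def) (metis jk(3))
      have "{p ! j, p ! (Suc j mod ?l)} = {snd (arg ls j), val ls j}" for j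
        by (auto simp: arg_def val_def)
      then have "{p ! j, p ! (Suc j mod ?l)} = {p ! k, p ! (Suc k mod ?l)}"
        using jk(3) val by metis
      then show "j = k" using cycle_edges_distinct[of p j k] p jk by auto
    qed
    then have dist: "distinct ?xs"
      unfolding distinct_map set_upt atLeast0LessThan by (intro conjI distinct_upt)
    have setx: "set ?xs \<subseteq> {..<d} \<times> {..<n}"
    proof -
      have argin: "arg ls j \<in> {..<d} \<times> {..<n}" if "j < ?l" for j
      proof -
        have "ls ! j \<in> set ls" using ls that by simp
        then have lsj: "ls ! j \<in> {..<d} \<times> UNIV" using ls by blast
        have "Suc j mod ?l < ?l" using that by (intro mod_less_divisor) auto
        then have "p ! j \<in> {..<n}" "p ! (Suc j mod ?l) \<in> {..<n}"
          using subsetD[OF p(3) nth_mem, of j] subsetD[OF p(3) nth_mem, of "Suc j mod ?l"] that by blast+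
        then show ?thesis using lsj by (cases "ls ! j") (simp add: arg_def)
      qed
      show ?thesis unfolding set_map set_upt by (rule image_subsetI) (use argin in simp)
    qed
    have "card {F \<in> ({..<d} \<times> {..<n}) \<rightarrow>\<^sub>E {..<n}. \<forall>j<length ?xs. F (?xs ! j) = ?ys ! j} * card {..<n} ^ length ?xs
      \<le> card {..<n} ^ card ({..<d} \<times> {..<n})"
      by (rule card_prescribed_values) (use dist setx in auto)
    moreover have "{F \<in> ({..<d} \<times> {..<n}) \<rightarrow>\<^sub>E {..<n}. \<forall>j<length ?xs. F (?xs ! j) = ?ys ! j} = Q ls"
      by (auto simp: Q_def \<Omega>_def)
    ultimately show ?thesis by (simp add: card_cartesian_product)
  qed simp
  have "card {F \<in> \<Omega>. is_cycle (map_graph d n F) p} \<le> card (\<Union>ls\<in>?L. Q ls)"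
    by (rule card_mono[OF _ sub]) (use fin\<Omega> finL in \<open>auto simp: Q_def\<close>)
  also have "\<dots> \<le> (\<Sum>ls\<in>?L. card (Q ls))" by (rule card_UN_le[OF finL])
  finally have "card {F \<in> \<Omega>. is_cycle (map_graph d n F) p} * n ^ ?l \<le> (\<Sum>ls\<in>?L. card (Q ls)) * n ^ ?l"
    by (rule mult_le_mono1)
  also have "\<dots> = (\<Sum>ls\<in>?L. card (Q ls) * n ^ ?l)" by (rule sum_distrib_right)
  also have "\<dots> \<le> (\<Sum>ls\<in>?L. n ^ (d * n))" by (rule sum_mono) (rule Qle)
  also have "\<dots> = (2 * d) ^ ?l * n ^ (d * n)" unfolding sum_constant cardL by (simp only: of_nat_id)
  finally show ?thesis .
qed

lemma finite_short_cycles: "finite (verts \<Gamma>) \<Longrightarrow> finite (short_cycles \<Gamma> M)"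
  by (rule finite_subset[OF _ finite_lists_length_le[of "verts \<Gamma>" M]])
     (auto simp: short_cycles_def is_cycle_def)

text \<open>There are \<open>n ^ l\<close> lists of length \<open>l\<close>, each a cycle with
  probability at most \<open>(2 * d / n) ^ l\<close>, so \<open>n\<close> cancels from the expected
  number. A cycle is counted once for every starting point and direction, which only makes the bound
  stronger.\<close>

lemma sum_short_cycles:
  fixes d n M :: nat
  assumes "n > 0"
  defines "\<Omega> \<equiv> ({..<d} \<times> {..<n}) \<rightarrow>\<^sub>E {..<n}"
  shows "(\<Sum>F\<in>\<Omega>. card (short_cycles (map_graph d n F) M)) \<le> (\<Sum>l<M. (2 * d) ^ l) * n ^ (d * n)"
proof -
  have fin\<Omega>: "finite \<Omega>" unfolding \<Omega>_def by (intro finite_PiE) auto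
  let ?P = "\<lambda>l. {p :: nat list. set p \<subseteq> {..<n} \<and> length p = l}"
  let ?I = "\<lambda>F p. if is_cycle (map_graph d n F) p then 1 else 0 :: nat"
  have finP: "finite (?P l)" for l by (rule finite_lists_length_eq) auto
  have cardP: "card (?P l) = n ^ l" for l by (subst card_lists_length_eq) auto
  have "card (short_cycles (map_graph d n F) M) \<le> (\<Sum>l<M. \<Sum>p\<in>?P l. ?I F p)" for F
  proof -
    have "short_cycles (map_graph d n F) M = (\<Union>l<M. {p \<in> ?P l. is_cycle (map_graph d n F) p})"
      by (auto simp: short_cycles_def is_cycle_def map_graph_def)
    then have "card (short_cycles (map_graph d n F) M) \<le> (\<Sum>l<M. card {p \<in> ?P l. is_cycle (map_graph d n F) p})"
      using card_UN_le[of "{..<M}" "\<lambda>l. {p \<in> ?P l. is_cycle (map_graph d n F) p}"] by simp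
    also have "\<dots> = (\<Sum>l<M. \<Sum>p\<in>?P l. ?I F p)"
    proof (rule sum.cong[OF HOL.refl])
      fix l
      have "(\<Sum>p\<in>?P l. ?I F p) = (\<Sum>p\<in>?P l \<inter> {p. is_cycle (map_graph d n F) p}. 1)"
        by (rule sum.inter_restrict[symmetric, OF finP, THEN HOL.trans[rotated]]) simp
      then show "card {p \<in> ?P l. is_cycle (map_graph d n F) p} = (\<Sum>p\<in>?P l. ?I F p)"
        by (simp add: Int_def)
    qed
    finally show ?thesis .
  qed
  then have "(\<Sum>F\<in>\<Omega>. card (short_cycles (map_graph d n F) M)) \<le> (\<Sum>F\<in>\<Omega>. \<Sum>l<M. \<Sum>p\<in>?P l. ?I F p)"
    by (rule sum_mono)
  also have "\<dots> = (\<Sum>l<M. \<Sum>F\<in>\<Omega>. \<Sum>p\<in>?P l. ?I F p)" by (rule sum.swap)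
  also have "\<dots> = (\<Sum>l<M. \<Sum>p\<in>?P l. \<Sum>F\<in>\<Omega>. ?I F p)" by (intro sum.cong HOL.refl sum.swap)
  also have "\<dots> \<le> (\<Sum>l<M. (2 * d) ^ l * n ^ (d * n))"
  proof (rule sum_mono)
    fix l
    have cancel: "x \<le> y" if "x * k \<le> y * k" "k > 0" for x y k :: nat using that by simp
    have le: "(\<Sum>F\<in>\<Omega>. ?I F p) * n ^ l \<le> (2 * d) ^ l * n ^ (d * n)" if p: "p \<in> ?P l" for p
    proof -
      have eq: "(\<Sum>F\<in>\<Omega>. ?I F p) = card {F \<in> \<Omega>. is_cycle (map_graph d n F) p}"
        using fin\<Omega> by (simp add: sum.If_cases Int_def)
      show ?thesis
      proof (cases "distinct p \<and> length p \<ge> 3")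
        case True
        then show ?thesis using card_graphs_with_cycle[of p n d] p eq unfolding \<Omega>_def by auto
      next
        case False
        then have "{F \<in> \<Omega>. is_cycle (map_graph d n F) p} = {}" by (auto simp: is_cycle_def)
        then have "(\<Sum>F\<in>\<Omega>. ?I F p) = 0" using eq by (metis card.empty)
        then show ?thesis by simp
      qed
    qed
    have "(\<Sum>p\<in>?P l. (\<Sum>F\<in>\<Omega>. ?I F p)) * n ^ l = (\<Sum>p\<in>?P l. (\<Sum>F\<in>\<Omega>. ?I F p) * n ^ l)"
      by (rule sum_distrib_right)
    also have "\<dots> \<le> (\<Sum>p\<in>?P l. (2 * d) ^ l * n ^ (d * n))"
      using le by (rule sum_mono)
    also have "\<dots> = ((2 * d) ^ l * n ^ (d * n)) * n ^ l"
      unfolding sum_constant cardP by (simp only: of_nat_id mult.commute)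
    finally have *: "(\<Sum>p\<in>?P l. (\<Sum>F\<in>\<Omega>. ?I F p)) * n ^ l \<le> ((2 * d) ^ l * n ^ (d * n)) * n ^ l" .
    show "(\<Sum>p\<in>?P l. (\<Sum>F\<in>\<Omega>. ?I F p)) \<le> (2 * d) ^ l * n ^ (d * n)"
      by (rule cancel[OF *]) (use assms(1) in simp)
  qed
  finally show ?thesis by (simp add: sum_distrib_right)
qed

text \<open>The \<open>d * m\<close> choices made at vertices of \<open>A\<close> all have to avoid
  the \<open>m - 1\<close> other vertices of \<open>A\<close>; the remaining choices are
  free.\<close>

lemma card_graphs_with_independent_set:
  fixes d n m :: nat
  assumes A: "A \<subseteq> {..<n}" "card A = m"
  defines "\<Omega> \<equiv> ({..<d} \<times> {..<n}) \<rightarrow>\<^sub>E {..<n}"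
  shows "card {F \<in> \<Omega>. \<forall>i<d. \<forall>x\<in>A. F (i, x) \<notin> A - {x}} * n ^ (d * m) \<le> (n - (m - 1)) ^ (d * m) * n ^ (d * n)"
proof -
  have finA: "finite A" using A by (meson finite_lessThan finite_subset)
  let ?B = "\<lambda>(i::nat, x). if x \<in> A then {..<n} - (A - {x}) else {..<n}"
  have "{F \<in> \<Omega>. \<forall>i<d. \<forall>x\<in>A. F (i, x) \<notin> A - {x}} \<subseteq> PiE ({..<d} \<times> {..<n}) ?B"
  proof
    fix F assume F: "F \<in> {F \<in> \<Omega>. \<forall>i<d. \<forall>x\<in>A. F (i, x) \<notin> A - {x}}"
    show "F \<in> PiE ({..<d} \<times> {..<n}) ?B"
    proof (rule PiE_I)
      fix a assume "a \<in> {..<d} \<times> {..<n}"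
      then obtain i x where ix: "a = (i, x)" "i < d" "x < n" by blast
      have "F a \<in> {..<n}" using F \<open>a \<in> _\<close> unfolding \<Omega>_def by blast
      moreover have "x \<in> A \<Longrightarrow> F a \<notin> A - {x}" using F ix by blast
      ultimately show "F a \<in> ?B a" using ix(1) by simp
    next
      fix a assume "a \<notin> {..<d} \<times> {..<n}"
      then show "F a = undefined" using F unfolding \<Omega>_def by blast
    qed
  qed
  then have "card {F \<in> \<Omega>. \<forall>i<d. \<forall>x\<in>A. F (i, x) \<notin> A - {x}} \<le> card (PiE ({..<d} \<times> {..<n}) ?B)"
    by (intro card_mono finite_PiE) auto
  also have "\<dots> = (\<Prod>a\<in>{..<d} \<times> {..<n}. card (?B a))" by (rule card_PiE) simp
  also have "\<dots> = (\<Prod>i<d. \<Prod>x<n. card (?B (i, x)))"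
    unfolding prod.cartesian_product by (rule prod.cong[OF HOL.refl]) auto
  also have "\<dots> = (\<Prod>i<d. (n - (m - 1)) ^ m * n ^ (n - m))"
  proof (rule prod.cong[OF HOL.refl])
    fix i
    have "(\<Prod>x<n. card (?B (i, x))) = (\<Prod>x\<in>{..<n} - A. card (?B (i, x))) * (\<Prod>x\<in>A. card (?B (i, x)))"
      by (rule prod.subset_diff) (use A in auto)
    also have "(\<Prod>x\<in>{..<n} - A. card (?B (i, x))) = n ^ (n - m)"
      using A finA by (simp add: card_Diff_subset)
    also have "(\<Prod>x\<in>A. card (?B (i, x))) = (\<Prod>x\<in>A. n - (m - 1))"
    proof (rule prod.cong[OF HOL.refl])
      fix x assume "x \<in> A"
      then have "card ({..<n} - (A - {x})) = n - (m - 1)"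
        using A finA by (subst card_Diff_subset) auto
      then show "card (?B (i, x)) = n - (m - 1)" using \<open>x \<in> A\<close> by simp
    qed
    finally show "(\<Prod>x<n. card (?B (i, x))) = (n - (m - 1)) ^ m * n ^ (n - m)"
      using A by (simp add: mult.commute)
  qed
  also have "\<dots> = (n - (m - 1)) ^ (d * m) * n ^ (d * (n - m))"
    by (simp add: power_mult_distrib power_mult[symmetric] mult.commute)
  finally have *: "card {F \<in> \<Omega>. \<forall>i<d. \<forall>x\<in>A. F (i, x) \<notin> A - {x}} \<le> (n - (m - 1)) ^ (d * m) * n ^ (d * (n - m))" .
  have "m \<le> n" using A by (metis card_lessThan card_mono finite_lessThan)
  then have "d * (n - m) + d * m = d * n" by (simp add: distrib_left[symmetric])
  then have "n ^ (d * (n - m)) * n ^ (d * m) = n ^ (d * n)" by (simp add: power_add[symmetric])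
  then show ?thesis using mult_le_mono1[OF *, of "n ^ (d * m)"] by (simp add: mult.assoc)
qed

text \<open>
  The expected number of short cycles of \<^term>\<open>map_graph d n F\<close> is bounded independently of \<open>n\<close>,
  while a union bound over vertex sets excludes independent sets of proportional size.
\<close>

lemma ex_map_graph:
  fixes K M :: nat
  shows "\<exists>d n m F C. n = (K + 1) * m \<and> m > C \<and> card (short_cycles (map_graph d n F) M) \<le> C \<and>
    (\<forall>A\<subseteq>{..<n}. card A = m \<longrightarrow> (\<exists>i<d. \<exists>x\<in>A. F (i, x) \<in> A - {x}))"
proof -
  \<comment> \<open>Since \<open>n = (K + 1) * m\<close> and \<open>m \<ge> 2\<close>, the
    proportion of values that avoid \<open>m - 1\<close> given vertices is at most \<rho>.\<close>
  define \<rho> :: real where "\<rho> = 1 - 1 / (2 * (real K + 1))"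
  have \<rho>: "0 < \<rho>" "\<rho> < 1" unfolding \<rho>_def by (auto simp: field_simps)
  \<comment> \<open>This makes \<open>2 ^ n * \<rho> ^ (d * m)\<close> at most \<open>1 / 2\<close>,
    so the union bound over all vertex sets leaves at least half of the functions.\<close>
  obtain d where d: "\<rho> ^ d < 1 / 2 ^ (K + 2)"
    using real_arch_pow_inv[of "1 / 2 ^ (K + 2)" \<rho>] \<rho> by auto
  define C where "C = (\<Sum>l<M. (2 * d) ^ l)"
  \<comment> \<open>By Markov's inequality fewer than half of the functions give more than
    \<open>2 * C\<close> short cycles. As \<open>m > 2 * C\<close>, deleting one vertex from each of
    them costs fewer than \<open>m\<close> vertices. The number called \<open>C\<close> in the
    statement is this \<open>2 * C\<close>.\<close>
  define m where "m = 2 * C + 2"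
  define n where "n = (K + 1) * m"
  define \<Omega> where "\<Omega> = ({..<d} \<times> {..<n}) \<rightarrow>\<^sub>E {..<n}"
  have n0: "n > 0" "m \<ge> 2" by (auto simp: n_def m_def)
  have fin\<Omega>: "finite \<Omega>" unfolding \<Omega>_def by (intro finite_PiE) auto
  have card\<Omega>: "card \<Omega> = n ^ (d * n)" unfolding \<Omega>_def
    by (simp add: card_PiE card_cartesian_product)
  define B1 where "B1 = {F \<in> \<Omega>. card (short_cycles (map_graph d n F) M) > 2 * C}"
  define B2 where "B2 = {F \<in> \<Omega>. \<exists>A\<subseteq>{..<n}. card A = m \<and> (\<forall>i<d. \<forall>x\<in>A. F (i, x) \<notin> A - {x})}"
  have "card B1 * (2 * C + 1) = (\<Sum>F\<in>B1. 2 * C + 1)" by simp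
  also have "\<dots> \<le> (\<Sum>F\<in>B1. card (short_cycles (map_graph d n F) M))"
    by (rule sum_mono) (auto simp: B1_def)
  also have "\<dots> \<le> (\<Sum>F\<in>\<Omega>. card (short_cycles (map_graph d n F) M))"
    by (rule sum_mono2[OF fin\<Omega>]) (auto simp: B1_def)
  also have "\<dots> \<le> C * card \<Omega>" unfolding C_def card\<Omega> unfolding \<Omega>_def by (rule sum_short_cycles[OF n0(1)])
  finally have b1: "card B1 * (2 * C + 1) \<le> C * card \<Omega>" .
  have b1': "2 * card B1 < card \<Omega>"
  proof (rule ccontr)
    assume "\<not> 2 * card B1 < card \<Omega>"
    then have "C * card \<Omega> \<le> C * (2 * card B1)" by simp
    then have "card B1 * (2 * C + 1) \<le> C * (2 * card B1)" using b1 by linarith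
    then have "card B1 = 0" by (simp add: algebra_simps)
    then show False using \<open>\<not> 2 * card B1 < card \<Omega>\<close> card\<Omega> n0 by simp
  qed
  let ?Q = "\<lambda>A. {F \<in> \<Omega>. \<forall>i<d. \<forall>x\<in>A. F (i, x) \<notin> A - {x}}"
  let ?S = "{A. A \<subseteq> {..<n} \<and> card A = m}"
  have finS: "finite ?S" by simp
  have "card ?S \<le> card (Pow {..<n})" by (rule card_mono) auto
  then have cardS: "real (card ?S) \<le> 2 ^ n" by (metis card_Pow finite_lessThan card_lessThan of_nat_le_iff of_nat_numeral of_nat_power)
  have Qle: "real (card (?Q A)) \<le> \<rho> ^ (d * m) * card \<Omega>" if "A \<in> ?S" for A
  proof -
    have "real (card (?Q A) * n ^ (d * m)) \<le> real ((n - (m - 1)) ^ (d * m) * n ^ (d * n))"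
      using card_graphs_with_independent_set[of A n m d] that unfolding \<Omega>_def of_nat_le_iff by auto
    then have "real (card (?Q A)) * real n ^ (d * m) \<le> real (n - (m - 1)) ^ (d * m) * card \<Omega>"
      by (simp add: card\<Omega>)
    also have "real (n - (m - 1)) \<le> \<rho> * n"
    proof -
      have "real (n - (m - 1)) = real n - real m + 1" using n0 by (simp add: n_def of_nat_diff)
      moreover have "\<rho> * n = real n - real m / 2" unfolding \<rho>_def n_def by (simp add: field_simps)
      ultimately show ?thesis using n0 by simp
    qed
    then have "real (n - (m - 1)) ^ (d * m) * card \<Omega> \<le> (\<rho> * n) ^ (d * m) * card \<Omega>"
      by (intro mult_right_mono power_mono) auto
    finally have "real (card (?Q A)) * real n ^ (d * m) \<le> (\<rho> ^ (d * m) * card \<Omega>) * real n ^ (d * m)"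
      by (simp add: power_mult_distrib mult_ac)
    then show ?thesis using n0 by simp
  qed
  have "B2 = (\<Union>A\<in>?S. ?Q A)" by (auto simp: B2_def)
  then have "card B2 \<le> (\<Sum>A\<in>?S. card (?Q A))" using card_UN_le[OF finS, of ?Q] by simp
  then have "real (card B2) \<le> (\<Sum>A\<in>?S. real (card (?Q A)))" by (simp flip: of_nat_sum)
  also have "\<dots> \<le> (\<Sum>A\<in>?S. \<rho> ^ (d * m) * card \<Omega>)" by (rule sum_mono) (rule Qle)
  also have "\<dots> = card ?S * (\<rho> ^ (d * m) * card \<Omega>)" by simp
  also have "\<dots> \<le> 2 ^ n * (\<rho> ^ (d * m) * card \<Omega>)" using cardS \<rho> by (intro mult_right_mono) auto
  finally have b2: "real (card B2) \<le> 2 ^ n * \<rho> ^ (d * m) * card \<Omega>" by (simp add: mult.assoc)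
  have "2 * (2 ^ n * \<rho> ^ (d * m)) \<le> 1"
  proof -
    have "2 ^ (K + 2) * \<rho> ^ d \<le> 1" using d by (simp add: field_simps)
    then have "(2 ^ (K + 2) * \<rho> ^ d) ^ m \<le> 1" using \<rho> by (intro power_le_one) auto
    moreover have "(2 ^ (K + 2) * \<rho> ^ d) ^ m = 2 ^ ((K + 2) * m) * \<rho> ^ (d * m)"
      by (simp only: power_mult_distrib power_mult)
    moreover have "(2::real) ^ (n + 1) \<le> 2 ^ ((K + 2) * m)"
      using n0 by (intro power_increasing) (auto simp: n_def)
    moreover from this have "2 ^ (n + 1) * \<rho> ^ (d * m) \<le> 2 ^ ((K + 2) * m) * \<rho> ^ (d * m)"
      using \<rho> by (intro mult_right_mono) auto
    ultimately have "2 ^ (n + 1) * \<rho> ^ (d * m) \<le> 1" by linarith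
    then show ?thesis by (simp only: power_add power_one_right mult_ac)
  qed
  then have "2 * real (card B2) \<le> card \<Omega>"
    using b2 mult_right_mono[of "2 * (2 ^ n * \<rho> ^ (d * m))" 1 "real (card \<Omega>)"] by (simp add: mult_ac)
  then have "card B1 + card B2 < card \<Omega>" using b1' by linarith
  moreover have "card (B1 \<union> B2) \<le> card B1 + card B2" by (rule card_Un_le)
  ultimately have "B1 \<union> B2 \<noteq> \<Omega>" by auto
  moreover have "B1 \<union> B2 \<subseteq> \<Omega>" unfolding B1_def B2_def by blast
  ultimately obtain F where F: "F \<in> \<Omega>" "F \<notin> B1" "F \<notin> B2" by blast
  have "card (short_cycles (map_graph d n F) M) \<le> 2 * C"
    using F(1,2) unfolding B1_def by (simp add: not_less)
  moreover have "\<forall>A\<subseteq>{..<n}. card A = m \<longrightarrow> (\<exists>i<d. \<exists>x\<in>A. F (i, x) \<in> A - {x})"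
    using F(1,3) unfolding B2_def by blast
  moreover have "m > 2 * C" by (simp add: m_def)
  ultimately show ?thesis using n_def by blast
qed

text \<open>Erdos's deletion argument: without the first vertex of every short cycle more than
  \<open>K * m\<close> vertices remain, so one of \<open>K\<close> colour classes has at least
  \<open>m\<close> elements and therefore contains an edge.\<close>

theorem ex_large_girth_not_colourable:
  fixes K M :: nat
  shows "\<exists>\<Lambda> :: nat sgraph. simplicial_graph \<Lambda> \<and> finite (verts \<Lambda>) \<and> girth \<Lambda> \<ge> enat M \<and>
    (\<forall>c. \<not> proper_colouring \<Lambda> K c)"
proof -
  obtain d n m F C where *: "n = (K + 1) * m \<and> m > C \<and> card (short_cycles (map_graph d n F) M) \<le> C \<and>
    (\<forall>A\<subseteq>{..<n}. card A = m \<longrightarrow> (\<exists>i<d. \<exists>x\<in>A. F (i, x) \<in> A - {x}))"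
    using ex_map_graph[of K M] by (elim exE) (rule that)
  note n = *[THEN conjunct1] and m = *[THEN conjunct2, THEN conjunct1]
    and sc = *[THEN conjunct2, THEN conjunct2, THEN conjunct1]
  have ind: "\<exists>i<d. \<exists>x\<in>A. F (i, x) \<in> A - {x}" if "A \<subseteq> {..<n}" "card A = m" for A
    using *[THEN conjunct2, THEN conjunct2, THEN conjunct2, rule_format, OF that] .
  let ?\<Gamma> = "map_graph d n F"
  define R where "R = hd ` short_cycles ?\<Gamma> M"
  define \<Lambda> :: "nat sgraph" where "\<Lambda> = ({..<n} - R, {e \<in> edges ?\<Gamma>. e \<inter> R = {}})"
  have "finite (short_cycles ?\<Gamma> M)" by (rule finite_short_cycles) (simp add: map_graph_def)
  then have cardR: "card R \<le> C" "finite R" unfolding R_def using sc card_image_le le_trans by blast+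
  have "simplicial_graph \<Lambda>"
    by (auto simp: simplicial_graph_def \<Lambda>_def map_graph_def)
  moreover have "finite (verts \<Lambda>)" by (simp add: \<Lambda>_def)
  moreover have "girth \<Lambda> \<ge> enat M"
    unfolding girth_def
  proof (rule Inf_greatest, clarsimp)
    fix p assume p: "is_cycle \<Lambda> p"
    show "M \<le> length p"
    proof (rule ccontr)
      assume "\<not> M \<le> length p"
      moreover have "is_cycle ?\<Gamma> p" using p by (auto simp: is_cycle_def \<Lambda>_def map_graph_def)
      ultimately have "hd p \<in> R" by (auto simp: R_def short_cycles_def)
      moreover have "p \<noteq> []" using p by (auto simp: is_cycle_def)
      moreover have "set p \<subseteq> {..<n} - R" using p by (simp add: is_cycle_def \<Lambda>_def)
      ultimately show False using hd_in_set[of p] by blast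
    qed
  qed
  moreover have "\<not> proper_colouring \<Lambda> K c" for c
  proof
    assume c: "proper_colouring \<Lambda> K c"
    have "\<exists>k<K. card {v \<in> verts \<Lambda>. c v = k} \<ge> m"
    proof (rule ccontr)
      assume "\<not> ?thesis"
      then have "card {v \<in> verts \<Lambda>. c v = k} \<le> m" if "k < K" for k using that by (meson nat_le_linear)
      then have "(\<Sum>k<K. card {v \<in> verts \<Lambda>. c v = k}) \<le> (\<Sum>k<K. m)" by (intro sum_mono) auto
      moreover have "verts \<Lambda> = (\<Union>k<K. {v \<in> verts \<Lambda>. c v = k})"
        using c by (auto simp: proper_colouring_def)
      then have "card (verts \<Lambda>) \<le> (\<Sum>k<K. card {v \<in> verts \<Lambda>. c v = k})"
        using card_UN_le[of "{..<K}" "\<lambda>k. {v \<in> verts \<Lambda>. c v = k}"] by simp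
      moreover have "card (verts \<Lambda>) \<ge> n - C"
        using cardR diff_card_le_card_Diff[of R "{..<n}"] by (simp add: \<Lambda>_def)
      ultimately have "n - C \<le> K * m" by simp
      then show False using n m by simp
    qed
    then obtain k where k: "k < K" "card {v \<in> verts \<Lambda>. c v = k} \<ge> m" by blast
    then obtain A where A: "A \<subseteq> {v \<in> verts \<Lambda>. c v = k}" "card A = m"
      using obtain_subset_with_card_n by metis
    have "A \<subseteq> {..<n}" using A by (auto simp: \<Lambda>_def)
    from ind[OF this A(2)] obtain i x where ix: "i < d" "x \<in> A" "F (i, x) \<in> A" "F (i, x) \<noteq> x" by auto
    then have "x \<in> verts \<Lambda>" "F (i, x) \<in> verts \<Lambda>" "c x = k" "c (F (i, x)) = k" using A by auto
    moreover from this have "{x, F (i, x)} \<in> edges \<Lambda>"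
      using ix unfolding \<Lambda>_def map_graph_def by auto
    ultimately show False using c unfolding proper_colouring_def by metis
  qed
  ultimately show ?thesis by blast
qed

section \<open>Words in right-angled Artin groups\<close>

lemma pres_eq_words:
  assumes "pres_eq X R u v" "\<forall>r\<in>R. fst ` set r \<subseteq> X"
  shows "fst ` set u \<subseteq> X \<and> fst ` set v \<subseteq> X"
  using assms by induction auto

lemma pres_eq_append:
  assumes "pres_eq X R u v" "fst ` set a \<subseteq> X" "fst ` set b \<subseteq> X"
  shows "pres_eq X R (a @ u @ b) (a @ v @ b)"
  using assms
proof induction
  case (cancel u w x c)
  then show ?case using pres_eq.cancel[of "a @ u" "w @ b" X x R c] by (simp add: image_Un)
next
  case (relator u r w)
  then show ?case using pres_eq.relator[of "a @ u" r "w @ b" X R] by (simp add: image_Un)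
next
  case (refl u)
  then show ?case by (intro pres_eq.refl) (simp add: image_Un)
next
  case (sym u v)
  then show ?case using pres_eq.sym[of X R "a @ u @ b"] by simp
next
  case (trans u v w)
  then show ?case using pres_eq.trans[of X R "a @ u @ b" "a @ v @ b"] by simp
qed

lemma pres_eq_congruence:
  assumes "pres_eq X R u u'" "pres_eq X R v v'" "\<forall>r\<in>R. fst ` set r \<subseteq> X"
  shows "pres_eq X R (u @ v) (u' @ v')"
proof -
  have "pres_eq X R (u @ v) (u' @ v)"
    using pres_eq_append[OF assms(1), of "[]" v] pres_eq_words[OF assms(2,3)] by simp
  moreover have "pres_eq X R (u' @ v) (u' @ v')"
    using pres_eq_append[OF assms(2), of u' "[]"] pres_eq_words[OF assms(1,3)] by simp
  ultimately show ?thesis by (rule pres_eq.trans)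
qed

lemma pres_rel_Image_eq_iff:
  assumes "fst ` set u \<subseteq> X"
  shows "pres_rel X R `` {u} = pres_rel X R `` {v} \<longleftrightarrow> pres_eq X R u v"
proof
  assume "pres_rel X R `` {u} = pres_rel X R `` {v}"
  moreover have "u \<in> pres_rel X R `` {u}" using assms by (auto simp: pres_rel_def intro: pres_eq.refl)
  ultimately show "pres_eq X R u v" by (auto simp: pres_rel_def intro: pres_eq.sym)
next
  assume "pres_eq X R u v"
  then show "pres_rel X R `` {u} = pres_rel X R `` {v}"
    by (auto simp: pres_rel_def intro: pres_eq.trans pres_eq.sym)
qed

lemma presented_group_mult:
  assumes "fst ` set u \<subseteq> X" "fst ` set v \<subseteq> X" "\<forall>r\<in>R. fst ` set r \<subseteq> X"
  shows "pres_rel X R `` {u} \<otimes>\<^bsub>presented_group X R\<^esub> pres_rel X R `` {v} = pres_rel X R `` {u @ v}"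
proof -
  let ?A = "pres_rel X R `` {u}" and ?B = "pres_rel X R `` {v}" and ?C = "pres_rel X R `` {u @ v}"
  have *: "pres_rel X R `` {u' @ v'} = ?C" if "u' \<in> ?A" "v' \<in> ?B" for u' v'
  proof -
    have "pres_eq X R (u @ v) (u' @ v')"
      by (rule pres_eq_congruence) (use that assms in \<open>auto simp: pres_rel_def\<close>)
    moreover have "fst ` set (u @ v) \<subseteq> X" using assms by (simp add: image_Un)
    ultimately show ?thesis using pres_rel_Image_eq_iff by metis
  qed
  have ne: "?A \<noteq> {}" "?B \<noteq> {}"
    using assms pres_eq.refl[of u X R] pres_eq.refl[of v X R] by (auto simp: pres_rel_def)
  have "(\<Union>u'\<in>?A. \<Union>v'\<in>?B. pres_rel X R `` {u' @ v'}) = (\<Union>u'\<in>?A. \<Union>v'\<in>?B. ?C)"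
    by (intro SUP_cong HOL.refl *)
  also have "\<dots> = ?C" using ne by (simp only: UN_constant if_False)
  finally show ?thesis unfolding presented_group_def monoid.simps .
qed

definition raag_class :: "'a sgraph \<Rightarrow> 'a word \<Rightarrow> 'a word set" where
  "raag_class \<Lambda> u = pres_rel (verts \<Lambda>) {commutator_word v w | v w. {v, w} \<in> edges \<Lambda>} `` {u}"

abbreviation raag_eq :: "'a sgraph \<Rightarrow> 'a word \<Rightarrow> 'a word \<Rightarrow> bool" where
  "raag_eq \<Lambda> \<equiv> pres_eq (verts \<Lambda>) {commutator_word v w | v w. {v, w} \<in> edges \<Lambda>}"

lemma raag_relator_words:
  assumes "simplicial_graph \<Lambda>"
  shows "\<forall>r\<in>{commutator_word v w | v w. {v, w} \<in> edges \<Lambda>}. fst ` set r \<subseteq> verts \<Lambda>"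
  using assms by (fastforce simp: simplicial_graph_def commutator_word_def)

lemma raag_class_mult:
  assumes "simplicial_graph \<Lambda>" "fst ` set u \<subseteq> verts \<Lambda>" "fst ` set v \<subseteq> verts \<Lambda>"
  shows "raag_class \<Lambda> u \<otimes>\<^bsub>raag \<Lambda>\<^esub> raag_class \<Lambda> v = raag_class \<Lambda> (u @ v)"
  unfolding raag_class_def raag_def using assms raag_relator_words[OF assms(1)]
  by (intro presented_group_mult)

lemma raag_class_carrier: "fst ` set u \<subseteq> verts \<Lambda> \<Longrightarrow> raag_class \<Lambda> u \<in> carrier (raag \<Lambda>)"
  by (auto simp: raag_class_def raag_def presented_group_def quotient_def)

lemma raag_class_eq_iff: "fst ` set u \<subseteq> verts \<Lambda> \<Longrightarrow> raag_class \<Lambda> u = raag_class \<Lambda> v \<longleftrightarrow> raag_eq \<Lambda> u v"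
  unfolding raag_class_def by (rule pres_rel_Image_eq_iff)

lemma raag_eq_commute:
  assumes "simplicial_graph \<Lambda>" "{v, w} \<in> edges \<Lambda>"
  shows "raag_eq \<Lambda> [(v, True), (w, True)] [(w, True), (v, True)]"
proof -
  let ?R = "{commutator_word v w | v w. {v, w} \<in> edges \<Lambda>}"
  have vw: "v \<in> verts \<Lambda>" "w \<in> verts \<Lambda>" using assms by (auto simp: simplicial_graph_def)
  have r: "commutator_word v w \<in> ?R" using assms by blast
  let ?c = "[(v, True), (w, True), (v, False), (w, False)]"
  have "raag_eq \<Lambda> ([] @ ?c @ [(w, True), (v, True)]) ([] @ [(w, True), (v, True)])"
    using pres_eq.relator[of "[]" "commutator_word v w" "[(w, True), (v, True)]" "verts \<Lambda>" ?R] vw r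
    by (simp add: commutator_word_def)
  moreover have "raag_eq \<Lambda> ([(v, True), (w, True), (v, False)] @ [(w, False), (w, \<not> False)] @ [(v, True)])
     ([(v, True), (w, True), (v, False)] @ [(v, True)])"
    by (rule pres_eq.cancel) (use vw in auto)
  moreover have "raag_eq \<Lambda> ([(v, True), (w, True)] @ [(v, False), (v, \<not> False)] @ []) ([(v, True), (w, True)] @ [])"
    by (rule pres_eq.cancel) (use vw in auto)
  ultimately show ?thesis
    by (simp only: append_Cons append_Nil append_Nil2 not_False_eq_True) (metis (no_types, lifting) pres_eq.sym pres_eq.trans)
qed

text \<open>Integer \<open>2 \<times> 2\<close> matrices as nested pairs of columns acting on vectors: the letters over \<open>v\<close> act as
  upper, those over \<open>w\<close> as lower elementary shears, all others trivially.\<close>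

fun shear :: "'a \<Rightarrow> 'a \<Rightarrow> 'a \<times> bool \<Rightarrow> int \<times> int \<Rightarrow> int \<times> int" where
  "shear v w (x, b) (p, q) =
     (if x = v then (if b then p + q else p - q, q)
      else if x = w then (p, if b then q + p else q - p) else (p, q))"

definition shears :: "'a \<Rightarrow> 'a \<Rightarrow> 'a word \<Rightarrow> int \<times> int \<Rightarrow> int \<times> int" where
  "shears v w u = foldr (shear v w) u"

lemma shears_append: "shears v w (u @ u') z = shears v w u (shears v w u' z)"
  by (simp add: shears_def)

text \<open>A relator commutes two different letters that are not the pair \<open>v\<close>,
  \<open>w\<close>, so at most one of them acts by a nontrivial shear. The case \<open>v = w\<close>
  is included and serves to detect the order of a generator.\<close>

lemma shears_raag_eq:
  assumes "raag_eq \<Lambda> u u'" "{v, w} \<notin> edges \<Lambda>" "simplicial_graph \<Lambda>"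
  shows "shears v w u z = shears v w u' z"
  using assms(1)
proof (induction arbitrary: z)
  case (cancel u t x b)
  have "shears v w [(x, b), (x, \<not> b)] y = y" for y by (cases y) (auto simp: shears_def)
  then show ?case by (simp only: shears_append)
next
  case (relator u r t)
  then obtain x y where xy: "r = commutator_word x y" "{x, y} \<in> edges \<Lambda>" by blast
  have "{x, y} \<noteq> {v, w}" using xy assms by metis
  moreover have "x \<noteq> y" using xy assms(3) by (auto simp: simplicial_graph_def)
  ultimately have "shears v w r y = y" for y
    unfolding xy(1) by (cases y) (auto simp: shears_def commutator_word_def)
  then show ?case by (simp only: shears_append)
qed auto

lemma shears_replicate:
  assumes "v \<noteq> w"
  shows "shears v w (replicate m (v, True)) (p, q) = (p + int m * q, q)"
    "shears v w (replicate n (w, True)) (p, q) = (p, q + int n * p)"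
proof -
  show "shears v w (replicate m (v, True)) (p, q) = (p + int m * q, q)"
    by (induction m) (auto simp: shears_def algebra_simps)
  show "shears v w (replicate n (w, True)) (p, q) = (p, q + int n * p)"
    using assms by (induction n) (auto simp: shears_def algebra_simps)
qed

lemma raag_powers_commute:
  assumes "simplicial_graph \<Lambda>" "m > 0" "n > 0"
    "raag_eq \<Lambda> (replicate m (v, True) @ replicate n (w, True)) (replicate n (w, True) @ replicate m (v, True))"
  shows "v = w \<or> {v, w} \<in> edges \<Lambda>"
proof (rule ccontr)
  assume "\<not> ?thesis"
  then have ne: "v \<noteq> w" "{v, w} \<notin> edges \<Lambda>" by auto
  \<comment> \<open>The two words send \<open>(1, 0)\<close> to \<open>(1 + m * n, n)\<close> and to
    \<open>(1, n)\<close>.\<close>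
  have "shears v w (replicate m (v, True) @ replicate n (w, True)) (1, 0) =
      shears v w (replicate n (w, True) @ replicate m (v, True)) (1, 0)"
    by (rule shears_raag_eq[OF assms(4) ne(2) assms(1)])
  then show False using assms(2,3) ne(1) by (simp add: shears_append shears_replicate)
qed

lemma raag_generator_infinite_order:
  assumes "simplicial_graph \<Lambda>" "n > 0"
  shows "\<not> raag_eq \<Lambda> (replicate n (v, True)) []"
proof
  assume *: "raag_eq \<Lambda> (replicate n (v, True)) []"
  have "{v, v} \<notin> edges \<Lambda>" using assms(1) by (auto simp: simplicial_graph_def)
  \<comment> \<open>With both distinguished vertices equal to \<open>v\<close>, the word sends
    \<open>(0, 1)\<close> to \<open>(n, 1)\<close>.\<close>
  from shears_raag_eq[OF * this assms(1), of "(0, 1)"]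
  have "shears v v (replicate n (v, True)) (0, 1) = (0, 1)" by (simp add: shears_def)
  moreover have "shears v v (replicate n (v, True)) (p, q) = (p + int n * q, q)" for p q
    by (induction n) (auto simp: shears_def algebra_simps)
  ultimately show False using assms(2) by simp
qed

section \<open>Images of the generators under an embedding\<close>

context
  fixes \<Lambda> :: "'a sgraph" and G :: "('g, 'm) monoid_scheme" and f :: "'a word set \<Rightarrow> 'g"
  assumes \<Lambda>: "simplicial_graph \<Lambda>" and G: "group G"
    and f: "f \<in> hom (raag \<Lambda>) G" "inj_on f (carrier (raag \<Lambda>))"
begin

interpretation group G by (rule G)

definition gen_image :: "'a \<Rightarrow> 'g" where "gen_image v = f (raag_class \<Lambda> [(v, True)])"

lemma gen_image_closed: "v \<in> verts \<Lambda> \<Longrightarrow> gen_image v \<in> carrier G"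
  unfolding gen_image_def by (rule hom_in_carrier[OF f(1)]) (auto intro: raag_class_carrier)

lemma hom_raag_class_append:
  assumes "fst ` set u \<subseteq> verts \<Lambda>" "fst ` set v \<subseteq> verts \<Lambda>"
  shows "f (raag_class \<Lambda> (u @ v)) = f (raag_class \<Lambda> u) \<otimes>\<^bsub>G\<^esub> f (raag_class \<Lambda> v)"
  using hom_mult[OF f(1) raag_class_carrier[OF assms(1)] raag_class_carrier[OF assms(2)]]
  unfolding raag_class_mult[OF \<Lambda> assms] .

lemma hom_raag_class_Nil: "f (raag_class \<Lambda> []) = \<one>\<^bsub>G\<^esub>"
proof -
  have "f (raag_class \<Lambda> []) \<in> carrier G" by (rule hom_in_carrier[OF f(1)]) (auto intro: raag_class_carrier)
  moreover have "f (raag_class \<Lambda> []) \<otimes>\<^bsub>G\<^esub> f (raag_class \<Lambda> []) = f (raag_class \<Lambda> [])"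
    using hom_raag_class_append[of "[]" "[]"] by simp
  ultimately show ?thesis by (metis l_cancel_one)
qed

lemma gen_image_pow:
  assumes "v \<in> verts \<Lambda>"
  shows "gen_image v [^]\<^bsub>G\<^esub> (n::nat) = f (raag_class \<Lambda> (replicate n (v, True)))"
proof (induction n)
  case 0
  then show ?case by (simp add: hom_raag_class_Nil)
next
  case (Suc n)
  have "f (raag_class \<Lambda> (replicate n (v, True) @ [(v, True)])) =
      f (raag_class \<Lambda> (replicate n (v, True))) \<otimes>\<^bsub>G\<^esub> gen_image v"
    unfolding gen_image_def by (rule hom_raag_class_append) (use assms in auto)
  then show ?case using Suc by (simp add: replicate_append_same)
qed

lemma gen_image_infinite_order:
  assumes "v \<in> verts \<Lambda>" "n > 0"
  shows "gen_image v [^]\<^bsub>G\<^esub> (n::nat) \<noteq> \<one>\<^bsub>G\<^esub>"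
proof
  assume "gen_image v [^]\<^bsub>G\<^esub> n = \<one>\<^bsub>G\<^esub>"
  then have "f (raag_class \<Lambda> (replicate n (v, True))) = f (raag_class \<Lambda> [])"
    using gen_image_pow[OF assms(1)] hom_raag_class_Nil by simp
  moreover have w: "fst ` set (replicate n (v, True)) \<subseteq> verts \<Lambda>" using assms by auto
  ultimately have "raag_class \<Lambda> (replicate n (v, True)) = raag_class \<Lambda> []"
    using inj_onD[OF f(2) _ raag_class_carrier[OF w] raag_class_carrier[of "[]"]] by simp
  then show False
    using raag_class_eq_iff[OF w] raag_generator_infinite_order[OF \<Lambda> assms(2)] by simp
qed

lemma gen_image_commute:
  assumes "{v, w} \<in> edges \<Lambda>"
  shows "gen_image v \<otimes>\<^bsub>G\<^esub> gen_image w = gen_image w \<otimes>\<^bsub>G\<^esub> gen_image v"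
proof -
  have vw: "v \<in> verts \<Lambda>" "w \<in> verts \<Lambda>" using assms \<Lambda> by (auto simp: simplicial_graph_def)
  have "raag_class \<Lambda> [(v, True), (w, True)] = raag_class \<Lambda> [(w, True), (v, True)]"
    using raag_eq_commute[OF \<Lambda> assms] vw by (subst raag_class_eq_iff) auto
  then show ?thesis
    using hom_raag_class_append[of "[(v, True)]" "[(w, True)]"] hom_raag_class_append[of "[(w, True)]" "[(v, True)]"] vw
    by (simp add: gen_image_def)
qed

lemma gen_image_powers_commute:
  assumes "v \<in> verts \<Lambda>" "w \<in> verts \<Lambda>" "m > 0" "n > 0"
    "gen_image v [^]\<^bsub>G\<^esub> (m::nat) \<otimes>\<^bsub>G\<^esub> gen_image w [^]\<^bsub>G\<^esub> (n::nat) = gen_image w [^]\<^bsub>G\<^esub> n \<otimes>\<^bsub>G\<^esub> gen_image v [^]\<^bsub>G\<^esub> m"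
  shows "v = w \<or> {v, w} \<in> edges \<Lambda>"
proof -
  let ?u = "replicate m (v, True)" and ?t = "replicate n (w, True)"
  have ut: "fst ` set ?u \<subseteq> verts \<Lambda>" "fst ` set ?t \<subseteq> verts \<Lambda>" using assms by auto
  then have ut': "fst ` set (?u @ ?t) \<subseteq> verts \<Lambda>" "fst ` set (?t @ ?u) \<subseteq> verts \<Lambda>" by auto
  have "f (raag_class \<Lambda> (?u @ ?t)) = f (raag_class \<Lambda> (?t @ ?u))"
    using assms ut by (simp only: gen_image_pow hom_raag_class_append)
  then have "raag_class \<Lambda> (?u @ ?t) = raag_class \<Lambda> (?t @ ?u)"
    by (rule inj_onD[OF f(2) _ raag_class_carrier[OF ut'(1)] raag_class_carrier[OF ut'(2)]])
  then show ?thesis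
    using raag_class_eq_iff[OF ut'(1)] raag_powers_commute[OF \<Lambda> assms(3,4)] by blast
qed

end

lemma finite_index_power:
  fixes G :: "('g, 'm) monoid_scheme"
  assumes "group G" "subgroup H G" "finite (rcosets\<^bsub>G\<^esub> H)" "g \<in> carrier G"
  shows "\<exists>n::nat. n > 0 \<and> g [^]\<^bsub>G\<^esub> n \<in> H"
proof -
  interpret group G by fact
  have "(\<lambda>n::nat. H #>\<^bsub>G\<^esub> (g [^]\<^bsub>G\<^esub> n)) ` UNIV \<subseteq> rcosets\<^bsub>G\<^esub> H"
    using assms(4) by (auto simp: RCOSETS_def)
  then have "finite (range (\<lambda>n::nat. H #>\<^bsub>G\<^esub> (g [^]\<^bsub>G\<^esub> n)))" using assms(3) finite_subset by blast
  then have "\<not> inj (\<lambda>n::nat. H #>\<^bsub>G\<^esub> (g [^]\<^bsub>G\<^esub> n))" using finite_imageD infinite_UNIV_nat by blast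
  then obtain i j :: nat where ij: "i < j" "H #>\<^bsub>G\<^esub> (g [^]\<^bsub>G\<^esub> i) = H #>\<^bsub>G\<^esub> (g [^]\<^bsub>G\<^esub> j)"
    by (auto simp: inj_def) (metis nat_neq_iff)
  have "g [^]\<^bsub>G\<^esub> j \<in> H #>\<^bsub>G\<^esub> (g [^]\<^bsub>G\<^esub> i)"
    unfolding ij(2) using assms(4) by (intro rcos_self[OF _ assms(2)]) auto
  then obtain h where h: "h \<in> H" "g [^]\<^bsub>G\<^esub> j = h \<otimes>\<^bsub>G\<^esub> g [^]\<^bsub>G\<^esub> i" by (auto simp: r_coset_def)
  have "g [^]\<^bsub>G\<^esub> j = g [^]\<^bsub>G\<^esub> (j - i) \<otimes>\<^bsub>G\<^esub> g [^]\<^bsub>G\<^esub> i"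
    using nat_pow_mult[OF assms(4), of "j - i" i] ij(1) by simp
  then have "h = g [^]\<^bsub>G\<^esub> (j - i)"
    using h assms(2,4) subgroup.mem_carrier by (metis nat_pow_closed right_cancel)
  then show ?thesis using h ij(1) by (intro exI[of _ "j - i"]) auto
qed

section \<open>Coarse subsets of metric spaces\<close>

text \<open>Quantifying over all pairs gives a relation with a triangle inequality, which the
  infimum \<open>set_dist\<close> lacks. For sets of bounded diameter the two differ by these
  diameters, see \<open>near_set_dist\<close>.\<close>

definition near :: "'a metric \<Rightarrow> real \<Rightarrow> 'a set \<Rightarrow> 'a set \<Rightarrow> bool" where
  "near m D A B \<longleftrightarrow> (\<forall>x\<in>A. \<forall>y\<in>B. mdist m x y \<le> D)"

lemma nearD: "near m D A B \<Longrightarrow> x \<in> A \<Longrightarrow> y \<in> B \<Longrightarrow> mdist m x y \<le> D"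
  by (simp add: near_def)

lemma near_sym: "near m D A B \<Longrightarrow> near m D B A"
  unfolding near_def by (metis mdist_commute)

lemma near_mono: "near m D A B \<Longrightarrow> D \<le> D' \<Longrightarrow> near m D' A B"
  by (fastforce simp: near_def)

lemma near_trans:
  assumes "near m D A B" "near m D' B C" "B \<noteq> {}" "A \<subseteq> mspace m" "B \<subseteq> mspace m" "C \<subseteq> mspace m"
  shows "near m (D + D') A C"
  unfolding near_def
proof (intro ballI)
  fix x z assume xz: "x \<in> A" "z \<in> C"
  obtain y where y: "y \<in> B" using assms(3) by blast
  have "mdist m x z \<le> mdist m x y + mdist m y z"
    using mdist_triangle[of x m y z] xz y assms(4-6) by blast
  then show "mdist m x z \<le> D + D'"
    using nearD[OF assms(1) xz(1) y] nearD[OF assms(2) y xz(2)] by linarith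
qed

lemma near_nonneg: "near m D A B \<Longrightarrow> A \<noteq> {} \<Longrightarrow> B \<noteq> {} \<Longrightarrow> 0 \<le> D"
  using nearD[of m D A B] mdist_nonneg[of m] by (metis ex_in_conv order_trans)

lemma diam_le_iff_near: "diam m A \<le> ereal D \<longleftrightarrow> near m D A A"
  unfolding diam_def near_def by (auto simp: SUP_le_iff)

lemma coarse_point_near: "coarse_point E m A \<Longrightarrow> near m E A A"
  by (simp add: coarse_point_def diam_le_iff_near)

lemma set_dist_le_near:
  assumes "near m D A B" "A \<noteq> {}" "B \<noteq> {}"
  shows "set_dist m A B \<le> D"
proof -
  obtain x y where "x \<in> A" "y \<in> B" using assms by blast
  moreover have "bdd_below ((\<lambda>(x, y). mdist m x y) ` (A \<times> B))"
    by (rule bdd_belowI[of _ 0]) auto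
  ultimately have "set_dist m A B \<le> mdist m x y"
    unfolding set_dist_def by (metis (no_types, lifting) SigmaI cINF_lower case_prod_conv)
  then show ?thesis using nearD[OF assms(1) \<open>x \<in> A\<close> \<open>y \<in> B\<close>] by linarith
qed

lemma near_set_dist:
  assumes "near m E A A" "near m E' B B" "A \<noteq> {}" "B \<noteq> {}" "A \<subseteq> mspace m" "B \<subseteq> mspace m" "set_dist m A B \<le> D"
  shows "near m (D + (E + E')) A B"
  unfolding near_def
proof (intro ballI)
  fix x y assume xy: "x \<in> A" "y \<in> B"
  show "mdist m x y \<le> D + (E + E')"
  \<comment> \<open>The infimum in \<open>set_dist\<close> need not be attained.\<close>
  proof (rule field_le_epsilon)
    fix e :: real assume "e > 0"
    then have "set_dist m A B < D + e" using assms(7) by linarith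
    then obtain u where u: "u \<in> A \<times> B" "(\<lambda>(x, y). mdist m x y) u < D + e"
      unfolding set_dist_def using assms(3,4) by (subst (asm) cINF_less_iff) (auto intro!: bdd_belowI[of _ 0])
    obtain x' y' where x': "u = (x', y')" "x' \<in> A" "y' \<in> B" using u(1) by blast
    have "mdist m x y \<le> mdist m x x' + mdist m x' y" "mdist m x' y \<le> mdist m x' y' + mdist m y' y"
      using mdist_triangle[of x m x' y] mdist_triangle[of x' m y' y] xy x' assms(5,6) by blast+
    moreover have "mdist m x x' \<le> E" "mdist m y' y \<le> E'" using nearD assms(1,2) xy x' by metis+
    ultimately show "mdist m x y \<le> D + (E + E') + e" using u(2) x'(1) by simp
  qed
qed

lemma near_isometry:
  assumes "isometry_onto m m' f" "A \<subseteq> mspace m" "B \<subseteq> mspace m"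
  shows "near m' D (f ` A) (f ` B) \<longleftrightarrow> near m D A B"
  using assms unfolding near_def isometry_onto_def by (auto simp: subset_iff)

section \<open>Geodesics, slim triangles and the four-point condition\<close>

lemma geodesic_between_sym:
  assumes "geodesic_between m x y \<gamma>"
  shows "geodesic_between m y x \<gamma>"
proof -
  obtain L c where c: "geodesic m L c" "c 0 = x" "c L = y" "\<gamma> = c ` {0..L}"
    using assms by (auto simp: geodesic_between_def)
  have im: "(\<lambda>t. L - t) ` {0..L} = {0..L}"
    by simp
  have "(\<lambda>t. c (L - t)) ` {0..L} = c ` (\<lambda>t. L - t) ` {0..L}" by (simp only: image_image)
  then have "(\<lambda>t. c (L - t)) ` {0..L} = c ` {0..L}" unfolding im .
  moreover from this have "geodesic m L (\<lambda>t. c (L - t))"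
    using c(1) by (auto simp: geodesic_def)
  ultimately show ?thesis unfolding geodesic_between_def
    using c by (intro exI[of _ L] exI[of _ "\<lambda>t. c (L - t)"]) auto
qed

lemma geodesic_between_point:
  assumes "geodesic_between m x y \<gamma>" "q \<in> \<gamma>"
  shows "q \<in> mspace m" "mdist m x q + mdist m q y = mdist m x y"
proof -
  obtain L c where c: "geodesic m L c" "c 0 = x" "c L = y" "\<gamma> = c ` {0..L}"
    using assms(1) by (auto simp: geodesic_between_def)
  obtain t where t: "q = c t" "t \<in> {0..L}" using assms(2) c(4) by blast
  show "q \<in> mspace m" using c t by (auto simp: geodesic_def)
  have "mdist m x q = t" "mdist m q y = L - t" "mdist m x y = L"
    using c t unfolding geodesic_def by force+
  then show "mdist m x q + mdist m q y = mdist m x y" by simp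
qed

lemma geodesic_between_ends: "geodesic_between m x y \<gamma> \<Longrightarrow> x \<in> \<gamma> \<and> y \<in> \<gamma>"
  by (auto simp: geodesic_between_def geodesic_def)

lemma hyperbolic_slim:
  assumes "hyperbolic_space \<delta> m" "geodesic_between m x y \<alpha>" "geodesic_between m y z \<beta>"
    "geodesic_between m x z \<gamma>" "p \<in> \<alpha>"
  shows "\<exists>q\<in>\<beta> \<union> \<gamma>. mdist m p q \<le> \<delta>"
  using assms unfolding hyperbolic_space_def by blast

text \<open>Going along \<open>\<gamma>\<close> in steps of length \<open>\<delta>\<close>, one meets a point close to both other sides of the triangle.\<close>

lemma slim_triangle_centre:
  assumes hyp: "hyperbolic_space \<delta> m" and "\<delta> > 0" "x \<in> mspace m" "y \<in> mspace m" "z \<in> mspace m"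
    and \<gamma>: "geodesic_between m y z \<gamma>"
  obtains p where "p \<in> \<gamma>" "2 * mdist m x p \<le> mdist m x y + mdist m x z - mdist m y z + 6 * \<delta>"
proof -
  obtain \<alpha> \<beta> where \<alpha>: "geodesic_between m x y \<alpha>" and \<beta>: "geodesic_between m x z \<beta>"
    using assms unfolding hyperbolic_space_def by metis
  have slim: "\<exists>q\<in>\<alpha> \<union> \<beta>. mdist m p q \<le> \<delta>" if "p \<in> \<gamma>" for p
    using hyp \<gamma> geodesic_between_sym[OF \<alpha>] geodesic_between_sym[OF \<beta>] that
    unfolding hyperbolic_space_def by (metis Un_commute)
  obtain L c where c: "geodesic m L c" "c 0 = y" "c L = z" "\<gamma> = c ` {0..L}"
    using \<gamma> by (auto simp: geodesic_between_def)
  have L: "L \<ge> 0" using c by (simp add: geodesic_def)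
  define f where "f n = min (real n * \<delta>) L" for n
  have f: "f n \<in> {0..L}" for n using L assms(2) by (auto simp: f_def)
  \<comment> \<open>The first step at which \<gamma> is \<delta>-close to \<beta>. The step before
    it is \<delta>-close to \<alpha> by slimness and within \<open>2 * \<delta>\<close> of
    \<beta>.\<close>
  define n where "n = (LEAST n. \<exists>q\<in>\<beta>. mdist m (c (f n)) q \<le> \<delta>)"
  obtain N where "L \<le> real N * \<delta>" using real_arch_simple[of "L / \<delta>"] assms(2) by (auto simp: field_simps)
  then have "f N = L" by (simp add: f_def)
  moreover have "z \<in> \<beta>" "z \<in> mspace m" using geodesic_between_ends[OF \<beta>] assms by auto
  ultimately have "\<exists>q\<in>\<beta>. mdist m (c (f N)) q \<le> \<delta>" using c assms(2) by (intro bexI[of _ z]) (auto simp: mdist_zero[THEN iffD2])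
  then have n: "\<exists>q\<in>\<beta>. mdist m (c (f n)) q \<le> \<delta>" unfolding n_def by (rule LeastI)
  have "\<exists>p\<in>\<gamma>. (\<exists>q\<in>\<alpha>. mdist m p q \<le> \<delta>) \<and> (\<exists>q\<in>\<beta>. mdist m p q \<le> 2 * \<delta>)"
  proof (cases n)
    case 0
    have "c (f n) = y" using 0 L c by (simp add: f_def)
    moreover have "y \<in> \<alpha>" using geodesic_between_ends[OF \<alpha>] by simp
    moreover have "mdist m y y = 0" using assms(4) by (simp add: mdist_zero[THEN iffD2])
    moreover have "y \<in> \<gamma>" using geodesic_between_ends[OF \<gamma>] by simp
    moreover obtain q where "q \<in> \<beta>" "mdist m (c (f n)) q \<le> \<delta>" using n by blast
    ultimately show ?thesis using assms(2) by (intro bexI[of _ y] conjI bexI[of _ q]) auto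
  next
    case (Suc k)
    have k: "\<not> (\<exists>q\<in>\<beta>. mdist m (c (f k)) q \<le> \<delta>)"
      by (rule not_less_Least) (use Suc in \<open>simp add: n_def\<close>)
    have ck: "c (f k) \<in> \<gamma>" "c (f n) \<in> \<gamma>" using c f by auto
    then have qa: "\<exists>q\<in>\<alpha>. mdist m (c (f k)) q \<le> \<delta>" using slim k by blast
    obtain q where q: "q \<in> \<beta>" "mdist m (c (f n)) q \<le> \<delta>" using n by blast
    have "mdist m (c (f k)) (c (f n)) = \<bar>f k - f n\<bar>" using c f by (simp add: geodesic_def)
    also have "\<dots> \<le> \<delta>" using assms(2) by (auto simp: f_def Suc algebra_simps min_def)
    finally have "mdist m (c (f k)) q \<le> 2 * \<delta>"
      using q(2) mdist_triangle[OF geodesic_between_point(1)[OF \<gamma> ck(1)]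
        geodesic_between_point(1)[OF \<gamma> ck(2)] geodesic_between_point(1)[OF \<beta> q(1)]] by linarith
    then show ?thesis using ck q(1) qa by blast
  qed
  then obtain p q r where p: "p \<in> \<gamma>" "q \<in> \<alpha>" "mdist m p q \<le> \<delta>" "r \<in> \<beta>" "mdist m p r \<le> 2 * \<delta>" by blast
  have M: "p \<in> mspace m" "q \<in> mspace m" "r \<in> mspace m"
    using geodesic_between_point(1) \<alpha> \<beta> \<gamma> p by metis+
  have "mdist m x q + mdist m q y = mdist m x y" "mdist m x r + mdist m r z = mdist m x z"
    "mdist m y p + mdist m p z = mdist m y z"
    using geodesic_between_point(2) \<alpha> \<beta> \<gamma> p by metis+
  moreover have "mdist m x p \<le> mdist m x q + mdist m q p" "mdist m x p \<le> mdist m x r + mdist m r p"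
    "mdist m y p \<le> mdist m y q + mdist m q p" "mdist m p z \<le> mdist m p r + mdist m r z"
    using mdist_triangle assms M by metis+
  \<comment> \<open>The errors \<delta> at \<open>q\<close> and \<open>2 * \<delta>\<close> at
    \<open>r\<close> both enter twice, hence \<open>6 * \<delta>\<close>.\<close>
  ultimately have "2 * mdist m x p \<le> mdist m x y + mdist m x z - mdist m y z + 6 * \<delta>"
    using p by (simp add: mdist_commute)
  then show thesis using that p by blast
qed

text \<open>Gromov's four-point condition. It involves distances only and can therefore be applied
  directly to points of orbits.\<close>

definition four_point :: "real \<Rightarrow> 'a metric \<Rightarrow> bool" where
  "four_point K m \<longleftrightarrow> (\<forall>x\<in>mspace m. \<forall>y\<in>mspace m. \<forall>z\<in>mspace m. \<forall>w\<in>mspace m.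
     mdist m x z + mdist m y w \<le> max (mdist m x y + mdist m z w) (mdist m y z + mdist m x w) + K)"

text \<open>The centre \<open>p\<close> of the triangle \<open>w\<close>, \<open>x\<close>,
  \<open>z\<close> on its side from \<open>x\<close> to \<open>z\<close> is \<delta>-close to one of
  the sides that meet at \<open>y\<close>. Splitting that side at the nearby point costs
  \<open>2 * \<delta>\<close> on top of the \<open>6 * \<delta>\<close> for the centre.\<close>

lemma hyperbolic_four_point:
  assumes hyp: "hyperbolic_space \<delta> m" and "\<delta> > 0"
  shows "four_point (8 * \<delta>) m"
  unfolding four_point_def
proof (intro ballI)
  fix x y z w assume M: "x \<in> mspace m" "y \<in> mspace m" "z \<in> mspace m" "w \<in> mspace m"
  obtain \<alpha> \<beta> \<gamma> where g: "geodesic_between m x z \<alpha>" "geodesic_between m z y \<beta>" "geodesic_between m x y \<gamma>"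
    using hyp M unfolding hyperbolic_space_def by metis
  obtain p where p: "p \<in> \<alpha>" "2 * mdist m w p \<le> mdist m w x + mdist m w z - mdist m x z + 6 * \<delta>"
    using slim_triangle_centre[OF hyp assms(2) M(4) M(1) M(3) g(1)] by blast
  obtain q where q: "q \<in> \<beta> \<union> \<gamma>" "mdist m p q \<le> \<delta>"
    using hyperbolic_slim[OF hyp g(1,2) g(3) p(1)] by blast
  have pM: "p \<in> mspace m" using geodesic_between_point(1)[OF g(1) p(1)] .
  have qM: "q \<in> mspace m"
    using q(1) geodesic_between_point(1)[OF g(2)] geodesic_between_point(1)[OF g(3)] by blast
  have wq: "mdist m w q \<le> mdist m w p + \<delta>" using mdist_triangle[OF M(4) pM qM] q(2) by linarith
  from q(1) show "mdist m x z + mdist m y w \<le> max (mdist m x y + mdist m z w) (mdist m y z + mdist m x w) + 8 * \<delta>"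
  proof
    assume "q \<in> \<beta>"
    then have "mdist m z q + mdist m q y = mdist m z y" by (rule geodesic_between_point(2)[OF g(2)])
    then have "mdist m w z + mdist m w y - mdist m z y \<le> 2 * mdist m w q"
      using mdist_triangle[OF M(4) qM M(3)] mdist_triangle[OF M(4) qM M(2)] by (simp add: mdist_commute)
    then show ?thesis using wq p(2) by (simp add: mdist_commute)
  next
    assume "q \<in> \<gamma>"
    then have "mdist m x q + mdist m q y = mdist m x y" by (rule geodesic_between_point(2)[OF g(3)])
    then have "mdist m w x + mdist m w y - mdist m x y \<le> 2 * mdist m w q"
      using mdist_triangle[OF M(4) qM M(1)] mdist_triangle[OF M(4) qM M(2)] by (simp add: mdist_commute)
    then show ?thesis using wq p(2) by (simp add: mdist_commute)
  qed
qed

lemma four_pointD: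
  assumes "four_point K m" "x \<in> mspace m" "y \<in> mspace m" "z \<in> mspace m" "w \<in> mspace m"
  shows "mdist m x z + mdist m y w \<le> max (mdist m x y + mdist m z w) (mdist m y z + mdist m x w) + K"
  using assms unfolding four_point_def by blast

section \<open>Isometries of hyperbolic spaces\<close>

text \<open>In this lemma \<open>q\<close>, \<open>r\<close>, \<open>u\<close> are the images of \<open>p\<close>, \<open>q\<close>, \<open>b\<close> under one isometry.\<close>

lemma bounded_displacement:
  assumes fp: "four_point K m" and M: "b \<in> mspace m" "u \<in> mspace m" "p \<in> mspace m" "q \<in> mspace m" "r \<in> mspace m"
    and iso: "mdist m u q = mdist m b p" "mdist m u r = mdist m b q" "mdist m q r = mdist m p q"
    and far: "mdist m b p \<ge> mdist m b u + K"
    and away: "mdist m b q \<ge> mdist m b p + mdist m p q - K"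
    and par: "mdist m p r \<le> mdist m p q + K"
  shows "mdist m p q \<le> 3 * K"
proof (rule ccontr)
  assume D: "\<not> mdist m p q \<le> 3 * K"
  have K: "K \<ge> 0" using four_pointD[OF fp M(1) M(1) M(1) M(1)] by (simp add: M)
  have "mdist m b q \<le> mdist m b u + mdist m u q" using mdist_triangle[OF M(1,2,4)] .
  then have D2: "mdist m p q \<le> mdist m b u + K" using iso away by linarith
  \<comment> \<open>Seen from \<open>u\<close>, the points \<open>p\<close>, \<open>q\<close>,
    \<open>r\<close> recede in two steps of almost full length, so \<open>p\<close> and
    \<open>r\<close> would be almost twice as far apart as \<open>p\<close> and \<open>q\<close>,
    against \<open>par\<close>.\<close>
  have "mdist m b q + mdist m u p \<le> max (mdist m b u + mdist m q p) (mdist m u q + mdist m b p) + K"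
    by (rule four_pointD[OF fp M(1,2,4,3)])
  then have up: "mdist m u p \<le> mdist m b p - mdist m p q + 2 * K"
    using iso far away D2 K by (simp add: mdist_commute)
  have "mdist m u r + mdist m q p \<le> max (mdist m u q + mdist m r p) (mdist m q r + mdist m u p) + K"
    by (rule four_pointD[OF fp M(2,4,5,3)])
  then show False using up iso away par D K by (simp add: mdist_commute)
qed

text \<open>A gain of more than \<open>K\<close> between one step and two steps propagates: the
  other term of the four-point maximum would contradict the growth already shown. The second part,
  doubling up to an additive constant, is what \<open>commuting_displacement\<close> asks
  for.\<close>

lemma orbit_linear_growth:
  fixes b :: "nat \<Rightarrow> real" and x :: "nat \<Rightarrow> 'a"
  assumes fp: "four_point K m" and M: "\<And>i. x i \<in> mspace m"
    and b: "\<And>i j. mdist m (x i) (x (i + j)) = b j"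
    and gap: "b 2 > b 1 + K"
  shows "b (Suc n) \<ge> b n + (b 2 - b 1 - K)" "\<exists>C. \<forall>n. b (2 * n) \<ge> 2 * b n - C"
proof -
  have K: "K \<ge> 0" using four_pointD[OF fp M M M M, of 0 0 0 0] by (simp add: M)
  define l where "l = b 2 - b 1 - K"
  have l: "l > 0" using gap by (simp add: l_def)
  have b0: "b 0 = 0" using b[of 0 0] mdist_zero[OF M M, of 0 0] by (metis add_0)
  have b_nonneg: "b j \<ge> 0" for j using b[of 0 j] by (metis mdist_nonneg)
  have step: "b (Suc n) \<ge> b n + l" for n
  proof (induction n)
    case 0
    have "b 2 \<le> b 1 + b 1"
      using mdist_triangle[OF M[of 0] M[of 1] M[of 2]] b[of 0 1] b[of 1 1] b[of 0 2] by (simp add: numeral_2_eq_2)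
    then show ?case using K b0 by (simp add: l_def)
  next
    case (Suc n)
    have "mdist m (x 0) (x (Suc n)) + mdist m (x n) (x (Suc (Suc n))) \<le>
      max (mdist m (x 0) (x n) + mdist m (x (Suc n)) (x (Suc (Suc n))))
        (mdist m (x n) (x (Suc n)) + mdist m (x 0) (x (Suc (Suc n)))) + K"
      by (rule four_pointD[OF fp M M M M])
    then have "b (Suc n) + b 2 \<le> max (b n + b 1) (b 1 + b (Suc (Suc n))) + K"
      using b[of 0 "Suc n"] b[of n 2] b[of 0 n] b[of "Suc n" 1] b[of n 1] b[of 0 "Suc (Suc n)"]
      by (simp add: numeral_2_eq_2)
    then show ?case using Suc l by (auto simp: l_def max_def split: if_splits)
  qed
  then show "b (Suc n) \<ge> b n + (b 2 - b 1 - K)" by (simp add: l_def)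
  have add: "b (n + k) \<ge> b n + real k * l" for n k
  proof (induction k)
    case (Suc k)
    then show ?case using step[of "n + k"] by (simp add: algebra_simps)
  qed simp
  \<comment> \<open>The delay \<open>k0\<close> pushes \<open>2 * b (n + k0)\<close> beyond
    \<open>2 * b n + K\<close>, which rules out the first term of the maximum below.\<close>
  obtain k0 :: nat where "K < real k0 * l" using reals_Archimedean3[OF l] by blast
  then have k0: "K < 2 * (real k0 * l)" using K by linarith
  have tri: "b (i + j) \<le> b i + b j" for i j
    using mdist_triangle[OF M[of 0] M[of i] M[of "i + j"]] b[of 0 i] b[of i j] b[of 0 "i + j"] by simp
  have "b (2 * n) \<ge> 2 * b n - (K + 2 * b k0)" for n
  proof -
    let ?m = "n + k0"
    have "mdist m (x 0) (x ?m) + mdist m (x n) (x (n + ?m)) \<le>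
      max (mdist m (x 0) (x n) + mdist m (x ?m) (x (n + ?m)))
        (mdist m (x n) (x ?m) + mdist m (x 0) (x (n + ?m))) + K"
      by (rule four_pointD[OF fp M M M M])
    moreover have "mdist m (x ?m) (x (n + ?m)) = b n" using b[of ?m n] by (simp add: ac_simps)
    ultimately have "2 * b ?m \<le> max (2 * b n) (b k0 + b (n + ?m)) + K"
      using b[of 0 ?m] b[of n ?m] b[of 0 n] b[of n k0] b[of 0 "n + ?m"] by simp
    moreover have "2 * b ?m \<ge> 2 * b n + 2 * (real k0 * l)" using add[of n k0] by simp
    moreover have "real k0 * l \<ge> 0" using l by simp
    moreover have "b (n + ?m) \<le> b (2 * n) + b k0"
    proof -
      have "n + ?m = 2 * n + k0" by simp
      then show ?thesis using tri[of "2 * n" k0] by (simp only:)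
    qed
    ultimately show ?thesis using k0 by (simp add: max_def split: if_splits)
  qed
  then show "\<exists>C. \<forall>n. b (2 * n) \<ge> 2 * b n - C" by blast
qed

text \<open>Here \<open>y\<close>, \<open>z\<close> and \<open>w\<close>, \<open>v\<close> are the images of \<open>p\<close> and \<open>w\<close> under an isometry and its inverse,
  and \<open>w\<close> is the image of \<open>p\<close> under an isometry commuting with it.\<close>

lemma commuting_displacement:
  assumes fp: "four_point K m"
    and M: "p \<in> mspace m" "y \<in> mspace m" "z \<in> mspace m" "w \<in> mspace m" "v \<in> mspace m"
    and iso: "mdist m p z = mdist m p y" "mdist m y v = mdist m p w" "mdist m w v = mdist m p y"
      "mdist m p v = mdist m z w"
    and qgeo: "mdist m z y \<ge> 2 * mdist m p y - C"
  shows "min (mdist m y w) (mdist m p v) \<le> \<bar>mdist m p y - mdist m p w\<bar> + C + 2 * K"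
proof -
  have "mdist m z y + mdist m p w \<le> max (mdist m z p + mdist m y w) (mdist m p y + mdist m z w) + K"
    by (rule four_pointD[OF fp M(3,1,2,4)])
  then have 1: "max (mdist m y w) (mdist m p v) \<ge> mdist m p y + mdist m p w - C - K"
    using qgeo iso by (simp add: mdist_commute max_def split: if_splits)
  have "mdist m p v + mdist m y w \<le> max (mdist m p y + mdist m v w) (mdist m y v + mdist m p w) + K"
    by (rule four_pointD[OF fp M(1,2,5,4)])
  then have "mdist m p v + mdist m y w \<le> 2 * max (mdist m p y) (mdist m p w) + K"
    using iso by (simp add: mdist_commute max_def split: if_splits)
  \<comment> \<open>The larger of the two distances is bounded below and their sum above, so the
    smaller one is bounded above.\<close>
  then show ?thesis using 1 by (simp add: max_def min_def abs_if split: if_splits)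
qed

section \<open>Virtually commuting elements\<close>

definition virt_commute :: "('g, 'm) monoid_scheme \<Rightarrow> 'g \<Rightarrow> 'g \<Rightarrow> bool" where
  "virt_commute G x y \<longleftrightarrow> (\<exists>(m::nat) (n::nat). m > 0 \<and> n > 0 \<and> commute G (x [^]\<^bsub>G\<^esub> m) (y [^]\<^bsub>G\<^esub> n))"

lemma commute_sym: "commute G x y \<Longrightarrow> commute G y x"
  by (simp add: commute_def)

lemma virt_commute_sym: "virt_commute G x y \<Longrightarrow> virt_commute G y x"
  unfolding virt_commute_def using commute_sym by metis

context group
begin

lemma commute_mult:
  assumes "commute G x z" "commute G y z" "x \<in> carrier G" "y \<in> carrier G" "z \<in> carrier G"
  shows "commute G (x \<otimes> y) z"
proof -
  have "(x \<otimes> y) \<otimes> z = x \<otimes> (z \<otimes> y)" using assms by (simp add: commute_def m_assoc)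
  also have "\<dots> = z \<otimes> (x \<otimes> y)" using assms by (simp add: commute_def m_assoc[symmetric])
  finally show ?thesis by (simp add: commute_def)
qed

lemma commute_one: "z \<in> carrier G \<Longrightarrow> commute G \<one> z"
  by (simp add: commute_def)

lemma commute_pow:
  assumes "commute G x z" "x \<in> carrier G" "z \<in> carrier G"
  shows "commute G (x [^] (n::nat)) z"
proof (induction n)
  case (Suc n)
  then show ?case using commute_mult[of "x [^] n" z x] assms by simp
qed (use assms commute_one in simp)

lemma commute_inv:
  assumes "commute G x z" "x \<in> carrier G" "z \<in> carrier G"
  shows "commute G (inv x) z"
proof -
  have "inv x \<otimes> z = inv x \<otimes> (z \<otimes> x) \<otimes> inv x" using assms by (simp add: m_assoc)
  also have "\<dots> = inv x \<otimes> (x \<otimes> z) \<otimes> inv x" using assms by (simp add: commute_def)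
  also have "\<dots> = z \<otimes> inv x" using assms by (simp add: m_assoc[symmetric])
  finally show ?thesis by (simp add: commute_def)
qed

lemma commute_int_pow:
  assumes "commute G x z" "x \<in> carrier G" "z \<in> carrier G"
  shows "commute G (x [^] (n::int)) z"
proof -
  have "commute G (x [^] k) z" "commute G (inv (x [^] k)) z" for k :: nat
    using commute_pow[OF assms] commute_inv[of "x [^] k" z] assms by auto
  then show ?thesis unfolding int_pow_def2 by metis
qed

lemma commute_pow2:
  assumes "commute G x z" "x \<in> carrier G" "z \<in> carrier G"
  shows "commute G (x [^] (m::nat)) (z [^] (n::nat))"
  by (rule commute_sym[OF commute_pow[OF commute_sym[OF commute_pow[OF assms]]]]) (use assms in auto)

lemma commute_self_pow: "x \<in> carrier G \<Longrightarrow> commute G (x [^] (m::int)) (x [^] (n::int))"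
  unfolding commute_def by (metis add.commute int_pow_mult)

lemma virt_commute_of_pow:
  assumes "virt_commute G (x [^] (n::nat)) y" "n > 0" "x \<in> carrier G"
  shows "virt_commute G x y"
proof -
  obtain a b :: nat where ab: "a > 0" "b > 0" "commute G ((x [^] n) [^] a) (y [^] b)"
    using assms(1) by (auto simp: virt_commute_def)
  then have "commute G (x [^] (n * a)) (y [^] b)" using assms(3) by (simp add: nat_pow_pow)
  then show ?thesis using ab assms(2) unfolding virt_commute_def by (intro exI[of _ "n * a"] exI[of _ b]) auto
qed

lemma commute_pow_abs:
  assumes c: "commute G (z [^] (k::int)) y" and "z \<in> carrier G" "y \<in> carrier G"
  shows "commute G (z [^] nat \<bar>k\<bar>) y"
proof (cases k rule: int_cases2)
  case (nonneg n)
  then show ?thesis using c by (simp add: int_pow_int)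
next
  case (nonpos n)
  then have "z [^] k = inv (z [^] n)" using int_pow_neg_int[OF assms(2)] by (simp only:)
  then have "commute G (inv (inv (z [^] n))) y"
    using commute_inv[of "inv (z [^] n)" y] c assms by (simp only:) simp
  then show ?thesis using nonpos assms by simp
qed

lemma virt_commute_common_power:
  assumes "virt_commute G x y" "common_power G y z" "x \<in> carrier G" "y \<in> carrier G" "z \<in> carrier G"
  shows "virt_commute G x z"
proof -
  obtain m n :: int where mn: "m \<noteq> 0" "n \<noteq> 0" "y [^] m = z [^] n" using assms(2) by (auto simp: common_power_def)
  obtain a b :: nat where ab: "a > 0" "b > 0" "commute G (y [^] a) (x [^] b)"
    using virt_commute_sym[OF assms(1)] by (auto simp: virt_commute_def)
  have "commute G ((y [^] a) [^] m) (x [^] b)" using ab assms by (intro commute_int_pow) auto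
  moreover have "(y [^] a) [^] m = (y [^] m) [^] a"
    using int_pow_pow[OF assms(4), of "int a" m] int_pow_pow[OF assms(4), of m "int a"]
    by (simp add: int_pow_int mult.commute)
  moreover have "(y [^] m) [^] a = z [^] (n * int a)"
    using int_pow_pow[OF assms(5), of n "int a"] by (simp add: mn int_pow_int)
  ultimately have c: "commute G (z [^] (n * int a)) (x [^] b)" by simp
  have "commute G (z [^] nat \<bar>n * int a\<bar>) (x [^] b)"
    by (rule commute_pow_abs[OF c]) (use assms in auto)
  moreover have "nat \<bar>n * int a\<bar> > 0" using mn(2) ab(1) by (simp only: zero_less_nat_eq zero_less_abs_iff) simp
  ultimately show ?thesis using ab commute_sym unfolding virt_commute_def by metis
qed

lemma group_prod_closed: "set hs \<subseteq> carrier G \<Longrightarrow> group_prod G hs \<in> carrier G"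
  by (induction hs) (auto simp: group_prod_def)

lemma group_prod_Cons: "group_prod G (h # hs) = h \<otimes> group_prod G hs"
  by (simp add: group_prod_def)

lemma group_prod_Nil: "group_prod G [] = \<one>"
  by (simp add: group_prod_def)

lemma commute_group_prod:
  assumes "\<And>h. h \<in> set hs \<Longrightarrow> commute G h z" "set hs \<subseteq> carrier G" "z \<in> carrier G"
  shows "commute G (group_prod G hs) z"
  using assms
proof (induction hs)
  case Nil
  then show ?case by (simp add: group_prod_Nil commute_one)
next
  case (Cons h hs)
  then show ?case unfolding group_prod_Cons by (intro commute_mult) (auto intro: group_prod_closed)
qed

lemma group_prod_pow:
  assumes "set hs \<subseteq> carrier G" "\<And>x y. x \<in> set hs \<Longrightarrow> y \<in> set hs \<Longrightarrow> commute G x y"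
  shows "group_prod G hs [^] (n::nat) = group_prod G (map (\<lambda>h. h [^] n) hs)"
  using assms
proof (induction hs)
  case (Cons h hs)
  have "commute G (group_prod G hs) h" using Cons.prems by (intro commute_group_prod) auto
  then have "(h \<otimes> group_prod G hs) [^] n = h [^] n \<otimes> group_prod G hs [^] n"
    using Cons.prems by (intro pow_mult_distrib) (auto simp: commute_def group_prod_closed)
  then show ?case using Cons by (simp add: group_prod_Cons)
qed (simp add: group_prod_Nil)

text \<open>The products of the exponents found for the single factors serve for all of them, and a
  power of the product is the product of the powers because the factors commute.\<close>

lemma virt_commute_group_prod:
  assumes "\<And>h. h \<in> set hs \<Longrightarrow> virt_commute G h z" "set hs \<subseteq> carrier G" "z \<in> carrier G"
    "\<And>x y. x \<in> set hs \<Longrightarrow> y \<in> set hs \<Longrightarrow> commute G x y"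
  shows "virt_commute G (group_prod G hs) z"
proof -
  have "\<exists>(m::nat) (n::nat). m > 0 \<and> n > 0 \<and> (\<forall>h\<in>set hs. commute G (h [^] m) (z [^] n))"
    using assms(1,2)
  proof (induction hs)
    case (Cons h hs)
    then obtain m n :: nat where mn: "m > 0" "n > 0" "\<forall>h\<in>set hs. commute G (h [^] m) (z [^] n)" by auto
    obtain a b :: nat where ab: "a > 0" "b > 0" "commute G (h [^] a) (z [^] b)"
      using Cons.prems(1)[of h] by (auto simp: virt_commute_def)
    have 1: "commute G (h [^] (m * a)) (z [^] (n * b))"
      using commute_pow2[OF ab(3), of m n] Cons.prems assms(3) by (simp add: nat_pow_pow mult.commute)
    have 2: "commute G (k [^] (m * a)) (z [^] (n * b))" if "k \<in> set hs" for k
      using commute_pow2[of "k [^] m" "z [^] n" a b] mn(3) that Cons.prems assms(3)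
      by (auto simp: nat_pow_pow)
    show ?case using 1 2 mn ab by (intro exI[of _ "m * a"] exI[of _ "n * b"]) auto
  qed auto
  then obtain m n :: nat where mn: "m > 0" "n > 0" "\<forall>h\<in>set hs. commute G (h [^] m) (z [^] n)" by blast
  have "commute G (group_prod G (map (\<lambda>h. h [^] m) hs)) (z [^] n)"
    using mn assms by (intro commute_group_prod) auto
  then show ?thesis
    using mn group_prod_pow[OF assms(2,4)] unfolding virt_commute_def by metis
qed

section \<open>Conjugation and powers\<close>

lemma conj_mult:
  assumes "x \<in> carrier G" "y \<in> carrier G" "t \<in> carrier G"
  shows "t \<otimes> (x \<otimes> y) \<otimes> inv t = (t \<otimes> x \<otimes> inv t) \<otimes> (t \<otimes> y \<otimes> inv t)"
proof -
  have "inv t \<otimes> (t \<otimes> (y \<otimes> inv t)) = y \<otimes> inv t"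
    using assms by (simp add: m_assoc[symmetric])
  then show ?thesis using assms by (simp add: m_assoc)
qed

lemma conj_int_pow:
  assumes "x \<in> carrier G" "t \<in> carrier G"
  shows "(t \<otimes> x \<otimes> inv t) [^] (n::int) = t \<otimes> x [^] n \<otimes> inv t"
proof -
  have "(\<lambda>x. t \<otimes> x \<otimes> inv t) \<in> hom G G"
    using conj_mult assms by (auto simp: hom_def)
  then show ?thesis using hom_int_pow[of "\<lambda>x. t \<otimes> x \<otimes> inv t" G G x n] assms is_group by simp
qed

lemma conj_commute:
  assumes "commute G t x" "x \<in> carrier G" "t \<in> carrier G"
  shows "t \<otimes> x \<otimes> inv t = x"
  using assms by (simp add: commute_def m_assoc)

text \<open>This turns a coincidence among the conjugates of \<open>x\<close> by powers of
  \<open>t\<close>, found by the pigeonhole principle, into virtual commutation.\<close>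

lemma conj_pow_eq_commute:
  assumes "x \<in> carrier G" "t \<in> carrier G" "k \<le> (l::nat)"
    "t [^] k \<otimes> x \<otimes> inv (t [^] k) = t [^] l \<otimes> x \<otimes> inv (t [^] l)"
  shows "commute G (t [^] (l - k)) x"
proof -
  let ?a = "t [^] k" and ?b = "t [^] (l - k)"
  have c: "?a \<in> carrier G" "?b \<in> carrier G" using assms by auto
  have l: "t [^] l = ?a \<otimes> ?b" using assms(2,3) by (simp add: nat_pow_mult)
  have "?a \<otimes> x \<otimes> inv ?a = ?a \<otimes> (?b \<otimes> x \<otimes> inv ?b) \<otimes> inv ?a"
    using assms(4) c assms(1) unfolding l by (simp add: inv_mult_group m_assoc)
  then have "x = ?b \<otimes> x \<otimes> inv ?b"
  proof -
    assume eq: "?a \<otimes> x \<otimes> inv ?a = ?a \<otimes> (?b \<otimes> x \<otimes> inv ?b) \<otimes> inv ?a"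
    have undo: "inv ?a \<otimes> (?a \<otimes> y \<otimes> inv ?a) \<otimes> ?a = y" if "y \<in> carrier G" for y
    proof -
      have "inv ?a \<otimes> (?a \<otimes> y \<otimes> inv ?a) \<otimes> ?a = (inv ?a \<otimes> ?a) \<otimes> y \<otimes> (inv ?a \<otimes> ?a)"
        using c that by (simp only: m_assoc m_closed inv_closed)
      then show ?thesis using c that by simp
    qed
    show ?thesis using arg_cong[OF eq, of "\<lambda>z. inv ?a \<otimes> z \<otimes> ?a"] undo c assms(1) by simp
  qed
  then have "x \<otimes> ?b = ?b \<otimes> x \<otimes> inv ?b \<otimes> ?b" by simp
  then show ?thesis using c assms(1) by (simp add: commute_def m_assoc)
qed

end

section \<open>Hierarchically hyperbolic groups\<close>

text \<open>The group \<open>J\<close> stands for the subgroup of finite index. One constant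
  \<open>E\<close> of the structure is fixed, so that the thresholds below can be compared as
  multiples of it.\<close>

locale hhg_group = group J for J :: "('g, 'm) monoid_scheme" (structure) +
  fixes s :: "('g, 'd, 'c) hhs_data" and a :: "('g, 'd, 'c) hhs_action" and E :: real
  assumes hhg: "hhg J s a" and hhs: "hhs_with_constant E s"
begin

abbreviation Cs :: "'d \<Rightarrow> 'c metric" where "Cs \<equiv> cspace s"
abbreviation P :: "'d \<Rightarrow> 'g \<Rightarrow> 'c set" where "P \<equiv> proj s"
abbreviation Dm :: "'d set" where "Dm \<equiv> domains s"
abbreviation D :: "'g \<Rightarrow> 'd \<Rightarrow> 'd" where "D \<equiv> act_dom a"
abbreviation T :: "'g \<Rightarrow> 'd \<Rightarrow> 'c \<Rightarrow> 'c" where "T \<equiv> act_pt a"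
abbreviation dT :: "'g \<Rightarrow> 'g \<Rightarrow> real" where "dT \<equiv> mdist (total s)"

lemma hhg_str: "hhg_structure J s a (\<otimes>)"
  using hhg by (simp add: hhg_def)

lemma mspace_total: "mspace (total s) = carrier J"
  using hhg by (simp add: hhg_def is_word_metric_def)

lemma E_ge_1: "E \<ge> 1"
  using hhs by (simp add: hhs_with_constant_def)

lemma automorphism:
  assumes "g \<in> carrier J"
  shows "\<exists>K. hhs_automorphism K s ((\<otimes>) g) (D g) (T g)"
proof -
  obtain K where "\<forall>g\<in>carrier J. hhs_automorphism K s ((\<otimes>) g) (D g) (T g)"
    using hhg_str unfolding hhg_structure_def by (elim conjE exE)
  then show ?thesis using assms by blast
qed

lemma D_bij: "g \<in> carrier J \<Longrightarrow> bij_betw (D g) Dm Dm"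
  using automorphism[of g] by (auto simp: hhs_automorphism_def)

lemma D_closed: "g \<in> carrier J \<Longrightarrow> U \<in> Dm \<Longrightarrow> D g U \<in> Dm"
  using D_bij bij_betw_apply by metis

lemma D_mult: "g \<in> carrier J \<Longrightarrow> h \<in> carrier J \<Longrightarrow> U \<in> Dm \<Longrightarrow> D (g \<otimes> h) U = D g (D h U)"
  using hhg_str unfolding hhg_structure_def by (elim conjE) simp

text \<open>Only multiplicativity of the action is given; \<open>D \<one>\<close> is an idempotent
  injection of the index set, hence the identity.\<close>

lemma D_one: assumes "U \<in> Dm" shows "D \<one> U = U"
proof -
  have "D \<one> (D \<one> U) = D \<one> U" using D_mult[of \<one> \<one> U] assms by simp
  then show ?thesis
    using bij_betw_imp_inj_on[OF D_bij[of \<one>]] assms D_closed[of \<one> U] by (auto dest: inj_onD)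
qed

lemma D_inv: "g \<in> carrier J \<Longrightarrow> U \<in> Dm \<Longrightarrow> D (inv g) (D g U) = U"
  "g \<in> carrier J \<Longrightarrow> U \<in> Dm \<Longrightarrow> D g (D (inv g) U) = U"
  using D_mult[of "inv g" g U] D_mult[of g "inv g" U] D_one by simp_all

lemma D_inv_fix: "g \<in> carrier J \<Longrightarrow> U \<in> Dm \<Longrightarrow> D g U = U \<Longrightarrow> D (inv g) U = U"
  using D_inv(1)[of g U] by simp

lemma D_pow_fix:
  assumes "g \<in> carrier J" "U \<in> Dm" "D g U = U"
  shows "D (g [^] (n::nat)) U = U"
  using assms by (induction n) (auto simp: D_one D_mult)

lemma D_int_pow_fix:
  assumes "g \<in> carrier J" "U \<in> Dm" "D g U = U"
  shows "D (g [^] (n::int)) U = U"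
proof (cases n rule: int_cases2)
  case (nonneg k)
  then show ?thesis using D_pow_fix[OF assms] by (simp add: int_pow_int)
next
  case (nonpos k)
  then show ?thesis
    using D_inv_fix[OF _ assms(2) D_pow_fix[OF assms]] assms(1) by (simp add: int_pow_neg_int)
qed

lemma T_isometry:
  assumes "g \<in> carrier J" "U \<in> Dm"
  shows "isometry_onto (Cs U) (Cs (D g U)) (T g U)"
  using automorphism[OF assms(1)] assms(2) unfolding hhs_automorphism_def by blast

lemma T_closed: "g \<in> carrier J \<Longrightarrow> U \<in> Dm \<Longrightarrow> p \<in> mspace (Cs U) \<Longrightarrow> T g U p \<in> mspace (Cs (D g U))"
  using T_isometry unfolding isometry_onto_def by (metis bij_betw_apply)

lemma T_mdist:
  assumes "g \<in> carrier J" "U \<in> Dm" "p \<in> mspace (Cs U)" "q \<in> mspace (Cs U)"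
  shows "mdist (Cs (D g U)) (T g U p) (T g U q) = mdist (Cs U) p q"
  using T_isometry[OF assms(1,2)] assms(3,4) unfolding isometry_onto_def by blast

lemma T_mult:
  assumes "g \<in> carrier J" "h \<in> carrier J" "U \<in> Dm" "p \<in> mspace (Cs U)"
  shows "T (g \<otimes> h) U p = T g (D h U) (T h U p)"
  using hhg_str assms unfolding hhg_structure_def by (elim conjE) simp

lemma T_one:
  assumes "U \<in> Dm" "p \<in> mspace (Cs U)"
  shows "T \<one> U p = p"
proof -
  have "T \<one> U (T \<one> U p) = T \<one> U p" using T_mult[of \<one> \<one> U p] assms by (simp add: D_one)
  moreover have "inj_on (T \<one> U) (mspace (Cs U))"
    using T_isometry[of \<one> U] assms by (auto simp: isometry_onto_def bij_betw_def)
  moreover have "T \<one> U p \<in> mspace (Cs U)" using T_closed[of \<one> U p] assms by (simp add: D_one)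
  ultimately show ?thesis using assms by (auto dest: inj_onD)
qed

lemma nest_act: "g \<in> carrier J \<Longrightarrow> U \<in> Dm \<Longrightarrow> V \<in> Dm \<Longrightarrow> nest s (D g U) (D g V) \<longleftrightarrow> nest s U V"
  using automorphism[of g] unfolding hhs_automorphism_def by blast

lemma orth_act: "g \<in> carrier J \<Longrightarrow> U \<in> Dm \<Longrightarrow> V \<in> Dm \<Longrightarrow> orth s (D g U) (D g V) \<longleftrightarrow> orth s U V"
  using automorphism[of g] unfolding hhs_automorphism_def by blast

lemma D_eq_iff: "g \<in> carrier J \<Longrightarrow> U \<in> Dm \<Longrightarrow> V \<in> Dm \<Longrightarrow> D g U = D g V \<longleftrightarrow> U = V"
  using D_inv(1) by metis

lemma pnest_act: "g \<in> carrier J \<Longrightarrow> U \<in> Dm \<Longrightarrow> V \<in> Dm \<Longrightarrow> pnest s (D g U) (D g V) \<longleftrightarrow> pnest s U V"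
  by (simp add: pnest_def nest_act D_eq_iff)

lemma transverse_act:
  "g \<in> carrier J \<Longrightarrow> U \<in> Dm \<Longrightarrow> V \<in> Dm \<Longrightarrow> transverse s (D g U) (D g V) \<longleftrightarrow> transverse s U V"
  by (simp add: transverse_def nest_act orth_act D_eq_iff)

lemma proj_act:
  "g \<in> carrier J \<Longrightarrow> U \<in> Dm \<Longrightarrow> x \<in> carrier J \<Longrightarrow> T g U ` P U x = P (D g U) (g \<otimes> x)"
  using hhg unfolding hhg_def by (elim conjE) simp

lemma rho_act:
  "g \<in> carrier J \<Longrightarrow> U \<in> Dm \<Longrightarrow> V \<in> Dm \<Longrightarrow> transverse s U V \<or> pnest s U V \<Longrightarrow>
     T g V ` rho s U V = rho s (D g U) (D g V)"
  using hhg unfolding hhg_def by (elim conjE disjE) simp_all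

lemma hhs_parts: "hhs_projections E s" "hhs_nesting E s" "hhs_orthogonality s" "hhs_rho E s"
  "hhs_consistency E s" "hhs_large_links E s" "hhs_bounded_geodesic_image E s"
  "hhs_partial_realization E s" "hhs_uniqueness s"
  using hhs unfolding hhs_with_constant_def by simp_all

section \<open>Nesting and orthogonality\<close>

lemma nest_partial_order: "partial_order_on Dm {(U, V). U \<in> Dm \<and> V \<in> Dm \<and> nest s U V}"
  using hhs_parts(2) unfolding hhs_nesting_def by (elim conjE)

lemma nest_refl: "U \<in> Dm \<Longrightarrow> nest s U U"
  using nest_partial_order unfolding partial_order_on_def preorder_on_def refl_on_def
  by (elim conjE) simp

lemma nest_trans:
  assumes "U \<in> Dm" "V \<in> Dm" "W \<in> Dm" "nest s U V" "nest s V W" shows "nest s U W"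
proof -
  have "trans {(U, V). U \<in> Dm \<and> V \<in> Dm \<and> nest s U V}"
    using nest_partial_order unfolding partial_order_on_def preorder_on_def by (elim conjE)
  then show ?thesis using assms by (auto dest: transD[of _ U V W])
qed

lemma nest_antisym:
  assumes "U \<in> Dm" "V \<in> Dm" "nest s U V" "nest s V U" shows "U = V"
proof -
  have "antisym {(U, V). U \<in> Dm \<and> V \<in> Dm \<and> nest s U V}"
    using nest_partial_order unfolding partial_order_on_def by (elim conjE)
  then show ?thesis using assms by (auto dest: antisymD[of _ U V])
qed

lemma pnest_trans:
  assumes "U \<in> Dm" "V \<in> Dm" "W \<in> Dm" "pnest s U V" "nest s V W" shows "pnest s U W"
  using assms nest_trans[of U V W] nest_antisym[of U V] unfolding pnest_def by blast

lemma orth_symD: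
  "\<forall>U\<in>Dm. \<forall>V\<in>Dm. orth s U V \<longrightarrow> orth s V U \<and> \<not> nest s U V \<and> \<not> nest s V U"
  using hhs_parts(3) unfolding hhs_orthogonality_def by (elim conjE)

lemma orth_sym: "U \<in> Dm \<Longrightarrow> V \<in> Dm \<Longrightarrow> orth s U V \<Longrightarrow> orth s V U"
  and orth_not_nest: "U \<in> Dm \<Longrightarrow> V \<in> Dm \<Longrightarrow> orth s U V \<Longrightarrow> \<not> nest s U V \<and> \<not> nest s V U"
  using orth_symD by simp_all

lemma orth_nestD: "\<forall>U\<in>Dm. \<forall>V\<in>Dm. \<forall>W\<in>Dm. nest s V U \<and> orth s U W \<longrightarrow> orth s V W"
  using hhs_parts(3) unfolding hhs_orthogonality_def by (elim conjE)

lemma orth_nest: "U \<in> Dm \<Longrightarrow> V \<in> Dm \<Longrightarrow> W \<in> Dm \<Longrightarrow> nest s V U \<Longrightarrow> orth s U W \<Longrightarrow> orth s V W"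
  using orth_nestD by blast

lemma transverse_sym: "U \<in> Dm \<Longrightarrow> V \<in> Dm \<Longrightarrow> transverse s U V \<Longrightarrow> transverse s V U"
  using orth_sym unfolding transverse_def by blast

lemma chain_cardD:
  "\<forall>\<C>\<subseteq>Dm. (\<forall>U\<in>\<C>. \<forall>V\<in>\<C>. nest s U V \<or> nest s V U) \<longrightarrow> finite \<C> \<and> real (card \<C>) \<le> E"
  using hhs_parts(2) unfolding hhs_nesting_def by (elim conjE)

lemma chain_card:
  assumes "\<C> \<subseteq> Dm" "\<And>U V. U \<in> \<C> \<Longrightarrow> V \<in> \<C> \<Longrightarrow> nest s U V \<or> nest s V U"
  shows "finite \<C>" "card \<C> \<le> nat \<lfloor>E\<rfloor>"
proof -
  have *: "finite \<C> \<and> real (card \<C>) \<le> E"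
    using assms by (intro chain_cardD[rule_format]) auto
  then show "finite \<C>" "card \<C> \<le> nat \<lfloor>E\<rfloor>" by (auto simp: le_nat_floor)
qed

text \<open>A strictly monotone sequence would be an infinite chain. Both directions are used: for
  maximal relevant domains and for minimal unbounded ones.\<close>

lemma ex_extremal:
  assumes S: "S \<subseteq> Dm" "S \<noteq> {}"
    and R: "R = pnest s \<or> R = (\<lambda>U V. pnest s V U)"
  shows "\<exists>U\<in>S. \<forall>V\<in>S. \<not> R U V"
proof (rule ccontr)
  assume "\<not> ?thesis"
  then have ex: "\<And>U. U \<in> S \<Longrightarrow> \<exists>V. V \<in> S \<and> R U V" by blast
  obtain U0 where "U0 \<in> S" using S by blast
  then obtain f where f: "\<And>n. f n \<in> S \<and> R (f n) (f (Suc n))"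
    using dependent_nat_choice[of "\<lambda>_ U. U \<in> S" "\<lambda>_ U V. R U V"] ex by metis
  have fD: "f n \<in> Dm" for n using f S by blast
  have "R (f i) (f (i + Suc k))" for i k
  proof (induction k)
    case (Suc k)
    have "pnest s (f i) (f (i + Suc k)) \<Longrightarrow> pnest s (f (i + Suc k)) (f (Suc (i + Suc k))) \<Longrightarrow>
        pnest s (f i) (f (Suc (i + Suc k)))"
      by (rule pnest_trans[OF fD fD fD]) (auto simp: pnest_def)
    moreover have "pnest s (f (i + Suc k)) (f i) \<Longrightarrow> pnest s (f (Suc (i + Suc k))) (f (i + Suc k)) \<Longrightarrow>
        pnest s (f (Suc (i + Suc k))) (f i)"
      by (rule pnest_trans[OF fD fD fD]) (auto simp: pnest_def)
    ultimately show ?case using R Suc f[of "i + Suc k"] by auto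
  qed (use f in simp)
  then have lt: "R (f i) (f j)" if "i < j" for i j
    using that less_iff_Suc_add[of i j] by auto
  have "f i \<noteq> f j" if "i < j" for i j using lt[OF that] R by (auto simp: pnest_def)
  then have "inj f" by (metis injI linorder_neqE_nat)
  moreover have "finite (range f)"
  proof (rule chain_card(1))
    fix U V assume "U \<in> range f" "V \<in> range f"
    then obtain i j where "U = f i" "V = f j" by blast
    then show "nest s U V \<or> nest s V U"
      using lt[of i j] lt[of j i] R nest_refl[OF fD] by (cases i j rule: linorder_cases) (auto simp: pnest_def)
  qed (use fD in blast)
  ultimately show False using finite_imageD infinite_UNIV_nat by blast
qed

section \<open>Projections and the distances they induce\<close>

lemma proj_coarse: "U \<in> Dm \<Longrightarrow> x \<in> carrier J \<Longrightarrow> coarse_point E (Cs U) (P U x)"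
  using hhs_parts(1) unfolding hhs_projections_def mspace_total by simp

lemma proj_nonempty: "U \<in> Dm \<Longrightarrow> x \<in> carrier J \<Longrightarrow> P U x \<noteq> {}"
  using proj_coarse unfolding coarse_point_def by blast

lemma proj_subset: "U \<in> Dm \<Longrightarrow> x \<in> carrier J \<Longrightarrow> P U x \<subseteq> mspace (Cs U)"
  using proj_coarse unfolding coarse_point_def by blast

lemma proj_near: "U \<in> Dm \<Longrightarrow> x \<in> carrier J \<Longrightarrow> near (Cs U) E (P U x) (P U x)"
  using proj_coarse coarse_point_near by blast

lemma rho_coarse:
  "U \<in> Dm \<Longrightarrow> V \<in> Dm \<Longrightarrow> transverse s U V \<or> pnest s U V \<Longrightarrow> coarse_point E (Cs V) (rho s U V)"
  using hhs_parts(4) unfolding hhs_rho_def by blast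

lemma rho_nonempty: "U \<in> Dm \<Longrightarrow> V \<in> Dm \<Longrightarrow> transverse s U V \<or> pnest s U V \<Longrightarrow> rho s U V \<noteq> {}"
  using rho_coarse unfolding coarse_point_def by blast

lemma rho_subset: "U \<in> Dm \<Longrightarrow> V \<in> Dm \<Longrightarrow> transverse s U V \<or> pnest s U V \<Longrightarrow> rho s U V \<subseteq> mspace (Cs V)"
  using rho_coarse unfolding coarse_point_def by blast

lemma rho_near: "U \<in> Dm \<Longrightarrow> V \<in> Dm \<Longrightarrow> transverse s U V \<or> pnest s U V \<Longrightarrow> near (Cs V) E (rho s U V) (rho s U V)"
  using rho_coarse coarse_point_near by blast

lemma cspace_four_point: "U \<in> Dm \<Longrightarrow> four_point (8 * E) (Cs U)"
  using hhs_parts(1) E_ge_1 unfolding hhs_projections_def by (intro hyperbolic_four_point) auto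

definition close :: "'d \<Rightarrow> real \<Rightarrow> 'g \<Rightarrow> 'g \<Rightarrow> bool" where
  "close U B x y \<longleftrightarrow> near (Cs U) B (P U x) (P U y)"

lemma closeD: "close U B x y \<Longrightarrow> p \<in> P U x \<Longrightarrow> q \<in> P U y \<Longrightarrow> mdist (Cs U) p q \<le> B"
  unfolding close_def by (rule nearD)

lemma close_sym: "close U B x y \<Longrightarrow> close U B y x"
  unfolding close_def by (rule near_sym)

lemma close_mono: "close U B x y \<Longrightarrow> B \<le> B' \<Longrightarrow> close U B' x y"
  unfolding close_def by (rule near_mono)

lemma close_trans:
  assumes "close U B x y" "close U B' y z" "U \<in> Dm" "x \<in> carrier J" "y \<in> carrier J" "z \<in> carrier J"
  shows "close U (B + B') x z"
  using near_trans[OF assms(1,2)[unfolded close_def]] proj_nonempty proj_subset assms(3-6)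
  unfolding close_def by simp

lemma close_refl: "U \<in> Dm \<Longrightarrow> x \<in> carrier J \<Longrightarrow> close U E x x"
  unfolding close_def by (rule proj_near)

lemma close_nonneg: "close U B x y \<Longrightarrow> U \<in> Dm \<Longrightarrow> x \<in> carrier J \<Longrightarrow> y \<in> carrier J \<Longrightarrow> 0 \<le> B"
  unfolding close_def by (rule near_nonneg) (auto simp: proj_nonempty)

lemma close_act:
  assumes "g \<in> carrier J" "U \<in> Dm" "x \<in> carrier J" "y \<in> carrier J"
  shows "close (D g U) B (g \<otimes> x) (g \<otimes> y) \<longleftrightarrow> close U B x y"
  unfolding close_def proj_act[OF assms(1,2,3), symmetric] proj_act[OF assms(1,2,4), symmetric]
  by (rule near_isometry[OF T_isometry[OF assms(1,2)]]) (use proj_subset assms in auto)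

lemma close_set_dist:
  assumes "U \<in> Dm" "x \<in> carrier J" "y \<in> carrier J"
  shows "dist_in s U (P U x) (P U y) \<le> B \<Longrightarrow> close U (B + 2 * E) x y"
    "close U B x y \<Longrightarrow> dist_in s U (P U x) (P U y) \<le> B"
proof -
  show "dist_in s U (P U x) (P U y) \<le> B \<Longrightarrow> close U (B + 2 * E) x y"
    unfolding close_def mult_2
    by (rule near_set_dist) (use assms proj_near proj_nonempty proj_subset in auto)
  show "close U B x y \<Longrightarrow> dist_in s U (P U x) (P U y) \<le> B"
    unfolding close_def by (rule set_dist_le_near) (use assms proj_nonempty in auto)
qed

lemma close_lipschitz:
  assumes "U \<in> Dm" "x \<in> carrier J" "y \<in> carrier J"
  shows "close U (E * dT x y + 3 * E) x y"
proof -
  have "dist_in s U (P U x) (P U y) \<le> E * dT x y + E"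
    using hhs_parts(1) assms unfolding hhs_projections_def mspace_total by simp
  from close_set_dist(1)[OF assms this] show ?thesis by (rule close_mono) simp
qed

lemma dT_left_invariant:
  assumes "g \<in> carrier J" "x \<in> carrier J" "y \<in> carrier J"
  shows "dT (g \<otimes> x) (g \<otimes> y) = dT x y"
proof -
  obtain A where A: "\<forall>x\<in>carrier J. \<forall>y\<in>carrier J. dT x y = real (word_length J A (inv x \<otimes> y))"
    using hhg by (auto simp: hhg_def is_word_metric_def)
  have "inv (g \<otimes> x) \<otimes> (g \<otimes> y) = inv x \<otimes> (inv g \<otimes> (g \<otimes> y))"
    using assms by (simp add: inv_mult_group m_assoc)
  also have "inv g \<otimes> (g \<otimes> y) = y" using assms by (simp add: m_assoc[symmetric])
  finally show ?thesis using A assms by simp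
qed

lemma finite_ball: "x \<in> carrier J \<Longrightarrow> finite {g \<in> carrier J. dT x (g \<otimes> x) \<le> r}"
  using hhg_str unfolding hhg_structure_def mspace_total by (elim conjE) simp

section \<open>The domains on which an element has unbounded orbits\<close>

definition bounded_orbit :: "'g \<Rightarrow> 'd \<Rightarrow> bool" where
  "bounded_orbit g U \<longleftrightarrow> (\<exists>B. \<forall>n::int. close U B \<one> (g [^] n))"

lemma near_orbit_imp_bounded_orbit:
  assumes "U \<in> Dm" "g \<in> carrier J" "x \<in> carrier J" "\<And>n::int. close U B x (g [^] n \<otimes> x)"
  shows "bounded_orbit g U"
proof -
  have d: "close U (E * dT x \<one> + 3 * E) (g [^] n \<otimes> x) (g [^] n)" for n :: int
    using close_lipschitz[OF assms(1), of "g [^] n \<otimes> x" "g [^] n \<otimes> \<one>"] assms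
      dT_left_invariant[of "g [^] n" x \<one>] by simp
  have "close U ((E * dT x \<one> + 3 * E) + B + (E * dT x \<one> + 3 * E)) \<one> (g [^] n)" for n :: int
    by (rule close_trans[OF close_trans[OF close_sym assms(4)] d])
       (use d[of 0] assms in auto)
  then show ?thesis unfolding bounded_orbit_def by blast
qed

lemma Big_iff:
  assumes g: "g \<in> carrier J"
  shows "U \<in> Big J s g \<longleftrightarrow> U \<in> Dm \<and> \<not> bounded_orbit g U"
proof
  assume "U \<in> Big J s g"
  then obtain x where x: "U \<in> Dm" "x \<in> carrier J" "diam_in s U (orbit_proj J s g x U) = \<infinity>"
    by (auto simp: Big_def)
  have "\<not> bounded_orbit g U"
  proof
    assume "bounded_orbit g U"
    then obtain B where B: "\<And>n::int. close U B \<one> (g [^] n)" by (auto simp: bounded_orbit_def)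
    have d: "close U (E * dT \<one> x + 3 * E) (g [^] n) (g [^] n \<otimes> x)" for n :: int
      using close_lipschitz[OF x(1), of "g [^] n \<otimes> \<one>" "g [^] n \<otimes> x"] x g
        dT_left_invariant[of "g [^] n" \<one> x] by simp
    have 1: "close U (B + (E * dT \<one> x + 3 * E)) \<one> (g [^] n \<otimes> x)" for n :: int
      by (rule close_trans[OF B d]) (use x g in auto)
    have "close U ((B + (E * dT \<one> x + 3 * E)) + (B + (E * dT \<one> x + 3 * E))) (g [^] m \<otimes> x) (g [^] n \<otimes> x)" for m n :: int
      by (rule close_trans[OF close_sym[OF 1] 1]) (use x g in auto)
    then have "near (Cs U) ((B + (E * dT \<one> x + 3 * E)) + (B + (E * dT \<one> x + 3 * E))) (orbit_proj J s g x U) (orbit_proj J s g x U)"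
      by (auto simp: near_def orbit_proj_def close_def)
    then have "diam_in s U (orbit_proj J s g x U) \<le> ereal ((B + (E * dT \<one> x + 3 * E)) + (B + (E * dT \<one> x + 3 * E)))"
      by (simp only: diam_le_iff_near)
    then show False using x(3) by simp
  qed
  then show "U \<in> Dm \<and> \<not> bounded_orbit g U" using x by simp
next
  assume U: "U \<in> Dm \<and> \<not> bounded_orbit g U"
  have "diam_in s U (orbit_proj J s g \<one> U) = \<infinity>"
  proof (rule ccontr)
    assume "diam_in s U (orbit_proj J s g \<one> U) \<noteq> \<infinity>"
    then obtain r where "diam_in s U (orbit_proj J s g \<one> U) \<le> ereal r"
      by (cases "diam_in s U (orbit_proj J s g \<one> U)") auto
    then have r: "near (Cs U) r (orbit_proj J s g \<one> U) (orbit_proj J s g \<one> U)"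
      by (simp add: diam_le_iff_near)
    have sub: "P U (g [^] n) \<subseteq> orbit_proj J s g \<one> U" for n :: int
      using g by (auto simp: orbit_proj_def intro!: exI[of _ n])
    have "close U r \<one> (g [^] n)" for n :: int
      using r sub[of n] sub[of 0] unfolding close_def near_def by (simp add: subset_iff)
    then show False using U by (auto simp: bounded_orbit_def)
  qed
  then show "U \<in> Big J s g" using U by (auto simp: Big_def)
qed

lemma Big_subset: "Big J s g \<subseteq> Dm"
  by (auto simp: Big_def)

lemma Big_unbounded: "Big J s g \<subseteq> unbounded_domains s" if "g \<in> carrier J"
proof
  fix U assume U: "U \<in> Big J s g"
  then obtain x where x: "U \<in> Dm" "x \<in> carrier J" "diam_in s U (orbit_proj J s g x U) = \<infinity>"
    by (auto simp: Big_def)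
  have "orbit_proj J s g x U \<subseteq> mspace (Cs U)"
    using proj_subset[OF x(1)] x(2) that unfolding orbit_proj_def by blast
  then have "diam_in s U (orbit_proj J s g x U) \<le> diam_in s U (mspace (Cs U))"
    unfolding diam_def by (intro SUP_subset_mono) auto
  then show "U \<in> unbounded_domains s" using x by (simp add: unbounded_domains_def)
qed

lemma bounded_orbit_pow:
  assumes "bounded_orbit g U" "g \<in> carrier J"
  shows "bounded_orbit (g [^] (c::int)) U"
proof -
  obtain B where B: "\<And>n::int. close U B \<one> (g [^] n)" using assms by (auto simp: bounded_orbit_def)
  then show ?thesis unfolding bounded_orbit_def using assms(2) by (auto simp: int_pow_pow)
qed

lemma bounded_orbit_of_pow:
  assumes bo: "bounded_orbit (g [^] (c::int)) U" and c: "c \<noteq> 0" and g: "g \<in> carrier J" and U: "U \<in> Dm"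
  shows "bounded_orbit g U"
proof -
  obtain B where B: "\<And>n::int. close U B \<one> ((g [^] c) [^] n)" using bo by (auto simp: bounded_orbit_def)
  let ?R = "(\<lambda>i::int. dT \<one> (g [^] i)) ` {-\<bar>c\<bar>..\<bar>c\<bar>}"
  have fin: "finite ?R" by simp
  have "close U (B + (E * Max ?R + 3 * E)) \<one> (g [^] n)" for n :: int
  proof -
    \<comment> \<open>The remainder may be negative when \<open>c\<close> is, hence the symmetric
      range of remainders.\<close>
    let ?k = "n div c" and ?i = "n mod c"
    have i: "?i \<in> {-\<bar>c\<bar>..\<bar>c\<bar>}"
      using c abs_mod_less[of c n] by auto
    have n: "g [^] n = (g [^] c) [^] ?k \<otimes> g [^] ?i"
      using g by (simp add: int_pow_pow int_pow_mult[symmetric])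
    have cl: "close U (E * dT ((g [^] c) [^] ?k) (g [^] n) + 3 * E) ((g [^] c) [^] ?k) (g [^] n)"
      by (rule close_lipschitz[OF U]) (use g in auto)
    have "dT ((g [^] c) [^] ?k) (g [^] n) = dT \<one> (g [^] ?i)"
      using dT_left_invariant[of "(g [^] c) [^] ?k" \<one> "g [^] ?i"] g unfolding n by simp
    also have "\<dots> \<le> Max ?R" by (rule Max_ge[OF fin]) (rule imageI[OF i])
    finally have le: "E * dT ((g [^] c) [^] ?k) (g [^] n) + 3 * E \<le> E * Max ?R + 3 * E" using E_ge_1 by simp
    show ?thesis by (rule close_trans[OF B close_mono[OF cl le] U]) (use g in auto)
  qed
  then show ?thesis unfolding bounded_orbit_def by blast
qed

lemma Big_int_pow:
  assumes "g \<in> carrier J" "c \<noteq> 0"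
  shows "Big J s (g [^] (c::int)) = Big J s g"
  using Big_iff[OF assms(1)] Big_iff[of "g [^] c"] assms bounded_orbit_pow[of g _ c] bounded_orbit_of_pow[of g c]
  by auto

lemma Big_pow:
  assumes "g \<in> carrier J" "c > 0"
  shows "Big J s (g [^] (c::nat)) = Big J s g"
  using Big_int_pow[OF assms(1), of "int c"] assms(2) by (simp add: int_pow_int)

lemma bounded_orbit_conj:
  assumes bo: "bounded_orbit g U" and g: "g \<in> carrier J" "t \<in> carrier J" and U: "U \<in> Dm"
  shows "bounded_orbit (t \<otimes> g \<otimes> inv t) (D t U)"
proof -
  obtain B where B: "\<And>n::int. close U B \<one> (g [^] n)" using bo by (auto simp: bounded_orbit_def)
  have "close (D t U) B t ((t \<otimes> g \<otimes> inv t) [^] n \<otimes> t)" for n :: int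
  proof -
    have "(t \<otimes> g \<otimes> inv t) [^] n \<otimes> t = t \<otimes> g [^] n"
      unfolding conj_int_pow[OF g] using g by (simp add: m_assoc)
    then show ?thesis using close_act[OF g(2) U, of \<one> "g [^] n" B] B g by simp
  qed
  then show ?thesis by (rule near_orbit_imp_bounded_orbit[rotated 3]) (use g U D_closed in auto)
qed

lemma Big_conj:
  assumes g: "g \<in> carrier J" "t \<in> carrier J"
  shows "Big J s (t \<otimes> g \<otimes> inv t) = D t ` Big J s g"
proof -
  have 1: "D t ` Big J s g \<subseteq> Big J s (t \<otimes> g \<otimes> inv t)" if g: "g \<in> carrier J" "t \<in> carrier J" for g t
  proof
    fix V assume "V \<in> D t ` Big J s g"
    then obtain U where U: "V = D t U" "U \<in> Dm" "\<not> bounded_orbit g U" using Big_iff[OF g(1)] by blast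
    have "\<not> bounded_orbit (t \<otimes> g \<otimes> inv t) V"
    proof
      assume "bounded_orbit (t \<otimes> g \<otimes> inv t) V"
      then have "bounded_orbit (inv t \<otimes> (t \<otimes> g \<otimes> inv t) \<otimes> inv (inv t)) (D (inv t) V)"
        by (rule bounded_orbit_conj) (use U g D_closed in auto)
      moreover have "inv t \<otimes> (t \<otimes> g \<otimes> inv t) \<otimes> inv (inv t) = (inv t \<otimes> t) \<otimes> g \<otimes> (inv t \<otimes> t)"
        using g by (simp only: m_assoc m_closed inv_closed inv_inv)
      ultimately show False using U g D_inv(1) by simp
    qed
    then show "V \<in> Big J s (t \<otimes> g \<otimes> inv t)" using U g D_closed by (subst Big_iff) auto
  qed
  have "D (inv t) ` Big J s (t \<otimes> g \<otimes> inv t) \<subseteq> Big J s (inv t \<otimes> (t \<otimes> g \<otimes> inv t) \<otimes> inv (inv t))"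
    by (rule 1) (use g in auto)
  moreover have "inv t \<otimes> (t \<otimes> g \<otimes> inv t) \<otimes> inv (inv t) = (inv t \<otimes> t) \<otimes> g \<otimes> (inv t \<otimes> t)"
    using g by (simp only: m_assoc m_closed inv_closed inv_inv)
  ultimately have 2: "D (inv t) ` Big J s (t \<otimes> g \<otimes> inv t) \<subseteq> Big J s g" using g by simp
  have "Big J s (t \<otimes> g \<otimes> inv t) \<subseteq> D t ` Big J s g"
  proof
    fix V assume V: "V \<in> Big J s (t \<otimes> g \<otimes> inv t)"
    then have "D (inv t) V \<in> Big J s g" using 2 by blast
    moreover have "V = D t (D (inv t) V)" using V Big_subset D_inv(2) g by (simp add: subset_iff)
    ultimately show "V \<in> D t ` Big J s g" by blast
  qed
  then show ?thesis using 1[OF g] by blast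
qed

text \<open>Conjugation by \<open>t\<close> fixes \<open>g [^] b\<close>, and \<open>Big\<close> is
  equivariant under conjugation and unchanged by passing to powers.\<close>

lemma commute_permutes_Big:
  assumes "commute J t (g [^] (b::nat))" "b > 0" "g \<in> carrier J" "t \<in> carrier J"
  shows "D t ` Big J s g = Big J s g"
  using Big_conj[of "g [^] b" t] conj_commute[OF assms(1)] Big_pow[OF assms(3,2)] assms by simp

lemma D_pow_permutes:
  assumes "D t ` A \<subseteq> A" "A \<subseteq> Dm" "U \<in> A" "t \<in> carrier J"
  shows "D (t [^] (k::nat)) U \<in> A"
proof (induction k)
  case (Suc k)
  have "D (t [^] Suc k) U = D t (D (t [^] k) U)"
    using D_mult[of t "t [^] k" U] assms nat_pow_Suc2[of t k] by auto
  then show ?case using Suc assms by auto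
qed (use assms D_one in auto)

text \<open>A repetition in the orbit of one domain yields a power that fixes it, since elements act
  injectively; the product of the exponents then serves all domains.\<close>

lemma pow_fixes_finite:
  assumes "D t ` A \<subseteq> A" "finite A" "A \<subseteq> Dm" "t \<in> carrier J"
  shows "\<exists>c::nat. c > 0 \<and> (\<forall>U\<in>A. D (t [^] c) U = U)"
proof -
  have one: "\<exists>c::nat. c > 0 \<and> D (t [^] c) U = U" if "U \<in> A" for U
  proof -
    have "range (\<lambda>k::nat. D (t [^] k) U) \<subseteq> A" using D_pow_permutes[OF assms(1,3) that assms(4)] by blast
    then have "\<not> inj (\<lambda>k::nat. D (t [^] k) U)"
      using assms(2) finite_subset finite_imageD infinite_UNIV_nat by metis
    then obtain k l :: nat where kl: "k < l" "D (t [^] k) U = D (t [^] l) U"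
      by (auto simp: inj_def) (metis nat_neq_iff)
    have UD: "U \<in> Dm" using that assms by blast
    have "D (t [^] l) U = D (t [^] k) (D (t [^] (l - k)) U)"
      using D_mult[of "t [^] k" "t [^] (l - k)" U] kl(1) UD assms(4) by (simp add: nat_pow_mult)
    then have "U = D (t [^] (l - k)) U"
      using kl(2) D_eq_iff[of "t [^] k" U "D (t [^] (l - k)) U"] UD D_closed assms(4) by simp
    then show ?thesis using kl by (intro exI[of _ "l - k"]) auto
  qed
  have "\<exists>c::nat. c > 0 \<and> (\<forall>U\<in>B. D (t [^] c) U = U)" if "B \<subseteq> A" for B
    using finite_subset[OF that assms(2)] that
  proof (induction B)
    case (insert U B)
    then obtain c where c: "c > 0" "\<forall>U\<in>B. D (t [^] (c::nat)) U = U" by auto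
    obtain c' where c': "c' > 0" "D (t [^] (c'::nat)) U = U" using one[of U] insert by auto
    have "D (t [^] (c * c')) U = U"
      using D_pow_fix[of "t [^] c'" U c] c' insert assms by (auto simp: nat_pow_pow mult.commute)
    moreover have "D (t [^] (c * c')) V = V" if "V \<in> B" for V
      using D_pow_fix[of "t [^] c" V c'] c that insert assms by (auto simp: nat_pow_pow)
    ultimately show ?case using c c' by (intro exI[of _ "c * c'"]) auto
  qed auto
  then show ?thesis by blast
qed

text \<open>An element fixing \<open>W\<close> and \<open>U\<close> preserves the bounded set \<open>\<rho>\<close> of \<open>W\<close> in the space of \<open>U\<close>.\<close>

lemma fixed_domain_bounded_orbit:
  assumes g: "g \<in> carrier J" and UW: "U \<in> Dm" "W \<in> Dm" "D g U = U" "D g W = W"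
    and rel: "pnest s W U \<or> transverse s W U"
  shows "bounded_orbit g U"
proof -
  let ?R = "rho s W U"
  have R: "?R \<noteq> {}" "?R \<subseteq> mspace (Cs U)" "near (Cs U) E ?R ?R"
    using rho_nonempty rho_subset rho_near UW rel by blast+
  have one: "P U \<one> \<noteq> {}" "P U \<one> \<subseteq> mspace (Cs U)" "near (Cs U) E (P U \<one>) (P U \<one>)"
    using proj_nonempty proj_subset proj_near UW by auto
  have N: "near (Cs U) (set_dist (Cs U) (P U \<one>) ?R + (E + E)) (P U \<one>) ?R"
    by (rule near_set_dist) (use R one in auto)
  define B where "B = set_dist (Cs U) (P U \<one>) ?R + (E + E)"
  have "close U (B + B) \<one> (g [^] n)" for n :: int
  proof -
    let ?h = "g [^] n"
    have h: "?h \<in> carrier J" "D ?h U = U" "D ?h W = W" using g UW D_int_pow_fix by auto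
    have "near (Cs (D ?h U)) B (T ?h U ` P U \<one>) (T ?h U ` ?R)"
      using near_isometry[OF T_isometry[OF h(1) UW(1)] one(2) R(2)] N unfolding B_def by blast
    moreover have "T ?h U ` ?R = ?R" using rho_act[OF h(1) UW(2,1)] rel h by auto
    moreover have "T ?h U ` P U \<one> = P U ?h" using proj_act[OF h(1) UW(1), of \<one>] h by simp
    ultimately have "near (Cs U) B (P U ?h) ?R" using h by simp
    then show ?thesis unfolding close_def
      by (rule near_trans[OF N[folded B_def] near_sym]) (use R one proj_subset UW h in auto)
  qed
  then show ?thesis unfolding bounded_orbit_def by blast
qed

lemma fixed_domain_not_Big:
  assumes g: "g \<in> carrier J" and c: "(c::nat) > 0" and UW: "U \<in> Big J s g" "W \<in> Dm" "D (g [^] c) U = U" "D (g [^] c) W = W"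
  shows "\<not> pnest s W U \<and> \<not> transverse s W U"
proof (rule ccontr)
  assume "\<not> ?thesis"
  then have "bounded_orbit (g [^] c) U"
    using fixed_domain_bounded_orbit[of "g [^] c" U W] UW g Big_subset by blast
  then show False using UW(1) Big_pow[OF g c] Big_iff[of "g [^] c"] g by auto
qed

text \<open>One power of \<open>g\<close> fixes both sets \<open>Big\<close> pointwise, so by
  \<open>fixed_domain_not_Big\<close> the domain \<open>W\<close> is neither properly nested in
  \<open>U\<close> nor transverse to it. Exchanging the roles excludes the other nesting.\<close>

lemma virt_commute_Big:
  assumes g: "g \<in> carrier J" "h \<in> carrier J" and vc: "virt_commute J g h"
    and fin: "finite (Big J s g)" "finite (Big J s h)" and U: "U \<in> Big J s g" "W \<in> Big J s h"
  shows "U = W \<or> orth s U W"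
proof -
  have UD: "U \<in> Dm" "W \<in> Dm" using U Big_subset by blast+
  have 1: "\<not> pnest s W U \<and> \<not> transverse s W U"
    if gh: "g \<in> carrier J" "h \<in> carrier J" "virt_commute J g h" "finite (Big J s g)" "finite (Big J s h)"
      "U \<in> Big J s g" "W \<in> Big J s h" for g h U W
  proof -
    obtain m n :: nat where mn: "m > 0" "n > 0" "commute J (g [^] m) (h [^] n)"
      using gh(3) by (auto simp: virt_commute_def)
    let ?t = "g [^] m"
    have "D ?t ` Big J s h = Big J s h" by (rule commute_permutes_Big[OF mn(3,2)]) (use gh in auto)
    then obtain c :: nat where c: "c > 0" "\<forall>V\<in>Big J s h. D (?t [^] c) V = V"
      using pow_fixes_finite[of ?t "Big J s h"] gh Big_subset by auto
    have "commute J ?t (g [^] (1::nat))"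
      using commute_self_pow[of g "int m" 1] gh by (simp add: int_pow_int)
    then have "D ?t ` Big J s g = Big J s g" by (rule commute_permutes_Big) (use gh in auto)
    then obtain c' :: nat where c': "c' > 0" "\<forall>V\<in>Big J s g. D (?t [^] c') V = V"
      using pow_fixes_finite[of ?t "Big J s g"] gh Big_subset by auto
    have WU: "U \<in> Dm" "W \<in> Dm" using gh Big_subset by blast+
    have "D ((?t [^] c) [^] c') W = W" "D ((?t [^] c') [^] c) U = U"
      by (rule D_pow_fix; use c c' gh WU in auto)+
    then have "D (g [^] (m * (c * c'))) W = W" "D (g [^] (m * (c * c'))) U = U"
      using gh by (simp_all add: nat_pow_pow mult_ac)
    then show ?thesis using fixed_domain_not_Big[of g "m * (c * c')" U W] gh c c' mn WU by simp
  qed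
  show ?thesis
    using 1[OF g vc fin U] 1[OF g(2,1) virt_commute_sym[OF vc] fin(2,1) U(2,1)]
    by (auto simp: pnest_def transverse_def)
qed

end

section \<open>Bounded geodesic images and consistency\<close>

context hhg_group
begin

lemma near_Un: "near m B X X \<Longrightarrow> near m B X Y \<Longrightarrow> near m B Y Y \<Longrightarrow> near m B (X \<union> Y) (X \<union> Y)"
  using near_sym[of m B X Y] unfolding near_def by blast

lemma ex_proj_point: "U \<in> Dm \<Longrightarrow> x \<in> carrier J \<Longrightarrow> \<exists>p. p \<in> P U x"
  using proj_nonempty by blast

lemma proj_in: "U \<in> Dm \<Longrightarrow> x \<in> carrier J \<Longrightarrow> p \<in> P U x \<Longrightarrow> p \<in> mspace (Cs U)"
  using proj_subset by blast

lemma rho_in: "V \<in> Dm \<Longrightarrow> W \<in> Dm \<Longrightarrow> transverse s V W \<or> pnest s V W \<Longrightarrow> r \<in> rho s V W \<Longrightarrow> r \<in> mspace (Cs W)"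
  using rho_subset by blast

lemma rho_map_coarse:
  "V \<in> Dm \<Longrightarrow> W \<in> Dm \<Longrightarrow> pnest s V W \<Longrightarrow> p \<in> mspace (Cs W) \<Longrightarrow> coarse_point E (Cs V) (rho_map s W V p)"
  using hhs_parts(4) unfolding hhs_rho_def by blast

lemma consistencyD: "\<forall>x\<in>carrier J. consistent_on E s Dm (\<lambda>V. P V x)"
  using hhs_parts(5) unfolding hhs_consistency_def mspace_total by (elim conjE)

lemma rho_coherenceD: "\<forall>U\<in>Dm. \<forall>V\<in>Dm. \<forall>W\<in>Dm.
        pnest s U V \<and> (pnest s V W \<or> transverse s V W \<and> \<not> orth s W U) \<longrightarrow>
        dist_in s W (rho s U W) (rho s V W) \<le> E"
  using hhs_parts(5) unfolding hhs_consistency_def by (elim conjE)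

lemma consistent_transverse:
  assumes "x \<in> carrier J" "U \<in> Dm" "V \<in> Dm" "transverse s U V"
  shows "dist_in s U (P U x) (rho s V U) \<le> E \<or> dist_in s V (P V x) (rho s U V) \<le> E"
  using consistencyD assms unfolding consistent_on_def by (metis min_le_iff_disj)

lemma consistent_nested:
  assumes "x \<in> carrier J" "U \<in> Dm" "V \<in> Dm" "pnest s U V"
  shows "dist_in s V (P V x) (rho s U V) \<le> E \<or>
    near (Cs U) E (P U x \<union> (\<Union>p\<in>P V x. rho_map s V U p)) (P U x \<union> (\<Union>p\<in>P V x. rho_map s V U p))"
proof -
  have "min (ereal (dist_in s V (P V x) (rho s U V)))
            (diam_in s U (P U x \<union> (\<Union>p\<in>P V x. rho_map s V U p))) \<le> ereal E"
    using consistencyD assms unfolding consistent_on_def by blast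
  then show ?thesis by (auto simp: min_le_iff_disj diam_le_iff_near)
qed

lemma near_rho_of_dist:
  assumes "x \<in> carrier J" "U \<in> Dm" "V \<in> Dm" "transverse s U V \<or> pnest s U V"
    "dist_in s V (P V x) (rho s U V) \<le> B"
  shows "near (Cs V) (B + 2 * E) (P V x) (rho s U V)"
  unfolding mult_2
  by (rule near_set_dist) (use assms proj_near proj_nonempty proj_subset rho_near rho_nonempty rho_subset in auto)

lemma near_rho_nested:
  assumes "U \<in> Dm" "V \<in> Dm" "W \<in> Dm" "pnest s U V" "pnest s V W"
  shows "near (Cs W) (3 * E) (rho s U W) (rho s V W)"
proof -
  have UW: "pnest s U W" using pnest_trans[OF assms(1-4)] assms(5) by (simp add: pnest_def)
  have "dist_in s W (rho s U W) (rho s V W) \<le> E" using rho_coherenceD assms by blast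
  then have "near (Cs W) (E + (E + E)) (rho s U W) (rho s V W)"
    by (intro near_set_dist) (use assms UW rho_near rho_nonempty rho_subset in auto)
  then show ?thesis by (rule near_mono) simp
qed

text \<open>The point of the geodesic near \<rho> is recorded by an equation of distances, so that
  geodesics disappear from the statements that follow. Adding the diameter of \<rho> bounds its
  distance to all points of \<rho>.\<close>

lemma geodesic_image:
  assumes "V \<in> Dm" "W \<in> Dm" "pnest s V W" "p \<in> mspace (Cs W)" "q \<in> mspace (Cs W)"
  shows "near (Cs V) E (rho_map s W V p) (rho_map s W V q) \<or>
    (\<exists>z\<in>mspace (Cs W). mdist (Cs W) p z + mdist (Cs W) z q = mdist (Cs W) p q \<and>
       (\<forall>r\<in>rho s V W. mdist (Cs W) z r \<le> 3 * E))"
proof -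
  have "hyperbolic_space E (Cs W)" using hhs_parts(1) assms(2) unfolding hhs_projections_def by blast
  then obtain \<gamma> where \<gamma>: "geodesic_between (Cs W) p q \<gamma>"
    using assms(4,5) unfolding hyperbolic_space_def by metis
  have "diam_in s V (\<Union>p\<in>\<gamma>. rho_map s W V p) \<le> ereal E \<or>
        (\<exists>p\<in>\<gamma>. \<exists>q\<in>rho s V W. mdist (Cs W) p q \<le> E)"
    using hhs_parts(7) assms(1-3) \<gamma> unfolding hhs_bounded_geodesic_image_def by blast
  then show ?thesis
  proof
    assume "diam_in s V (\<Union>p\<in>\<gamma>. rho_map s W V p) \<le> ereal E"
    then have n: "near (Cs V) E (\<Union>p\<in>\<gamma>. rho_map s W V p) (\<Union>p\<in>\<gamma>. rho_map s W V p)"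
      by (simp only: diam_le_iff_near)
    have "p \<in> \<gamma>" "q \<in> \<gamma>" using geodesic_between_ends[OF \<gamma>] by auto
    then have "near (Cs V) E (rho_map s W V p) (rho_map s W V q)" using n unfolding near_def by blast
    then show ?thesis by blast
  next
    assume "\<exists>p\<in>\<gamma>. \<exists>q\<in>rho s V W. mdist (Cs W) p q \<le> E"
    then obtain z r where z: "z \<in> \<gamma>" "r \<in> rho s V W" "mdist (Cs W) z r \<le> E" by blast
    have zM: "z \<in> mspace (Cs W)" using geodesic_between_point(1)[OF \<gamma> z(1)] .
    have "mdist (Cs W) z r' \<le> 3 * E" if "r' \<in> rho s V W" for r'
    proof -
      have "mdist (Cs W) r r' \<le> E" using nearD[OF rho_near] assms z(2) that by blast
      moreover have "mdist (Cs W) z r' \<le> mdist (Cs W) z r + mdist (Cs W) r r'"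
        using mdist_triangle[of z "Cs W" r r'] zM rho_in assms z(2) that by blast
      ultimately show ?thesis using z(3) E_ge_1 by linarith
    qed
    then show ?thesis using zM geodesic_between_point(2)[OF \<gamma> z(1)] by blast
  qed
qed

text \<open>Nested consistency at the two ends passes from the maps \<rho> to the projections. Where
  consistency says instead that an end is itself near \<rho>, this end serves as
  \<open>z\<close>.\<close>

lemma bounded_geodesic_image:
  assumes "V \<in> Dm" "W \<in> Dm" "pnest s V W" "x \<in> carrier J" "y \<in> carrier J" "p \<in> P W x" "q \<in> P W y"
  shows "close V (3 * E) x y \<or>
    (\<exists>z\<in>mspace (Cs W). mdist (Cs W) p z + mdist (Cs W) z q = mdist (Cs W) p q \<and>
       (\<forall>r\<in>rho s V W. mdist (Cs W) z r \<le> 3 * E))"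
    (is "_ \<or> ?Z")
proof -
  have pq: "p \<in> mspace (Cs W)" "q \<in> mspace (Cs W)" using proj_in assms by blast+
  have zero: "mdist (Cs W) p p = 0" "mdist (Cs W) q q = 0" using pq by simp_all
  show ?thesis
  proof (cases "?Z")
    case False
    have x: "near (Cs V) E (P V x) (rho_map s W V p)"
      using consistent_nested[OF assms(4,1,2,3)]
    proof
      assume "dist_in s W (P W x) (rho s V W) \<le> E"
      from near_rho_of_dist[OF assms(4,1,2) _ this] have "\<forall>r\<in>rho s V W. mdist (Cs W) p r \<le> 3 * E"
        using assms(3,6) by (auto simp: near_def)
      then have ?Z using zero pq by (intro bexI[of _ p]) auto
      then show ?thesis using False by blast
    qed (use assms(6) in \<open>auto simp: near_def\<close>)
    have y: "near (Cs V) E (P V y) (rho_map s W V q)"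
      using consistent_nested[OF assms(5,1,2,3)]
    proof
      assume "dist_in s W (P W y) (rho s V W) \<le> E"
      from near_rho_of_dist[OF assms(5,1,2) _ this] have "\<forall>r\<in>rho s V W. mdist (Cs W) q r \<le> 3 * E"
        using assms(3,7) by (auto simp: near_def)
      then have ?Z using zero pq by (intro bexI[of _ q]) auto
      then show ?thesis using False by blast
    qed (use assms(7) in \<open>auto simp: near_def\<close>)
    have pq': "near (Cs V) E (rho_map s W V p) (rho_map s W V q)"
      using geodesic_image[OF assms(1-3) pq] False by blast
    have c: "rho_map s W V p \<noteq> {}" "rho_map s W V p \<subseteq> mspace (Cs V)"
      "rho_map s W V q \<noteq> {}" "rho_map s W V q \<subseteq> mspace (Cs V)"
      using rho_map_coarse[OF assms(1-3)] pq unfolding coarse_point_def by blast+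
    have "near (Cs V) (E + E + E) (P V x) (P V y)"
      by (rule near_trans[OF near_trans[OF x pq'] near_sym[OF y]]) (use c proj_subset assms in auto)
    then show ?thesis unfolding close_def by (auto elim: near_mono)
  qed blast
qed

text \<open>A geodesic from \<open>p\<close> to a point at distance at most \<open>B\<close> cannot
  come within \<open>3 * E\<close> of \<rho>, which leaves the other alternative of the bounded
  geodesic image.\<close>

lemma far_close:
  assumes "V \<in> Dm" "W \<in> Dm" "pnest s V W" "x \<in> carrier J" "y \<in> carrier J"
    and "close W B x y" "p \<in> P W x" "r \<in> rho s V W" "mdist (Cs W) p r > B + 3 * E"
  shows "close V (3 * E) x y"
proof -
  obtain q where q: "q \<in> P W y" using ex_proj_point assms by blast
  have False if z: "z \<in> mspace (Cs W)" "mdist (Cs W) p z + mdist (Cs W) z q = mdist (Cs W) p q"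
      "\<forall>r\<in>rho s V W. mdist (Cs W) z r \<le> 3 * E" for z
  proof -
    have "mdist (Cs W) p r \<le> mdist (Cs W) p z + mdist (Cs W) z r"
      using mdist_triangle[of p "Cs W" z r] z(1) proj_in rho_in assms by blast
    moreover have "mdist (Cs W) p q \<le> B" using closeD[OF assms(6,7) q] .
    moreover have "mdist (Cs W) z r \<le> 3 * E" using z(3) assms(8) by blast
    moreover have "0 \<le> mdist (Cs W) z q" by simp
    ultimately show False using z(2) assms(9) by linarith
  qed
  then show ?thesis using bounded_geodesic_image[OF assms(1-5,7) q] by blast
qed

text \<open>Consistency relates two domains at a time, so coordinates taken from different points
  fit together once any two transverse or properly nested domains coarsely see a common point
  \<open>u\<close>. The second alternative admits nested pairs whose larger domain has its
  coordinate near \<rho>, which is consistent by itself.\<close>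

lemma consistent_on_pairwise_close:
  assumes D: "D' \<subseteq> Dm" and z: "\<And>V. V \<in> D' \<Longrightarrow> z V \<in> carrier J" and B: "B \<ge> 0"
    and pair: "\<And>V W. V \<in> D' \<Longrightarrow> W \<in> D' \<Longrightarrow> transverse s V W \<or> pnest s V W \<Longrightarrow>
      (\<exists>u\<in>carrier J. close V B (z V) u \<and> close W B (z W) u) \<or>
      pnest s V W \<and> near (Cs W) (B + 4 * E) (P W (z W)) (rho s V W)"
  shows "consistent_on (B + 4 * E) s D' (\<lambda>V. P V (z V))"
  unfolding consistent_on_def
proof (intro ballI conjI impI)
  fix U V assume UV: "U \<in> D'" "V \<in> D'" "transverse s U V"
  then have UD: "U \<in> Dm" "V \<in> Dm" using D by blast+
  have nested: "\<not> pnest s U V" using UV(3) by (auto simp: transverse_def pnest_def)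
  then obtain u where u: "u \<in> carrier J" "close U B (z U) u" "close V B (z V) u" using pair[of U V] UV by blast
  have VU: "transverse s V U" using transverse_sym UD UV(3) by blast
  have tr: "dist_in s W (P W (z W)) R \<le> B + 4 * E"
    if "W \<in> D'" "close W B (z W) u" "near (Cs W) (E + 2 * E) (P W u) R" "R \<noteq> {}" "R \<subseteq> mspace (Cs W)" for W R
  proof -
    have W: "W \<in> Dm" "z W \<in> carrier J" using that(1) D z by blast+
    have "near (Cs W) (B + (E + 2 * E)) (P W (z W)) R"
      by (rule near_trans[OF that(2)[unfolded close_def] that(3)])
         (use that(5) proj_nonempty[OF W(1) u(1)] proj_subset[OF W(1) u(1)] proj_subset[OF W] in auto)
    then have "dist_in s W (P W (z W)) R \<le> B + (E + 2 * E)"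
      by (rule set_dist_le_near) (use that(4) proj_nonempty[OF W] in auto)
    then show ?thesis using E_ge_1 by linarith
  qed
  from consistent_transverse[OF u(1) UD UV(3)]
  have "dist_in s U (P U (z U)) (rho s V U) \<le> B + 4 * E \<or> dist_in s V (P V (z V)) (rho s U V) \<le> B + 4 * E"
  proof
    assume "dist_in s U (P U u) (rho s V U) \<le> E"
    then have "near (Cs U) (E + 2 * E) (P U u) (rho s V U)"
      by (intro near_rho_of_dist[OF u(1) UD(2,1)]) (use VU in auto)
    then show ?thesis using tr[OF UV(1) u(2)] rho_nonempty[OF UD(2,1)] rho_subset[OF UD(2,1)] VU by blast
  next
    assume "dist_in s V (P V u) (rho s U V) \<le> E"
    then have "near (Cs V) (E + 2 * E) (P V u) (rho s U V)"
      by (intro near_rho_of_dist[OF u(1) UD]) (use UV in auto)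
    then show ?thesis using tr[OF UV(2) u(3)] rho_nonempty[OF UD] rho_subset[OF UD] UV by blast
  qed
  then show "min (dist_in s U (P U (z U)) (rho s V U)) (dist_in s V (P V (z V)) (rho s U V)) \<le> B + 4 * E"
    by (simp add: min_le_iff_disj)
next
  fix U V assume UV: "U \<in> D'" "V \<in> D'" "pnest s U V"
  then have UD: "U \<in> Dm" "V \<in> Dm" using D by blast+
  have zc: "z U \<in> carrier J" "z V \<in> carrier J" using z UV by auto
  have R: "rho s U V \<noteq> {}" "rho s U V \<subseteq> mspace (Cs V)" using rho_nonempty rho_subset UD UV by blast+
  let ?A = "P U (z U) \<union> (\<Union>p\<in>P V (z V). rho_map s V U p)"
  have "dist_in s V (P V (z V)) (rho s U V) \<le> B + 4 * E \<or> near (Cs U) (B + 4 * E) ?A ?A"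
  proof (cases "\<exists>u\<in>carrier J. close U B (z U) u \<and> close V B (z V) u")
    case True
    then obtain u where u: "u \<in> carrier J" "close U B (z U) u" "close V B (z V) u" by blast
    show ?thesis using consistent_nested[OF u(1) UD UV(3)]
    proof
      assume "dist_in s V (P V u) (rho s U V) \<le> E"
      then have n: "near (Cs V) (E + 2 * E) (P V u) (rho s U V)"
        by (intro near_rho_of_dist[OF u(1) UD]) (use UV in auto)
      have "near (Cs V) (B + (E + 2 * E)) (P V (z V)) (rho s U V)"
        by (rule near_trans[OF u(3)[unfolded close_def] n])
           (use R(2) proj_nonempty[OF UD(2) u(1)] proj_subset[OF UD(2) u(1)] proj_subset[OF UD(2) zc(2)] in auto)
      then have "dist_in s V (P V (z V)) (rho s U V) \<le> B + (E + 2 * E)"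
        by (rule set_dist_le_near) (use R(1) proj_nonempty[OF UD(2) zc(2)] in auto)
      then show ?thesis using E_ge_1 by linarith
    next
      assume n: "near (Cs U) E (P U u \<union> (\<Union>p\<in>P V u. rho_map s V U p)) (P U u \<union> (\<Union>p\<in>P V u. rho_map s V U p))"
      obtain p where p: "p \<in> P V u" using ex_proj_point UD u by blast
      have pM: "p \<in> mspace (Cs V)" using proj_in UD u p by blast
      have Rp: "rho_map s V U p \<noteq> {}" "rho_map s V U p \<subseteq> mspace (Cs U)"
        using rho_map_coarse[OF UD UV(3) pM] by (simp_all add: coarse_point_def)
      have up: "near (Cs U) E (P U u) (rho_map s V U p)" using n p unfolding near_def by blast
      have zp: "near (Cs U) (B + E) (P U (z U)) (rho_map s V U p)"
        by (rule near_trans[OF u(2)[unfolded close_def] up])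
          (use Rp(2) proj_nonempty[OF UD(1) u(1)] proj_subset[OF UD(1) u(1)] proj_subset[OF UD(1) zc(1)] in auto)
      show ?thesis
      \<comment> \<open>If the image under \<rho> of some coordinate \<open>b\<close> of
        \<open>z V\<close> is not close to that of \<open>p\<close>, the geodesic from
        \<open>p\<close> to \<open>b\<close> passes near \<rho>; as it has length at most
        \<open>B\<close>, the point \<open>b\<close> is near \<rho> too.\<close>
      proof (cases "\<exists>b\<in>P V (z V). \<not> near (Cs U) E (rho_map s V U p) (rho_map s V U b)")
        case True
        then obtain b where b: "b \<in> P V (z V)" "\<not> near (Cs U) E (rho_map s V U p) (rho_map s V U b)" by blast
        have bM: "b \<in> mspace (Cs V)" using proj_in UD zc b by blast
        obtain y where y: "y \<in> mspace (Cs V)" "mdist (Cs V) p y + mdist (Cs V) y b = mdist (Cs V) p b"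
            "\<forall>r\<in>rho s U V. mdist (Cs V) y r \<le> 3 * E"
          using geodesic_image[OF UD UV(3) pM bM] b(2) by blast
        obtain r where r: "r \<in> rho s U V" using R by blast
        have "mdist (Cs V) b r \<le> mdist (Cs V) b y + mdist (Cs V) y r"
          using mdist_triangle[of b "Cs V" y r] bM y(1) r R by blast
        moreover have "mdist (Cs V) b p \<le> B" using closeD[OF u(3) b(1) p] .
        moreover have "0 \<le> mdist (Cs V) p y" by simp
        moreover have "mdist (Cs V) y r \<le> 3 * E" using y(3) r by blast
        ultimately have br: "mdist (Cs V) b r \<le> B + 3 * E"
          using y(2) mdist_commute[of "Cs V" y b] mdist_commute[of "Cs V" p b] by linarith
        have bdd: "bdd_below ((\<lambda>(x, y). mdist (Cs V) x y) ` (P V (z V) \<times> rho s U V))"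
          by (rule bdd_belowI[of _ 0]) auto
        have "dist_in s V (P V (z V)) (rho s U V) \<le> mdist (Cs V) b r"
          unfolding set_dist_def using cINF_lower[OF bdd, of "(b, r)"] b(1) r by simp
        then show ?thesis using br E_ge_1 by linarith
      next
        case False
        have far: "near (Cs U) E (\<Union>p\<in>P V (z V). rho_map s V U p) (rho_map s V U p)"
          unfolding near_def
        proof (intro ballI)
          fix x y assume "x \<in> (\<Union>p\<in>P V (z V). rho_map s V U p)" and y: "y \<in> rho_map s V U p"
          then obtain b where b: "b \<in> P V (z V)" "x \<in> rho_map s V U b" by blast
          then have "near (Cs U) E (rho_map s V U p) (rho_map s V U b)" using False by blast
          from nearD[OF near_sym[OF this] b(2) y] show "mdist (Cs U) x y \<le> E" .
        qed
        have sub: "(\<Union>p\<in>P V (z V). rho_map s V U p) \<subseteq> mspace (Cs U)"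
        proof
          fix x assume "x \<in> (\<Union>p\<in>P V (z V). rho_map s V U p)"
          then obtain p where "p \<in> P V (z V)" "x \<in> rho_map s V U p" by blast
          then show "x \<in> mspace (Cs U)"
            using rho_map_coarse[OF UD UV(3) proj_in[OF UD(2) zc(2)]] by (auto simp: coarse_point_def)
        qed
        have 1: "near (Cs U) (B + E + E) (P U (z U)) (\<Union>p\<in>P V (z V). rho_map s V U p)"
          by (rule near_trans[OF zp near_sym[OF far]]) (use Rp(1,2) sub proj_subset[OF UD(1) zc(1)] in auto)
        have 2: "near (Cs U) (E + E) (\<Union>p\<in>P V (z V). rho_map s V U p) (\<Union>p\<in>P V (z V). rho_map s V U p)"
          by (rule near_trans[OF far near_sym[OF far]]) (use Rp(1,2) sub in auto)
        have 3: "near (Cs U) E (P U (z U)) (P U (z U))" using proj_near UD zc by blast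
        have "near (Cs U) (B + 4 * E) ?A ?A"
          by (intro near_Un near_mono[OF 1] near_mono[OF 2] near_mono[OF 3]) (use B E_ge_1 in auto)
        then show ?thesis by blast
      qed
    qed
  next
    case False
    then have "near (Cs V) (B + 4 * E) (P V (z V)) (rho s U V)" using pair[of U V] UV by blast
    then have "dist_in s V (P V (z V)) (rho s U V) \<le> B + 4 * E"
      by (rule set_dist_le_near) (use R(1) proj_nonempty[OF UD(2) zc(2)] in auto)
    then show ?thesis by blast
  qed
  then show "min (ereal (dist_in s V (P V (z V)) (rho s U V))) (diam_in s U ?A) \<le> ereal (B + 4 * E)"
    by (auto simp: min_le_iff_disj diam_le_iff_near)
qed

section \<open>Counting domains and group elements\<close>

lemma large_links:
  assumes W: "W \<in> Dm" and xy: "x \<in> carrier J" "y \<in> carrier J" and C: "close W C x y"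
  shows "\<exists>\<T>. finite \<T> \<and> card \<T> \<le> nat \<lfloor>E * C + E\<rfloor> \<and> (\<forall>T\<in>\<T>. T \<in> Dm \<and> pnest s T W) \<and>
    (\<forall>T\<in>Dm. pnest s T W \<longrightarrow> (\<exists>T'\<in>\<T>. nest s T T') \<or> close T (3 * E) x y)"
proof -
  have d: "dist_in s W (P W x) (P W y) \<le> C" by (rule close_set_dist(2)[OF W xy C])
  define N where "N = E * dist_in s W (P W x) (P W y) + E"
  have "\<exists>\<T>. finite \<T> \<and> int (card \<T>) \<le> \<lfloor>N\<rfloor> \<and>
          (\<forall>T\<in>\<T>. T \<in> Dm \<and> pnest s T W \<and> dist_in s W (P W x) (rho s T W) \<le> N) \<and>
          (\<forall>T\<in>Dm. pnest s T W \<longrightarrow>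
             (\<exists>T'\<in>\<T>. nest s T T') \<or> dist_in s T (P T x) (P T y) < E)"
    using hhs_parts(6)[unfolded hhs_large_links_def mspace_total, rule_format, OF W xy] unfolding N_def Let_def .
  then obtain \<T> where t: "finite \<T>" "int (card \<T>) \<le> \<lfloor>N\<rfloor>" "\<forall>T\<in>\<T>. T \<in> Dm \<and> pnest s T W"
    "\<forall>T\<in>Dm. pnest s T W \<longrightarrow> (\<exists>T'\<in>\<T>. nest s T T') \<or> dist_in s T (P T x) (P T y) < E"
    by blast
  have "N \<le> E * C + E" using d E_ge_1 by (simp add: N_def)
  then have "\<lfloor>N\<rfloor> \<le> \<lfloor>E * C + E\<rfloor>" by (rule floor_mono)
  then have "card \<T> \<le> nat \<lfloor>E * C + E\<rfloor>" using t(2) by linarith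
  moreover have "close T (3 * E) x y" if "T \<in> Dm" "dist_in s T (P T x) (P T y) < E" for T
    using close_set_dist(1)[OF that(1) xy, of E] that(2) by (simp add: less_imp_le)
  ultimately show ?thesis using t by blast
qed

definition chains_below :: "'d \<Rightarrow> nat \<Rightarrow> bool" where
  "chains_below W n \<longleftrightarrow> (\<forall>\<C>\<subseteq>Dm. (\<forall>U\<in>\<C>. nest s U W) \<and> (\<forall>U\<in>\<C>. \<forall>V\<in>\<C>. nest s U V \<or> nest s V U) \<longrightarrow> card \<C> \<le> n)"

text \<open>The bound \<open>F\<close> is uniform over all \<open>W\<close>, \<open>x\<close> and
  \<open>y\<close>; the length \<open>n\<close> of the chains below \<open>W\<close> is the
  parameter of an induction.\<close>

definition relevant_count :: "real \<Rightarrow> nat \<Rightarrow> nat \<Rightarrow> bool" where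
  "relevant_count C n F \<longleftrightarrow> (\<forall>W x y \<V>. W \<in> Dm \<longrightarrow> x \<in> carrier J \<longrightarrow> y \<in> carrier J \<longrightarrow> \<V> \<subseteq> Dm \<longrightarrow>
     chains_below W n \<longrightarrow> (\<forall>V\<in>\<V>. pnest s V W \<and> \<not> close V (3 * E) x y) \<longrightarrow>
     (\<forall>V\<in>\<V>. \<forall>T\<in>Dm. pnest s V T \<and> nest s T W \<longrightarrow> close T C x y) \<longrightarrow> finite \<V> \<and> card \<V> \<le> F)"

text \<open>Large links cover the relevant domains by boundedly many domains \<open>T\<close>
  properly nested in \<open>W\<close>. Chains below \<open>T\<close> are shorter than those below
  \<open>W\<close>, since \<open>W\<close> can be added to them, and smallness in the domains above
  relevant ones is inherited.\<close>

lemma ex_relevant_count: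
  assumes C: "C \<ge> 0"
  shows "\<exists>F. relevant_count C n F"
proof (induction n)
  case 0
  show ?case unfolding relevant_count_def
  proof (intro exI[of _ 0] allI impI)
    fix W x y \<V>
    assume W: "W \<in> Dm" and ch: "chains_below W 0"
    have "card {W} \<le> 0" by (rule ch[unfolded chains_below_def, rule_format]) (use W nest_refl in auto)
    then show "finite \<V> \<and> card \<V> \<le> 0" by simp
  qed
next
  case (Suc n)
  then obtain F where F: "relevant_count C n F" by blast
  define N where "N = nat \<lfloor>E * C + E\<rfloor>"
  show ?case unfolding relevant_count_def
  proof (intro exI[of _ "N * (1 + F)"] allI impI)
    fix W x y \<V>
    assume W: "W \<in> Dm" and xy: "x \<in> carrier J" "y \<in> carrier J" and V: "\<V> \<subseteq> Dm"
      and ch: "chains_below W (Suc n)"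
      and rel: "\<forall>V\<in>\<V>. pnest s V W \<and> \<not> close V (3 * E) x y"
      and cl: "\<forall>V\<in>\<V>. \<forall>T\<in>Dm. pnest s V T \<and> nest s T W \<longrightarrow> close T C x y"
    show "finite \<V> \<and> card \<V> \<le> N * (1 + F)"
    proof (cases "\<V> = {}")
      case False
      \<comment> \<open>\<open>W\<close> is itself one of the domains above a relevant one, so its
        large links number at most \<open>N\<close>.\<close>
      then have "close W C x y" using cl rel W nest_refl by blast
      then obtain \<T> where t: "finite \<T>" "card \<T> \<le> N" "\<And>T. T \<in> \<T> \<Longrightarrow> T \<in> Dm \<and> pnest s T W"
        "\<And>T. T \<in> Dm \<Longrightarrow> pnest s T W \<Longrightarrow> (\<exists>T'\<in>\<T>. nest s T T') \<or> close T (3 * E) x y"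
        using large_links[OF W xy] unfolding N_def by metis
      define Q where "Q T = {T} \<union> {V \<in> \<V>. pnest s V T}" for T
      have Q: "finite (Q T) \<and> card (Q T) \<le> 1 + F" if T: "T \<in> \<T>" for T
      proof -
        have TD: "T \<in> Dm" "pnest s T W" using t(3)[OF T] by auto
        have "finite {V \<in> \<V>. pnest s V T} \<and> card {V \<in> \<V>. pnest s V T} \<le> F"
        proof (rule F[unfolded relevant_count_def, rule_format, OF TD(1) xy])
          show "{V \<in> \<V>. pnest s V T} \<subseteq> Dm" using V by blast
          show "pnest s V T \<and> \<not> close V (3 * E) x y" if "V \<in> {V \<in> \<V>. pnest s V T}" for V
            using rel that by blast
          show "close T' C x y" if "V \<in> {V \<in> \<V>. pnest s V T}" "T' \<in> Dm" "pnest s V T' \<and> nest s T' T" for V T'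
            using cl nest_trans[OF that(2) TD(1) W] TD(2) that unfolding pnest_def by blast
          show "chains_below T n" unfolding chains_below_def
          proof (intro allI impI)
            fix \<C> assume c: "\<C> \<subseteq> Dm" "(\<forall>U\<in>\<C>. nest s U T) \<and> (\<forall>U\<in>\<C>. \<forall>V\<in>\<C>. nest s U V \<or> nest s V U)"
            have finC: "finite \<C>" by (rule chain_card(1)) (use c in auto)
            have CW: "nest s U W" if "U \<in> \<C>" for U
              using nest_trans[of U T W] that c TD W unfolding pnest_def by blast
            have "W \<notin> \<C>"
            proof
              assume "W \<in> \<C>"
              then have "W = T" using nest_antisym[of W T] c TD W unfolding pnest_def by blast
              then show False using TD by (simp add: pnest_def)
            qed
            moreover have "card (insert W \<C>) \<le> Suc n"
            proof (rule ch[unfolded chains_below_def, rule_format])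
              show "insert W \<C> \<subseteq> Dm" using c W by blast
              show "(\<forall>U\<in>insert W \<C>. nest s U W) \<and> (\<forall>U\<in>insert W \<C>. \<forall>V\<in>insert W \<C>. nest s U V \<or> nest s V U)"
                using c(2) CW nest_refl[OF W] by blast
            qed
            ultimately show "card \<C> \<le> n" using finC by simp
          qed
        qed
        then show ?thesis unfolding Q_def by (auto intro: order_trans[OF card_insert_le_m1] simp: card_insert_if)
      qed
      have sub: "\<V> \<subseteq> (\<Union>T\<in>\<T>. Q T)"
      proof
        fix V' assume v: "V' \<in> \<V>"
        then have "V' \<in> Dm" "pnest s V' W" "\<not> close V' (3 * E) x y" using V rel by blast+
        then obtain T where T: "T \<in> \<T>" "nest s V' T" using t(4) by blast
        then have "V' \<in> Q T" using v by (auto simp: Q_def pnest_def)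
        then show "V' \<in> (\<Union>T\<in>\<T>. Q T)" using T by blast
      qed
      have finU: "finite (\<Union>T\<in>\<T>. Q T)" using t(1) Q by blast
      have "card \<V> \<le> card (\<Union>T\<in>\<T>. Q T)" by (rule card_mono[OF finU sub])
      also have "\<dots> \<le> (\<Sum>T\<in>\<T>. card (Q T))" by (rule card_UN_le[OF t(1)])
      also have "\<dots> \<le> (\<Sum>T\<in>\<T>. 1 + F)" by (rule sum_mono) (use Q in blast)
      also have "\<dots> = card \<T> * (1 + F)" by simp
      also have "\<dots> \<le> N * (1 + F)" using t(2) by (rule mult_le_mono1)
      finally show ?thesis using finite_subset[OF sub finU] by blast
    qed simp
  qed
qed

lemma card_relevant_domains:
  assumes C: "C \<ge> 0"
  shows "\<exists>F::nat. \<forall>W\<in>Dm. \<forall>x\<in>carrier J. \<forall>y\<in>carrier J. \<forall>\<V>\<subseteq>Dm.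
     (\<forall>V\<in>\<V>. pnest s V W \<and> \<not> close V (3 * E) x y) \<longrightarrow>
     (\<forall>V\<in>\<V>. \<forall>T\<in>Dm. pnest s V T \<and> nest s T W \<longrightarrow> close T C x y) \<longrightarrow> finite \<V> \<and> card \<V> \<le> F"
proof -
  have ch: "chains_below W (nat \<lfloor>E\<rfloor>)" for W
    unfolding chains_below_def using chain_card(2) by blast
  obtain F where F: "relevant_count C (nat \<lfloor>E\<rfloor>) F" using ex_relevant_count[OF C] by blast
  show ?thesis
    using F ch unfolding relevant_count_def by (intro exI[of _ F]) simp
qed

text \<open>Uniqueness bounds the displacement in the group, and conjugation by \<open>x\<close>
  moves the base point to the identity. Thus the size of one ball bounds the number for all
  \<open>x\<close> at once.\<close>

lemma card_small_displacement:
  "\<exists>N::nat. \<forall>x\<in>carrier J. \<forall>Z\<subseteq>carrier J. (\<forall>z\<in>Z. \<forall>V\<in>Dm. close V B x (z \<otimes> x)) \<longrightarrow> finite Z \<and> card Z \<le> N"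
proof -
  obtain \<theta> where \<theta>: "\<forall>x\<in>carrier J. \<forall>y\<in>carrier J. dT x y \<ge> \<theta> \<longrightarrow>
        (\<exists>V\<in>Dm. dist_in s V (P V x) (P V y) \<ge> B + 1)"
    using hhs_parts(9) unfolding hhs_uniqueness_def mspace_total by blast
  let ?S = "{g \<in> carrier J. dT \<one> (g \<otimes> \<one>) \<le> \<theta>}"
  have finS: "finite ?S" by (rule finite_ball) simp
  show ?thesis
  proof (intro exI[of _ "card ?S"] ballI allI impI)
    fix x Z assume x: "x \<in> carrier J" and Z: "Z \<subseteq> carrier J" and cl: "\<forall>z\<in>Z. \<forall>V\<in>Dm. close V B x (z \<otimes> x)"
    let ?f = "\<lambda>z. inv x \<otimes> z \<otimes> x"
    have "?f z \<in> ?S" if z: "z \<in> Z" for z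
    proof -
      have zc: "z \<in> carrier J" using z Z by blast
      have "\<not> dT x (z \<otimes> x) \<ge> \<theta>"
      proof
        assume "dT x (z \<otimes> x) \<ge> \<theta>"
        then obtain V where V: "V \<in> Dm" "dist_in s V (P V x) (P V (z \<otimes> x)) \<ge> B + 1" using \<theta> x zc by blast
        moreover have "dist_in s V (P V x) (P V (z \<otimes> x)) \<le> B"
          by (rule close_set_dist(2)) (use V cl x zc z in auto)
        ultimately show False by linarith
      qed
      moreover have "x \<otimes> ?f z = z \<otimes> x"
      proof -
        have "x \<otimes> ?f z = (x \<otimes> inv x) \<otimes> (z \<otimes> x)" using x zc by (simp only: m_assoc m_closed inv_closed)
        then show ?thesis using x zc by simp
      qed
      then have "dT x (z \<otimes> x) = dT \<one> (?f z)"
        using dT_left_invariant[of x \<one> "?f z"] x zc by simp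
      ultimately show ?thesis using x zc by simp
    qed
    moreover have "inj_on ?f Z"
    proof (rule inj_onI)
      fix z w assume "z \<in> Z" "w \<in> Z" and eq: "?f z = ?f w"
      then have c: "z \<in> carrier J" "w \<in> carrier J" using Z by auto
      have "x \<otimes> (inv x \<otimes> y \<otimes> x) \<otimes> inv x = y" if "y \<in> carrier J" for y
      proof -
        have "x \<otimes> (inv x \<otimes> y \<otimes> x) \<otimes> inv x = (x \<otimes> inv x) \<otimes> y \<otimes> (x \<otimes> inv x)"
          using x that by (simp only: m_assoc m_closed inv_closed)
        then show ?thesis using x that by simp
      qed
      then show "z = w" using eq c by metis
    qed
    ultimately show "finite Z \<and> card Z \<le> card ?S"
      using finS inj_on_finite[of ?f Z ?S] card_inj_on_le[of ?f Z ?S] by blast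
  qed
qed

text \<open>The standard product region of \<open>U\<close> in coordinates: those nested in or
  orthogonal to \<open>U\<close> are free, all others are prescribed by \<rho>.\<close>

definition in_product_region :: "'d \<Rightarrow> real \<Rightarrow> 'g \<Rightarrow> bool" where
  "in_product_region U B x \<longleftrightarrow> x \<in> carrier J \<and>
     (\<forall>W\<in>Dm. pnest s U W \<or> transverse s U W \<longrightarrow> near (Cs W) B (P W x) (rho s U W))"

lemma ex_in_product_region:
  assumes U: "U \<in> Dm"
  shows "\<exists>x. in_product_region U (3 * E) x"
proof -
  obtain p where p: "p \<in> P U \<one>" using ex_proj_point U by blast
  have "\<exists>x\<in>carrier J. \<forall>V\<in>{U}.
           dist_in s V (P V x) {(\<lambda>_. p) V} \<le> E \<and>
           (\<forall>W\<in>Dm. pnest s V W \<or> transverse s W V \<longrightarrow> dist_in s W (P W x) (rho s V W) \<le> E)"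
    using hhs_parts(8)[unfolded hhs_partial_realization_def mspace_total, rule_format, of "{U}" "\<lambda>_. p"] U p
    by auto
  then obtain x where x: "x \<in> carrier J"
    "\<And>W. W \<in> Dm \<Longrightarrow> pnest s U W \<or> transverse s W U \<Longrightarrow> dist_in s W (P W x) (rho s U W) \<le> E" by auto
  have "near (Cs W) (3 * E) (P W x) (rho s U W)" if W: "W \<in> Dm" "pnest s U W \<or> transverse s U W" for W
  proof -
    have "dist_in s W (P W x) (rho s U W) \<le> E" using x(2) W transverse_sym U by blast
    from near_rho_of_dist[OF x(1) U W(1) _ this] show ?thesis using W(2) by (auto elim: near_mono)
  qed
  then show ?thesis using x(1) by (auto simp: in_product_region_def)
qed

text \<open>In every domain neither nested in nor orthogonal to \<open>U\<close>, the coordinates of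
  \<open>x\<close> and \<open>z \<otimes> x\<close> are both near \<rho>, because \<open>z\<close>
  fixes \<open>U\<close>. The displacement is therefore controlled by the two factors.\<close>

lemma card_small_displacement_in_region:
  assumes U: "U \<in> Dm"
  shows "\<exists>N::nat. \<forall>x Z. in_product_region U B x \<longrightarrow> Z \<subseteq> carrier J \<longrightarrow>
    (\<forall>z\<in>Z. D z U = U \<and> (\<forall>V\<in>Dm. nest s V U \<or> orth s V U \<longrightarrow> close V B' x (z \<otimes> x))) \<longrightarrow> finite Z \<and> card Z \<le> N"
proof -
  obtain N where N: "\<forall>x\<in>carrier J. \<forall>Z\<subseteq>carrier J. (\<forall>z\<in>Z. \<forall>V\<in>Dm. close V (max B' (B + B)) x (z \<otimes> x)) \<longrightarrow>
     finite Z \<and> card Z \<le> (N::nat)"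
    using card_small_displacement[of "max B' (B + B)"] by (elim exE)
  show ?thesis
  proof (intro exI[of _ N] allI impI)
    fix x Z assume x: "in_product_region U B x" and Z: "Z \<subseteq> carrier J"
      and z: "\<forall>z\<in>Z. D z U = U \<and> (\<forall>V\<in>Dm. nest s V U \<or> orth s V U \<longrightarrow> close V B' x (z \<otimes> x))"
    have xc: "x \<in> carrier J" using x by (simp add: in_product_region_def)
    have cl: "close V (max B' (B + B)) x (w \<otimes> x)" if w: "w \<in> Z" and V: "V \<in> Dm" for w V
    proof (cases "nest s V U \<or> orth s V U")
      case True
      then show ?thesis using z w V by (meson close_mono max.cobounded1)
    next
      case False
      have wc: "w \<in> carrier J" "D w U = U" using w Z z by auto
      have rel: "pnest s U V \<or> transverse s U V"
        using False nest_refl[OF V] orth_sym[OF U V] unfolding pnest_def transverse_def by blast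
      let ?V = "D (inv w) V"
      have V': "?V \<in> Dm" "D w ?V = V" using D_closed D_inv(2) wc V by auto
      have rel': "pnest s U ?V \<or> transverse s U ?V"
        using rel pnest_act[OF wc(1) U V'(1)] transverse_act[OF wc(1) U V'(1)] wc(2) V'(2) by simp
      have n: "near (Cs V) B (P V x) (rho s U V)" using x V rel unfolding in_product_region_def by blast
      have "near (Cs ?V) B (P ?V x) (rho s U ?V)" using x V' rel' unfolding in_product_region_def by blast
      then have "near (Cs (D w ?V)) B (T w ?V ` P ?V x) (T w ?V ` rho s U ?V)"
        using near_isometry[OF T_isometry[OF wc(1) V'(1)] proj_subset[OF V'(1) xc] rho_subset[OF U V'(1)]] rel'
        by blast
      then have n': "near (Cs V) B (P V (w \<otimes> x)) (rho s U V)"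
        using proj_act[OF wc(1) V'(1) xc] rho_act[OF wc(1) U V'(1)] rel' V'(2) wc(2) by auto
      have "near (Cs V) (B + B) (P V x) (P V (w \<otimes> x))"
        by (rule near_trans[OF n near_sym[OF n']])
          (use rel rho_nonempty[OF U V] rho_subset[OF U V] proj_subset[OF V] xc wc in auto)
      then show ?thesis unfolding close_def by (rule near_mono) simp
    qed
    show "finite Z \<and> card Z \<le> N" by (rule N[rule_format, OF xc Z]) (rule cl)
  qed
qed

end

section \<open>Elements supported in a domain\<close>

context hhg_group
begin

text \<open>The form in which membership in \<open>factor_group\<close> enters: coordinates
  orthogonal to \<open>U\<close> are preserved exactly, not only coarsely, so the property is closed
  under products without any loss.\<close>

definition supported_in :: "'d \<Rightarrow> 'g \<Rightarrow> bool" where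
  "supported_in U z \<longleftrightarrow> z \<in> carrier J \<and> D z U = U \<and>
     (\<forall>V\<in>Dm. orth s V U \<longrightarrow> (\<forall>x\<in>carrier J. P V (z \<otimes> x) = P V x))"

definition trivial_below :: "'d \<Rightarrow> 'g \<Rightarrow> bool" where
  "trivial_below U z \<longleftrightarrow> z \<in> carrier J \<and>
     (\<forall>V\<in>Dm. nest s V U \<longrightarrow> (\<forall>x\<in>carrier J. P V (z \<otimes> x) = P V x))"

lemma supported_in_mult:
  "U \<in> Dm \<Longrightarrow> supported_in U z \<Longrightarrow> supported_in U w \<Longrightarrow> supported_in U (z \<otimes> w)"
  unfolding supported_in_def by (simp add: D_mult m_assoc)

lemma inv_same_proj:
  assumes "z \<in> carrier J" "\<forall>x\<in>carrier J. P V (z \<otimes> x) = P V x" "x \<in> carrier J"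
  shows "P V (inv z \<otimes> x) = P V x"
proof -
  have "P V (z \<otimes> (inv z \<otimes> x)) = P V (inv z \<otimes> x)" using assms by simp
  moreover have "z \<otimes> (inv z \<otimes> x) = x" using assms by (simp add: m_assoc[symmetric])
  ultimately show ?thesis by simp
qed

lemma supported_in_inv: "U \<in> Dm \<Longrightarrow> supported_in U z \<Longrightarrow> supported_in U (inv z)"
  unfolding supported_in_def using inv_same_proj D_inv_fix by simp

lemma supported_in_one: "U \<in> Dm \<Longrightarrow> supported_in U \<one>"
  unfolding supported_in_def by (simp add: D_one)

lemma supported_in_pow: "U \<in> Dm \<Longrightarrow> supported_in U z \<Longrightarrow> supported_in U (z [^] (n::nat))"
  by (induction n) (auto simp: supported_in_one supported_in_mult)

lemma supported_in_int_pow: "U \<in> Dm \<Longrightarrow> supported_in U z \<Longrightarrow> supported_in U (z [^] (n::int))"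
proof (cases n rule: int_cases2)
  case (nonneg k)
  then show "U \<in> Dm \<Longrightarrow> supported_in U z \<Longrightarrow> ?thesis" by (simp add: int_pow_int supported_in_pow)
next
  case (nonpos k)
  then show "U \<in> Dm \<Longrightarrow> supported_in U z \<Longrightarrow> ?thesis"
    using int_pow_neg_int[of z k] supported_in_inv[OF _ supported_in_pow, of U z k] by (auto simp: supported_in_def)
qed

lemma conj_same_proj:
  assumes c: "z \<in> carrier J" "t \<in> carrier J" "x \<in> carrier J" and V: "V \<in> Dm"
    and z: "\<forall>x\<in>carrier J. P (D (inv t) V) (z \<otimes> x) = P (D (inv t) V) x"
  shows "P V ((t \<otimes> z \<otimes> inv t) \<otimes> x) = P V x"
proof -
  let ?V = "D (inv t) V"
  have V': "?V \<in> Dm" "D t ?V = V" using V c D_closed D_inv(2) by auto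
  have "(t \<otimes> z \<otimes> inv t) \<otimes> x = t \<otimes> (z \<otimes> (inv t \<otimes> x))" using c by (simp add: m_assoc)
  then have "P V ((t \<otimes> z \<otimes> inv t) \<otimes> x) = T t ?V ` P ?V (z \<otimes> (inv t \<otimes> x))"
    using proj_act[OF c(2) V'(1), of "z \<otimes> (inv t \<otimes> x)"] V'(2) c by simp
  also have "\<dots> = T t ?V ` P ?V (inv t \<otimes> x)" using z c by simp
  also have "\<dots> = P V (t \<otimes> (inv t \<otimes> x))" using proj_act[OF c(2) V'(1), of "inv t \<otimes> x"] V'(2) c by simp
  also have "t \<otimes> (inv t \<otimes> x) = x" using c by (simp add: m_assoc[symmetric])
  finally show ?thesis .
qed

lemma supported_in_conj:
  assumes "U \<in> Dm" "supported_in U z" "t \<in> carrier J" "D t U = U"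
  shows "supported_in U (t \<otimes> z \<otimes> inv t)"
  unfolding supported_in_def
proof (intro conjI ballI impI)
  have z: "z \<in> carrier J" "D z U = U" using assms(2) by (auto simp: supported_in_def)
  show "t \<otimes> z \<otimes> inv t \<in> carrier J" using z assms by simp
  show "D (t \<otimes> z \<otimes> inv t) U = U" using z assms D_inv_fix by (simp add: D_mult)
  fix V x assume V: "V \<in> Dm" "orth s V U" and x: "x \<in> carrier J"
  have "orth s (D (inv t) V) (D (inv t) U)" using orth_act[of "inv t" V U] V assms by simp
  then have "orth s (D (inv t) V) U" using D_inv_fix assms by simp
  then show "P V ((t \<otimes> z \<otimes> inv t) \<otimes> x) = P V x"
    using conj_same_proj[OF z(1) assms(3) x V(1)] assms(2) D_closed[of "inv t" V] V assms(3)
    by (simp add: supported_in_def)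
qed

lemma trivial_below_conj:
  assumes "U \<in> Dm" "trivial_below U z" "t \<in> carrier J" "D t U = U"
  shows "trivial_below U (t \<otimes> z \<otimes> inv t)"
  unfolding trivial_below_def
proof (intro conjI ballI impI)
  have z: "z \<in> carrier J" using assms(2) by (auto simp: trivial_below_def)
  show "t \<otimes> z \<otimes> inv t \<in> carrier J" using z assms by simp
  fix V x assume V: "V \<in> Dm" "nest s V U" and x: "x \<in> carrier J"
  have "nest s (D (inv t) V) (D (inv t) U)" using nest_act[of "inv t" V U] V assms by simp
  then have "nest s (D (inv t) V) U" using D_inv_fix assms by simp
  then show "P V ((t \<otimes> z \<otimes> inv t) \<otimes> x) = P V x"
    using conj_same_proj[OF z assms(3) x V(1)] assms(2) D_closed[of "inv t" V] V assms(3)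
    by (simp add: trivial_below_def)
qed

lemma trivial_below_mult: "trivial_below U z \<Longrightarrow> trivial_below U w \<Longrightarrow> trivial_below U (z \<otimes> w)"
  unfolding trivial_below_def by (simp add: m_assoc)

lemma trivial_below_inv: "trivial_below U z \<Longrightarrow> trivial_below U (inv z)"
  unfolding trivial_below_def using inv_same_proj by simp

lemma trivial_below_one: "trivial_below U \<one>"
  unfolding trivial_below_def by simp

lemma supported_in_trivial_below:
  assumes "supported_in W z" "orth s U W" "U \<in> Dm" "W \<in> Dm"
  shows "trivial_below U z"
  unfolding trivial_below_def using assms orth_nest[OF assms(3) _ assms(4) _ assms(2)]
  by (auto simp: supported_in_def)

lemma close_same_proj: "V \<in> Dm \<Longrightarrow> x \<in> carrier J \<Longrightarrow> P V y = P V x \<Longrightarrow> close V E x y"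
  using close_refl[of V x] unfolding close_def by simp

lemma supported_in_close_orth:
  "supported_in U z \<Longrightarrow> V \<in> Dm \<Longrightarrow> orth s V U \<Longrightarrow> x \<in> carrier J \<Longrightarrow> close V E x (z \<otimes> x)"
  by (rule close_same_proj) (auto simp: supported_in_def)

text \<open>The elements \<open>h\<inverse> t\<^sup>k h t\<^sup>-\<^sup>k\<close> have support in \<open>U\<close> but act trivially on it, so they form a finite set.\<close>

lemma commute_with_factor:
  assumes U: "U \<in> Dm" and h: "supported_in U h" and q: "trivial_below U q"
    and t: "t \<in> carrier J" "D t U = U" "commute J t (h \<otimes> q)"
  shows "virt_commute J t h"
proof -
  have c: "h \<in> carrier J" "q \<in> carrier J" using h q by (auto simp: supported_in_def trivial_below_def)
  obtain x where x: "in_product_region U (3 * E) x" using ex_in_product_region[OF U] by blast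
  then have xc: "x \<in> carrier J" by (simp add: in_product_region_def)
  obtain N where N: "\<forall>x Z. in_product_region U (3 * E) x \<longrightarrow> Z \<subseteq> carrier J \<longrightarrow>
    (\<forall>z\<in>Z. D z U = U \<and> (\<forall>V\<in>Dm. nest s V U \<or> orth s V U \<longrightarrow> close V E x (z \<otimes> x))) \<longrightarrow> finite Z \<and> card Z \<le> (N::nat)"
    using card_small_displacement_in_region[OF U, of "3 * E" E] by (elim exE)
  define z where "z k = inv h \<otimes> (t [^] k \<otimes> h \<otimes> inv (t [^] k))" for k :: nat
  have z: "supported_in U (z k) \<and> trivial_below U (z k)" for k
  proof -
    let ?t = "t [^] k"
    have tk: "?t \<in> carrier J" "D ?t U = U" using t D_pow_fix U by auto
    have "supported_in U (z k)" unfolding z_def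
      by (intro supported_in_mult supported_in_inv supported_in_conj U h tk)
    \<comment> \<open>As \<open>t [^] k\<close> commutes with \<open>h \<otimes> q\<close>, the same
      element can be written in terms of \<open>q\<close> and its conjugate and is therefore trivial
      below \<open>U\<close>.\<close>
    moreover have "z k = q \<otimes> inv (?t \<otimes> q \<otimes> inv ?t)"
    proof -
      have "?t \<otimes> (h \<otimes> q) \<otimes> inv ?t = h \<otimes> q"
        by (rule conj_commute[OF commute_pow[OF t(3,1)]]) (use c t in auto)
      then have "(?t \<otimes> h \<otimes> inv ?t) \<otimes> (?t \<otimes> q \<otimes> inv ?t) = h \<otimes> q"
        using conj_mult[OF c tk(1)] by simp
      then have "?t \<otimes> h \<otimes> inv ?t = (h \<otimes> q) \<otimes> inv (?t \<otimes> q \<otimes> inv ?t)"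
        using c tk(1) inv_solve_right[of "?t \<otimes> h \<otimes> inv ?t" "h \<otimes> q" "?t \<otimes> q \<otimes> inv ?t"] by simp
      then have "z k = inv h \<otimes> ((h \<otimes> q) \<otimes> inv (?t \<otimes> q \<otimes> inv ?t))" by (simp only: z_def)
      also have "\<dots> = (inv h \<otimes> h) \<otimes> (q \<otimes> inv (?t \<otimes> q \<otimes> inv ?t))"
        using c tk(1) by (simp only: m_assoc m_closed inv_closed)
      finally show ?thesis using c tk(1) by simp
    qed
    moreover have "trivial_below U (q \<otimes> inv (?t \<otimes> q \<otimes> inv ?t))"
      by (intro trivial_below_mult trivial_below_inv trivial_below_conj U q tk)
    ultimately show ?thesis by simp
  qed
  have "finite (range z) \<and> card (range z) \<le> N"
  proof (rule N[rule_format, OF x])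
    show "range z \<subseteq> carrier J" using z by (auto simp: supported_in_def)
    fix w assume "w \<in> range z"
    then obtain k where k: "w = z k" by blast
    show "D w U = U \<and> (\<forall>V\<in>Dm. nest s V U \<or> orth s V U \<longrightarrow> close V E x (w \<otimes> x))"
      using z[of k] xc unfolding k supported_in_def trivial_below_def by (auto intro: close_same_proj)
  qed
  then have "\<not> inj z" using finite_imageD infinite_UNIV_nat by blast
  then obtain k l where kl: "k < l" "z k = z l" by (auto simp: inj_def) (metis nat_neq_iff)
  have "t [^] k \<otimes> h \<otimes> inv (t [^] k) = t [^] l \<otimes> h \<otimes> inv (t [^] l)"
  proof -
    have "h \<otimes> z i = t [^] i \<otimes> h \<otimes> inv (t [^] i)" for i
      unfolding z_def using c t by (simp add: m_assoc[symmetric])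
    then show ?thesis using kl(2) by metis
  qed
  then have "commute J (t [^] (l - k)) (h [^] (1::nat))"
    using conj_pow_eq_commute[OF c(1) t(1), of k l] kl(1) c by simp
  then show ?thesis unfolding virt_commute_def using kl(1) by (intro exI[of _ "l - k"] exI[of _ 1]) auto
qed

section \<open>Loxodromic elements\<close>

lemma T_fix:
  assumes "g \<in> carrier J" "U \<in> Dm" "D g U = U"
  shows "p \<in> mspace (Cs U) \<Longrightarrow> T g U p \<in> mspace (Cs U)"
    "p \<in> mspace (Cs U) \<Longrightarrow> q \<in> mspace (Cs U) \<Longrightarrow> mdist (Cs U) (T g U p) (T g U q) = mdist (Cs U) p q"
    "x \<in> carrier J \<Longrightarrow> T g U ` P U x = P U (g \<otimes> x)"
  using T_closed[OF assms(1,2), unfolded assms(3)] T_mdist[OF assms(1,2), unfolded assms(3)]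
    proj_act[OF assms(1,2), unfolded assms(3)] by blast+

lemma T_fix_mult:
  assumes "g \<in> carrier J" "h \<in> carrier J" "U \<in> Dm" "D h U = U" "p \<in> mspace (Cs U)"
  shows "T (g \<otimes> h) U p = T g U (T h U p)"
  using T_mult[OF assms(1-3,5)] assms(4) by simp

text \<open>For each \<open>j\<close> some power of \<open>h\<close> brings the image of
  \<open>p\<close> under \<open>e [^] j\<close> back near \<open>p\<close>, by
  \<open>commuting_displacement\<close>. The products \<open>z j\<close> commute with
  \<open>h\<close>, so they also move \<open>h [^] M \<otimes> x\<close> little, and every domain
  properly nested in \<open>U\<close> has its \<rho> far from one of these two points. This bounds
  the displacement on both factors of the product region, so two of the \<open>z j\<close>
  coincide.\<close>

lemma common_power_of_loxodromic:
  assumes U: "U \<in> Dm" and he: "supported_in U h" "supported_in U e" "commute J h e"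
    and x0: "in_product_region U (3 * E) x" and p: "p \<in> P U x"
    and qgeo: "\<And>n::nat. mdist (Cs U) p (T (h [^] (2 * n)) U p) \<ge> 2 * mdist (Cs U) p (T (h [^] n) U p) - C"
    and unb: "\<And>B. \<exists>n::nat. mdist (Cs U) p (T (h [^] n) U p) > B"
  shows "\<exists>(i::int) (j::int). j \<noteq> 0 \<and> h [^] i = e [^] j"
proof -
  let ?d = "mdist (Cs U)"
  have xc: "x \<in> carrier J" using x0 by (simp add: in_product_region_def)
  have hc: "h \<in> carrier J" "D h U = U" and ec: "e \<in> carrier J" "D e U = U"
    using he by (auto simp: supported_in_def)
  have pM: "p \<in> mspace (Cs U)" using proj_in[OF U xc p] .
  define \<tau> where "\<tau> g = T g U p" for g
  have fix_h: "h [^] n \<in> carrier J \<and> D (h [^] n) U = U" for n :: int using hc D_int_pow_fix U by simp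
  have fix_e: "e [^] n \<in> carrier J \<and> D (e [^] n) U = U" for n :: int using ec D_int_pow_fix U by simp
  have \<tau>M: "\<tau> g \<in> mspace (Cs U)" if "g \<in> carrier J" "D g U = U" for g
    unfolding \<tau>_def by (rule T_fix(1)[OF that(1) U that(2) pM])
  have \<tau>d: "?d (\<tau> (g \<otimes> k)) (\<tau> (g \<otimes> k')) = ?d (\<tau> k) (\<tau> k')"
    if "g \<in> carrier J" "D g U = U" "k \<in> carrier J" "D k U = U" "k' \<in> carrier J" "D k' U = U" for g k k'
    using T_fix(2)[OF that(1) U that(2) \<tau>M[OF that(3,4)] \<tau>M[OF that(5,6)]]
      T_fix_mult[OF that(1,3) U that(4) pM] T_fix_mult[OF that(1,5) U that(6) pM] unfolding \<tau>_def by simp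
  have \<tau>1: "\<tau> \<one> = p" unfolding \<tau>_def by (rule T_one[OF U pM])
  define b where "b n = ?d p (\<tau> (h [^] (n::nat)))" for n
  have b0: "b 0 = 0" using pM by (simp add: b_def \<tau>1)
  have bstep: "b (Suc n) \<le> b n + b 1" for n
  proof -
    have c: "h [^] n \<in> carrier J" "D (h [^] n) U = U" using hc D_pow_fix U by auto
    have c': "h [^] Suc n \<in> carrier J" "D (h [^] Suc n) U = U"
      using hc D_pow_fix[of h U "Suc n"] U by (auto simp del: nat_pow_Suc)
    have "?d (\<tau> (h [^] n \<otimes> \<one>)) (\<tau> (h [^] n \<otimes> h)) = ?d (\<tau> \<one>) (\<tau> h)"
      by (rule \<tau>d) (use c hc D_one U in auto)
    then have "?d (\<tau> (h [^] n)) (\<tau> (h [^] Suc n)) = b 1" using hc c \<tau>1 by (simp add: b_def)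
    then show ?thesis using mdist_triangle[OF pM \<tau>M[OF c] \<tau>M[OF c']] by (simp add: b_def)
  qed
  define C' where "C' = b 1 + C + 2 * (8 * E)"
  have ex_i: "\<exists>i::int. ?d p (\<tau> (h [^] i \<otimes> e [^] j)) \<le> C'" for j :: int
  proof -
    let ?w = "e [^] j"
    let ?W = "?d p (\<tau> ?w)"
    have w: "?w \<in> carrier J" "D ?w U = U" using fix_e by auto
    \<comment> \<open>The first time at which the orbit of \<open>h\<close> is as far from
      \<open>p\<close> as \<open>e [^] j\<close> moves it; a single step overshoots by at most
      \<open>b 1\<close>.\<close>
    define n where "n = (LEAST n. b n \<ge> ?W)"
    obtain n0 where "b n0 > ?W" using unb[of ?W] by (auto simp: b_def \<tau>_def)
    then have n: "b n \<ge> ?W" unfolding n_def by (intro LeastI[of "\<lambda>n. b n \<ge> ?W" n0]) simp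
    have bn: "b n \<le> ?W + b 1"
    proof (cases n)
      case 0
      then show ?thesis using b0 by (simp add: b_def)
    next
      case (Suc m)
      then have "\<not> b m \<ge> ?W" using not_less_Least[of m "\<lambda>n. b n \<ge> ?W"] by (simp add: n_def)
      then show ?thesis using bstep[of m] Suc by simp
    qed
    let ?n = "int n"
    have hn: "h [^] ?n = h [^] n" by (rule int_pow_int)
    have g: "h [^] ?n \<in> carrier J" "D (h [^] ?n) U = U" "h [^] (-?n) \<in> carrier J" "D (h [^] (-?n)) U = U"
      using fix_h by auto
    have cancel: "h [^] (-?n) \<otimes> h [^] ?n = \<one>" "h [^] ?n \<otimes> h [^] (-?n) = \<one>"
      using int_pow_mult[OF hc(1), of "-?n" ?n] int_pow_mult[OF hc(1), of ?n "-?n"] by simp_all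
    have v: "h [^] ?n \<otimes> ?w \<in> carrier J" "D (h [^] ?n \<otimes> ?w) U = U" using g w by (auto simp: D_mult U)
    have v': "h [^] (-?n) \<otimes> ?w \<in> carrier J" "D (h [^] (-?n) \<otimes> ?w) U = U" using g w by (auto simp: D_mult U)
    have com: "h [^] ?n \<otimes> ?w = ?w \<otimes> h [^] ?n"
    proof -
      have "commute J (e [^] j) h" by (rule commute_int_pow[OF commute_sym[OF he(3)] ec(1) hc(1)])
      then have "commute J (h [^] ?n) (e [^] j)" by (rule commute_int_pow[OF commute_sym hc(1) w(1)])
      then show ?thesis by (simp add: commute_def)
    qed
    have iso1: "?d p (\<tau> (h [^] (-?n))) = ?d p (\<tau> (h [^] ?n))"
      using \<tau>d[OF g(1,2), of \<one> "h [^] (-?n)"] g cancel D_one U \<tau>1 by (simp add: mdist_commute)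
    have iso2: "?d (\<tau> (h [^] ?n)) (\<tau> (h [^] ?n \<otimes> ?w)) = ?d p (\<tau> ?w)"
      using \<tau>d[OF g(1,2), of \<one> ?w] g w D_one U \<tau>1 by simp
    have iso3: "?d (\<tau> ?w) (\<tau> (h [^] ?n \<otimes> ?w)) = ?d p (\<tau> (h [^] ?n))"
      using \<tau>d[OF w, of \<one> "h [^] ?n"] g w D_one U \<tau>1 com by simp
    have iso4: "?d p (\<tau> (h [^] ?n \<otimes> ?w)) = ?d (\<tau> (h [^] (-?n))) (\<tau> ?w)"
    proof -
      have "h [^] ?n \<otimes> (h [^] (-?n)) = \<one>" using cancel by simp
      then show ?thesis using \<tau>d[OF g(1,2) g(3,4) w] \<tau>1 by simp
    qed
    have iso5: "?d (\<tau> (h [^] ?n)) (\<tau> ?w) = ?d p (\<tau> (h [^] (-?n) \<otimes> ?w))"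
      using \<tau>d[OF g(3,4) g(1,2) w] cancel \<tau>1 by simp
    have qg: "?d (\<tau> (h [^] (-?n))) (\<tau> (h [^] ?n)) \<ge> 2 * ?d p (\<tau> (h [^] ?n)) - C"
    proof -
      have "?d (\<tau> (h [^] (-?n))) (\<tau> (h [^] ?n)) = ?d (\<tau> (h [^] ?n \<otimes> h [^] (-?n))) (\<tau> (h [^] ?n \<otimes> h [^] ?n))"
        by (rule \<tau>d[symmetric]) (use g in auto)
      also have "h [^] ?n \<otimes> h [^] (-?n) = \<one>" by (rule cancel(2))
      also have "h [^] ?n \<otimes> h [^] ?n = h [^] (2 * n)"
        unfolding hn using nat_pow_mult[OF hc(1), of n n] unfolding mult_2 .
      also have "\<tau> \<one> = p" by (rule \<tau>1)
      finally show ?thesis using qgeo[of n] hn unfolding \<tau>_def by simp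
    qed
    have "min (?d (\<tau> (h [^] ?n)) (\<tau> ?w)) (?d p (\<tau> (h [^] ?n \<otimes> ?w)))
      \<le> \<bar>?d p (\<tau> (h [^] ?n)) - ?d p (\<tau> ?w)\<bar> + C + 2 * (8 * E)"
      by (rule commuting_displacement[OF cspace_four_point[OF U] pM \<tau>M[OF g(1,2)] \<tau>M[OF g(3,4)] \<tau>M[OF w] \<tau>M[OF v] iso1 iso2 iso3 iso4 qg])
    moreover have "\<bar>?d p (\<tau> (h [^] ?n)) - ?d p (\<tau> ?w)\<bar> \<le> b 1" using n bn hn by (simp add: b_def)
    ultimately have "min (?d p (\<tau> (h [^] (-?n) \<otimes> ?w))) (?d p (\<tau> (h [^] ?n \<otimes> ?w))) \<le> C'"
      unfolding iso5 C'_def by linarith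
    \<comment> \<open>Which of the exponents \<open>n\<close> and \<open>-n\<close> works depends on
      the direction of \<open>e [^] j\<close> relative to \<open>h\<close>.\<close>
    then show ?thesis by (metis min_le_iff_disj)
  qed
  then obtain i where i: "\<And>j. ?d p (\<tau> (h [^] (i j :: int) \<otimes> e [^] (j :: int))) \<le> C'" by metis
  define z where "z j = h [^] i j \<otimes> e [^] j" for j
  have zs: "supported_in U (z j)" for j
    unfolding z_def by (intro supported_in_mult supported_in_int_pow U he)
  have zc: "z j \<in> carrier J" "D (z j) U = U" for j using zs[of j] by (auto simp: supported_in_def)
  have zh: "commute J (z j) h" for j
  proof -
    have "commute J (h [^] i j) h" using commute_self_pow[OF hc(1), of "i j" 1] hc by simp
    moreover have "commute J (e [^] j) h" by (rule commute_int_pow[OF commute_sym[OF he(3)] ec(1) hc(1)])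
    ultimately show ?thesis unfolding z_def by (rule commute_mult) (use hc fix_h fix_e in auto)
  qed
  define C1 where "C1 = C' + 2 * E"
  have clU: "close U C1 x (z j \<otimes> x)" for j
    unfolding close_def near_def
  proof (intro ballI)
    fix a b assume a: "a \<in> P U x" and b: "b \<in> P U (z j \<otimes> x)"
    have t: "\<tau> (z j) \<in> P U (z j \<otimes> x)" using T_fix(3)[OF zc(1) U zc(2) xc] p unfolding \<tau>_def by blast
    have "?d a p \<le> E" "?d (\<tau> (z j)) b \<le> E"
      using closeD[OF close_refl[OF U xc] a p] closeD[OF close_refl[OF U] t b] xc zc by auto
    moreover have "?d p (\<tau> (z j)) \<le> C'" using i[of j] by (simp add: z_def)
    moreover have bM: "b \<in> mspace (Cs U)" by (rule proj_in[OF U _ b]) (use xc zc in auto)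
    moreover have "?d a b \<le> ?d a p + ?d p b" by (rule mdist_triangle[OF proj_in[OF U xc a] pM bM])
    moreover have "?d p b \<le> ?d p (\<tau> (z j)) + ?d (\<tau> (z j)) b" by (rule mdist_triangle[OF pM \<tau>M[OF zc] bM])
    ultimately show "?d a b \<le> C1" by (simp add: C1_def)
  qed
  \<comment> \<open>A point within \<open>C1 + 3 * E\<close> of \<open>p\<close> is then farther
    than \<open>C1 + 3 * E\<close> from the image of \<open>p\<close> under \<open>h [^] M\<close>,
    so \<open>far_close\<close> applies at one of the two points.\<close>
  obtain M :: nat where M: "?d p (\<tau> (h [^] M)) > 2 * C1 + 6 * E" using unb by (auto simp: \<tau>_def)
  have hM: "h [^] M \<in> carrier J" "D (h [^] M) U = U" using hc D_pow_fix U by auto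
  define L where "L = E * dT x (h [^] M \<otimes> x) + 3 * E"
  have L0: "L \<ge> 0" using E_ge_1 by (simp add: L_def)
  have C10: "C1 \<ge> 0" by (rule close_nonneg[OF clU[of 0] U xc]) (use xc zc in auto)
  \<comment> \<open>\<open>L\<close> is the cost of passing between \<open>x\<close> and
    \<open>h [^] M \<otimes> x\<close>, and it is paid once before and once after applying
    \<open>z j\<close>.\<close>
  define B' where "B' = C1 + L + 3 * E + L"
  have cl: "close V B' x (z j \<otimes> x)" if V: "V \<in> Dm" "nest s V U \<or> orth s V U" for V j
  proof (cases "orth s V U")
    case True
    show ?thesis
      by (rule close_mono[OF supported_in_close_orth[OF zs V(1) True xc]])
        (use L0 C10 E_ge_1 in \<open>simp add: B'_def\<close>)
  next
    case False
    show ?thesis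
    proof (cases "V = U")
      case True
      show ?thesis unfolding True
        by (rule close_mono[OF clU[of j]]) (use L0 E_ge_1 in \<open>simp add: B'_def\<close>)
    next
      case False
      then have VU: "pnest s V U" using V \<open>\<not> orth s V U\<close> by (simp add: pnest_def)
      obtain r where r: "r \<in> rho s V U" using rho_nonempty[OF V(1) U] VU by blast
      have rM: "r \<in> mspace (Cs U)" using rho_in[OF V(1) U _ r] VU by blast
      show ?thesis
      proof (cases "?d p r > C1 + 3 * E")
        case True
        have "close V (3 * E) x (z j \<otimes> x)"
          by (rule far_close[OF V(1) U VU xc _ clU p r True]) (use zc xc in auto)
        then show ?thesis by (rule close_mono) (use L0 C10 in \<open>simp add: B'_def\<close>)
      next
        case False
        let ?q = "\<tau> (h [^] M)" and ?y = "h [^] M \<otimes> x"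
        have q: "?q \<in> P U ?y" using T_fix(3)[OF hM(1) U hM(2) xc] p unfolding \<tau>_def by blast
        have "?d p ?q \<le> ?d p r + ?d r ?q" using mdist_triangle[OF pM rM \<tau>M[OF hM]] .
        then have far: "?d ?q r > C1 + 3 * E" using M False by (simp add: mdist_commute)
        have com: "h [^] M \<otimes> (z j \<otimes> x) = z j \<otimes> ?y"
        proof -
          have "commute J (h [^] M) (z j)" by (rule commute_pow[OF commute_sym[OF zh] hc(1) zc(1)])
          then show ?thesis using hM zc xc by (simp add: commute_def m_assoc[symmetric])
        qed
        have clM: "close U C1 ?y (z j \<otimes> ?y)"
          using close_act[OF hM(1) U xc, of "z j \<otimes> x" C1] clU[of j] hM(2) com xc zc by simp
        have 1: "close V (3 * E) ?y (z j \<otimes> ?y)"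
          by (rule far_close[OF V(1) U VU _ _ clM q r far]) (use hM zc xc in auto)
        have 2: "close V L x ?y" unfolding L_def by (rule close_lipschitz) (use V hM xc in auto)
        have 3: "close V L (z j \<otimes> ?y) (z j \<otimes> x)"
        proof -
          have "close V (E * dT (z j \<otimes> x) (z j \<otimes> ?y) + 3 * E) (z j \<otimes> x) (z j \<otimes> ?y)"
            by (rule close_lipschitz) (use V hM zc xc in auto)
          moreover have "dT (z j \<otimes> x) (z j \<otimes> ?y) = dT x ?y" by (rule dT_left_invariant) (use hM zc xc in auto)
          ultimately show ?thesis unfolding L_def by (metis close_sym)
        qed
        have "close V (L + 3 * E + L) x (z j \<otimes> x)"
          by (rule close_trans[OF close_trans[OF 2 1] 3]) (use V hM zc xc in auto)
        then show ?thesis by (rule close_mono) (use C10 in \<open>simp add: B'_def\<close>)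
      qed
    qed
  qed
  obtain N where N: "\<forall>x Z. in_product_region U (3 * E) x \<longrightarrow> Z \<subseteq> carrier J \<longrightarrow>
    (\<forall>z\<in>Z. D z U = U \<and> (\<forall>V\<in>Dm. nest s V U \<or> orth s V U \<longrightarrow> close V B' x (z \<otimes> x))) \<longrightarrow> finite Z \<and> card Z \<le> (N::nat)"
    using card_small_displacement_in_region[OF U, of "3 * E" B'] by (elim exE)
  have "finite (range z) \<and> card (range z) \<le> N"
    by (rule N[rule_format, OF x0]) (use zc cl in blast)+
  then have "\<not> inj z" using finite_imageD infinite_UNIV_int by blast
  then obtain j k where jk: "j \<noteq> k" "z j = z k" by (auto simp: inj_def)
  have "h [^] (i j - i k) = e [^] (k - j)"
  proof -
    have "h [^] i j \<otimes> e [^] j = h [^] i k \<otimes> e [^] k" using jk(2) by (simp add: z_def)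
    then have "h [^] (- i k) \<otimes> (h [^] i j \<otimes> e [^] j) \<otimes> e [^] (- j) = h [^] (- i k) \<otimes> (h [^] i k \<otimes> e [^] k) \<otimes> e [^] (- j)"
      by simp
    moreover have "h [^] (- i k) \<otimes> (h [^] m \<otimes> e [^] n) \<otimes> e [^] (- j) = h [^] (- i k + m) \<otimes> e [^] (n - j)" for m n
    proof -
      have "h [^] (- i k) \<otimes> (h [^] m \<otimes> e [^] n) \<otimes> e [^] (- j) = (h [^] (- i k) \<otimes> h [^] m) \<otimes> (e [^] n \<otimes> e [^] (- j))"
        using hc ec by (simp only: m_assoc m_closed int_pow_closed)
      then show ?thesis using int_pow_mult[OF hc(1), of "- i k" m] int_pow_mult[OF ec(1), of n "- j"] by simp
    qed
    ultimately have "h [^] (- i k + i j) \<otimes> e [^] (0::int) = h [^] (0::int) \<otimes> e [^] (k - j)" by simp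
    then show ?thesis using hc ec by (simp add: add.commute)
  qed
  then show ?thesis using jk(1) by (intro exI[of _ "i j - i k"] exI[of _ "k - j"]) auto
qed

end

section \<open>Elements moving three aligned points little\<close>

context hhg_group
begin

text \<open>The points will be lifts, with error \<open>2 * E\<close>, of points spaced
  \<open>200 * E\<close> along a geodesic: each distance is off by at most \<open>4 * E\<close>, and
  three of them give the defect \<open>12 * E\<close>.\<close>

definition aligned :: "'d \<Rightarrow> 'g \<Rightarrow> 'g \<Rightarrow> 'g \<Rightarrow> bool" where
  "aligned U x q y \<longleftrightarrow> x \<in> carrier J \<and> q \<in> carrier J \<and> y \<in> carrier J \<and>
     (\<forall>a\<in>P U x. \<forall>b\<in>P U q. \<forall>c\<in>P U y.
        mdist (Cs U) a b \<ge> 196 * E \<and> mdist (Cs U) b c \<ge> 196 * E \<and>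
        mdist (Cs U) a b + mdist (Cs U) b c \<le> mdist (Cs U) a c + 12 * E)"

text \<open>The points of the geodesic will be moved at most \<open>24 * E\<close>; the lift adds
  \<open>2 * E\<close> before and after.\<close>

definition moves_little :: "'d \<Rightarrow> 'g \<Rightarrow> 'g \<Rightarrow> 'g \<Rightarrow> 'g \<Rightarrow> bool" where
  "moves_little U g x q y \<longleftrightarrow> g \<in> carrier J \<and> D g U = U \<and>
     close U (28 * E) x (g \<otimes> x) \<and> close U (28 * E) q (g \<otimes> q) \<and> close U (28 * E) y (g \<otimes> y)"

lemma aligned_sym:
  assumes "aligned U x q y" shows "aligned U y q x"
  unfolding aligned_def
proof (intro conjI ballI)
  fix a b c assume "a \<in> P U y" "b \<in> P U q" "c \<in> P U x"
  then have "mdist (Cs U) c b \<ge> 196 * E" "mdist (Cs U) b a \<ge> 196 * E"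
    "mdist (Cs U) c b + mdist (Cs U) b a \<le> mdist (Cs U) c a + 12 * E"
    using assms unfolding aligned_def by blast+
  moreover have "mdist (Cs U) c b = mdist (Cs U) b c" "mdist (Cs U) b a = mdist (Cs U) a b"
    "mdist (Cs U) c a = mdist (Cs U) a c" by (rule mdist_commute)+
  ultimately show "mdist (Cs U) a b \<ge> 196 * E" "mdist (Cs U) b c \<ge> 196 * E"
    "mdist (Cs U) a b + mdist (Cs U) b c \<le> mdist (Cs U) a c + 12 * E" by linarith+
qed (use assms in \<open>auto simp: aligned_def\<close>)

lemma moves_little_sym: "moves_little U g x q y \<Longrightarrow> moves_little U g y q x"
  unfolding moves_little_def by blast

text \<open>A \<rho> within \<open>100 * E\<close> of the middle is at least \<open>96 * E\<close>
  away from the end, beyond the \<open>28 * E + 3 * E\<close> that \<open>far_close\<close>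
  requires.\<close>

lemma near_middle_close_end:
  assumes U: "U \<in> Dm" and al: "aligned U x q y" and mv: "moves_little U g x q y"
    and W: "W \<in> Dm" "pnest s W U" and br: "b \<in> P U q" "r \<in> rho s W U" "mdist (Cs U) b r \<le> 100 * E"
  shows "close W (3 * E) x (g \<otimes> x)"
proof -
  have c: "x \<in> carrier J" "q \<in> carrier J" "y \<in> carrier J" "g \<in> carrier J"
    using al mv by (auto simp: aligned_def moves_little_def)
  obtain a where a: "a \<in> P U x" using ex_proj_point U c by blast
  obtain c' where c': "c' \<in> P U y" using ex_proj_point U c by blast
  have M: "a \<in> mspace (Cs U)" "b \<in> mspace (Cs U)" "r \<in> mspace (Cs U)"
    using proj_in[OF U c(1) a] proj_in[OF U c(2) br(1)] rho_in[OF W(1) U _ br(2)] W(2) by auto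
  have "mdist (Cs U) a b \<ge> 196 * E" using al a br(1) c' unfolding aligned_def by blast
  moreover have "mdist (Cs U) a b \<le> mdist (Cs U) a r + mdist (Cs U) r b" by (rule mdist_triangle[OF M(1,3,2)])
  ultimately have "mdist (Cs U) a r > 28 * E + 3 * E" using br(3) E_ge_1 by (simp add: mdist_commute)
  moreover have "close U (28 * E) x (g \<otimes> x)" using mv by (simp add: moves_little_def)
  ultimately show ?thesis using far_close[OF W(1) U W(2) c(1) _ _ a br(2)] c by simp
qed

lemma near_middle_close_ends:
  assumes U: "U \<in> Dm" and al: "aligned U x q y" and mv: "moves_little U g x q y"
    and W: "W \<in> Dm" "pnest s W U" and br: "b \<in> P U q" "r \<in> rho s W U" "mdist (Cs U) b r \<le> 100 * E"
  shows "close W (3 * E) x (g \<otimes> x)" "close W (3 * E) y (g \<otimes> y)"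
  by (rule near_middle_close_end[OF assms],
      rule near_middle_close_end[OF U aligned_sym[OF al] moves_little_sym[OF mv] W br])

text \<open>Otherwise the geodesics from the middle to both ends pass within \<open>3 * E\<close> of
  \<rho>. By alignment the way between the ends cannot be shortened much there, so both passages are
  near the middle: twice the distance to \<rho> is at most
  \<open>12 * E + 6 * E + 6 * E\<close>.\<close>

lemma far_from_middle_close:
  assumes U: "U \<in> Dm" and al: "aligned U x q y"
    and W: "W \<in> Dm" "pnest s W U" and br: "b \<in> P U q" "r \<in> rho s W U" "mdist (Cs U) b r > 12 * E"
  shows "close W (3 * E) q x \<or> close W (3 * E) q y"
proof (rule ccontr)
  assume no: "\<not> ?thesis"
  let ?d = "mdist (Cs U)"
  have c: "x \<in> carrier J" "q \<in> carrier J" "y \<in> carrier J" using al by (auto simp: aligned_def)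
  obtain a where a: "a \<in> P U x" using ex_proj_point U c by blast
  obtain c' where c': "c' \<in> P U y" using ex_proj_point U c by blast
  have M: "a \<in> mspace (Cs U)" "b \<in> mspace (Cs U)" "c' \<in> mspace (Cs U)" "r \<in> mspace (Cs U)"
    using proj_in[OF U c(1) a] proj_in[OF U c(2) br(1)] proj_in[OF U c(3) c'] rho_in[OF W(1) U _ br(2)] W(2) by auto
  obtain u where u: "u \<in> mspace (Cs U)" "?d b u + ?d u a = ?d b a" "?d u r \<le> 3 * E"
    using bounded_geodesic_image[OF W(1) U W(2) c(2,1) br(1) a] no br(2) by blast
  obtain v where v: "v \<in> mspace (Cs U)" "?d b v + ?d v c' = ?d b c'" "?d v r \<le> 3 * E"
    using bounded_geodesic_image[OF W(1) U W(2) c(2,3) br(1) c'] no br(2) by blast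
  have "?d a b + ?d b c' \<le> ?d a c' + 12 * E" using al a br(1) c' unfolding aligned_def by blast
  moreover have "?d a c' \<le> ?d a u + ?d u c'" by (rule mdist_triangle[OF M(1) u(1) M(3)])
  moreover have "?d u c' \<le> ?d u v + ?d v c'" by (rule mdist_triangle[OF u(1) v(1) M(3)])
  moreover have "?d u v \<le> ?d u r + ?d r v" by (rule mdist_triangle[OF u(1) M(4) v(1)])
  moreover have "?d b r \<le> ?d b u + ?d u r" by (rule mdist_triangle[OF M(2) u(1) M(4)])
  moreover have "?d b r \<le> ?d b v + ?d v r" by (rule mdist_triangle[OF M(2) v(1) M(4)])
  moreover have "?d r v = ?d v r" "?d a u = ?d u a" "?d b a = ?d a b" by (rule mdist_commute)+
  ultimately show False using u v br(3) by linarith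
qed

lemma rho_near_moved:
  assumes U: "U \<in> Dm" and q: "q \<in> carrier J" and g: "g \<in> carrier J" "D g U = U" "close U (28 * E) q (g \<otimes> q)"
    and V: "V \<in> Dm" "pnest s V U" and br: "b0 \<in> P U q" "r \<in> rho s V U" "mdist (Cs U) b0 r \<le> B" and b: "b \<in> P U q"
  shows "\<exists>r'\<in>rho s (D g V) U. mdist (Cs U) b r' \<le> B + 28 * E"
proof -
  have b0M: "b0 \<in> mspace (Cs U)" "b \<in> mspace (Cs U)" using proj_in[OF U q] br(1) b by auto
  have rM: "r \<in> mspace (Cs U)" using rho_in[OF V(1) U _ br(2)] V(2) by blast
  have "T g U ` rho s V U = rho s (D g V) U" using rho_act[OF g(1) V(1) U] V(2) g(2) by simp
  then have r': "T g U r \<in> rho s (D g V) U" using br(2) by blast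
  have "T g U b0 \<in> P U (g \<otimes> q)" using T_fix(3)[OF g(1) U g(2) q] br(1) by blast
  then have "mdist (Cs U) b (T g U b0) \<le> 28 * E" using closeD[OF g(3) b] by blast
  moreover have "mdist (Cs U) (T g U b0) (T g U r) = mdist (Cs U) b0 r" by (rule T_fix(2)[OF g(1) U g(2) b0M(1) rM])
  moreover have "mdist (Cs U) b (T g U r) \<le> mdist (Cs U) b (T g U b0) + mdist (Cs U) (T g U b0) (T g U r)"
    by (rule mdist_triangle[OF b0M(2) T_fix(1)[OF g(1) U g(2) b0M(1)] T_fix(1)[OF g(1) U g(2) rM]])
  ultimately show ?thesis using r' br(3) by force
qed

text \<open>
  A relevant domain near the middle point has, after passing to a maximal one, only boundedly many
  translates by elements that move the three points little.
\<close>

lemma relevant_middle_domain: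
  assumes U: "U \<in> Dm" and R2: "R2 \<ge> 0"
  shows "\<exists>F::nat. \<forall>x q y V0 h. aligned U x q y \<longrightarrow> close U R2 x y \<longrightarrow> V0 \<in> Dm \<longrightarrow> pnest s V0 U \<longrightarrow>
    (\<exists>b\<in>P U q. \<exists>r\<in>rho s V0 U. mdist (Cs U) b r \<le> 42 * E) \<longrightarrow> \<not> close V0 (9 * E) x y \<longrightarrow>
    h \<in> carrier J \<longrightarrow> (\<forall>j\<le>F. moves_little U (h [^] j) x q y) \<longrightarrow>
    (\<exists>j::nat. \<exists>V\<in>Dm. j > 0 \<and> pnest s V U \<and> D (h [^] j) V = V)"
proof -
  \<comment> \<open>\<open>R2\<close> is for \<open>U\<close> itself; a domain strictly between has
    \<open>9 * E\<close> by maximality and loses \<open>3 * E\<close> at each end.\<close>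
  define C where "C = max R2 (15 * E)"
  have C0: "C \<ge> 0" using R2 by (simp add: C_def)
  obtain F where F: "\<forall>W\<in>Dm. \<forall>x\<in>carrier J. \<forall>y\<in>carrier J. \<forall>\<V>\<subseteq>Dm.
     (\<forall>V\<in>\<V>. pnest s V W \<and> \<not> close V (3 * E) x y) \<longrightarrow>
     (\<forall>V\<in>\<V>. \<forall>T\<in>Dm. pnest s V T \<and> nest s T W \<longrightarrow> close T C x y) \<longrightarrow> finite \<V> \<and> card \<V> \<le> (F::nat)"
    using card_relevant_domains[OF C0] by (elim exE)
  show ?thesis
  proof (rule exI[of _ F], intro allI impI)
    fix x q y V0 h
    assume al: "aligned U x q y" and cl: "close U R2 x y" and V0: "V0 \<in> Dm" "pnest s V0 U"
      and br: "\<exists>b\<in>P U q. \<exists>r\<in>rho s V0 U. mdist (Cs U) b r \<le> 42 * E" and rel: "\<not> close V0 (9 * E) x y"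
      and h: "h \<in> carrier J" and mv: "\<forall>j\<le>F. moves_little U (h [^] j) x q y"
    have c: "x \<in> carrier J" "q \<in> carrier J" "y \<in> carrier J" using al by (auto simp: aligned_def)
    let ?S = "{V \<in> Dm. nest s V0 V \<and> pnest s V U \<and> \<not> close V (9 * E) x y}"
    have "?S \<subseteq> Dm" "?S \<noteq> {}" using V0 rel nest_refl by blast+
    \<comment> \<open>Maximality makes \<open>x\<close> and \<open>y\<close> close in all domains
      properly between \<open>V\<close> and \<open>U\<close>, which is the hypothesis under which
      relevant domains can be counted.\<close>
    then obtain V where V: "V \<in> ?S" "\<forall>V'\<in>?S. \<not> pnest s V V'"
      using ex_extremal[of ?S "pnest s"] by blast
    then have V1: "V \<in> Dm" "nest s V0 V" "pnest s V U" "\<not> close V (9 * E) x y" by auto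
    obtain b0 r0 where b0: "b0 \<in> P U q" "r0 \<in> rho s V0 U" "mdist (Cs U) b0 r0 \<le> 42 * E" using br by blast
    have "\<exists>r\<in>rho s V U. mdist (Cs U) b0 r \<le> 45 * E"
    proof (cases "V = V0")
      case True
      then show ?thesis using b0(2,3) E_ge_1 by (intro bexI[of _ r0]) auto
    next
      case False
      then have nr: "near (Cs U) (3 * E) (rho s V0 U) (rho s V U)"
        using near_rho_nested[OF V0(1) V1(1) U] V1 by (simp add: pnest_def)
      obtain r where r: "r \<in> rho s V U" using rho_nonempty[OF V1(1) U] V1 by blast
      have "mdist (Cs U) r0 r \<le> 3 * E" by (rule nearD[OF nr b0(2) r])
      moreover have "mdist (Cs U) b0 r \<le> mdist (Cs U) b0 r0 + mdist (Cs U) r0 r"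
        by (rule mdist_triangle) (use proj_in[OF U c(2) b0(1)] rho_in[OF V0(1) U _ b0(2)] rho_in[OF V1(1) U _ r] V0 V1 in auto)
      ultimately show ?thesis using r b0(3) by (intro bexI[of _ r]) auto
    qed
    then obtain r where r: "r \<in> rho s V U" "mdist (Cs U) b0 r \<le> 45 * E" by blast
    define W where "W j = D (h [^] j) V" for j :: nat
    have mvj: "h [^] j \<in> carrier J" "D (h [^] j) U = U" "moves_little U (h [^] j) x q y"
      "close U (28 * E) q (h [^] j \<otimes> q)" if "j \<le> F" for j :: nat
      using mv that unfolding moves_little_def by blast+
    have W: "W j \<in> Dm" "pnest s (W j) U" if j: "j \<le> F" for j
      using D_closed[OF mvj(1)[OF j] V1(1)] pnest_act[OF mvj(1)[OF j] V1(1) U] V1(3) mvj(2)[OF j] by (auto simp: W_def)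
    have Wr: "\<exists>r'\<in>rho s (W j) U. mdist (Cs U) b0 r' \<le> 73 * E" if j: "j \<le> F" for j
      using rho_near_moved[OF U c(2) mvj(1,2,4)[OF j] V1(1,3) b0(1) r b0(1)] by (simp add: W_def)
    have moved: "close T B x y" if m: "close T B' (h [^] j \<otimes> x) (h [^] j \<otimes> y)" "B' + 6 * E \<le> B" "j \<le> F"
      "T \<in> Dm" "pnest s T U" "\<exists>r'\<in>rho s T U. mdist (Cs U) b0 r' \<le> 100 * E" for T j B B'
    proof -
      obtain r' where r': "r' \<in> rho s T U" "mdist (Cs U) b0 r' \<le> 100 * E" using m(6) by blast
      note ends = near_middle_close_ends[OF U al mvj(3)[OF m(3)] m(4,5) b0(1) r']
      have "close T (3 * E + B' + 3 * E) x y"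
        by (rule close_trans[OF close_trans[OF ends(1) m(1)] close_sym[OF ends(2)]]) (use m(4) mvj(1)[OF m(3)] c in auto)
      then show ?thesis by (rule close_mono) (use m(2) in simp)
    qed
    \<comment> \<open>Near the middle both ends are moved at most \<open>3 * E\<close>, so the
      threshold \<open>9 * E\<close> for \<open>V\<close> leaves \<open>3 * E\<close> for its
      translates.\<close>
    have Wrel: "\<not> close (W j) (3 * E) x y" if j: "j \<le> F" for j
    proof
      assume cw: "close (W j) (3 * E) x y"
      obtain r' where "r' \<in> rho s (W j) U" "mdist (Cs U) b0 r' \<le> 73 * E" using Wr[OF j] by blast
      then have r': "r' \<in> rho s (W j) U" "mdist (Cs U) b0 r' \<le> 100 * E" using E_ge_1 by auto
      note ends = near_middle_close_ends[OF U al mvj(3)[OF j] W[OF j] b0(1) r']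
      have "close (W j) (3 * E + 3 * E + 3 * E) (h [^] j \<otimes> x) (h [^] j \<otimes> y)"
        by (rule close_trans[OF close_trans[OF close_sym[OF ends(1)] cw] ends(2)]) (use W[OF j] mvj[OF j] c in auto)
      then have "close V (3 * E + 3 * E + 3 * E) x y" using close_act[OF mvj(1)[OF j] V1(1) c(1,3)] by (simp add: W_def)
      then have "close V (9 * E) x y" by (rule close_mono) simp
      then show False using V1(4) by blast
    qed
    have above: "close T C x y" if j: "j \<le> F" and T: "T \<in> Dm" "pnest s (W j) T" "nest s T U" for j T
    proof (cases "T = U")
      case True
      then show ?thesis using cl by (auto intro: close_mono simp: C_def)
    next
      case False
      then have TU: "pnest s T U" using T by (simp add: pnest_def)
      let ?g = "h [^] j"
      let ?T = "D (inv ?g) T"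
      have T': "?T \<in> Dm" "D ?g ?T = T" using D_closed D_inv(2) T(1) mvj(1)[OF j] by auto
      have VT: "pnest s V ?T" using pnest_act[OF mvj(1)[OF j] V1(1) T'(1)] T(2) T'(2) by (simp add: W_def)
      have TU': "pnest s ?T U" using pnest_act[OF mvj(1)[OF j] T'(1) U] TU T'(2) mvj(2)[OF j] by simp
      have "nest s V0 ?T" using nest_trans[OF V0(1) V1(1) T'(1) V1(2)] VT by (simp add: pnest_def)
      then have "close ?T (9 * E) x y" using V(2) VT TU' T'(1) by blast
      then have 1: "close T (9 * E) (?g \<otimes> x) (?g \<otimes> y)" using close_act[OF mvj(1)[OF j] T'(1) c(1,3)] T'(2) by simp
      obtain r' where r': "r' \<in> rho s (W j) U" "mdist (Cs U) b0 r' \<le> 73 * E" using Wr[OF j] by blast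
      obtain r2 where r2: "r2 \<in> rho s T U" using rho_nonempty[OF T(1) U] TU by blast
      have "mdist (Cs U) r' r2 \<le> 3 * E"
        using nearD[OF near_rho_nested[OF W(1)[OF j] T(1) U T(2) TU] r'(1) r2] .
      moreover have "mdist (Cs U) b0 r2 \<le> mdist (Cs U) b0 r' + mdist (Cs U) r' r2"
        by (rule mdist_triangle)
          (use proj_in[OF U c(2) b0(1)] rho_in[OF W(1)[OF j] U _ r'(1)] rho_in[OF T(1) U _ r2] W[OF j] TU in auto)
      ultimately have "mdist (Cs U) b0 r2 \<le> 100 * E" using r'(2) E_ge_1 by linarith
      then show ?thesis using moved[OF 1 _ j T(1) TU, of C] r2 by (auto simp: C_def)
    qed
    have 1: "W ` {..F} \<subseteq> Dm" using W by auto
    have 2: "\<forall>V\<in>W ` {..F}. pnest s V U \<and> \<not> close V (3 * E) x y" using W Wrel by auto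
    have 3: "\<forall>V\<in>W ` {..F}. \<forall>T\<in>Dm. pnest s V T \<and> nest s T U \<longrightarrow> close T C x y" using above by auto
    have "finite (W ` {..F}) \<and> card (W ` {..F}) \<le> F"
      by (rule F[THEN bspec, OF U, THEN bspec, OF c(1), THEN bspec, OF c(3), THEN spec, THEN mp, OF 1,
            THEN mp, OF 2, THEN mp, OF 3])
    \<comment> \<open>The indices up to \<open>F\<close> are one more than the number of translates
      can be.\<close>
    then have "\<not> inj_on W {..F}" using card_image[of W "{..F}"] by auto
    then obtain i j where ij: "i < j" "j \<le> F" "W i = W j"
      by (auto simp: inj_on_def) (metis nat_neq_iff)
    have "h [^] j = h [^] i \<otimes> h [^] (j - i)" using ij(1) h by (simp add: nat_pow_mult)
    then have "D (h [^] i) V = D (h [^] i) (D (h [^] (j - i)) V)"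
      using ij(3) D_mult[of "h [^] i" "h [^] (j - i)" V] h V1(1) by (simp add: W_def)
    then have "V = D (h [^] (j - i)) V"
      using D_eq_iff[of "h [^] i" V "D (h [^] (j - i)) V"] h V1(1) D_closed by simp
    then show "\<exists>j::nat. \<exists>V\<in>Dm. j > 0 \<and> pnest s V U \<and> D (h [^] j) V = V"
      using ij(1) V1 by (intro exI[of _ "j - i"] bexI[of _ V]) auto
  qed
qed

text \<open>This is the map \<open>\<phi>\<close> of \<open>is_product_map\<close> with a fixed
  orthogonal coordinate forgotten. For class \<Xi> it is supplied by the factor metric.\<close>

definition realizable :: "real \<Rightarrow> 'd \<Rightarrow> bool" where
  "realizable \<kappa> U \<longleftrightarrow> (\<exists>\<theta>. \<forall>b\<in>F_tuples \<kappa> s U. \<exists>w\<in>carrier J.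
     (\<forall>V\<in>Dm. nest s V U \<longrightarrow> dist_in s V (P V w) (b V) \<le> \<theta>) \<and>
     (\<forall>V\<in>Dm. pnest s U V \<or> transverse s U V \<longrightarrow> dist_in s V (P V w) (rho s U V) \<le> \<theta>))"

lemma consistent_on_mono:
  assumes "consistent_on B s D' b" "B \<le> B'" "\<And>V. V \<in> D' \<Longrightarrow> b V = b' V"
  shows "consistent_on B' s D' b'"
  unfolding consistent_on_def
proof (intro ballI conjI impI)
  fix U V assume UV: "U \<in> D'" "V \<in> D'"
  { assume "transverse s U V"
    then have "min (dist_in s U (b U) (rho s V U)) (dist_in s V (b V) (rho s U V)) \<le> B"
      using assms(1) UV unfolding consistent_on_def by blast
    then show "min (dist_in s U (b' U) (rho s V U)) (dist_in s V (b' V) (rho s U V)) \<le> B'"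
      using assms(2) assms(3)[OF UV(1)] assms(3)[OF UV(2)] by simp }
  { assume "pnest s U V"
    then have "min (ereal (dist_in s V (b V) (rho s U V)))
            (diam_in s U (b U \<union> (\<Union>p\<in>b V. rho_map s V U p))) \<le> ereal B"
      using assms(1) UV unfolding consistent_on_def by blast
    also have "ereal B \<le> ereal B'" using assms(2) by simp
    finally show "min (ereal (dist_in s V (b' V) (rho s U V)))
            (diam_in s U (b' U \<union> (\<Union>p\<in>b' V. rho_map s V U p))) \<le> ereal B'"
      using assms(3)[OF UV(1)] assms(3)[OF UV(2)] by simp }
qed

lemma coarse_point_mono: "coarse_point B m X \<Longrightarrow> B \<le> B' \<Longrightarrow> coarse_point B' m X"
  unfolding coarse_point_def by (meson ereal_less_eq(3) order_trans)

text \<open>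
  Without relevant domains near the middle point \<open>q\<close>, replacing \<open>q\<close> by \<open>x\<close> in the domains near \<open>q\<close>
  gives a consistent tuple; it is moved a bounded amount in every domain.
\<close>

lemma irrelevant_middle_domains:
  assumes U: "U \<in> Dm" and \<kappa>: "\<kappa> \<ge> 44 * E" and re: "realizable \<kappa> U"
  shows "\<exists>N::nat. \<forall>x q y Z. aligned U x q y \<longrightarrow>
    (\<forall>V\<in>Dm. pnest s V U \<longrightarrow> (\<exists>b\<in>P U q. \<exists>r\<in>rho s V U. mdist (Cs U) b r \<le> 40 * E) \<longrightarrow> close V (9 * E) x y) \<longrightarrow>
    (\<forall>g\<in>Z. supported_in U g \<and> moves_little U g x q y) \<longrightarrow> finite Z \<and> card Z \<le> N"
proof -
  obtain \<theta> where \<theta>: "\<And>b. b \<in> F_tuples \<kappa> s U \<Longrightarrow> \<exists>w\<in>carrier J.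
     (\<forall>V\<in>Dm. nest s V U \<longrightarrow> dist_in s V (P V w) (b V) \<le> \<theta>) \<and>
     (\<forall>V\<in>Dm. pnest s U V \<or> transverse s U V \<longrightarrow> dist_in s V (P V w) (rho s U V) \<le> \<theta>)"
    using re unfolding realizable_def by blast
  define \<theta>' where "\<theta>' = max \<theta> 0 + 2 * E"
  have \<theta>'0: "\<theta>' \<ge> 0" using E_ge_1 by (simp add: \<theta>'_def)
  define B where "B = \<theta>' + 28 * E + \<theta>'"
  obtain N where N: "\<forall>x Z. in_product_region U \<theta>' x \<longrightarrow> Z \<subseteq> carrier J \<longrightarrow>
    (\<forall>z\<in>Z. D z U = U \<and> (\<forall>V\<in>Dm. nest s V U \<or> orth s V U \<longrightarrow> close V B x (z \<otimes> x))) \<longrightarrow> finite Z \<and> card Z \<le> (N::nat)"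
    using card_small_displacement_in_region[OF U, of \<theta>' B] by (elim exE)
  show ?thesis
  proof (intro exI[of _ N] allI impI)
    fix x q y Z
    assume al: "aligned U x q y"
      and irr: "\<forall>V\<in>Dm. pnest s V U \<longrightarrow> (\<exists>b\<in>P U q. \<exists>r\<in>rho s V U. mdist (Cs U) b r \<le> 40 * E) \<longrightarrow> close V (9 * E) x y"
      and Z: "\<forall>g\<in>Z. supported_in U g \<and> moves_little U g x q y"
    have c: "x \<in> carrier J" "q \<in> carrier J" "y \<in> carrier J" using al by (auto simp: aligned_def)
    define mid where "mid V \<longleftrightarrow> (\<exists>b\<in>P U q. \<exists>r\<in>rho s V U. mdist (Cs U) b r \<le> 40 * E)" for V
    \<comment> \<open>In a proper domain with \<rho> near \<open>q\<close>, the elements in question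
      are controlled at the ends but not at \<open>q\<close>, so the coordinate of \<open>x\<close>
      is taken there. In \<open>U\<close> and in domains far from \<open>q\<close> the coordinate of
      \<open>q\<close> is kept.\<close>
    define z where "z V = (if V \<noteq> U \<and> mid V then x else q)" for V
    have zc: "z V \<in> carrier J" for V using c by (simp add: z_def)
    have mid_close: "close V (9 * E) x y" if "V \<in> Dm" "pnest s V U" "mid V" for V
      using irr that unfolding mid_def by blast
    have far_close': "close V (3 * E) q x \<or> close V (3 * E) q y" if V: "V \<in> Dm" "pnest s V U" "\<not> mid V" for V
    proof -
      obtain b where b: "b \<in> P U q" using ex_proj_point U c by blast
      obtain r where r: "r \<in> rho s V U" using rho_nonempty[OF V(1) U] V(2) by blast
      have "\<not> mdist (Cs U) b r \<le> 40 * E" using V(3) b r unfolding mid_def by blast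
      then have "mdist (Cs U) b r > 12 * E" using E_ge_1 by linarith
      then show ?thesis by (rule far_from_middle_close[OF U al V(1,2) b r])
    qed
    let ?D = "below s U"
    have D: "?D \<subseteq> Dm" by (auto simp: below_def)
    \<comment> \<open>The radius \<open>40 * E\<close> of the neighbourhood of \<open>q\<close> and
      the loss in \<open>consistent_on_pairwise_close\<close> make up the bound
      \<open>44 * E\<close> for \<kappa>.\<close>
    have "consistent_on (40 * E + 4 * E) s ?D (\<lambda>V. P V (z V))"
    proof (rule consistent_on_pairwise_close[OF D zc])
      show "0 \<le> 40 * E" using E_ge_1 by simp
      fix V W assume VW: "V \<in> ?D" "W \<in> ?D" "transverse s V W \<or> pnest s V W"
      have VD: "V \<in> Dm" "nest s V U" "W \<in> Dm" "nest s W U" using VW by (auto simp: below_def)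
      have VU: "V \<noteq> U"
        using VW(3) VD nest_antisym[OF U VD(3)] unfolding transverse_def pnest_def by blast
      then have pV: "pnest s V U" using VD by (simp add: pnest_def)
      have same: "close V (40 * E) u u" if "V \<in> Dm" "u \<in> carrier J" for V u
        by (rule close_mono[OF close_refl[OF that]]) (use E_ge_1 in simp)
      show "(\<exists>u\<in>carrier J. close V (40 * E) (z V) u \<and> close W (40 * E) (z W) u) \<or>
            pnest s V W \<and> near (Cs W) (40 * E + 4 * E) (P W (z W)) (rho s V W)"
      proof (cases "W = U")
        case True
        then have pVW: "pnest s V W" using pV by simp
        show ?thesis
        proof (cases "mid V")
          case True
          then obtain b r where br: "b \<in> P U q" "r \<in> rho s V U" "mdist (Cs U) b r \<le> 40 * E" unfolding mid_def by blast
          have "near (Cs U) (E + 40 * E) (P U q) {r}"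
            by (rule near_trans[of _ _ _ "{b}"])
              (use nearD[OF proj_near[OF U c(2)] _ br(1)] br proj_in[OF U c(2)] rho_in[OF VD(1) U _ br(2)] pV in \<open>auto simp: near_def\<close>)
          then have "near (Cs U) (E + 40 * E + E) (P U q) (rho s V U)"
            by (rule near_trans[of _ _ _ "{r}"])
              (use nearD[OF rho_near[OF VD(1) U] br(2)] br proj_in[OF U c(2)] rho_in[OF VD(1) U] pV in \<open>auto simp: near_def\<close>)
          then have "near (Cs U) (40 * E + 4 * E) (P U q) (rho s V U)" by (rule near_mono) (use E_ge_1 in simp)
          then show ?thesis using pVW \<open>W = U\<close> by (simp add: z_def)
        next
          case False
          then have "z V = q" "z W = q" using \<open>W = U\<close> by (auto simp: z_def)
          then show ?thesis using same[OF VD(1) c(2)] same[OF VD(3) c(2)] c(2) by auto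
        qed
      next
        case False
        then have pW: "pnest s W U" using VD by (simp add: pnest_def)
        \<comment> \<open>The domain far from \<open>q\<close> sees \<open>q\<close> as one of the
          ends, and the domain near \<open>q\<close> sees the two ends as one point, so an end
          serves as the common point.\<close>
        have mixed: "\<exists>u\<in>carrier J. close A (40 * E) x u \<and> close B (40 * E) q u"
          if "A \<in> Dm" "pnest s A U" "mid A" "B \<in> Dm" "pnest s B U" "\<not> mid B" for A B
          using far_close'[OF that(4-6)]
        proof
          assume "close B (3 * E) q x"
          then have "close B (40 * E) q x" by (rule close_mono) (use E_ge_1 in simp)
          then show ?thesis using same that c by blast
        next
          assume "close B (3 * E) q y"
          then have "close B (40 * E) q y" by (rule close_mono) (use E_ge_1 in simp)
          moreover have "close A (40 * E) x y" by (rule close_mono[OF mid_close[OF that(1-3)]]) (use E_ge_1 in simp)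
          ultimately show ?thesis using c by blast
        qed
        show ?thesis
          using mixed[OF VD(1) pV _ VD(3) pW] mixed[OF VD(3) pW _ VD(1) pV] same[OF VD(1)] same[OF VD(3)] c VU False
          unfolding z_def by (cases "mid V"; cases "mid W") auto
      qed
    qed
    then have "consistent_on \<kappa> s ?D (restrict (\<lambda>V. P V (z V)) ?D)"
      by (rule consistent_on_mono) (use \<kappa> in auto)
    moreover have "coarse_point \<kappa> (Cs V) (P V (z V))" if "V \<in> ?D" for V
      by (rule coarse_point_mono[OF proj_coarse]) (use that D zc \<kappa> E_ge_1 in auto)
    ultimately have "restrict (\<lambda>V. P V (z V)) ?D \<in> F_tuples \<kappa> s U"
      unfolding F_tuples_def consistent_tuples_def by auto
    from \<theta>[OF this] obtain w where w: "w \<in> carrier J"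
      "\<And>V. V \<in> Dm \<Longrightarrow> nest s V U \<Longrightarrow> dist_in s V (P V w) (restrict (\<lambda>V. P V (z V)) ?D V) \<le> \<theta>"
      "\<And>V. V \<in> Dm \<Longrightarrow> pnest s U V \<or> transverse s U V \<Longrightarrow> dist_in s V (P V w) (rho s U V) \<le> \<theta>" by blast
    have wz: "close V \<theta>' w (z V)" if V: "V \<in> Dm" "nest s V U" for V
    proof -
      have "dist_in s V (P V w) (P V (z V)) \<le> max \<theta> 0" using w(2)[OF V] V by (simp add: below_def)
      from close_set_dist(1)[OF V(1) w(1) zc this] show ?thesis by (simp add: \<theta>'_def)
    qed
    have reg: "in_product_region U \<theta>' w"
      unfolding in_product_region_def
    proof (intro conjI ballI impI)
      fix V assume V: "V \<in> Dm" "pnest s U V \<or> transverse s U V"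
      have "dist_in s V (P V w) (rho s U V) \<le> max \<theta> 0" using w(3)[OF V] by simp
      from near_rho_of_dist[OF w(1) U V(1) _ this] show "near (Cs V) \<theta>' (P V w) (rho s U V)"
        using V(2) unfolding \<theta>'_def by blast
    qed (rule w(1))
    have moved: "close V (28 * E) (z V) (g \<otimes> z (D (inv g) V))" if g: "g \<in> Z" and V: "V \<in> Dm" "nest s V U" for g V
    proof (cases "V = U")
      case True
      have "g \<in> carrier J" "D g U = U" "close U (28 * E) q (g \<otimes> q)" using Z g by (auto simp: moves_little_def)
      then show ?thesis using True D_inv_fix[of g U] U by (simp add: z_def)
    next
      case False
      then have pV: "pnest s V U" using V by (simp add: pnest_def)
      have mv: "moves_little U g x q y" using Z g by blast
      then have gc: "g \<in> carrier J" "D g U = U" "close U (28 * E) q (g \<otimes> q)" by (auto simp: moves_little_def)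
      let ?V = "D (inv g) V"
      have V': "?V \<in> Dm" "D g ?V = V" using D_closed D_inv(2) V(1) gc by auto
      have pV': "pnest s ?V U" using pnest_act[OF gc(1) V'(1) U] pV V'(2) gc(2) by simp
      then have V'U: "?V \<noteq> U" by (simp add: pnest_def)
      have gx: "g \<otimes> x \<in> carrier J" "g \<otimes> y \<in> carrier J" "g \<otimes> q \<in> carrier J" using gc c by auto
      obtain b where b: "b \<in> P U q" using ex_proj_point U c by blast
      have tr: "close V B (g \<otimes> u) (g \<otimes> v)" if "close ?V B u v" "u \<in> carrier J" "v \<in> carrier J" for B u v
        using close_act[OF gc(1) V'(1) that(2,3)] that(1) V'(2) by simp
      have ends: "close V (3 * E) x (g \<otimes> x)" "close V (3 * E) y (g \<otimes> y)" if m: "mid V \<or> mid ?V"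
      proof -
        have "\<exists>b\<in>P U q. \<exists>r\<in>rho s V U. mdist (Cs U) b r \<le> 100 * E"
        proof (cases "mid V")
          case True
          then obtain b r where br: "b \<in> P U q" "r \<in> rho s V U" "mdist (Cs U) b r \<le> 40 * E" unfolding mid_def by blast
          then show ?thesis using E_ge_1 by (intro bexI[of _ b] bexI[of _ r]) auto
        next
          case False
          then obtain b0 r where br: "b0 \<in> P U q" "r \<in> rho s ?V U" "mdist (Cs U) b0 r \<le> 40 * E"
            using m unfolding mid_def by blast
          obtain r' where "r' \<in> rho s V U" "mdist (Cs U) b r' \<le> 40 * E + 28 * E"
            using rho_near_moved[OF U c(2) gc V'(1) pV' br b] V'(2) by auto
          then show ?thesis using b E_ge_1 by (intro bexI[of _ b] bexI[of _ r']) auto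
        qed
        then show "close V (3 * E) x (g \<otimes> x)" "close V (3 * E) y (g \<otimes> y)"
          using near_middle_close_ends[OF U al mv V(1) pV] by blast+
      qed
      \<comment> \<open>The translate of \<open>V\<close> by the inverse of \<open>g\<close> may lie
        on the other side of the threshold \<open>40 * E\<close>; in the mixed cases the coordinates
        of \<open>x\<close> and \<open>q\<close> are compared through an end.\<close>
      consider (ff) "\<not> mid V" "\<not> mid ?V" | (mm) "mid V" "mid ?V" | (mf) "mid V" "\<not> mid ?V" | (fm) "\<not> mid V" "mid ?V"
        by blast
      then show ?thesis
      proof cases
        case ff
        obtain r where r: "r \<in> rho s V U" using rho_nonempty[OF V(1) U] pV by blast
        have "\<not> mdist (Cs U) b r \<le> 40 * E" using ff(1) b r unfolding mid_def by blast
        then have "mdist (Cs U) b r > 28 * E + 3 * E" using E_ge_1 by linarith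
        then have "close V (3 * E) q (g \<otimes> q)"
          by (rule far_close[OF V(1) U pV c(2) gx(3) gc(3) b r])
        then have "close V (28 * E) q (g \<otimes> q)" by (rule close_mono) (use E_ge_1 in simp)
        then show ?thesis using ff by (simp add: z_def)
      next
        case mm
        have "close V (28 * E) x (g \<otimes> x)" by (rule close_mono[OF ends(1)]) (use mm E_ge_1 in auto)
        then show ?thesis using mm False V'U by (simp add: z_def)
      next
        case mf
        note e = ends[OF disjI1[OF mf(1)]]
        have "close V (28 * E) x (g \<otimes> q)" using far_close'[OF V'(1) pV' mf(2)]
        proof
          assume "close ?V (3 * E) q x"
          then have "close V (3 * E + 3 * E) x (g \<otimes> q)"
            by (intro close_trans[OF e(1) close_sym[OF tr]] V c gx)
          then show ?thesis by (rule close_mono) (use E_ge_1 in simp)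
        next
          assume q: "close ?V (3 * E) q y"
          have "close V (9 * E + 3 * E + 3 * E) x (g \<otimes> q)"
            by (rule close_trans[OF close_trans[OF mid_close[OF V(1) pV mf(1)] e(2)] close_sym[OF tr[OF q]]]) (use V c gx in auto)
          then show ?thesis by (rule close_mono) (use E_ge_1 in simp)
        qed
        then show ?thesis using mf False V'U by (simp add: z_def)
      next
        case fm
        note e = ends[OF disjI2[OF fm(2)]]
        have "close V (28 * E) q (g \<otimes> x)" using far_close'[OF V(1) pV fm(1)]
        proof
          assume q: "close V (3 * E) q x"
          have "close V (3 * E + 3 * E) q (g \<otimes> x)" by (rule close_trans[OF q e(1)]) (use V c gx in auto)
          then show ?thesis by (rule close_mono) (use E_ge_1 in simp)
        next
          assume q: "close V (3 * E) q y"
          have "close V (3 * E + 3 * E + 9 * E) q (g \<otimes> x)"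
            by (rule close_trans[OF close_trans[OF q e(2)] close_sym[OF tr[OF mid_close[OF V'(1) pV' fm(2)]]]]) (use V c gx in auto)
          then show ?thesis by (rule close_mono) (use E_ge_1 in simp)
        qed
        then show ?thesis using fm False V'U by (simp add: z_def)
      qed
    qed
    show "finite Z \<and> card Z \<le> N"
    proof (rule N[rule_format, OF reg])
      show "Z \<subseteq> carrier J" using Z by (auto simp: supported_in_def)
      fix g assume g: "g \<in> Z"
      have gc: "g \<in> carrier J" "D g U = U" "supported_in U g" using Z g by (auto simp: supported_in_def)
      have "close V B w (g \<otimes> w)" if V: "V \<in> Dm" "nest s V U \<or> orth s V U" for V
      proof (cases "nest s V U")
        case True
        let ?V = "D (inv g) V"
        have V': "?V \<in> Dm" "D g ?V = V" using D_closed D_inv(2) V(1) gc by auto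
        have nV': "nest s ?V U" using nest_act[OF gc(1) V'(1) U] True V'(2) gc(2) by simp
        have 1: "close V \<theta>' (g \<otimes> z ?V) (g \<otimes> w)"
          using close_act[OF gc(1) V'(1) zc w(1)] close_sym[OF wz[OF V'(1) nV']] V'(2) by simp
        show ?thesis unfolding B_def
          by (rule close_trans[OF close_trans[OF wz[OF V(1) True] moved[OF g V(1) True]] 1]) (use V w zc gc in auto)
      next
        case False
        then have "orth s V U" using V by blast
        from supported_in_close_orth[OF gc(3) V(1) this w(1)] show ?thesis
          by (rule close_mono) (use \<theta>'0 E_ge_1 in \<open>simp add: B_def\<close>)
      qed
      then show "D g U = U \<and> (\<forall>V\<in>Dm. nest s V U \<or> orth s V U \<longrightarrow> close V B w (g \<otimes> w))" using gc by blast
    qed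
  qed
qed

end

section \<open>Common powers of commuting elements with common support\<close>

context hhg_group
begin

lemma T_fix_pow_add:
  assumes "h \<in> carrier J" "U \<in> Dm" "D h U = U" "p \<in> mspace (Cs U)"
  shows "T (h [^] (i + j :: nat)) U p = T (h [^] i) U (T (h [^] j) U p)"
proof -
  have "h [^] (i + j) = h [^] i \<otimes> h [^] j" using assms(1) by (simp add: nat_pow_mult)
  then show ?thesis
    using T_fix_mult[of "h [^] i" "h [^] j" U p] assms D_pow_fix by simp
qed

text \<open>Negative powers have the same displacement as positive ones, and changing the base point
  costs a constant.\<close>

lemma unbounded_orbit_points:
  assumes h: "h \<in> carrier J" "U \<in> Dm" "D h U = U" and nb: "\<not> bounded_orbit h U" and p: "p \<in> mspace (Cs U)"
  shows "\<exists>n::nat. mdist (Cs U) p (T (h [^] n) U p) > B"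
proof (rule ccontr)
  assume "\<not> ?thesis"
  then have B: "mdist (Cs U) p (T (h [^] (n::nat)) U p) \<le> B" for n by (meson not_le)
  obtain o' where o': "o' \<in> P U \<one>" using ex_proj_point[OF h(2), of \<one>] by blast
  have oM: "o' \<in> mspace (Cs U)" using proj_in[OF h(2) _ o'] by simp
  define k where "k = mdist (Cs U) o' p"
  have pt: "h [^] (n::int) \<in> carrier J" "D (h [^] (n::int)) U = U" for n using h D_int_pow_fix by auto
  have bd: "mdist (Cs U) p (T (h [^] (n::int)) U p) \<le> B" for n
  proof (cases n rule: int_cases2)
    case (nonneg m)
    then show ?thesis using B[of m] by (simp add: int_pow_int)
  next
    case (nonpos m)
    have hm: "h [^] m \<in> carrier J" "D (h [^] m) U = U" using h D_pow_fix by auto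
    have "T (h [^] m) U (T (h [^] n) U p) = T \<one> U p"
      using T_fix_mult[OF hm(1) pt(1) h(2) pt(2) p, of n] nonpos h(1) by (simp add: int_pow_neg_int)
    then have "mdist (Cs U) (T (h [^] m) U p) p = mdist (Cs U) p (T (h [^] n) U p)"
      using T_fix(2)[OF hm(1) h(2) hm(2) p T_fix(1)[OF pt(1) h(2) pt(2) p], of n] T_one[OF h(2) p] by simp
    then show ?thesis using B[of m] by (simp add: mdist_commute)
  qed
  have "close U (E + (k + B + k) + E) \<one> (h [^] (n::int))" for n
    unfolding close_def near_def
  proof (intro ballI)
    fix a b assume a: "a \<in> P U \<one>" and b: "b \<in> P U (h [^] n)"
    let ?t = "T (h [^] n) U"
    have M: "a \<in> mspace (Cs U)" "b \<in> mspace (Cs U)" "?t o' \<in> mspace (Cs U)" "?t p \<in> mspace (Cs U)"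
      using proj_in[OF h(2) _ a] proj_in[OF h(2) _ b] pt T_fix(1)[OF pt(1) h(2) pt(2)] oM p by auto
    have "?t o' \<in> P U (h [^] n)" using T_fix(3)[OF pt(1) h(2) pt(2), of \<one> n] o' pt(1) by auto
    then have "mdist (Cs U) (?t o') b \<le> E" using nearD[OF proj_near[OF h(2)] _ b] pt(1) by blast
    moreover have "mdist (Cs U) a o' \<le> E" using nearD[OF proj_near[OF h(2)] a o'] by simp
    moreover have "mdist (Cs U) (?t p) (?t o') = k"
      using T_fix(2)[OF pt(1) h(2) pt(2) p oM] by (simp add: k_def mdist_commute)
    moreover have "mdist (Cs U) p (?t p) \<le> B" by (rule bd)
    moreover have "mdist (Cs U) a b \<le> mdist (Cs U) a o' + mdist (Cs U) o' b" by (rule mdist_triangle[OF M(1) oM M(2)])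
    moreover have "mdist (Cs U) o' b \<le> mdist (Cs U) o' p + mdist (Cs U) p b" by (rule mdist_triangle[OF oM p M(2)])
    moreover have "mdist (Cs U) p b \<le> mdist (Cs U) p (?t p) + mdist (Cs U) (?t p) b" by (rule mdist_triangle[OF p M(4,2)])
    moreover have "mdist (Cs U) (?t p) b \<le> mdist (Cs U) (?t p) (?t o') + mdist (Cs U) (?t o') b" by (rule mdist_triangle[OF M(4,3,2)])
    ultimately show "mdist (Cs U) a b \<le> E + (k + B + k) + E" by (simp add: k_def)
  qed
  then show False using nb unfolding bounded_orbit_def by blast
qed

lemma ex_coarse_lift:
  assumes "U \<in> Dm" "p \<in> mspace (Cs U)"
  shows "\<exists>x\<in>carrier J. \<forall>a\<in>P U x. mdist (Cs U) a p \<le> 2 * E"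
proof -
  obtain x where x: "x \<in> carrier J" "dist_in s U (P U x) {p} \<le> E"
    using hhs_parts(1) assms unfolding hhs_projections_def mspace_total by blast
  have "mdist (Cs U) p p = 0" using assms(2) by simp
  then have "near (Cs U) 0 {p} {p}" by (simp add: near_def)
  from near_set_dist[OF proj_near[OF assms(1) x(1)] this proj_nonempty[OF assms(1) x(1)] _ proj_subset[OF assms(1) x(1)] _ x(2)]
  have "near (Cs U) (E + (E + 0)) (P U x) {p}" using assms(2) by simp
  then show ?thesis using x(1) by (auto simp: near_def)
qed

text \<open>Since \<open>p\<close> lies between \<open>b\<close> and \<open>w\<close>, the
  four-point inequality makes its image recede at full speed from one of the two ends, and
  \<open>bounded_displacement\<close> applies at this end with \<open>K = 8 * E\<close>.\<close>

lemma geodesic_displacement: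
  assumes U: "U \<in> Dm" and g: "g \<in> carrier J" "D g U = U"
    and M: "b \<in> mspace (Cs U)" "w \<in> mspace (Cs U)" "p \<in> mspace (Cs U)"
    and par: "mdist (Cs U) p (T g U (T g U p)) \<le> mdist (Cs U) p (T g U p) + 8 * E"
    and btw: "mdist (Cs U) b p + mdist (Cs U) p w = mdist (Cs U) b w"
    and far: "mdist (Cs U) b (T g U b) + 8 * E \<le> mdist (Cs U) b p" "mdist (Cs U) w (T g U w) + 8 * E \<le> mdist (Cs U) p w"
  shows "mdist (Cs U) p (T g U p) \<le> 24 * E"
proof -
  let ?d = "mdist (Cs U)" and ?t = "T g U"
  note fp = cspace_four_point[OF U]
  have tM: "?t u \<in> mspace (Cs U)" if "u \<in> mspace (Cs U)" for u using T_fix(1)[OF g(1) U g(2) that] .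
  have iso: "?d (?t u) (?t v) = ?d u v" if "u \<in> mspace (Cs U)" "v \<in> mspace (Cs U)" for u v
    using T_fix(2)[OF g(1) U g(2) that] .
  have "?d b w + ?d p (?t p) \<le> max (?d b p + ?d w (?t p)) (?d p w + ?d b (?t p)) + 8 * E"
    by (rule four_pointD[OF fp M(1,3,2) tM[OF M(3)]])
  then consider "?d b (?t p) \<ge> ?d b p + ?d p (?t p) - 8 * E" | "?d w (?t p) \<ge> ?d w p + ?d p (?t p) - 8 * E"
    using btw mdist_commute[of "Cs U" p w] by (auto simp: max_def split: if_splits)
  then have "?d p (?t p) \<le> 3 * (8 * E)"
  proof cases
    case 1
    show ?thesis
      by (rule bounded_displacement[OF fp M(1) tM[OF M(1)] M(3) tM[OF M(3)] tM[OF tM[OF M(3)]]])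
        (use 1 far par M iso tM in auto)
  next
    case 2
    show ?thesis
      by (rule bounded_displacement[OF fp M(2) tM[OF M(2)] M(3) tM[OF M(3)] tM[OF tM[OF M(3)]]])
        (use 2 far par M iso tM mdist_commute[of "Cs U" p w] in auto)
  qed
  then show ?thesis by simp
qed

text \<open>The three points are taken from the middle part of a long geodesic joining two points of an orbit of \<open>h\<close>.\<close>

lemma ex_aligned_moves_little:
  assumes U: "U \<in> Dm" and h: "h \<in> carrier J" "D h U = U" and nb: "\<not> bounded_orbit h U"
    and par: "\<And>p j::nat. p \<in> mspace (Cs U) \<Longrightarrow>
      mdist (Cs U) p (T (h [^] (2 * j)) U p) \<le> mdist (Cs U) p (T (h [^] j) U p) + 8 * E"
  shows "\<exists>x q y. aligned U x q y \<and> close U (410 * E) x y \<and> (\<forall>j\<le>(N::nat). moves_little U (h [^] j) x q y)"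
proof -
  let ?d = "mdist (Cs U)"
  obtain b where "b \<in> P U \<one>" using ex_proj_point[OF U, of \<one>] by blast
  then have bM: "b \<in> mspace (Cs U)" using proj_in[OF U] by blast
  have hj: "h [^] j \<in> carrier J" "D (h [^] j) U = U" for j :: nat using h U D_pow_fix by auto
  \<comment> \<open>The maximum over the finitely many powers considered. It also bounds the
    displacement of \<open>w\<close>, since powers of \<open>h\<close> commute.\<close>
  define A where "A = Max ((\<lambda>j. ?d b (T (h [^] j) U b)) ` {..N})"
  have A: "?d b (T (h [^] j) U b) \<le> A" if "j \<le> N" for j unfolding A_def by (rule Max_ge) (use that in auto)
  have A0: "A \<ge> 0" using order_trans[OF mdist_nonneg A[of 0]] by simp
  \<comment> \<open>The distance from the ends that \<open>geodesic_displacement\<close> asks for.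
    The length of the geodesic beyond \<open>2 * t0\<close> leaves room for three points spaced
    \<open>200 * E\<close>.\<close>
  define t0 where "t0 = A + 8 * E"
  obtain k :: nat where k: "?d b (T (h [^] k) U b) > 2 * t0 + 400 * E"
    using unbounded_orbit_points[OF h(1) U h(2) nb bM] by blast
  define w where "w = T (h [^] k) U b"
  have wM: "w \<in> mspace (Cs U)" unfolding w_def by (rule T_fix(1)[OF hj(1) U hj(2) bM])
  have Aw: "?d w (T (h [^] j) U w) \<le> A" if "j \<le> N" for j
  proof -
    have "T (h [^] j) U w = T (h [^] k) U (T (h [^] j) U b)"
      using T_fix_pow_add[OF h(1) U h(2) bM, of j k] T_fix_pow_add[OF h(1) U h(2) bM, of k j]
      by (simp add: w_def add.commute)
    then have "?d w (T (h [^] j) U w) = ?d b (T (h [^] j) U b)"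
      using T_fix(2)[OF hj(1) U hj(2) bM T_fix(1)[OF hj(1) U hj(2) bM]] by (simp add: w_def)
    then show ?thesis using A[OF that] by simp
  qed
  have "hyperbolic_space E (Cs U)" using hhs_parts(1) U unfolding hhs_projections_def by blast
  then obtain \<gamma> where "geodesic_between (Cs U) b w \<gamma>" using bM wM unfolding hyperbolic_space_def by blast
  then obtain L c where c: "geodesic (Cs U) L c" "c 0 = b" "c L = w" by (auto simp: geodesic_between_def)
  have L0: "L \<ge> 0" using c(1) by (simp add: geodesic_def)
  have cd: "?d (c u) (c v) = \<bar>u - v\<bar>" if "0 \<le> u" "u \<le> L" "0 \<le> v" "v \<le> L" for u v
    using c(1) that by (simp add: geodesic_def)
  have cM: "c u \<in> mspace (Cs U)" if "0 \<le> u" "u \<le> L" for u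
    using c(1) that unfolding geodesic_def by (simp add: image_subset_iff)
  have "?d b w = L" using cd[of 0 L] c L0 by simp
  then have L: "L > 2 * t0 + 400 * E" using k by (simp add: w_def)
  have t00: "t0 \<ge> 0" using A0 E_ge_1 by (simp add: t0_def)
  have disp: "?d (c u) (T (h [^] j) U (c u)) \<le> 24 * E" if u: "t0 \<le> u" "u \<le> L - t0" and j: "j \<le> N" for u j
  proof (rule geodesic_displacement[OF U hj bM wM])
    have u': "0 \<le> u" "u \<le> L" using u t00 by auto
    show "c u \<in> mspace (Cs U)" by (rule cM[OF u'])
    show "?d (c u) (T (h [^] j) U (T (h [^] j) U (c u))) \<le> ?d (c u) (T (h [^] j) U (c u)) + 8 * E"
      using par[OF cM[OF u'], of j] T_fix_pow_add[OF h(1) U h(2) cM[OF u'], of j j] by (simp add: mult_2)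
    have bc: "?d b (c u) = u" "?d (c u) w = L - u" using cd[of 0 u] cd[of u L] c u' L0 by auto
    show "?d b (c u) + ?d (c u) w = ?d b w" using bc \<open>?d b w = L\<close> by simp
    show "?d b (T (h [^] j) U b) + 8 * E \<le> ?d b (c u)" using bc A[OF j] u by (simp add: t0_def)
    show "?d w (T (h [^] j) U w) + 8 * E \<le> ?d (c u) w" using bc Aw[OF j] u by (simp add: t0_def)
  qed
  have E0: "E \<ge> 0" using E_ge_1 by simp
  obtain x where x: "x \<in> carrier J" "\<forall>a\<in>P U x. ?d a (c t0) \<le> 2 * E"
    using ex_coarse_lift[OF U cM[of t0]] t00 L E0 by auto
  obtain q where q: "q \<in> carrier J" "\<forall>a\<in>P U q. ?d a (c (t0 + 200 * E)) \<le> 2 * E"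
    using ex_coarse_lift[OF U cM[of "t0 + 200 * E"]] t00 L E0 by auto
  obtain y where y: "y \<in> carrier J" "\<forall>a\<in>P U y. ?d a (c (t0 + 400 * E)) \<le> 2 * E"
    using ex_coarse_lift[OF U cM[of "t0 + 400 * E"]] t00 L E0 by auto
  have lift_dist: "\<bar>?d a b - ?d u v\<bar> \<le> 4 * E"
    if "a \<in> mspace (Cs U)" "b \<in> mspace (Cs U)" "u \<in> mspace (Cs U)" "v \<in> mspace (Cs U)" "?d a u \<le> 2 * E" "?d b v \<le> 2 * E"
    for a b u v
  proof -
    have "?d a b \<le> ?d a u + ?d u b" "?d u b \<le> ?d u v + ?d v b" "?d u v \<le> ?d u a + ?d a v" "?d a v \<le> ?d a b + ?d b v"
      by (rule mdist_triangle; fact)+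
    moreover have "?d v b = ?d b v" "?d u a = ?d a u" by (rule mdist_commute)+
    ultimately show ?thesis using that(5,6) by linarith
  qed
  have pM: "c t0 \<in> mspace (Cs U)" "c (t0 + 200 * E) \<in> mspace (Cs U)" "c (t0 + 400 * E) \<in> mspace (Cs U)"
    using cM t00 L E0 by auto
  have pd: "?d (c t0) (c (t0 + 200 * E)) = 200 * E" "?d (c (t0 + 200 * E)) (c (t0 + 400 * E)) = 200 * E"
    "?d (c t0) (c (t0 + 400 * E)) = 400 * E"
    using cd[of t0 "t0 + 200 * E"] cd[of "t0 + 200 * E" "t0 + 400 * E"] cd[of t0 "t0 + 400 * E"] t00 L E0 by auto
  have ds: "\<bar>?d a b - 200 * E\<bar> \<le> 4 * E \<and> \<bar>?d b e - 200 * E\<bar> \<le> 4 * E \<and> \<bar>?d a e - 400 * E\<bar> \<le> 4 * E"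
    if "a \<in> P U x" "b \<in> P U q" "e \<in> P U y" for a b e
  proof -
    note M = proj_in[OF U x(1) that(1)] proj_in[OF U q(1) that(2)] proj_in[OF U y(1) that(3)]
    note l = x(2)[rule_format, OF that(1)] q(2)[rule_format, OF that(2)] y(2)[rule_format, OF that(3)]
    show ?thesis
      using lift_dist[OF M(1,2) pM(1,2) l(1,2)] lift_dist[OF M(2,3) pM(2,3) l(2,3)] lift_dist[OF M(1,3) pM(1,3) l(1,3)]
      unfolding pd by blast
  qed
  have "aligned U x q y"
    unfolding aligned_def
  proof (intro conjI ballI x(1) q(1) y(1))
    fix a b e assume "a \<in> P U x" "b \<in> P U q" "e \<in> P U y"
    from ds[OF this] show "196 * E \<le> ?d a b" "196 * E \<le> ?d b e" "?d a b + ?d b e \<le> ?d a e + 12 * E" by linarith+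
  qed
  moreover have "close U (410 * E) x y"
    unfolding close_def near_def
  proof (intro ballI)
    fix a e assume ae: "a \<in> P U x" "e \<in> P U y"
    obtain b where "b \<in> P U q" using ex_proj_point U q by blast
    from ds[OF ae(1) this ae(2)] show "?d a e \<le> 410 * E" using E0 by linarith
  qed
  moreover have "moves_little U (h [^] j) x q y" if j: "j \<le> N" for j
  proof -
    have mv: "close U (28 * E) v (h [^] j \<otimes> v)"
      if v: "v \<in> carrier J" "\<forall>a\<in>P U v. ?d a (c u) \<le> 2 * E" and u: "t0 \<le> u" "u \<le> L - t0" for u v
      unfolding close_def near_def
    proof (intro ballI)
      fix a e assume a: "a \<in> P U v" and e: "e \<in> P U (h [^] j \<otimes> v)"
      obtain a' where a': "e = T (h [^] j) U a'" "a' \<in> P U v" using e T_fix(3)[OF hj(1) U hj(2) v(1), of j] by blast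
      let ?p = "c u" and ?t = "T (h [^] j) U"
      have M: "a \<in> mspace (Cs U)" "a' \<in> mspace (Cs U)" "?p \<in> mspace (Cs U)"
        using proj_in[OF U v(1)] a a'(2) cM[of u] u t00 by auto
      have tM: "?t a' \<in> mspace (Cs U)" "?t ?p \<in> mspace (Cs U)" using T_fix(1)[OF hj(1) U hj(2)] M by auto
      have "?d a e \<le> ?d a ?p + ?d ?p e" using mdist_triangle[OF M(1) M(3) tM(1)] a' by simp
      moreover have "?d ?p e \<le> ?d ?p (?t ?p) + ?d (?t ?p) e" using mdist_triangle[OF M(3) tM(2) tM(1)] a' by simp
      moreover have "?d (?t ?p) e = ?d a' ?p" using T_fix(2)[OF hj(1) U hj(2) M(3,2)] a' by (simp add: mdist_commute)
      moreover have "?d a ?p \<le> 2 * E" "?d a' ?p \<le> 2 * E" using v(2) a a'(2) by auto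
      moreover have "?d ?p (?t ?p) \<le> 24 * E" by (rule disp[OF u j])
      ultimately show "?d a e \<le> 28 * E" by linarith
    qed
    show ?thesis unfolding moves_little_def
      using mv[OF x] mv[OF q] mv[OF y] hj L t00 E0 by simp
  qed
  ultimately show ?thesis by blast
qed

text \<open>If doubling some power of \<open>h\<close> gains more than \<open>8 * E\<close>, its
  orbit is quasi-geodesic and \<open>common_power_of_loxodromic\<close> applies. Otherwise any given
  number of powers moves the middle of a long geodesic little, and both the presence and the absence
  of relevant domains there are contradictory.\<close>

lemma common_power_supported:
  assumes U: "U \<in> Dm" and \<kappa>: "\<kappa> \<ge> 44 * E" and re: "realizable \<kappa> U"
    and he: "supported_in U h" "supported_in U e" "commute J h e" and Big: "U \<in> Big J s h"
  shows "\<exists>(i::int) (j::int). j \<noteq> 0 \<and> h [^] i = e [^] j"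
proof -
  let ?d = "mdist (Cs U)"
  have hc: "h \<in> carrier J" "D h U = U" and ec: "e \<in> carrier J" using he by (auto simp: supported_in_def)
  have nb: "\<not> bounded_orbit h U" using Big Big_iff[OF hc(1)] by blast
  show ?thesis
  proof (cases "\<exists>p\<in>mspace (Cs U). \<exists>j::nat. ?d p (T (h [^] (2 * j)) U p) > ?d p (T (h [^] j) U p) + 8 * E")
    case True
    then obtain p' and j :: nat where p': "p' \<in> mspace (Cs U)"
      "?d p' (T (h [^] (2 * j)) U p') > ?d p' (T (h [^] j) U p') + 8 * E" by blast
    define g where "g = h [^] j"
    have gs: "supported_in U g" unfolding g_def by (rule supported_in_pow[OF U he(1)])
    have gc: "g \<in> carrier J" "D g U = U" using gs by (auto simp: supported_in_def)
    have gn: "g [^] n \<in> carrier J" "D (g [^] n) U = U" for n :: nat using gc U D_pow_fix by auto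
    define b where "b n = ?d p' (T (g [^] n) U p')" for n :: nat
    have bd: "?d (T (g [^] i) U p') (T (g [^] (i + n)) U p') = b n" for i n
      using T_fix(2)[OF gn(1) U gn(2) p'(1) T_fix(1)[OF gn(1) U gn(2) p'(1)]]
        T_fix_pow_add[OF gc(1) U gc(2) p'(1), of i n] by (simp add: b_def)
    have gap: "b 2 > b 1 + 8 * E"
      using p'(2) gc(1) hc(1) by (simp add: b_def g_def nat_pow_pow mult.commute)
    note growth = orbit_linear_growth[OF cspace_four_point[OF U] T_fix(1)[OF gn(1) U gn(2) p'(1)] bd gap]
    obtain C where C: "\<And>n. b (2 * n) \<ge> 2 * b n - C" using growth(2) by blast
    define l where "l = b 2 - b 1 - 8 * E"
    have l: "l > 0" using gap by (simp add: l_def)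
    have lin: "b n \<ge> real n * l" for n
    proof (induction n)
      case 0
      then show ?case by (simp add: b_def)
    next
      case (Suc n)
      then show ?case using growth(1)[of n] by (simp add: l_def algebra_simps)
    qed
    obtain x where x: "in_product_region U (3 * E) x" using ex_in_product_region[OF U] by blast
    then have xc: "x \<in> carrier J" by (simp add: in_product_region_def)
    obtain p where p: "p \<in> P U x" using ex_proj_point[OF U xc] by blast
    have pM: "p \<in> mspace (Cs U)" by (rule proj_in[OF U xc p])
    let ?k = "?d p p'"
    \<comment> \<open>The gain was found at \<open>p'\<close>, whereas the counting takes place in
      the product region; the change of the point costs a constant.\<close>
    have cmp: "\<bar>?d p (T (g [^] n) U p) - b n\<bar> \<le> 2 * ?k" for n :: nat
    proof -
      let ?t = "T (g [^] n) U"
      have tM: "?t p \<in> mspace (Cs U)" "?t p' \<in> mspace (Cs U)" using T_fix(1)[OF gn(1) U gn(2)] pM p' by auto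
      have "?d (?t p) (?t p') = ?k" by (rule T_fix(2)[OF gn(1) U gn(2) pM p'(1)])
      moreover have "?d p (?t p) \<le> ?d p p' + ?d p' (?t p)" by (rule mdist_triangle[OF pM p'(1) tM(1)])
      moreover have "?d p' (?t p) \<le> ?d p' (?t p') + ?d (?t p') (?t p)" by (rule mdist_triangle[OF p'(1) tM(2,1)])
      moreover have "?d p' (?t p') \<le> ?d p' p + ?d p (?t p')" by (rule mdist_triangle[OF p'(1) pM tM(2)])
      moreover have "?d p (?t p') \<le> ?d p (?t p) + ?d (?t p) (?t p')" by (rule mdist_triangle[OF pM tM])
      moreover have "?d p' p = ?k" "?d (?t p') (?t p) = ?d (?t p) (?t p')" by (rule mdist_commute)+
      ultimately show ?thesis by (simp add: b_def)
    qed
    have "\<exists>(i::int) (j::int). j \<noteq> 0 \<and> g [^] i = e [^] j"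
    proof (rule common_power_of_loxodromic[OF U gs he(2) _ x p])
      show "commute J g e" unfolding g_def by (rule commute_pow[OF he(3) hc(1) ec])
      fix n :: nat
      show "?d p (T (g [^] (2 * n)) U p) \<ge> 2 * ?d p (T (g [^] n) U p) - (C + 6 * ?k)"
        using cmp[of "2 * n"] cmp[of n] C[of n] by linarith
    next
      fix B
      obtain n :: nat where "real n * l > B + 2 * ?k" using reals_Archimedean3[OF l] by blast
      then show "\<exists>n::nat. ?d p (T (g [^] n) U p) > B"
        using lin[of n] cmp[of n] by (intro exI[of _ n]) linarith
    qed
    then obtain i k :: int where "k \<noteq> 0" "g [^] i = e [^] k" by blast
    moreover have "g [^] i = h [^] (int j * i)"
      unfolding g_def using int_pow_pow[OF hc(1), of "int j" i] by (simp add: int_pow_int)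
    ultimately show ?thesis by metis
  next
    case False
    then have par: "\<And>p j::nat. p \<in> mspace (Cs U) \<Longrightarrow> ?d p (T (h [^] (2 * j)) U p) \<le> ?d p (T (h [^] j) U p) + 8 * E"
      by (meson not_le)
    have R2: "410 * E \<ge> 0" using E_ge_1 by simp
    obtain F where F: "\<forall>x q y V0 h. aligned U x q y \<longrightarrow> close U (410 * E) x y \<longrightarrow> V0 \<in> Dm \<longrightarrow> pnest s V0 U \<longrightarrow>
      (\<exists>b\<in>P U q. \<exists>r\<in>rho s V0 U. mdist (Cs U) b r \<le> 42 * E) \<longrightarrow> \<not> close V0 (9 * E) x y \<longrightarrow>
      h \<in> carrier J \<longrightarrow> (\<forall>j\<le>(F::nat). moves_little U (h [^] j) x q y) \<longrightarrow>
      (\<exists>j::nat. \<exists>V\<in>Dm. j > 0 \<and> pnest s V U \<and> D (h [^] j) V = V)"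
      using relevant_middle_domain[OF U R2] by (elim exE)
    obtain N where N: "\<forall>x q y Z. aligned U x q y \<longrightarrow>
      (\<forall>V\<in>Dm. pnest s V U \<longrightarrow> (\<exists>b\<in>P U q. \<exists>r\<in>rho s V U. mdist (Cs U) b r \<le> 40 * E) \<longrightarrow> close V (9 * E) x y) \<longrightarrow>
      (\<forall>g\<in>Z. supported_in U g \<and> moves_little U g x q y) \<longrightarrow> finite Z \<and> card Z \<le> (N::nat)"
      using irrelevant_middle_domains[OF U \<kappa> re] by (elim exE)
    \<comment> \<open>The bounds \<open>F\<close> and \<open>N\<close> are known before the points,
      so enough powers can be required to move them little.\<close>
    obtain x q y where al: "aligned U x q y" and cl: "close U (410 * E) x y"
      and mv: "\<forall>j\<le>max F N. moves_little U (h [^] j) x q y"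
      using ex_aligned_moves_little[OF U hc nb par] by metis
    have False
    proof (cases "\<forall>V\<in>Dm. pnest s V U \<longrightarrow> (\<exists>b\<in>P U q. \<exists>r\<in>rho s V U. mdist (Cs U) b r \<le> 40 * E) \<longrightarrow> close V (9 * E) x y")
      case True
      let ?Z = "(\<lambda>j::nat. h [^] j) ` {..N}"
      have "\<forall>g\<in>?Z. supported_in U g \<and> moves_little U g x q y"
        using mv supported_in_pow[OF U he(1)] by auto
      then have "card ?Z \<le> N" using N al True by blast
      \<comment> \<open>Two of the powers with exponents up to \<open>N\<close> coincide, so
        \<open>h\<close> would have finite order and bounded orbits.\<close>
      then have "\<not> inj_on (\<lambda>j::nat. h [^] j) {..N}" using card_image[of "\<lambda>j::nat. h [^] j" "{..N}"] by auto
      then obtain i j :: nat where ij: "i < j" "h [^] i = h [^] j"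
        by (auto simp: inj_on_def) (metis nat_neq_iff)
      have "h [^] i \<otimes> h [^] (j - i) = h [^] j" using nat_pow_mult[OF hc(1), of i "j - i"] ij(1) by simp
      then have "h [^] i \<otimes> h [^] (j - i) = h [^] i \<otimes> \<one>" using ij(2) hc(1) by simp
      then have "h [^] (j - i) = \<one>" using hc(1) by (metis Units_eq Units_l_cancel nat_pow_closed one_closed)
      then have "Big J s \<one> = Big J s h" using Big_pow[OF hc(1), of "j - i"] ij(1) by simp
      then have "\<not> bounded_orbit \<one> U" using Big Big_iff[of \<one> U] by simp
      then show False using close_refl[OF U, of \<one>] by (auto simp: bounded_orbit_def)
    next
      case False
      then obtain V0 b r where V0: "V0 \<in> Dm" "pnest s V0 U" "b \<in> P U q" "r \<in> rho s V0 U"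
        "mdist (Cs U) b r \<le> 40 * E" "\<not> close V0 (9 * E) x y" by blast
      have "mdist (Cs U) b r \<le> 42 * E" using V0(5) E_ge_1 by linarith
      then have "\<exists>b\<in>P U q. \<exists>r\<in>rho s V0 U. mdist (Cs U) b r \<le> 42 * E" using V0 by blast
      moreover have "\<forall>j\<le>F. moves_little U (h [^] j) x q y" using mv by simp
      ultimately obtain j :: nat and V where V: "V \<in> Dm" "j > 0" "pnest s V U" "D (h [^] j) V = V"
        using F[rule_format, OF al cl V0(1,2) _ V0(6) hc(1)] by blast
      \<comment> \<open>A power of \<open>h\<close> fixes a domain properly nested in
        \<open>U\<close>, so the orbits of \<open>h\<close> in the space of \<open>U\<close> would
        be bounded.\<close>
      then show False using fixed_domain_not_Big[OF hc(1) V(2) Big V(1) _ V(4)] D_pow_fix[OF hc(1) U hc(2)] by blast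
    qed
    then show ?thesis ..
  qed
qed

end

section \<open>Limit points of orbits\<close>

lemma Metric_space_int: "Metric_space (UNIV :: int set) (\<lambda>m n. \<bar>real_of_int m - real_of_int n\<bar>)"
  by unfold_locales auto

lemma int_metric_simps: "mspace int_metric = UNIV" "mdist int_metric m n = \<bar>real_of_int m - real_of_int n\<bar>"
  unfolding int_metric_def
  using Metric_space.mspace_metric[OF Metric_space_int] Metric_space.mdist_metric[OF Metric_space_int] by simp_all

lemma gromov_product_perturb:
  assumes M: "b \<in> mspace m" "b' \<in> mspace m" "x \<in> mspace m" "x' \<in> mspace m" "y \<in> mspace m" "y' \<in> mspace m"
  shows "gromov_product m b' x' y' \<ge> gromov_product m b x y - (mdist m b b' + mdist m x x' + mdist m y y')"
proof -
  have "mdist m x b \<le> mdist m x x' + mdist m x' b" "mdist m x' b \<le> mdist m x' b' + mdist m b' b"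
    "mdist m y b \<le> mdist m y y' + mdist m y' b" "mdist m y' b \<le> mdist m y' b' + mdist m b' b"
    "mdist m x' y' \<le> mdist m x' x + mdist m x y'" "mdist m x y' \<le> mdist m x y + mdist m y y'"
    by (rule mdist_triangle; fact)+
  moreover have "mdist m b' b = mdist m b b'" "mdist m x' x = mdist m x x'" by (rule mdist_commute)+
  ultimately show ?thesis
    unfolding gromov_product_def by (simp add: field_simps)
qed

text \<open>One linear lower bound yields both the double limit that defines convergence to infinity
  and the diagonal limit that defines equivalence of sequences.\<close>

lemma gromov_product_limit:
  fixes \<sigma> \<tau> :: "nat \<Rightarrow> 'a"
  assumes "\<And>i j. gromov_product m b (\<sigma> i) (\<tau> j) \<ge> real (min i j) / 2 - C"
  shows "filterlim (\<lambda>(i, j). gromov_product m b (\<sigma> i) (\<tau> j)) at_top (sequentially \<times>\<^sub>F sequentially)"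
    "filterlim (\<lambda>n. gromov_product m b (\<sigma> n) (\<tau> n)) at_top sequentially"
proof -
  have ev: "\<exists>N. \<forall>i\<ge>N. \<forall>j\<ge>N. Z \<le> gromov_product m b (\<sigma> i) (\<tau> j)" for Z
  proof -
    obtain N :: nat where N: "2 * (Z + C) \<le> real N" using real_arch_simple by blast
    have "Z \<le> gromov_product m b (\<sigma> i) (\<tau> j)" if "i \<ge> N" "j \<ge> N" for i j
    proof -
      have "real N \<le> real (min i j)" using that by simp
      then show ?thesis using assms[of i j] N by argo
    qed
    then show ?thesis by blast
  qed
  show "filterlim (\<lambda>(i, j). gromov_product m b (\<sigma> i) (\<tau> j)) at_top (sequentially \<times>\<^sub>F sequentially)"
    unfolding filterlim_at_top eventually_prod_sequentially using ev by (simp add: split_def) blast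
  show "filterlim (\<lambda>n. gromov_product m b (\<sigma> n) (\<tau> n)) at_top sequentially"
    unfolding filterlim_at_top eventually_sequentially using ev by blast
qed

text \<open>
  Along the first times at which the orbit leaves larger and larger balls, the orbit converges to a point
  at infinity; no hyperbolicity is needed for this.
\<close>

lemma common_limit_point:
  fixes x :: "nat \<Rightarrow> 'a" and b :: "nat \<Rightarrow> real" and A A' :: "'a set"
  assumes M: "A \<subseteq> mspace m" "A' \<subseteq> mspace m"
    and x: "\<And>i. x i \<in> A" "\<And>i j. mdist m (x i) (x (i + j)) = b j"
    and unb: "\<And>B. \<exists>n. b n > B" and y: "\<And>i. y i \<in> A'" "\<And>i. mdist m (x i) (y i) \<le> B'"
  shows "limit_set m A \<inter> limit_set m A' \<noteq> {}"
proof -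
  define f where "f i = (LEAST n. b n \<ge> real i)" for i :: nat
  have f: "b (f i) \<ge> real i" for i
  proof -
    obtain n where "b n > real i" using unb by blast
    then show ?thesis unfolding f_def by (intro LeastI[of "\<lambda>n. b n \<ge> real i" n]) simp
  qed
  have less: "b n < real i" if "n < f i" for n i
    using not_less_Least[of n "\<lambda>n. b n \<ge> real i"] that unfolding f_def by simp
  have xM: "x i \<in> mspace m" and yM: "y i \<in> mspace m" for i using M x(1) y(1) by auto
  have b0: "b 0 = 0" using x(2)[of 0 0] mdist_zero[OF xM[of 0] xM[of 0]] by (simp del: mdist_zero)
  have bx: "mdist m (x i) (x 0) = b i" for i using x(2)[of 0 i] mdist_commute[of m "x 0" "x i"] by simp
  have half: "gromov_product m (x 0) (x (f i)) (x (f j)) \<ge> real i / 2" if le: "f i \<le> f j" for i j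
  proof -
    have "mdist m (x (f i)) (x (f j)) = b (f j - f i)" using x(2)[of "f i" "f j - f i"] le by simp
    \<comment> \<open>Unless one of the times is \<open>0\<close>, the difference precedes the first
      exit time \<open>f j\<close>, when the orbit is still inside the ball of radius
      \<open>j\<close>. The Gromov product is then at least \<open>b (f i) / 2\<close>.\<close>
    moreover have "b (f j - f i) \<le> b (f j)"
    proof (cases "f i = 0 \<or> f j = 0")
      case True
      then show ?thesis using le by auto
    next
      case False
      then have "b (f j - f i) < real j" by (intro less) auto
      then show ?thesis using f[of j] by linarith
    qed
    ultimately show ?thesis using f[of i] bx unfolding gromov_product_def by simp
  qed
  have gp_comm: "gromov_product m c u v = gromov_product m c v u" for c u v
    using mdist_commute[of m u v] unfolding gromov_product_def by simp
  have base: "gromov_product m (x 0) (x (f i)) (x (f j)) \<ge> real (min i j) / 2" for i j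
  proof (cases "f i \<le> f j")
    case True
    have "real (min i j) \<le> real i" by simp
    then show ?thesis using half[OF True] by (simp add: field_simps)
  next
    case False
    then have "gromov_product m (x 0) (x (f j)) (x (f i)) \<ge> real j / 2" by (intro half) simp
    moreover have "real (min i j) \<le> real j" by simp
    ultimately show ?thesis using gp_comm[of "x 0" "x (f j)" "x (f i)"] by (simp add: field_simps)
  qed
  let ?\<sigma> = "\<lambda>i. x (f i)" and ?\<tau> = "\<lambda>i. y (f i)"
  have B'0: "B' \<ge> 0" using order_trans[OF mdist_nonneg y(2)] .
  have gen: "gromov_product m c (u i) (v j) \<ge> real (min i j) / 2 - (mdist m (x 0) c + B' + B')"
    if c: "c \<in> mspace m" and u: "\<And>i. u i \<in> mspace m \<and> mdist m (x (f i)) (u i) \<le> B'"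
      and v: "\<And>i. v i \<in> mspace m \<and> mdist m (x (f i)) (v i) \<le> B'" for c u v i j
  proof -
    have "gromov_product m c (u i) (v j) \<ge> gromov_product m (x 0) (x (f i)) (x (f j)) -
        (mdist m (x 0) c + mdist m (x (f i)) (u i) + mdist m (x (f j)) (v j))"
      by (rule gromov_product_perturb) (use xM c u v in auto)
    then show ?thesis using base[of i j] conjunct2[OF u[of i]] conjunct2[OF v[of j]] by argo
  qed
  have u\<sigma>: "x (f i) \<in> mspace m \<and> mdist m (x (f i)) (x (f i)) \<le> B'" for i
    using xM B'0 by (simp add: mdist_zero[THEN iffD2])
  have u\<tau>: "y (f i) \<in> mspace m \<and> mdist m (x (f i)) (y (f i)) \<le> B'" for i using yM y(2) by simp
  have conv\<sigma>: "converges_to_infinity m ?\<sigma>"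
    unfolding converges_to_infinity_def using xM gromov_product_limit(1)[OF gen[OF _ u\<sigma> u\<sigma>]] by blast
  have conv\<tau>: "converges_to_infinity m ?\<tau>"
    unfolding converges_to_infinity_def using yM gromov_product_limit(1)[OF gen[OF _ u\<tau> u\<tau>]] by blast
  have "(?\<sigma>, ?\<sigma>) \<in> boundary_rel m" "(?\<sigma>, ?\<tau>) \<in> boundary_rel m"
    unfolding boundary_rel_def
    using conv\<sigma> conv\<tau> gromov_product_limit(2)[OF gen[OF _ u\<sigma> u\<sigma>]] gromov_product_limit(2)[OF gen[OF _ u\<sigma> u\<tau>]] by auto
  then have in_class: "?\<sigma> \<in> boundary_rel m `` {?\<sigma>}" "?\<tau> \<in> boundary_rel m `` {?\<sigma>}" by auto
  have "boundary_rel m `` {?\<sigma>} \<in> gromov_boundary m"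
    unfolding gromov_boundary_def using conv\<sigma> by (auto intro: quotientI)
  moreover have "range ?\<sigma> \<subseteq> A" "range ?\<tau> \<subseteq> A'" using x(1) y(1) by auto
  ultimately have "boundary_rel m `` {?\<sigma>} \<in> limit_set m A \<inter> limit_set m A'"
    unfolding limit_set_def using in_class by blast
  then show ?thesis by blast
qed

section \<open>Elliptic and fully supported elements\<close>

context hhg_group
begin

text \<open>The bound is the same for all points \<open>p\<close>, so the displacements of commuting
  elements add up although one of them is applied to a point already moved by the other.\<close>

definition elliptic_on :: "'d \<Rightarrow> 'g \<Rightarrow> bool" where
  "elliptic_on U z \<longleftrightarrow> z \<in> carrier J \<and> D z U = U \<and>
     (\<exists>B. \<forall>p\<in>mspace (Cs U). \<forall>n::int. mdist (Cs U) p (T (z [^] n) U p) \<le> B)"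

lemma elliptic_on_one: "U \<in> Dm \<Longrightarrow> elliptic_on U \<one>"
  unfolding elliptic_on_def by (auto simp: D_one T_one mdist_zero[THEN iffD2] intro!: exI[of _ 0])

lemma elliptic_on_mult:
  assumes U: "U \<in> Dm" and e: "elliptic_on U z" "elliptic_on U w" and c: "commute J z w"
  shows "elliptic_on U (z \<otimes> w)"
proof -
  obtain B B' where B: "\<And>p n::int. p \<in> mspace (Cs U) \<Longrightarrow> mdist (Cs U) p (T (z [^] n) U p) \<le> B"
    "\<And>p n::int. p \<in> mspace (Cs U) \<Longrightarrow> mdist (Cs U) p (T (w [^] n) U p) \<le> B'"
    using e unfolding elliptic_on_def by blast
  have zw: "z \<in> carrier J" "D z U = U" "w \<in> carrier J" "D w U = U" using e by (auto simp: elliptic_on_def)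
  have "mdist (Cs U) p (T ((z \<otimes> w) [^] n) U p) \<le> B + B'" if p: "p \<in> mspace (Cs U)" for p and n :: int
  proof -
    have zn: "z [^] n \<in> carrier J" "D (z [^] n) U = U" "w [^] n \<in> carrier J" "D (w [^] n) U = U"
      using zw U D_int_pow_fix by auto
    have wp: "T (w [^] n) U p \<in> mspace (Cs U)" by (rule T_fix(1)[OF zn(3) U zn(4) p])
    have "(z \<otimes> w) [^] n = z [^] n \<otimes> w [^] n"
      using int_pow_mult_distrib[of z w n] c zw by (simp add: commute_def)
    then have "T ((z \<otimes> w) [^] n) U p = T (z [^] n) U (T (w [^] n) U p)"
      using T_fix_mult[OF zn(1,3) U zn(4) p] by simp
    moreover have "mdist (Cs U) p (T (z [^] n) U (T (w [^] n) U p)) \<le>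
        mdist (Cs U) p (T (w [^] n) U p) + mdist (Cs U) (T (w [^] n) U p) (T (z [^] n) U (T (w [^] n) U p))"
      by (rule mdist_triangle[OF p wp T_fix(1)[OF zn(1) U zn(2) wp]])
    ultimately show ?thesis using B(1)[OF wp, of n] B(2)[OF p, of n] by simp
  qed
  then show ?thesis unfolding elliptic_on_def using zw by (auto simp: D_mult U)
qed

lemma elliptic_on_pow: "U \<in> Dm \<Longrightarrow> elliptic_on U z \<Longrightarrow> elliptic_on U (z [^] (n::nat))"
proof (induction n)
  case (Suc n)
  then have zc: "z \<in> carrier J" by (simp add: elliptic_on_def)
  have "commute J (z [^] n) z" using commute_pow[of z z n] zc by (simp add: commute_def)
  then show ?case using elliptic_on_mult[of U "z [^] n" z] Suc by simp
qed (simp add: elliptic_on_one)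

lemma elliptic_on_group_prod:
  assumes "U \<in> Dm" "\<And>h. h \<in> set hs \<Longrightarrow> elliptic_on U h"
    "\<And>x y. x \<in> set hs \<Longrightarrow> y \<in> set hs \<Longrightarrow> commute J x y"
  shows "elliptic_on U (group_prod J hs)"
  using assms(2,3)
proof (induction hs)
  case Nil
  then show ?case by (simp add: group_prod_Nil elliptic_on_one assms(1))
next
  case (Cons h hs)
  have c: "set hs \<subseteq> carrier J" "h \<in> carrier J" using Cons.prems(1) by (auto simp: elliptic_on_def)
  have "commute J (group_prod J hs) h"
    by (rule commute_group_prod) (use Cons.prems(2) c in auto)
  then show ?case unfolding group_prod_Cons
    by (intro elliptic_on_mult[OF assms(1)] commute_sym[of J "group_prod J hs"]) (use Cons in auto)
qed

lemma elliptic_on_conj: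
  assumes z: "elliptic_on U z" and U: "U \<in> Dm" and t: "t \<in> carrier J"
  shows "elliptic_on (D t U) (t \<otimes> z \<otimes> inv t)"
proof -
  have zc: "z \<in> carrier J" "D z U = U" using z by (auto simp: elliptic_on_def)
  obtain B where B: "\<And>p n::int. p \<in> mspace (Cs U) \<Longrightarrow> mdist (Cs U) p (T (z [^] n) U p) \<le> B"
    using z unfolding elliptic_on_def by blast
  let ?V = "D t U"
  have V: "?V \<in> Dm" "D (inv t) ?V = U" using D_closed D_inv(1) t U by auto
  have "mdist (Cs ?V) p (T ((t \<otimes> z \<otimes> inv t) [^] n) ?V p) \<le> B" if p: "p \<in> mspace (Cs ?V)" for p and n :: int
  proof -
    let ?q = "T (inv t) ?V p"
    have zn: "z [^] n \<in> carrier J" "D (z [^] n) U = U" using zc U D_int_pow_fix by auto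
    have q: "?q \<in> mspace (Cs U)" using T_closed[of "inv t" ?V p] V p t by simp
    have "T (t \<otimes> inv t) ?V p = T t U ?q" using T_mult[of t "inv t" ?V p] V p t by simp
    then have pq: "p = T t U ?q" using T_one[OF V(1) p] t by simp
    have "T ((t \<otimes> z \<otimes> inv t) [^] n) ?V p = T (t \<otimes> z [^] n) U ?q"
      using T_mult[of "t \<otimes> z [^] n" "inv t" ?V p] V p t zn zc by (simp add: conj_int_pow)
    also have "\<dots> = T t U (T (z [^] n) U ?q)" using T_fix_mult[OF t zn(1) U zn(2) q] .
    finally have "mdist (Cs ?V) p (T ((t \<otimes> z \<otimes> inv t) [^] n) ?V p) =
        mdist (Cs ?V) (T t U ?q) (T t U (T (z [^] n) U ?q))" using pq by metis
    also have "\<dots> = mdist (Cs U) ?q (T (z [^] n) U ?q)"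
      by (rule T_mdist[OF t U q T_fix(1)[OF zn(1) U zn(2) q]])
    finally show ?thesis using B[OF q, of n] by simp
  qed
  moreover have "D (t \<otimes> z \<otimes> inv t) ?V = ?V" using V zc t U by (simp add: D_mult)
  ultimately show ?thesis unfolding elliptic_on_def using zc t by blast
qed

text \<open>Uniform bounds on displacements and on diameters of orbits imply each other, up to a
  factor 2.\<close>

lemma fully_supported_iff:
  "fully_supported J s a g U \<longleftrightarrow> axial J s g \<and> U \<in> unbounded_domains s \<and> Big J s g = {U} \<and>
     (\<forall>V\<in>unbounded_domains s. orth s V U \<longrightarrow> elliptic_on V g)"
proof -
  have "(D g V = V \<and> (\<exists>B::real. \<forall>p\<in>mspace (Cs V). diam_in s V {T (g [^] n) V p | n::int. True} \<le> ereal B))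
      \<longleftrightarrow> elliptic_on V g" if g: "g \<in> carrier J" and V: "V \<in> Dm" for V
  proof (cases "D g V = V")
    case True
    let ?O = "\<lambda>p. {T (g [^] n) V p | n::int. True}"
    have 1: "mdist (Cs V) p (T (g [^] m) V p) \<le> B"
      if "near (Cs V) B (?O p) (?O p)" "p \<in> mspace (Cs V)" for p B and m :: int
    proof (rule nearD[OF that(1)])
      have "p = T (g [^] (0::int)) V p" using T_one[OF V that(2)] by simp
      then show "p \<in> ?O p" by blast
    qed blast
    have 2: "near (Cs V) (B + B) (?O p) (?O p)"
      if B: "\<And>n::int. mdist (Cs V) p (T (g [^] n) V p) \<le> B" and p: "p \<in> mspace (Cs V)" for p B
      unfolding near_def
    proof (intro ballI)
      fix u v assume "u \<in> ?O p" "v \<in> ?O p"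
      then obtain i j :: int where uv: "u = T (g [^] i) V p" "v = T (g [^] j) V p" by blast
      have M: "u \<in> mspace (Cs V)" "v \<in> mspace (Cs V)"
        unfolding uv using T_fix(1)[of "g [^] _" V p] g V p D_int_pow_fix True by auto
      have "mdist (Cs V) u v \<le> mdist (Cs V) u p + mdist (Cs V) p v" by (rule mdist_triangle[OF M(1) p M(2)])
      then show "mdist (Cs V) u v \<le> B + B" using B[of i] B[of j] mdist_commute[of "Cs V" u p] uv by simp
    qed
    have "(\<exists>B::real. \<forall>p\<in>mspace (Cs V). near (Cs V) B (?O p) (?O p)) \<longleftrightarrow>
        (\<exists>B. \<forall>p\<in>mspace (Cs V). \<forall>n::int. mdist (Cs V) p (T (g [^] n) V p) \<le> B)" (is "?L \<longleftrightarrow> ?R")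
    proof
      assume ?L
      then obtain B where "\<forall>p\<in>mspace (Cs V). near (Cs V) B (?O p) (?O p)" by blast
      then show ?R using 1 by (intro exI[of _ B] ballI allI) simp
    next
      assume ?R
      then obtain B where "\<forall>p\<in>mspace (Cs V). \<forall>n::int. mdist (Cs V) p (T (g [^] n) V p) \<le> B" by blast
      then show ?L using 2 by (intro exI[of _ "B + B"] ballI) simp
    qed
    then show ?thesis unfolding elliptic_on_def diam_le_iff_near using True g by simp
  qed (simp add: elliptic_on_def)
  moreover have "axial J s g \<Longrightarrow> g \<in> carrier J" by (simp add: axial_def)
  moreover have "unbounded_domains s \<subseteq> Dm" by (auto simp: unbounded_domains_def)
  ultimately show ?thesis unfolding fully_supported_def by blast
qed

lemma axial_pow:
  assumes "axial J s g" "b > 0"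
  shows "axial J s (g [^] (b::nat))"
proof -
  obtain x K where g: "g \<in> carrier J" "x \<in> carrier J"
    and qi: "qi_embedding K int_metric (total s) (\<lambda>n. g [^] n \<otimes> x)" using assms(1) by (auto simp: axial_def)
  have K: "K \<ge> 1" and dist: "\<And>m n::int. \<bar>real_of_int m - real_of_int n\<bar> / K - K \<le> dT (g [^] m \<otimes> x) (g [^] n \<otimes> x) \<and>
      dT (g [^] m \<otimes> x) (g [^] n \<otimes> x) \<le> K * \<bar>real_of_int m - real_of_int n\<bar> + K"
    using qi unfolding qi_embedding_def int_metric_simps by auto
  let ?K = "K * real b"
  have b: "real b \<ge> 1" using assms(2) by simp
  have KK: "?K \<ge> K" using K b by simp
  have pow: "(g [^] b) [^] n = g [^] (int b * n)" for n :: int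
    using int_pow_pow[OF g(1), of "int b" n] by (simp add: int_pow_int)
  have "\<bar>real_of_int m - real_of_int n\<bar> / ?K - ?K \<le> dT ((g [^] b) [^] m \<otimes> x) ((g [^] b) [^] n \<otimes> x) \<and>
      dT ((g [^] b) [^] m \<otimes> x) ((g [^] b) [^] n \<otimes> x) \<le> ?K * \<bar>real_of_int m - real_of_int n\<bar> + ?K" for m n :: int
  proof -
    let ?r = "\<bar>real_of_int m - real_of_int n\<bar>"
    have e: "\<bar>real_of_int (int b * m) - real_of_int (int b * n)\<bar> = real b * ?r"
      by (simp add: right_diff_distrib[symmetric] abs_mult)
    note d = dist[of "int b * m" "int b * n", unfolded e, folded pow]
    have "?r / ?K \<le> real b * ?r / K"
    proof -
      have "?r / ?K \<le> ?r / K" using K KK by (intro divide_left_mono) auto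
      also have "\<dots> \<le> real b * ?r / K" using K b by (intro divide_right_mono) (auto simp: mult_le_cancel_right1)
      finally show ?thesis .
    qed
    moreover have "K * (real b * ?r) = ?K * ?r" by simp
    ultimately show ?thesis using d KK by linarith
  qed
  moreover have "?K \<ge> 1" using K KK by linarith
  ultimately have "qi_embedding ?K int_metric (total s) (\<lambda>n. (g [^] b) [^] n \<otimes> x)"
    unfolding qi_embedding_def int_metric_simps mspace_total using g by auto
  then show ?thesis using g unfolding axial_def by auto
qed

lemma axial_conj:
  assumes "axial J s g" "t \<in> carrier J"
  shows "axial J s (t \<otimes> g \<otimes> inv t)"
proof -
  obtain x K where g: "g \<in> carrier J" "x \<in> carrier J"
    and qi: "qi_embedding K int_metric (total s) (\<lambda>n. g [^] n \<otimes> x)" using assms(1) by (auto simp: axial_def)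
  have e: "(t \<otimes> g \<otimes> inv t) [^] n \<otimes> (t \<otimes> x) = t \<otimes> (g [^] n \<otimes> x)" for n :: int
  proof -
    have "(t \<otimes> g \<otimes> inv t) [^] n \<otimes> (t \<otimes> x) = t \<otimes> g [^] n \<otimes> (inv t \<otimes> t) \<otimes> x"
      unfolding conj_int_pow[OF g(1) assms(2)] using g assms(2)
      by (simp only: m_assoc m_closed inv_closed int_pow_closed)
    then show ?thesis using g assms(2) by (simp add: m_assoc)
  qed
  have "dT (t \<otimes> (g [^] m \<otimes> x)) (t \<otimes> (g [^] n \<otimes> x)) = dT (g [^] m \<otimes> x) (g [^] n \<otimes> x)" for m n :: int
    by (rule dT_left_invariant) (use g assms in auto)
  then have "qi_embedding K int_metric (total s) (\<lambda>n. (t \<otimes> g \<otimes> inv t) [^] n \<otimes> (t \<otimes> x))"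
    using qi g assms(2) unfolding qi_embedding_def e mspace_total by auto
  then show ?thesis using g assms unfolding axial_def
    by (intro conjI bexI[of _ "t \<otimes> x"] exI[of _ K]) auto
qed

lemma unbounded_domains_iff: "V \<in> unbounded_domains s \<longleftrightarrow> V \<in> Dm \<and> (\<forall>B. \<not> near (Cs V) B (mspace (Cs V)) (mspace (Cs V)))"
proof -
  have "diam_in s V (mspace (Cs V)) = \<infinity> \<longleftrightarrow> (\<forall>B. \<not> diam_in s V (mspace (Cs V)) \<le> ereal B)"
    by (cases "diam_in s V (mspace (Cs V))") auto
  then show ?thesis unfolding unbounded_domains_def by (simp add: diam_le_iff_near)
qed

lemma unbounded_act:
  assumes "g \<in> carrier J" "V \<in> unbounded_domains s"
  shows "D g V \<in> unbounded_domains s"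
proof -
  have V: "V \<in> Dm" using assms(2) by (simp add: unbounded_domains_def)
  have "T g V ` mspace (Cs V) = mspace (Cs (D g V))"
    using T_isometry[OF assms(1) V] by (simp add: isometry_onto_def bij_betw_def)
  then show ?thesis
    using assms(2) near_isometry[OF T_isometry[OF assms(1) V] order_refl order_refl] D_closed[OF assms(1) V]
    unfolding unbounded_domains_iff by auto
qed

lemma fully_supported_pow:
  assumes "fully_supported J s a g U" "b > 0"
  shows "fully_supported J s a (g [^] (b::nat)) U"
proof -
  have g: "g \<in> carrier J" using assms(1) by (auto simp: fully_supported_def axial_def)
  have "unbounded_domains s \<subseteq> Dm" by (auto simp: unbounded_domains_def)
  then show ?thesis using assms axial_pow[of g b] Big_pow[OF g assms(2)] elliptic_on_pow[of _ g b]
    unfolding fully_supported_iff by blast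
qed

lemma fully_supported_conj:
  assumes fs: "fully_supported J s a g U" and t: "t \<in> carrier J"
  shows "fully_supported J s a (t \<otimes> g \<otimes> inv t) (D t U)"
  unfolding fully_supported_iff
proof (intro conjI ballI impI)
  have f: "axial J s g" "U \<in> unbounded_domains s" "Big J s g = {U}"
    "\<And>V. V \<in> unbounded_domains s \<Longrightarrow> orth s V U \<Longrightarrow> elliptic_on V g" using fs unfolding fully_supported_iff by blast+
  have g: "g \<in> carrier J" using f(1) by (simp add: axial_def)
  have U: "U \<in> Dm" using f(2) by (simp add: unbounded_domains_def)
  show "axial J s (t \<otimes> g \<otimes> inv t)" by (rule axial_conj[OF f(1) t])
  show "D t U \<in> unbounded_domains s" by (rule unbounded_act[OF t f(2)])
  show "Big J s (t \<otimes> g \<otimes> inv t) = {D t U}" using Big_conj[OF g t] f(3) by simp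
  fix V assume V: "V \<in> unbounded_domains s" "orth s V (D t U)"
  then have VD: "V \<in> Dm" by (simp add: unbounded_domains_def)
  let ?V = "D (inv t) V"
  have V': "?V \<in> unbounded_domains s" "?V \<in> Dm" "D t ?V = V"
    using unbounded_act[of "inv t" V] V D_closed[of "inv t" V] D_inv(2)[OF t VD] VD t by auto
  have "orth s ?V U" using orth_act[OF t V'(2) U] V(2) V'(3) by simp
  then show "elliptic_on V (t \<otimes> g \<otimes> inv t)" using elliptic_on_conj[OF f(4)[OF V'(1)] V'(2) t] V'(3) by simp
qed

text \<open>\<open>Big\<close> is equivariant under conjugation, and conjugating \<open>g\<close> by
  itself gives \<open>g\<close>.\<close>

lemma Big_singleton_fix:
  assumes "g \<in> carrier J" "Big J s g = {U}"
  shows "D g U = U"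
proof -
  have "g \<otimes> g \<otimes> inv g = g" using assms(1) by (simp add: m_assoc)
  then show ?thesis using Big_conj[OF assms(1,1)] assms(2) by simp
qed

text \<open>The orbit of \<open>f\<close> consists of the images of one point under powers of an
  isometry, as \<open>common_limit_point\<close> requires; the orbit of \<open>f'\<close> follows it
  at bounded distance.\<close>

lemma elt_limit_sets_meet:
  assumes f: "f \<in> carrier J" "f' \<in> carrier J" "W \<in> Big J s f" "D f W = W"
    and cl: "\<And>m::nat. close W B (f [^] m) (f' [^] m)"
  shows "elt_limit_set J s f W \<inter> elt_limit_set J s f' W \<noteq> {}"
proof -
  have W: "W \<in> Dm" "\<not> bounded_orbit f W" using f Big_iff by auto
  obtain p where p: "p \<in> P W \<one>" using ex_proj_point[OF W(1), of \<one>] by blast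
  have pM: "p \<in> mspace (Cs W)" using proj_in[OF W(1) _ p] by simp
  have fi: "f [^] i \<in> carrier J" "D (f [^] i) W = W" for i :: nat using f W D_pow_fix by auto
  define x where "x i = T (f [^] i) W p" for i :: nat
  have xP: "x i \<in> P W (f [^] i)" for i
    using T_fix(3)[OF fi(1) W(1) fi(2), of \<one> i] p fi(1) unfolding x_def by auto
  obtain y where y: "\<And>i::nat. y i \<in> P W (f' [^] i)"
    using choice[of "\<lambda>i q. q \<in> P W (f' [^] (i::nat))"] ex_proj_point[OF W(1)] f(2) by auto
  have sub: "P W (g [^] i) \<subseteq> orbit_proj J s g \<one> W" if "g \<in> carrier J" for i :: nat and g
    using that unfolding orbit_proj_def by (auto intro!: exI[of _ "int i"] simp: int_pow_int)
  have subM: "orbit_proj J s g \<one> W \<subseteq> mspace (Cs W)" if "g \<in> carrier J" for g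
    unfolding orbit_proj_def using proj_subset[OF W(1)] that by auto
  have "limit_set (Cs W) (orbit_proj J s f \<one> W) \<inter> limit_set (Cs W) (orbit_proj J s f' \<one> W) \<noteq> {}"
  proof (rule common_limit_point[where x = x and y = y and b = "\<lambda>j. mdist (Cs W) p (x j)"])
    show "orbit_proj J s f \<one> W \<subseteq> mspace (Cs W)" "orbit_proj J s f' \<one> W \<subseteq> mspace (Cs W)" using subM f by auto
    show "x i \<in> orbit_proj J s f \<one> W" for i using xP sub[OF f(1)] by blast
    show "y i \<in> orbit_proj J s f' \<one> W" for i using y sub[OF f(2)] by blast
    show "mdist (Cs W) (x i) (x (i + j)) = mdist (Cs W) p (x j)" for i j
      using T_fix(2)[OF fi(1) W(1) fi(2) pM T_fix(1)[OF fi(1) W(1) fi(2) pM]]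
        T_fix_pow_add[OF f(1) W(1) f(4) pM, of i j] by (simp add: x_def)
    show "\<exists>n. mdist (Cs W) p (x n) > B" for B
      using unbounded_orbit_points[OF f(1) W(1) f(4) W(2) pM] unfolding x_def by blast
    show "mdist (Cs W) (x i) (y i) \<le> B" for i using closeD[OF cl xP y] .
  qed
  then show ?thesis unfolding elt_limit_set_def by blast
qed

end

section \<open>Decompositions into supported elements\<close>

context group
begin

lemma group_prod_append_Cons:
  assumes "set xs \<subseteq> carrier G" "y \<in> carrier G" "set ys \<subseteq> carrier G" "\<And>x. x \<in> set xs \<Longrightarrow> commute G x y"
  shows "group_prod G (xs @ y # ys) = y \<otimes> group_prod G (xs @ ys)"
  using assms
proof (induction xs)
  case (Cons x xs)
  have c: "group_prod G (xs @ ys) \<in> carrier G" using Cons.prems by (intro group_prod_closed) auto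
  have "group_prod G ((x # xs) @ y # ys) = x \<otimes> (y \<otimes> group_prod G (xs @ ys))"
    using Cons by (simp add: group_prod_Cons)
  also have "\<dots> = (x \<otimes> y) \<otimes> group_prod G (xs @ ys)" using Cons.prems c by (simp add: m_assoc)
  also have "x \<otimes> y = y \<otimes> x" using Cons.prems(4)[of x] by (simp add: commute_def)
  finally show ?case using Cons.prems c by (simp add: group_prod_Cons m_assoc)
qed (simp add: group_prod_Cons)

end

context hhg_group
begin

text \<open>The parameter \<open>S\<close> stands for the notion of support of either class.
  Pairwise commutation of the factors is part of \<Omega>; for \<Xi> it follows from the
  orthogonality of different domains in \<open>Big\<close>.\<close>

definition decomposition :: "('g \<Rightarrow> 'd \<Rightarrow> bool) \<Rightarrow> 'g \<Rightarrow> nat \<Rightarrow> 'd list \<Rightarrow> 'g list \<Rightarrow> bool" where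
  "decomposition S g n Us hs \<longleftrightarrow> n > 0 \<and> distinct Us \<and> set Us = Big J s g \<and> length hs = length Us \<and>
     g [^] n = group_prod J hs \<and> (\<forall>i<length Us. S (hs ! i) (Us ! i)) \<and> set hs \<subseteq> carrier J \<and>
     (\<forall>x\<in>set hs. \<forall>y\<in>set hs. commute J x y)"

lemma decomposition_split:
  assumes dec: "decomposition S g n Us hs" and i: "i < length Us"
  shows "\<exists>qs. g [^] n = hs ! i \<otimes> group_prod J qs \<and> set qs \<subseteq> set hs \<and>
    (\<forall>x\<in>set qs. \<exists>j<length Us. j \<noteq> i \<and> x = hs ! j)"
proof -
  have len: "length hs = length Us" and hs: "set hs \<subseteq> carrier J" "\<And>x y. x \<in> set hs \<Longrightarrow> y \<in> set hs \<Longrightarrow> commute J x y"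
    using dec by (auto simp: decomposition_def)
  let ?qs = "take i hs @ drop (Suc i) hs"
  have hs_eq: "hs = take i hs @ hs ! i # drop (Suc i) hs" using id_take_nth_drop[of i hs] i len by simp
  have sub: "set ?qs \<subseteq> set hs" using set_take_subset[of i hs] set_drop_subset[of "Suc i" hs] by auto
  have hi: "hs ! i \<in> set hs" using i len by simp
  have "group_prod J (take i hs @ hs ! i # drop (Suc i) hs) = hs ! i \<otimes> group_prod J ?qs"
  proof (rule group_prod_append_Cons)
    show "set (take i hs) \<subseteq> carrier J" "set (drop (Suc i) hs) \<subseteq> carrier J" "hs ! i \<in> carrier J"
      using sub hs(1) hi by auto
    show "commute J x (hs ! i)" if "x \<in> set (take i hs)" for x using hs(2) hi that sub by auto
  qed
  moreover have "\<exists>j<length Us. j \<noteq> i \<and> x = hs ! j" if "x \<in> set ?qs" for x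
  proof -
    from that consider "x \<in> set (take i hs)" | "x \<in> set (drop (Suc i) hs)" by auto
    then show ?thesis
    proof cases
      case 1
      then obtain j where "j < i" "j < length hs" "x = hs ! j" by (auto simp: in_set_conv_nth)
      then show ?thesis using len by (intro exI[of _ j]) auto
    next
      case 2
      then obtain j where "j < length hs - Suc i" "x = hs ! (Suc i + j)" by (auto simp: in_set_conv_nth)
      then show ?thesis using len by (intro exI[of _ "Suc i + j"]) auto
    qed
  qed
  ultimately show ?thesis using dec hs_eq sub unfolding decomposition_def by (intro exI[of _ ?qs]) auto
qed

text \<open>Let \<open>h\<close> and \<open>h'\<close> be the components of \<open>g\<close> and
  \<open>g'\<close> on one domain. By \<open>factor\<close>, both \<open>u\<close> and
  \<open>g'\<close> virtually commute with \<open>h\<close>; by \<open>factor\<close> for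
  \<open>g'\<close>, so does \<open>h'\<close>. Then \<open>same\<close> gives \<open>h\<close> and
  \<open>h'\<close> a common power, through which \<open>u\<close> virtually commutes with
  \<open>h'\<close>, and the components of \<open>g'\<close> are put together again.\<close>

lemma virt_commute_transfer:
  assumes factor: "\<And>g n Us hs i u. g \<in> carrier J \<Longrightarrow> decomposition S g n Us hs \<Longrightarrow> i < length Us \<Longrightarrow> u \<in> carrier J \<Longrightarrow>
      virt_commute J u g \<Longrightarrow> virt_commute J u (hs ! i)"
    and same: "\<And>h e U. S h U \<Longrightarrow> S e U \<Longrightarrow> virt_commute J h e \<Longrightarrow> common_power J h e"
    and g: "g \<in> carrier J" "g' \<in> carrier J" "u \<in> carrier J"
    and dec: "decomposition S g n Us hs" "decomposition S g' n' Us' hs'"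
    and Big: "Big J s g = Big J s g'" and vc: "virt_commute J g' g" "virt_commute J u g"
  shows "virt_commute J u g'"
proof -
  have d: "length hs = length Us" "set hs \<subseteq> carrier J" "length hs' = length Us'" "set hs' \<subseteq> carrier J"
    "set Us = set Us'" "n' > 0" "g' [^] n' = group_prod J hs'"
    "\<And>x y. x \<in> set hs' \<Longrightarrow> y \<in> set hs' \<Longrightarrow> commute J x y"
    using dec Big by (auto simp: decomposition_def)
  have "virt_commute J (hs' ! i) u" if i: "i < length Us'" for i
  proof -
    have "Us' ! i \<in> set Us" using i d(5) by simp
    then obtain j where j: "j < length Us" "Us ! j = Us' ! i" by (metis in_set_conv_nth)
    have c: "hs ! j \<in> carrier J" "hs' ! i \<in> carrier J" using i j d nth_mem by (metis subsetD)+
    have 1: "virt_commute J u (hs ! j)" by (rule factor[OF g(1) dec(1) j(1) g(3) vc(2)])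
    have "virt_commute J g' (hs ! j)" by (rule factor[OF g(1) dec(1) j(1) g(2) vc(1)])
    then have "virt_commute J (hs ! j) (hs' ! i)"
      by (rule factor[OF g(2) dec(2) i c(1) virt_commute_sym])
    moreover have "S (hs ! j) (Us' ! i)" "S (hs' ! i) (Us' ! i)"
      using dec i j unfolding decomposition_def by metis+
    ultimately have "common_power J (hs ! j) (hs' ! i)" by (intro same)
    from virt_commute_common_power[OF 1 this g(3) c] show ?thesis by (rule virt_commute_sym)
  qed
  then have "virt_commute J h u" if "h \<in> set hs'" for h using that d(3) by (metis in_set_conv_nth)
  then have "virt_commute J (group_prod J hs') u"
    by (rule virt_commute_group_prod) (use d g in auto)
  then have "virt_commute J (g' [^] n') u" using d by simp
  then show ?thesis by (rule virt_commute_sym[OF virt_commute_of_pow[OF _ d(6) g(2)]])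
qed

text \<open>\<open>g\<close> commutes with itself, so \<open>virt_commute_Big\<close> compares the
  domains of a single element.\<close>

lemma decomposition_orth:
  assumes dec: "decomposition S g n Us hs" and g: "g \<in> carrier J" and ij: "i < length Us" "j < length Us" "i \<noteq> j"
  shows "orth s (Us ! i) (Us ! j)"
proof -
  have d: "distinct Us" "set Us = Big J s g" using dec by (auto simp: decomposition_def)
  have "virt_commute J g g" unfolding virt_commute_def by (intro exI[of _ 1]) (use g in \<open>simp add: commute_def\<close>)
  moreover have "finite (Big J s g)" using d(2) by (metis List.finite_set)
  ultimately have "Us ! i = Us ! j \<or> orth s (Us ! i) (Us ! j)"
    using virt_commute_Big[OF g g] d(2) ij nth_mem by metis
  then show ?thesis using d(1) ij nth_eq_iff_index_eq by metis
qed

section \<open>The two classes\<close>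

lemma pow_split:
  assumes "commute J h q" "h \<in> carrier J" "q \<in> carrier J" "g \<in> carrier J" "g [^] (n::nat) = h \<otimes> q"
  shows "(g [^] (b::nat)) [^] n = h [^] b \<otimes> q [^] b"
proof -
  have "(g [^] b) [^] n = (g [^] n) [^] b" using assms(4) by (simp add: nat_pow_pow mult.commute)
  also have "\<dots> = h [^] b \<otimes> q [^] b" unfolding assms(5)
    by (rule pow_mult_distrib) (use assms in \<open>auto simp: commute_def\<close>)
  finally show ?thesis .
qed

section \<open>Class \<Xi>\<close>

lemma factor_group_supported:
  assumes \<kappa>: "\<kappa> \<ge> E" and U: "U \<in> Dm" and g: "g \<in> factor_group \<kappa> J s a U"
  shows "supported_in U g"
  unfolding supported_in_def
proof (intro conjI ballI impI)
  have gc: "g \<in> carrier J" "D g U = U" and fix_e: "\<And>e. e \<in> E_tuples \<kappa> s U \<Longrightarrow> tuple_act J a (orth_to s U) g e = e"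
    using g by (auto simp: factor_group_def dom_stabilizer_def)
  show "g \<in> carrier J" "D g U = U" by fact+
  fix V x assume V: "V \<in> Dm" "orth s V U" and x: "x \<in> carrier J"
  \<comment> \<open>The projections of one point \<open>x\<close> form a consistent tuple, on which
    the trivial action on the orthogonal factor can be tested.\<close>
  let ?e = "restrict (\<lambda>V. P V x) (orth_to s U)"
  have sub: "orth_to s U \<subseteq> Dm" by (auto simp: orth_to_def)
  have "consistent_on E s (orth_to s U) (\<lambda>V. P V x)"
    using consistencyD x sub unfolding consistent_on_def by blast
  then have "consistent_on \<kappa> s (orth_to s U) ?e" by (rule consistent_on_mono) (use \<kappa> in auto)
  moreover have "coarse_point \<kappa> (Cs V) (P V x)" if "V \<in> orth_to s U" for V
    by (rule coarse_point_mono[OF proj_coarse \<kappa>]) (use that sub x in auto)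
  ultimately have "?e \<in> E_tuples \<kappa> s U" unfolding E_tuples_def consistent_tuples_def by auto
  then have eq: "tuple_act J a (orth_to s U) g ?e V = ?e V" using fix_e by simp
  let ?V = "D (inv g) V"
  have V': "?V \<in> Dm" "D g ?V = V" using D_closed D_inv(2) gc V by auto
  have "orth s ?V U" using orth_act[OF gc(1) V'(1) U] V(2) V'(2) gc(2) by simp
  then have mem: "V \<in> orth_to s U" "?V \<in> orth_to s U" using V V'(1) by (auto simp: orth_to_def)
  have "tuple_act J a (orth_to s U) g ?e V = T g ?V ` P ?V x"
    using mem by (simp add: tuple_act_def Let_def)
  also have "\<dots> = P V (g \<otimes> x)" using proj_act[OF gc(1) V'(1) x] V'(2) by simp
  finally show "P V (g \<otimes> x) = P V x" using eq mem by simp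
qed

lemma Xi_realizable:
  assumes "Xi_conditions \<kappa> J s a" and U: "U \<in> Dm"
  shows "realizable \<kappa> U"
proof -
  obtain m where "is_factor_metric \<kappa> s U m" using assms unfolding Xi_conditions_def by blast
  then obtain \<theta> \<phi> e where p: "is_product_map \<theta> \<kappa> s U \<phi>" "e \<in> E_tuples \<kappa> s U"
    unfolding is_factor_metric_def by blast
  show ?thesis unfolding realizable_def
  proof (intro exI[of _ \<theta>] ballI)
    fix b assume b: "b \<in> F_tuples \<kappa> s U"
    have w: "\<phi> (b, e) \<in> carrier J" "\<And>V. V \<in> Dm \<Longrightarrow> dist_in s V (P V (\<phi> (b, e)))
        (if nest s V U then b V else if orth s V U then e V else rho s U V) \<le> \<theta>"
      using p b unfolding is_product_map_def mspace_total by blast+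
    have "dist_in s V (P V (\<phi> (b, e))) (rho s U V) \<le> \<theta>" if V: "V \<in> Dm" "pnest s U V \<or> transverse s U V" for V
    proof -
      have "\<not> nest s V U" using V(2) nest_antisym[OF U V(1)] by (auto simp: pnest_def transverse_def)
      moreover have "\<not> orth s V U"
        using V(2) orth_not_nest[OF V(1) U] orth_sym[OF V(1) U] by (auto simp: pnest_def transverse_def)
      ultimately show ?thesis using w(2)[OF V(1)] by simp
    qed
    moreover have "dist_in s V (P V (\<phi> (b, e))) (b V) \<le> \<theta>" if "V \<in> Dm" "nest s V U" for V
      using w(2)[OF that(1)] that(2) by simp
    ultimately show "\<exists>w\<in>carrier J. (\<forall>V\<in>Dm. nest s V U \<longrightarrow> dist_in s V (P V w) (b V) \<le> \<theta>) \<and>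
     (\<forall>V\<in>Dm. pnest s U V \<or> transverse s U V \<longrightarrow> dist_in s V (P V w) (rho s U V) \<le> \<theta>)"
      using w(1) by blast
  qed
qed

lemma sfs_supported:
  assumes "\<kappa> \<ge> E" "strongly_fully_supported \<kappa> J s a h U"
  shows "supported_in U h" "U \<in> Big J s h" "U \<in> Dm" "h \<in> carrier J"
proof -
  show "U \<in> Dm" "U \<in> Big J s h" "h \<in> carrier J"
    using assms(2) by (auto simp: strongly_fully_supported_def unbounded_domains_def axial_def)
  then show "supported_in U h" using factor_group_supported[OF assms(1)] assms(2)
    by (simp add: strongly_fully_supported_def)
qed

text \<open>The other components are supported in domains orthogonal to \<open>Us ! i\<close>, so
  their product is trivial below it. A power of \<open>u\<close> fixes \<open>Us ! i\<close> because
  it permutes the finite set \<open>Big J s g\<close>. This is the situation of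
  \<open>commute_with_factor\<close>.\<close>

lemma Xi_factor:
  assumes \<kappa>: "\<kappa> \<ge> E" and dec: "decomposition (strongly_fully_supported \<kappa> J s a) g n Us hs" and i: "i < length Us"
    and g: "g \<in> carrier J" and u: "u \<in> carrier J" "virt_commute J u g"
  shows "virt_commute J u (hs ! i)"
proof -
  let ?h = "hs ! i" and ?U = "Us ! i"
  have d: "\<And>j. j < length Us \<Longrightarrow> strongly_fully_supported \<kappa> J s a (hs ! j) (Us ! j)" "set hs \<subseteq> carrier J"
    "\<And>x y. x \<in> set hs \<Longrightarrow> y \<in> set hs \<Longrightarrow> commute J x y" "set Us = Big J s g" "length hs = length Us"
    using dec by (auto simp: decomposition_def)
  note S = sfs_supported[OF \<kappa> d(1)]
  obtain qs where qs: "g [^] n = ?h \<otimes> group_prod J qs" "set qs \<subseteq> set hs"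
    "\<forall>x\<in>set qs. \<exists>j<length Us. j \<noteq> i \<and> x = hs ! j" using decomposition_split[OF dec i] by blast
  let ?q = "group_prod J qs"
  have qc: "?q \<in> carrier J" by (rule group_prod_closed) (use qs d in auto)
  have hi: "?h \<in> set hs" using i d(5) by simp
  have com: "commute J ?h ?q"
    by (rule commute_sym[OF commute_group_prod]) (use qs(2) d(2,3) hi in auto)
  have tq: "trivial_below ?U ?q"
  proof -
    have "trivial_below ?U x" if x: "x \<in> set qs" for x
    proof -
      obtain j where j: "j < length Us" "j \<noteq> i" "x = hs ! j" using bspec[OF qs(3) x] by blast
      have "orth s ?U (Us ! j)" by (rule decomposition_orth[OF dec g i j(1)]) (use j in simp)
      then show ?thesis unfolding j(3)
        by (rule supported_in_trivial_below[OF S(1)[OF j(1)] _ S(3)[OF i] S(3)[OF j(1)]])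
    qed
    then show ?thesis by (induction qs) (auto simp: group_prod_Nil group_prod_Cons trivial_below_one trivial_below_mult)
  qed
  obtain m b :: nat where mb: "m > 0" "b > 0" "commute J (u [^] m) (g [^] b)"
    using u(2) by (auto simp: virt_commute_def)
  let ?t = "u [^] m"
  have "D ?t ` Big J s g = Big J s g" by (rule commute_permutes_Big[OF mb(3,2) g]) (use u in simp)
  then obtain c :: nat where c: "c > 0" "\<forall>V\<in>Big J s g. D (?t [^] c) V = V"
    using pow_fixes_finite[of ?t "Big J s g"] Big_subset u(1) d(4) by (metis List.finite_set nat_pow_closed order_refl)
  have "Us ! i \<in> Big J s g" using i d(4) nth_mem by blast
  then have fixU: "D (?t [^] c) ?U = ?U" using c by blast
  have "commute J (?t [^] c) ((g [^] b) [^] n)"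
    by (rule commute_pow2[OF mb(3)]) (use u g in auto)
  then have "commute J (?t [^] c) (?h [^] b \<otimes> ?q [^] b)"
    using pow_split[OF com S(4)[OF i] qc g qs(1)] by simp
  moreover have "trivial_below ?U (?q [^] b)"
    by (induction b) (auto simp: trivial_below_one trivial_below_mult tq)
  ultimately have "virt_commute J (?t [^] c) (?h [^] b)"
    by (intro commute_with_factor[OF S(3)[OF i] supported_in_pow[OF S(3)[OF i] S(1)[OF i]]] fixU) (use u in auto)
  then have "virt_commute J ?t (?h [^] b)" by (rule virt_commute_of_pow[OF _ c(1)]) (use u in simp)
  then have "virt_commute J u (?h [^] b)" by (rule virt_commute_of_pow[OF _ mb(1) u(1)])
  from virt_commute_of_pow[OF virt_commute_sym[OF this] mb(2) S(4)[OF i]] show ?thesis by (rule virt_commute_sym)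
qed

lemma Xi_same:
  assumes \<kappa>: "\<kappa> \<ge> 44 * E" and xi: "Xi_conditions \<kappa> J s a"
    and S: "strongly_fully_supported \<kappa> J s a h U" "strongly_fully_supported \<kappa> J s a e U" and vc: "virt_commute J h e"
  shows "common_power J h e"
proof -
  have \<kappa>E: "\<kappa> \<ge> E" using \<kappa> E_ge_1 by linarith
  note H = sfs_supported[OF \<kappa>E S(1)] and F = sfs_supported[OF \<kappa>E S(2)]
  obtain m n :: nat where mn: "m > 0" "n > 0" "commute J (h [^] m) (e [^] n)"
    using vc by (auto simp: virt_commute_def)
  have "\<exists>(i::int) (j::int). j \<noteq> 0 \<and> (h [^] m) [^] i = (e [^] n) [^] j"
    by (rule common_power_supported[OF H(3) \<kappa> Xi_realizable[OF xi H(3)] supported_in_pow[OF H(3,1)] supported_in_pow[OF H(3) F(1)] mn(3)])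
       (use Big_pow[OF H(4) mn(1)] H(2) in simp)
  then obtain i j :: int where ij: "j \<noteq> 0" "(h [^] m) [^] i = (e [^] n) [^] j" by blast
  have p: "h [^] (int m * i) = e [^] (int n * j)"
    using ij(2) int_pow_pow[OF H(4), of "int m" i] int_pow_pow[OF F(4), of "int n" j] by (simp add: int_pow_int)
  \<comment> \<open>For \<open>i = 0\<close> a nonzero power of \<open>e\<close> would be trivial,
    against \<open>U \<in> Big J s e\<close>.\<close>
  have "i \<noteq> 0"
  proof
    assume "i = 0"
    then have "e [^] (int n * j) = \<one>" using p by simp
    moreover have "int n * j \<noteq> 0" using ij mn by simp
    ultimately have "Big J s \<one> = Big J s e" using Big_int_pow[OF F(4)] by metis
    then have "\<not> bounded_orbit \<one> U" using F(2) Big_iff[of \<one> U] by simp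
    then show False using close_refl[OF F(3), of \<one>] by (auto simp: bounded_orbit_def)
  qed
  then show ?thesis unfolding common_power_def using p ij mn by (intro exI[of _ "int m * i"] exI[of _ "int n * j"]) auto
qed

section \<open>Class \<Omega>\<close>

lemma Omega_same:
  assumes c3: "\<And>f1 f2 U1 U2. fully_supported J s a f1 U1 \<Longrightarrow> fully_supported J s a f2 U2 \<Longrightarrow>
      commute J f1 f2 \<Longrightarrow> common_power J f1 f2 \<or> orth s U1 U2"
    and S: "fully_supported J s a h U" "fully_supported J s a e U" and vc: "virt_commute J h e"
  shows "common_power J h e"
proof -
  have c: "h \<in> carrier J" "e \<in> carrier J" "U \<in> Dm"
    using S by (auto simp: fully_supported_def axial_def unbounded_domains_def)
  obtain m n :: nat where mn: "m > 0" "n > 0" "commute J (h [^] m) (e [^] n)"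
    using vc by (auto simp: virt_commute_def)
  \<comment> \<open>Of the two alternatives for commuting elements, orthogonality is impossible on a
    single domain.\<close>
  have "\<not> orth s U U" using orth_not_nest[OF c(3,3)] nest_refl[OF c(3)] by blast
  then have "common_power J (h [^] m) (e [^] n)"
    using c3[OF fully_supported_pow[OF S(1) mn(1)] fully_supported_pow[OF S(2) mn(2)] mn(3)] by blast
  then obtain i j :: int where ij: "i \<noteq> 0" "j \<noteq> 0" "(h [^] m) [^] i = (e [^] n) [^] j"
    by (auto simp: common_power_def)
  have "h [^] (int m * i) = e [^] (int n * j)"
    using ij(3) int_pow_pow[OF c(1), of "int m" i] int_pow_pow[OF c(2), of "int n" j] by (simp add: int_pow_int)
  then show ?thesis unfolding common_power_def using ij mn by (intro exI[of _ "int m * i"] exI[of _ "int n * j"]) auto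
qed

text \<open>The conjugates of a power \<open>f\<close> of the component by powers of
  \<open>t\<close> all follow the orbit of \<open>g1\<close>, each on its own domain, since the
  other components are elliptic on \<open>Us ! i\<close>. Two of them live on the same domain; their
  limit sets meet, so by \<open>c3\<close> they have a common power. Comparing exponents, a power of
  \<open>t\<close> commutes with a power of \<open>f\<close>.\<close>

lemma Omega_factor:
  assumes c3: "\<And>f1 f2 U. fully_supported J s a f1 U \<Longrightarrow> fully_supported J s a f2 U \<Longrightarrow>
      common_power J f1 f2 \<or> geometrically_irredundant J s {f1, f2}"
    and dec: "decomposition (fully_supported J s a) g n Us hs" and i: "i < length Us"
    and g: "g \<in> carrier J" and u: "u \<in> carrier J" "virt_commute J u g"
  shows "virt_commute J u (hs ! i)"
proof -
  let ?h = "hs ! i" and ?U = "Us ! i"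
  have d: "\<And>j. j < length Us \<Longrightarrow> fully_supported J s a (hs ! j) (Us ! j)" "set hs \<subseteq> carrier J"
    "\<And>x y. x \<in> set hs \<Longrightarrow> y \<in> set hs \<Longrightarrow> commute J x y" "set Us = Big J s g" "length hs = length Us" "n > 0"
    using dec by (auto simp: decomposition_def)
  have unb: "Us ! j \<in> unbounded_domains s" "Us ! j \<in> Dm" if "j < length Us" for j
    using d(1)[OF that] by (auto simp: fully_supported_def unbounded_domains_def)
  note U = unb[OF i]
  obtain qs where qs: "g [^] n = ?h \<otimes> group_prod J qs" "set qs \<subseteq> set hs"
    "\<forall>x\<in>set qs. \<exists>j<length Us. j \<noteq> i \<and> x = hs ! j" using decomposition_split[OF dec i] by blast
  let ?q = "group_prod J qs"
  have qc: "?q \<in> carrier J" by (rule group_prod_closed) (use qs d in auto)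
  have hi: "?h \<in> set hs" using i d(5) by simp
  have hc: "?h \<in> carrier J" using hi d(2) by blast
  have com: "commute J ?h ?q"
    by (rule commute_sym[OF commute_group_prod]) (use qs(2) d(2,3) hi in auto)
  have ellq: "elliptic_on ?U ?q"
  proof (rule elliptic_on_group_prod[OF U(2)])
    fix x assume "x \<in> set qs"
    from bspec[OF qs(3) this] obtain j where j: "j < length Us" "j \<noteq> i" "x = hs ! j" by blast
    have "orth s ?U (Us ! j)" by (rule decomposition_orth[OF dec g i j(1)]) (use j in simp)
    then show "elliptic_on ?U x" using d(1)[OF j(1)] U(1) j(3) unfolding fully_supported_iff by blast
  qed (use qs(2) d(3) in blast)
  obtain m b :: nat where mb: "m > 0" "b > 0" "commute J (u [^] m) (g [^] b)"
    using u(2) by (auto simp: virt_commute_def)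
  define t where "t = u [^] m"
  define f where "f = ?h [^] b"
  define q where "q = ?q [^] b"
  define g1 where "g1 = (g [^] b) [^] n"
  have tc: "t \<in> carrier J" "f \<in> carrier J" "q \<in> carrier J" "g1 \<in> carrier J"
    using u hc qc g by (auto simp: t_def f_def q_def g1_def)
  have g1: "g1 = f \<otimes> q" unfolding g1_def f_def q_def by (rule pow_split[OF com hc qc g qs(1)])
  have tg1: "commute J t g1" unfolding t_def g1_def
    by (rule commute_sym[OF commute_pow[OF commute_sym[OF mb(3)]]]) (use u g in auto)
  have fq: "commute J f q" unfolding f_def q_def by (rule commute_pow2[OF com hc qc])
  have ell: "elliptic_on ?U q" unfolding q_def by (rule elliptic_on_pow[OF U(2) ellq])
  have fs: "fully_supported J s a f ?U" unfolding f_def by (rule fully_supported_pow[OF d(1)[OF i] mb(2)])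
  obtain B where B: "\<And>p m::int. p \<in> mspace (Cs ?U) \<Longrightarrow> mdist (Cs ?U) p (T (q [^] m) ?U p) \<le> B"
    using ell unfolding elliptic_on_def by blast
  have qU: "D q ?U = ?U" using ell by (simp add: elliptic_on_def)
  \<comment> \<open>The powers of \<open>q\<close> move all points of the space by at most
    \<open>B\<close>, hence the orbits of \<open>f\<close> and \<open>g1 = f \<otimes> q\<close>
    stay close.\<close>
  have cl: "close ?U (E + B + E) (f [^] k) (g1 [^] k)" for k :: int
    unfolding close_def near_def
  proof (intro ballI)
    fix x y assume x: "x \<in> P ?U (f [^] k)" and y: "y \<in> P ?U (g1 [^] k)"
    have fk: "f [^] k \<in> carrier J" "q [^] k \<in> carrier J" "D (q [^] k) ?U = ?U" "g1 [^] k \<in> carrier J"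
      using tc D_int_pow_fix[OF tc(3) U(2) qU] by auto
    have "g1 [^] k = f [^] k \<otimes> q [^] k"
      unfolding g1 using fq tc by (intro int_pow_mult_distrib) (auto simp: commute_def)
    moreover have "commute J (f [^] k) (q [^] k)"
      by (rule commute_int_pow[OF commute_sym[OF commute_int_pow[OF commute_sym[OF fq]]]]) (use tc in auto)
    ultimately have gk: "g1 [^] k = q [^] k \<otimes> f [^] k" by (simp add: commute_def)
    obtain p where p: "p \<in> P ?U (f [^] k)" using ex_proj_point[OF U(2) fk(1)] by blast
    let ?p = "T (q [^] k) ?U p"
    have "?p \<in> P ?U (g1 [^] k)" using T_fix(3)[OF fk(2) U(2) fk(3,1)] p unfolding gk by blast
    then have 1: "mdist (Cs ?U) ?p y \<le> E" using nearD[OF proj_near[OF U(2) fk(4)] _ y] by blast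
    have 2: "mdist (Cs ?U) x p \<le> E" by (rule nearD[OF proj_near[OF U(2) fk(1)] x p])
    have M: "x \<in> mspace (Cs ?U)" "p \<in> mspace (Cs ?U)" "y \<in> mspace (Cs ?U)"
      using proj_in[OF U(2) fk(1)] proj_in[OF U(2) fk(4)] x y p by auto
    have pM: "?p \<in> mspace (Cs ?U)" by (rule T_fix(1)[OF fk(2) U(2) fk(3) M(2)])
    have "mdist (Cs ?U) x y \<le> mdist (Cs ?U) x p + mdist (Cs ?U) p y" by (rule mdist_triangle[OF M])
    moreover have "mdist (Cs ?U) p y \<le> mdist (Cs ?U) p ?p + mdist (Cs ?U) ?p y" by (rule mdist_triangle[OF M(2) pM M(3)])
    ultimately show "mdist (Cs ?U) x y \<le> E + B + E" using 1 2 B[OF M(2), of k] by linarith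
  qed
  define F where "F k = t [^] k \<otimes> f \<otimes> inv (t [^] k)" for k :: nat
  define W where "W k = D (t [^] k) ?U" for k :: nat
  have tk: "t [^] k \<in> carrier J" for k :: nat using tc by simp
  have Fc: "F k \<in> carrier J" for k using tc tk by (simp add: F_def)
  have WD: "W k \<in> Dm" for k unfolding W_def by (rule D_closed[OF tk U(2)])
  have Ffs: "fully_supported J s a (F k) (W k)" for k
    unfolding F_def W_def by (rule fully_supported_conj[OF fs tk])
  \<comment> \<open>Conjugation by \<open>t [^] k\<close> fixes \<open>g1\<close> and carries
    \<open>f\<close> to \<open>F k\<close>; removing the factor on the right costs \<open>R\<close>
    for each of the two orbits.\<close>
  have clF: "\<exists>B'. \<forall>j::int. close (W k) B' (F k [^] j) (g1 [^] j)" for k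
  proof -
    let ?t = "t [^] k"
    define R where "R = E * dT \<one> (inv ?t) + 3 * E"
    have shift: "close (W k) R (?t \<otimes> x) (?t \<otimes> x \<otimes> inv ?t)" if "x \<in> carrier J" for x
    proof -
      have "dT ((?t \<otimes> x) \<otimes> \<one>) ((?t \<otimes> x) \<otimes> inv ?t) = dT \<one> (inv ?t)"
        by (rule dT_left_invariant) (use that tk in auto)
      then show ?thesis using close_lipschitz[OF WD, of "?t \<otimes> x" "?t \<otimes> x \<otimes> inv ?t" k] that tk
        by (simp add: R_def)
    qed
    have "close (W k) (R + (E + B + E) + R) (F k [^] j) (g1 [^] j)" for j :: int
    proof -
      have jc: "f [^] j \<in> carrier J" "g1 [^] j \<in> carrier J" using tc by auto
      have e1: "F k [^] j = ?t \<otimes> f [^] j \<otimes> inv ?t" unfolding F_def by (rule conj_int_pow[OF tc(2) tk])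
      have "commute J ?t g1" by (rule commute_pow[OF tg1 tc(1,4)])
      then have "commute J ?t (g1 [^] j)"
        by (rule commute_sym[OF commute_int_pow[OF commute_sym tc(4) tk]])
      then have e2: "?t \<otimes> g1 [^] j \<otimes> inv ?t = g1 [^] j" by (rule conj_commute[OF _ jc(2) tk])
      have mid: "close (W k) (E + B + E) (?t \<otimes> f [^] j) (?t \<otimes> g1 [^] j)"
        unfolding W_def using close_act[OF tk U(2) jc] cl by blast
      have "close (W k) (R + (E + B + E) + R) (?t \<otimes> f [^] j \<otimes> inv ?t) (?t \<otimes> g1 [^] j \<otimes> inv ?t)"
        by (rule close_trans[OF close_trans[OF close_sym[OF shift] mid] shift]) (use jc tk WD in auto)
      then show ?thesis using e1 e2 by simp
    qed
    then show ?thesis by blast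
  qed
  have Big_f: "Big J s f = {?U}" using fs by (simp add: fully_supported_def)
  have "W k \<in> Big J s g" for k
    unfolding W_def
  proof (rule D_pow_permutes[OF _ Big_subset _ tc(1)])
    have "D t ` Big J s g = Big J s g" unfolding t_def by (rule commute_permutes_Big[OF mb(3,2) g]) (use u in simp)
    then show "D t ` Big J s g \<subseteq> Big J s g" by simp
    show "?U \<in> Big J s g" using i d(4) nth_mem by blast
  qed
  then have "range W \<subseteq> Big J s g" by blast
  moreover have "finite (Big J s g)" using d(4) by (metis List.finite_set)
  ultimately have "\<not> inj W" using finite_subset finite_imageD infinite_UNIV_nat by metis
  then obtain k l where kl: "k < l" "W k = W l" by (auto simp: inj_def) (metis nat_neq_iff)
  obtain B1 B2 where B12: "\<And>j::int. close (W k) B1 (F k [^] j) (g1 [^] j)" "\<And>j::int. close (W l) B2 (F l [^] j) (g1 [^] j)"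
    using clF by metis
  have near_kl: "close (W l) (B1 + B2) (F k [^] j) (F l [^] j)" for j :: int
    by (rule close_trans[OF B12(1)[of j, unfolded kl(2)] close_sym[OF B12(2)]]) (use WD Fc tc in auto)
  have BigF: "Big J s (F k) = {W l}" "Big J s (F l) = {W l}"
    using Ffs[of k] Ffs[of l] kl(2) by (auto simp: fully_supported_def)
  have fixW: "D (F k) (W l) = W l" "D (F l) (W l) = W l" using Big_singleton_fix Fc BigF by auto
  have "common_power J (F k) (F l)"
  proof (rule ccontr)
    assume no: "\<not> common_power J (F k) (F l)"
    then have "geometrically_irredundant J s {F k, F l}" using c3 Ffs[of k] Ffs[of l] kl(2) by metis
    moreover have "F k \<noteq> F l"
    proof
      assume "F k = F l"
      then have "common_power J (F k) (F l)" unfolding common_power_def by (intro exI[of _ 1]) simp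
      then show False using no by blast
    qed
    ultimately have "elt_limit_set J s (F k) (W l) \<inter> elt_limit_set J s (F l) (W l) = {}"
      using BigF unfolding geometrically_irredundant_def by auto
    moreover have "elt_limit_set J s (F k) (W l) \<inter> elt_limit_set J s (F l) (W l) \<noteq> {}"
    proof (rule elt_limit_sets_meet[OF Fc Fc _ fixW(1)])
      show "W l \<in> Big J s (F k)" using BigF by simp
      show "close (W l) (B1 + B2) (F k [^] j) (F l [^] j)" for j :: nat using near_kl[of "int j"] by (simp add: int_pow_int)
    qed
    ultimately show False by blast
  qed
  then obtain m1 m2 :: int where m12: "m1 \<noteq> 0" "m2 \<noteq> 0" "F k [^] m1 = F l [^] m2" by (auto simp: common_power_def)
  have nb: "\<not> bounded_orbit (F l) (W l)" using BigF Big_iff[OF Fc[of l]] by blast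
  \<comment> \<open>Both conjugates follow \<open>g1\<close> at the same speed: with different
    exponents a nonzero power of \<open>F l\<close> would have a bounded orbit.\<close>
  have "m1 = m2"
  proof (rule ccontr)
    assume ne: "m1 \<noteq> m2"
    have "close (W l) (B1 + B2) \<one> ((F l [^] (m1 - m2)) [^] j)" for j :: int
    proof -
      have "close (W l) (B1 + B2) (F l [^] (m2 * j)) (F l [^] (m1 * j))"
        using near_kl[of "m1 * j"] m12(3) int_pow_pow[OF Fc[of k], of m1 j] int_pow_pow[OF Fc[of l], of m2 j] by metis
      then have "close (D (F l [^] (- (m2 * j))) (W l)) (B1 + B2) (F l [^] (- (m2 * j)) \<otimes> F l [^] (m2 * j)) (F l [^] (- (m2 * j)) \<otimes> F l [^] (m1 * j))"
        using close_act[of "F l [^] (- (m2 * j))" "W l"] Fc WD by simp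
      moreover have "F l [^] (- (m2 * j)) \<otimes> F l [^] (m2 * j) = \<one>"
        using int_pow_mult[OF Fc[of l], of "- (m2 * j)" "m2 * j"] by simp
      moreover have "F l [^] (- (m2 * j)) \<otimes> F l [^] (m1 * j) = (F l [^] (m1 - m2)) [^] j"
        using int_pow_mult[OF Fc[of l], of "- (m2 * j)" "m1 * j"] int_pow_pow[OF Fc[of l], of "m1 - m2" j]
        by (simp add: left_diff_distrib)
      ultimately show ?thesis using D_int_pow_fix[OF Fc WD fixW(2)] by simp
    qed
    then have "bounded_orbit (F l [^] (m1 - m2)) (W l)" unfolding bounded_orbit_def by blast
    then show False using bounded_orbit_of_pow[OF _ _ Fc WD] ne nb by simp
  qed
  then have "t [^] k \<otimes> f [^] m1 \<otimes> inv (t [^] k) = t [^] l \<otimes> f [^] m1 \<otimes> inv (t [^] l)"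
    using m12(3) conj_int_pow[OF tc(2) tk] unfolding F_def by simp
  then have "commute J (t [^] (l - k)) (f [^] m1)"
    by (intro conj_pow_eq_commute) (use tc kl(1) in auto)
  then have "commute J (f [^] nat \<bar>m1\<bar>) (t [^] (l - k))"
    by (intro commute_pow_abs[OF commute_sym]) (use tc in auto)
  then have "virt_commute J f t" unfolding virt_commute_def
    using kl(1) m12(1) by (intro exI[of _ "nat \<bar>m1\<bar>"] exI[of _ "l - k"]) auto
  then have "virt_commute J ?h t" unfolding f_def by (rule virt_commute_of_pow[OF _ mb(2) hc])
  then have "virt_commute J (u [^] m) ?h" unfolding t_def by (rule virt_commute_sym)
  then show ?thesis by (rule virt_commute_of_pow[OF _ mb(1) u(1)])
qed

text \<open>The only consequences of membership in either class that the colouring argument needs.\<close>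

definition tame :: bool where
  "tame \<longleftrightarrow> (\<forall>g. infinite_order J g \<longrightarrow> finite (Big J s g)) \<and>
     (\<forall>g g' u. infinite_order J g \<longrightarrow> infinite_order J g' \<longrightarrow> u \<in> carrier J \<longrightarrow> Big J s g = Big J s g' \<longrightarrow>
        virt_commute J g' g \<longrightarrow> virt_commute J u g \<longrightarrow> virt_commute J u g')"

lemma tameI:
  assumes dec: "\<And>g. infinite_order J g \<Longrightarrow> \<exists>n Us hs. decomposition S g n Us hs"
    and factor: "\<And>g n Us hs i u. g \<in> carrier J \<Longrightarrow> decomposition S g n Us hs \<Longrightarrow> i < length Us \<Longrightarrow> u \<in> carrier J \<Longrightarrow>
      virt_commute J u g \<Longrightarrow> virt_commute J u (hs ! i)"
    and same: "\<And>h e U. S h U \<Longrightarrow> S e U \<Longrightarrow> virt_commute J h e \<Longrightarrow> common_power J h e"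
  shows tame
  unfolding tame_def
proof (intro conjI allI impI)
  fix g assume "infinite_order J g"
  then obtain n Us hs where "decomposition S g n Us hs" using dec by blast
  then show "finite (Big J s g)" unfolding decomposition_def by (metis List.finite_set)
next
  fix g g' u
  assume g: "infinite_order J g" "infinite_order J g'" and u: "u \<in> carrier J"
    and h: "Big J s g = Big J s g'" "virt_commute J g' g" "virt_commute J u g"
  obtain n Us hs where 1: "decomposition S g n Us hs" using dec[OF g(1)] by blast
  obtain n' Us' hs' where 2: "decomposition S g' n' Us' hs'" using dec[OF g(2)] by blast
  have c: "g \<in> carrier J" "g' \<in> carrier J" using g by (auto simp: infinite_order_def)
  show "virt_commute J u g'" by (rule virt_commute_transfer[OF factor same c u 1 2 h])
qed

lemma class_Omega_tame:
  assumes "class_Omega J s a"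
  shows tame
proof (rule tameI)
  have c2: "\<forall>g. infinite_order J g \<longrightarrow>
        (\<exists>n::nat. n > 0 \<and> (\<exists>Us hs. distinct Us \<and> set Us = Big J s g \<and> length hs = length Us \<and>
           g [^] n = group_prod J hs \<and>
           (\<forall>i<length hs. \<forall>j<length hs. commute J (hs ! i) (hs ! j)) \<and>
           (\<forall>i<length Us. fully_supported J s a (hs ! i) (Us ! i))))"
    using assms unfolding class_Omega_def by (elim conjE)
  have c3: "\<forall>f1 f2 U1 U2. fully_supported J s a f1 U1 \<and> fully_supported J s a f2 U2 \<longrightarrow>
        (U1 = U2 \<longrightarrow> common_power J f1 f2 \<or> geometrically_irredundant J s {f1, f2}) \<and>
        (orth s U1 U2 \<longrightarrow> (\<exists>N::nat. N > 0 \<and> commute J (f1 [^] N) (f2 [^] N))) \<and>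
        (commute J f1 f2 \<longrightarrow> common_power J f1 f2 \<or> orth s U1 U2)"
    using assms unfolding class_Omega_def by (elim conjE)
  show "\<exists>n Us hs. decomposition (fully_supported J s a) g n Us hs" if g: "infinite_order J g" for g
  proof -
    obtain n Us hs where n: "n > 0" "distinct Us" "set Us = Big J s g" "length hs = length Us"
      "g [^] (n::nat) = group_prod J hs" "\<forall>i<length hs. \<forall>j<length hs. commute J (hs ! i) (hs ! j)"
      "\<forall>i<length Us. fully_supported J s a (hs ! i) (Us ! i)"
      using c2[THEN spec, THEN mp, OF g] by (elim exE conjE) (rule that)
    have "set hs \<subseteq> carrier J"
      using n(4,7) by (auto simp: in_set_conv_nth fully_supported_def axial_def)
    moreover have "\<forall>x\<in>set hs. \<forall>y\<in>set hs. commute J x y" using n(6) by (metis in_set_conv_nth)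
    ultimately have "decomposition (fully_supported J s a) g n Us hs" using n unfolding decomposition_def by blast
    then show ?thesis by blast
  qed
  show "virt_commute J u (hs ! i)"
    if "g \<in> carrier J" "decomposition (fully_supported J s a) g n Us hs" "i < length Us" "u \<in> carrier J" "virt_commute J u g"
    for g n Us hs i u
    by (rule Omega_factor[OF _ that(2,3,1,4,5)]) (use c3 in blast)
  show "common_power J h e" if "fully_supported J s a h U" "fully_supported J s a e U" "virt_commute J h e" for h e U
    by (rule Omega_same[OF _ that]) (use c3 in blast)
qed

lemma class_Xi_tame:
  assumes "class_Xi J s a"
  shows tame
proof -
  have "\<exists>\<^sub>F \<kappa> in at_top. Xi_conditions \<kappa> J s a" using assms by (simp add: class_Xi_def)
  \<comment> \<open>The conditions hold for arbitrarily large \<kappa>; one above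
    \<open>44 * E\<close> makes the tuples of \<open>irrelevant_middle_domains\<close>
    available.\<close>
  from frequently_ex[OF frequently_eventually_frequently[OF this eventually_ge_at_top[of "44 * E"]]]
  obtain \<kappa> where \<kappa>: "\<kappa> \<ge> 44 * E" and xi: "Xi_conditions \<kappa> J s a" by blast
  have \<kappa>E: "\<kappa> \<ge> E" using \<kappa> E_ge_1 by linarith
  let ?S = "strongly_fully_supported \<kappa> J s a"
  have c2: "\<forall>g. infinite_order J g \<longrightarrow>
        (\<exists>n::nat. n > 0 \<and> (\<exists>Us hs. distinct Us \<and> set Us = Big J s g \<and> length hs = length Us \<and>
           g [^] n = group_prod J hs \<and> (\<forall>i<length Us. ?S (hs ! i) (Us ! i))))"
    using xi unfolding Xi_conditions_def by (elim conjE)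
  have c3: "\<forall>g h U V. ?S g U \<and> ?S h V \<and> orth s U V \<longrightarrow> commute J g h"
    using xi unfolding Xi_conditions_def by (elim conjE)
  show ?thesis
  proof (rule tameI)
    show "\<exists>n Us hs. decomposition ?S g n Us hs" if g: "infinite_order J g" for g
    proof -
      obtain n Us hs where n: "n > 0" "distinct Us" "set Us = Big J s g" "length hs = length Us"
        "g [^] (n::nat) = group_prod J hs" "\<forall>i<length Us. ?S (hs ! i) (Us ! i)"
        using c2[THEN spec, THEN mp, OF g] by (elim exE conjE) (rule that)
      have gc: "g \<in> carrier J" using g by (simp add: infinite_order_def)
      have carr: "set hs \<subseteq> carrier J"
        using n(4,6) by (auto simp: in_set_conv_nth strongly_fully_supported_def axial_def)
      have vc: "virt_commute J g g" unfolding virt_commute_def by (intro exI[of _ 1]) (use gc in \<open>simp add: commute_def\<close>)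
      have fin: "finite (Big J s g)" using n(3) by (metis List.finite_set)
      \<comment> \<open>Different domains of \<open>Big J s g\<close> are orthogonal, so the last
        condition of \<Xi> makes the components commute.\<close>
      have "commute J (hs ! i) (hs ! j)" if ij: "i < length hs" "j < length hs" for i j
      proof (cases "i = j")
        case False
        have "Us ! i = Us ! j \<or> orth s (Us ! i) (Us ! j)"
          by (rule virt_commute_Big[OF gc gc vc fin fin]) (use n(3,4) ij nth_mem in auto)
        then have "orth s (Us ! i) (Us ! j)" using False n(2,4) ij nth_eq_iff_index_eq by metis
        then show ?thesis using c3 n(4,6) ij by metis
      qed (simp add: commute_def)
      then have "\<forall>x\<in>set hs. \<forall>y\<in>set hs. commute J x y" by (metis in_set_conv_nth)
      then have "decomposition ?S g n Us hs" using n carr unfolding decomposition_def by blast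
      then show ?thesis by blast
    qed
    show "virt_commute J u (hs ! i)"
      if "g \<in> carrier J" "decomposition ?S g n Us hs" "i < length Us" "u \<in> carrier J" "virt_commute J u g"
      for g n Us hs i u by (rule Xi_factor[OF \<kappa>E that(2,3,1,4,5)])
    show "common_power J h e" if "?S h U" "?S e U" "virt_commute J h e" for h e U
      by (rule Xi_same[OF \<kappa> xi that])
  qed
qed

section \<open>Colouring the unbounded domains\<close>

lemma ex_core_domain_below:
  assumes "U \<in> unbounded_domains s"
  shows "\<exists>W\<in>core_domains s. nest s W U"
proof -
  let ?S = "{V \<in> unbounded_domains s. nest s V U}"
  have UD: "U \<in> Dm" "?S \<subseteq> Dm" using assms by (auto simp: unbounded_domains_def)
  have "?S \<noteq> {}" using assms nest_refl UD by blast
  then obtain W where W: "W \<in> ?S" "\<forall>V\<in>?S. \<not> pnest s V W"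
    using ex_extremal[OF UD(2), of "\<lambda>U V. pnest s V U"] by blast
  have "\<not> pnest s V W" if V: "V \<in> unbounded_domains s" for V
  proof
    assume p: "pnest s V W"
    have "V \<in> Dm" "W \<in> Dm" using V W(1) by (auto simp: unbounded_domains_def)
    then have "nest s V U" using nest_trans[of V W U] p W(1) UD(1) by (simp add: pnest_def)
    then show False using W(2) p V by blast
  qed
  then show ?thesis using W(1) unfolding core_domains_def by blast
qed

text \<open>Orthogonality passes to nested domains, so a colour can be read off at any core domain
  below. The vertex with index \<open>0\<close> is present whether or not the space is a
  quasi-line.\<close>

lemma ex_domain_colouring:
  assumes "chromatic_number (expanded_core_graph s) < \<infinity>"
  shows "\<exists>(k::nat) c. (\<forall>U\<in>unbounded_domains s. c U < k) \<and>
    (\<forall>U\<in>unbounded_domains s. \<forall>V\<in>unbounded_domains s. orth s U V \<longrightarrow> c U \<noteq> c V)"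
proof -
  let ?\<Gamma> = "expanded_core_graph s"
  \<comment> \<open>The infimum of the empty set is infinite, so finiteness provides a
    colouring.\<close>
  have "{enat k | k. \<exists>c. proper_colouring ?\<Gamma> k c} \<noteq> {}"
    using assms unfolding chromatic_number_def by (metis Inf_empty less_irrefl top_enat_def)
  then obtain k c where c: "proper_colouring ?\<Gamma> k c" by blast
  obtain \<mu> where \<mu>: "\<And>U. U \<in> unbounded_domains s \<Longrightarrow> \<mu> U \<in> core_domains s \<and> nest s (\<mu> U) U"
    using ex_core_domain_below by metis
  have vert: "(\<mu> U, 0) \<in> verts ?\<Gamma>" if "U \<in> unbounded_domains s" for U
    using \<mu>[OF that] by (auto simp: expanded_core_graph_def Let_def)
  have "c (\<mu> U, 0) \<noteq> c (\<mu> V, 0)" if UV: "U \<in> unbounded_domains s" "V \<in> unbounded_domains s" "orth s U V" for U V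
  proof -
    have dom: "U \<in> Dm" "V \<in> Dm" "\<mu> U \<in> Dm" "\<mu> V \<in> Dm"
      using UV \<mu>[OF UV(1)] \<mu>[OF UV(2)] by (auto simp: unbounded_domains_def core_domains_def)
    have "orth s (\<mu> U) V" by (rule orth_nest[OF dom(1,3,2)]) (use \<mu> UV in auto)
    then have "orth s (\<mu> V) (\<mu> U)"
      by (intro orth_nest[OF dom(2,4,3)]) (use \<mu> UV orth_sym dom in auto)
    then have "orth s (\<mu> U) (\<mu> V)" using orth_sym dom by blast
    then have "{(\<mu> U, 0), (\<mu> V, 0)} \<in> edges ?\<Gamma>"
      using vert[OF UV(1)] vert[OF UV(2)] unfolding expanded_core_graph_def Let_def by fastforce
    then show ?thesis using c unfolding proper_colouring_def by blast
  qed
  moreover have "c (\<mu> U, 0) < k" if "U \<in> unbounded_domains s" for U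
    using c vert[OF that] unfolding proper_colouring_def by blast
  ultimately show ?thesis by (intro exI[of _ k] exI[of _ "\<lambda>U. c (\<mu> U, 0)"]) blast
qed

end

section \<open>The induced colouring of the defining graph\<close>

lemma girth_no_triangle:
  assumes "girth \<Lambda> \<ge> 4" "simplicial_graph \<Lambda>" "{u, w} \<in> edges \<Lambda>" "{w, v} \<in> edges \<Lambda>" "{u, v} \<in> edges \<Lambda>"
  shows False
proof -
  have ne: "u \<noteq> w" "w \<noteq> v" "u \<noteq> v" "u \<in> verts \<Lambda>" "w \<in> verts \<Lambda>" "v \<in> verts \<Lambda>"
    using assms by (auto simp: simplicial_graph_def)
  let ?p = "[u, w, v]"
  have vu: "{v, u} \<in> edges \<Lambda>" using assms(5) by (simp only: insert_commute)
  have "{?p ! i, ?p ! (Suc i mod 3)} \<in> edges \<Lambda>" if i: "i < 3" for i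
  proof -
    consider "i = 0" | "i = 1" | "i = 2" using i by linarith
    then show ?thesis using assms(3,4) vu by cases simp_all
  qed
  then have "is_cycle \<Lambda> ?p" using ne unfolding is_cycle_def by simp
  then have "enat (length ?p) \<in> {enat (length p) | p. is_cycle \<Lambda> p}" by blast
  then have "girth \<Lambda> \<le> enat (length ?p)" unfolding girth_def by (rule Inf_lower)
  then have "girth \<Lambda> \<le> enat 3" by (simp add: numeral_3_eq_3)
  from order_trans[OF assms(1) this] show False by (simp add: numeral_eq_enat)
qed

theorem proposition5p11:
  fixes G :: "('g, 'm) monoid_scheme" and H :: "'g set"
    and s :: "('g, 'd, 'c) hhs_data" and a :: "('g, 'd, 'c) hhs_action"
  assumes "group G"
    and "virtually_Xi G H s a \<or> virtually_Omega G H s a"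
    and "chromatic_number (expanded_core_graph s) < \<infinity>"
  shows "\<forall>M::nat. M > 0 \<longrightarrow>
    (\<exists>\<Lambda> :: nat sgraph. simplicial_graph \<Lambda> \<and> finite (verts \<Lambda>) \<and> girth \<Lambda> \<ge> enat M \<and>
       \<not> embeds_into (raag \<Lambda>) G)"
proof (intro allI impI)
  fix M :: nat
  let ?J = "G\<lparr>carrier := H\<rparr>"
  interpret G: group G by fact
  have H: "subgroup H G" "finite (rcosets\<^bsub>G\<^esub> H)" and cls: "class_Xi ?J s a \<or> class_Omega ?J s a"
    using assms(2) by (auto simp: virtually_Xi_def virtually_Omega_def)
  have hhg: "hhg ?J s a" using cls by (auto simp: class_Xi_def class_Omega_def)
  then have "hhs s" by (simp add: hhg_def hhg_structure_def)
  then obtain E where E: "hhs_with_constant E s" by (auto simp: hhs_def)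
  have grpJ: "group ?J" by (rule subgroup.subgroup_is_group[OF H(1) assms(1)])
  interpret hhg_group ?J s a E
    by (intro hhg_group.intro hhg_group_axioms.intro grpJ hhg E)
  have tame: tame using cls class_Xi_tame class_Omega_tame by blast
  obtain k :: nat and c where c: "\<And>U. U \<in> unbounded_domains s \<Longrightarrow> c U < k"
    "\<And>U V. U \<in> unbounded_domains s \<Longrightarrow> V \<in> unbounded_domains s \<Longrightarrow> orth s U V \<Longrightarrow> c U \<noteq> c V"
    using ex_domain_colouring[OF assms(3)] by blast
  \<comment> \<open>Girth at least 4 excludes triangles. The colours to come are subsets of the
    \<open>k\<close> domain colours together with one bit.\<close>
  obtain \<Lambda> :: "nat sgraph" where \<Lambda>: "simplicial_graph \<Lambda>" "finite (verts \<Lambda>)" "girth \<Lambda> \<ge> enat (max M 4)"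
    and nocol: "\<And>c. \<not> proper_colouring \<Lambda> (card (Pow {..<k} \<times> (UNIV :: bool set))) c"
    using ex_large_girth_not_colourable by metis
  have girth: "girth \<Lambda> \<ge> enat M" "girth \<Lambda> \<ge> 4"
    using \<Lambda>(3) order_trans[OF _ \<Lambda>(3)] by (auto simp: numeral_eq_enat)
  have "\<not> embeds_into (raag \<Lambda>) G"
  proof
    assume "embeds_into (raag \<Lambda>) G"
    then obtain f where f: "f \<in> hom (raag \<Lambda>) G" "inj_on f (carrier (raag \<Lambda>))" by (auto simp: embeds_into_def)
    define F where "F = gen_image \<Lambda> f"
    note gen = gen_image_closed[OF \<Lambda>(1) assms(1) f] gen_image_infinite_order[OF \<Lambda>(1) assms(1) f]
      gen_image_commute[OF \<Lambda>(1) assms(1) f] gen_image_powers_commute[OF \<Lambda>(1) assms(1) f]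
    have "\<exists>n::nat. n > 0 \<and> F v [^]\<^bsub>G\<^esub> n \<in> H" if "v \<in> verts \<Lambda>" for v
      unfolding F_def by (rule finite_index_power[OF assms(1) H gen(1)[OF that]])
    then obtain n :: "nat \<Rightarrow> nat" where n: "\<And>v. v \<in> verts \<Lambda> \<Longrightarrow> n v > 0 \<and> F v [^]\<^bsub>G\<^esub> n v \<in> H" by metis
    define g where "g v = F v [^]\<^bsub>G\<^esub> n v" for v
    have Fc: "F v \<in> carrier G" if "v \<in> verts \<Lambda>" for v unfolding F_def by (rule gen(1)[OF that])
    have gH: "g v \<in> H" if "v \<in> verts \<Lambda>" for v using n[OF that] by (simp add: g_def)
    have gJ: "g v \<in> carrier ?J" if "v \<in> verts \<Lambda>" for v using gH[OF that] by simp
    have powJ: "x [^]\<^bsub>?J\<^esub> (i::nat) = x [^]\<^bsub>G\<^esub> i" for x i by (rule G.nat_pow_consistent[symmetric])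
    have gpow: "g v [^]\<^bsub>?J\<^esub> (i::nat) = F v [^]\<^bsub>G\<^esub> (n v * i)" if "v \<in> verts \<Lambda>" for v i
      unfolding powJ g_def by (rule G.nat_pow_pow[OF Fc[OF that]])
    have inf: "infinite_order ?J (g v)" if v: "v \<in> verts \<Lambda>" for v
      unfolding infinite_order_def
    proof (intro conjI allI impI gJ[OF v])
      fix i :: nat assume "i > 0"
      then have "F v [^]\<^bsub>G\<^esub> (n v * i) \<noteq> \<one>\<^bsub>G\<^esub>" unfolding F_def by (intro gen(2)[OF v]) (use n[OF v] in simp)
      then show "g v [^]\<^bsub>?J\<^esub> i \<noteq> \<one>\<^bsub>?J\<^esub>" using gpow[OF v] by simp
    qed
    have ends: "v \<in> verts \<Lambda>" "w \<in> verts \<Lambda>" "v \<noteq> w" if "{v, w} \<in> edges \<Lambda>" for v w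
      using that \<Lambda>(1) by (auto simp: simplicial_graph_def)
    have edge: "virt_commute ?J (g v) (g w)" if e: "{v, w} \<in> edges \<Lambda>" for v w
    proof -
      have "commute G (F v) (F w)" unfolding commute_def F_def by (rule gen(3)[OF e])
      then have "commute G (g v) (g w)"
        unfolding g_def by (rule G.commute_pow2) (use Fc ends[OF e] in auto)
      then have "commute ?J (g v [^]\<^bsub>?J\<^esub> (1::nat)) (g w [^]\<^bsub>?J\<^esub> (1::nat))"
        using gH ends[OF e] subgroup.mem_carrier[OF H(1)] unfolding powJ commute_def by simp
      then show ?thesis unfolding virt_commute_def by (intro exI[of _ 1]) auto
    qed
    have vc_edge: "v = w \<or> {v, w} \<in> edges \<Lambda>"
      if vw: "v \<in> verts \<Lambda>" "w \<in> verts \<Lambda>" "virt_commute ?J (g v) (g w)" for v w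
    proof -
      obtain i j :: nat where ij: "i > 0" "j > 0" "commute ?J (g v [^]\<^bsub>?J\<^esub> i) (g w [^]\<^bsub>?J\<^esub> j)"
        using vw(3) by (auto simp: virt_commute_def)
      have "n v * i > 0" "n w * j > 0" using n vw ij by auto
      moreover have "F v [^]\<^bsub>G\<^esub> (n v * i) \<otimes>\<^bsub>G\<^esub> F w [^]\<^bsub>G\<^esub> (n w * j) = F w [^]\<^bsub>G\<^esub> (n w * j) \<otimes>\<^bsub>G\<^esub> F v [^]\<^bsub>G\<^esub> (n v * i)"
        using ij(3) unfolding gpow[OF vw(1)] gpow[OF vw(2)] commute_def by simp
      ultimately show ?thesis unfolding F_def by (rule gen(4)[OF vw(1,2)])
    qed
    define col where "col v = c ` Big ?J s (g v)" for v
    have unb: "Big ?J s (g v) \<subseteq> unbounded_domains s" if "v \<in> verts \<Lambda>" for v by (rule Big_unbounded[OF gJ[OF that]])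
    \<comment> \<open>Equal colour sets give each \<open>U\<close> a partner \<open>V\<close> of the
      same colour. Adjacency makes the two equal or orthogonal, and orthogonal domains have
      different colours.\<close>
    have same_Big: "Big ?J s (g v) \<subseteq> Big ?J s (g w)" if e: "{v, w} \<in> edges \<Lambda>" and eq: "col v = col w" for v w
    proof
      fix U assume U: "U \<in> Big ?J s (g v)"
      then obtain V where V: "V \<in> Big ?J s (g w)" "c U = c V" using eq unfolding col_def by blast
      have "finite (Big ?J s (g v))" "finite (Big ?J s (g w))" using tame inf ends[OF e] unfolding tame_def by blast+
      then have "U = V \<or> orth s U V"
        using virt_commute_Big[OF gJ gJ edge[OF e] _ _ U V(1)] ends[OF e] by blast
      then show "U \<in> Big ?J s (g w)" using c(2) U V unb ends[OF e] by blast
    qed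
    \<comment> \<open>\<open>u\<close> virtually commutes with \<open>w\<close>, and tameness
      transfers this to \<open>v\<close>, which has the same \<open>Big\<close> as \<open>w\<close>.
      The resulting edge would close a triangle.\<close>
    have isolated: "u = v" if e: "{v, w} \<in> edges \<Lambda>" "col v = col w" "{u, w} \<in> edges \<Lambda>" for u v w
    proof (rule ccontr)
      assume ne: "u \<noteq> v"
      have e': "{w, v} \<in> edges \<Lambda>" using e(1) by (simp add: insert_commute)
      have "Big ?J s (g w) = Big ?J s (g v)" using same_Big[OF e(1,2)] same_Big[OF e' e(2)[symmetric]] by blast
      then have "virt_commute ?J (g u) (g v)"
        using tame inf[OF ends(1)[OF e']] inf[OF ends(1)[OF e(1)]] gJ[OF ends(1)[OF e(3)]] edge[OF e(1)] edge[OF e(3)]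
        unfolding tame_def by blast
      then have "{u, v} \<in> edges \<Lambda>" using vc_edge[OF ends(1)[OF e(3)] ends(1)[OF e(1)]] ne by blast
      then show False using girth_no_triangle[OF girth(2) \<Lambda>(1) e(3) e'] by blast
    qed
    \<comment> \<open>The bit tells the larger end of a monochromatic edge from the smaller one,
      which is consistent because such an edge meets no other edge.\<close>
    define col2 where "col2 v = (col v, \<exists>w<v. {v, w} \<in> edges \<Lambda> \<and> col w = col v)" for v
    have proper: False if e: "{v, w} \<in> edges \<Lambda>" and eq: "col2 v = col2 w" and lt: "w < v" for v w
    proof -
      have cw: "col v = col w" using eq by (simp add: col2_def)
      have "\<exists>u<v. {v, u} \<in> edges \<Lambda> \<and> col u = col v" using e lt cw by auto
      then have "\<exists>u<w. {w, u} \<in> edges \<Lambda> \<and> col u = col w" using eq by (simp add: col2_def)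
      then obtain u where u: "u < w" "{w, u} \<in> edges \<Lambda>" by blast
      then have "u = v" using isolated[OF e cw, of u] by (simp add: insert_commute)
      then show False using u lt by simp
    qed
    let ?A = "Pow {..<k} \<times> (UNIV :: bool set)"
    have "finite ?A" by simp
    then obtain h where h: "bij_betw h ?A {0..<card ?A}" using ex_bij_betw_finite_nat by blast
    have mem: "col2 v \<in> ?A" if "v \<in> verts \<Lambda>" for v
      using c(1) unb[OF that] by (auto simp: col2_def col_def)
    have "proper_colouring \<Lambda> (card ?A) (\<lambda>v. h (col2 v))"
      unfolding proper_colouring_def
    proof (intro conjI allI impI)
      show "(\<lambda>v. h (col2 v)) ` verts \<Lambda> \<subseteq> {..<card ?A}"
      proof
        fix x assume "x \<in> (\<lambda>v. h (col2 v)) ` verts \<Lambda>"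
        then obtain v where "v \<in> verts \<Lambda>" "x = h (col2 v)" by blast
        then show "x \<in> {..<card ?A}" using bij_betw_apply[OF h mem] by auto
      qed
      fix v w assume e: "{v, w} \<in> edges \<Lambda>"
      show "h (col2 v) \<noteq> h (col2 w)"
      proof
        assume "h (col2 v) = h (col2 w)"
        then have eq: "col2 v = col2 w"
          using inj_onD[OF bij_betw_imp_inj_on[OF h]] mem ends[OF e] by blast
        show False
        proof (cases "w < v")
          case True
          then show False by (rule proper[OF e eq])
        next
          case False
          then have "v < w" using ends(3)[OF e] by simp
          moreover have "{w, v} \<in> edges \<Lambda>" using e by (simp add: insert_commute)
          ultimately show False using proper[of w v] eq by simp
        qed
      qed
    qed
    then show False using nocol by blast
  qed
  then show "\<exists>\<Lambda> :: nat sgraph. simplicial_graph \<Lambda> \<and> finite (verts \<Lambda>) \<and> girth \<Lambda> \<ge> enat M \<and>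
       \<not> embeds_into (raag \<Lambda>) G"
    using \<Lambda> girth(1) by blast
qed

end
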